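(* Let $u$ be the solution of the Poisson problem $$-\Delta u=f\ \text{ in }\Omega,\qquad u=g\ \text{ on }\partial\Omega,$$ and for $\delta>0$ let $u_\delta$ be the solution of the nonlocal model $$\frac{1}{\delta^2}\int_{\Omega}R_\delta(x,y)(u_\delta(x)-u_\delta(y))\,dy+\frac{2}{\mu(x)}\int_{\partial\Omega}\bar R_\delta(x,y)(u_\delta(x)-g(y))\,dS_y=\int_\Omega \bar R_\delta(x,y)f(y)\,dy,\qquad x\in\Omega,$$ where $$\mu(x)=\min\{2\delta,\max\{\delta^2,d(x)\}\},\qquad d(x)=\min_{y\in\partial\Omega}|x-y|.$$ Suppose $u\in C^4(\bar\Omega)$. Then there exists $C>0$ independent of $\delta$ such that for every $x\in\Omega$ $$|u(x)-u_\delta(x)|\le C\delta^2.$$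
   Context: $\Omega\subset\mathbb{R}^n$ is a bounded connected open set with smooth ($C^\infty$) boundary; $dS_y$ is surface measure on $\partial\Omega$. The function $R:[0,\infty)\to[0,\infty)$ satisfies: $R\in C^1([0,1])$; $R(r)\ge 0$ and $R(r)=0$ for all $r>1$; there is $\gamma_0>0$ with $R(r)\ge\gamma_0$ for $0\le r\le \frac12$. Set $\bar R(r)=\int_r^{\infty}R(s)\,ds$. For $\delta>0$ put $$R_\delta(x,y)=\alpha_n\delta^{-n}R\left(\frac{|x-y|^2}{4\delta^2}\right),\qquad \bar R_\delta(x,y)=\alpha_n\delta^{-n}\bar R\left(\frac{|x-y|^2}{4\delta^2}\right),$$ where the constant $\alpha_n>0$ is chosen so that $\int_{\mathbb{R}^n}\bar R_\delta(x,y)\,dy=1$. The solution $u_\delta\in L^2(\Omega)$ of the nonlocal model satisfies the equation at every point $x\in\Omega$. The constant $C$ may depend on $\Omega$, $R$ and $u$. *)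

theory Defs
  imports "HOL-Analysis.Analysis"
begin

text \<open>Iterated partial derivatives: \<open>iter_partial [b\<^sub>1, \<dots>, b\<^sub>k] f\<close> is
  \<open>\<partial>\<^bsub>b\<^sub>1\<^esub> \<dots> \<partial>\<^bsub>b\<^sub>k\<^esub> f\<close>. Its values are meaningful only where the derivatives
  exist, which \<open>Ck_on\<close> guarantees on an open set.\<close>

primrec iter_partial ::
  "'a::euclidean_space list \<Rightarrow> ('a \<Rightarrow> real) \<Rightarrow> 'a \<Rightarrow> real" where
  "iter_partial [] f = f"
| "iter_partial (b # bs) f = (\<lambda>x. frechet_derivative (iter_partial bs f) (at x) b)"

text \<open>\<open>C\<^sup>k\<close> on an open set \<open>U\<close>.\<close>

definition Ck_on :: "nat \<Rightarrow> ('a::euclidean_space \<Rightarrow> real) \<Rightarrow> 'a set \<Rightarrow> bool" where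
  "Ck_on k f U \<longleftrightarrow>
     (\<forall>bs. set bs \<subseteq> Basis \<and> length bs \<le> k \<longrightarrow> continuous_on U (iter_partial bs f)) \<and>
     (\<forall>bs. set bs \<subseteq> Basis \<and> length bs < k \<longrightarrow>
        (\<forall>x\<in>U. iter_partial bs f differentiable (at x)))"

text \<open>\<open>C\<^sup>k\<close> on the closure of an open set \<open>U\<close>: \<open>f\<close> is continuous on the closure and
  all partial derivatives up to order \<open>k\<close> extend continuously from \<open>U\<close> to the closure.
  (Derivatives at boundary points are not used, so the values of \<open>f\<close> outside the
  closure are irrelevant.)\<close>

definition Ck_on_closure :: "nat \<Rightarrow> ('a::euclidean_space \<Rightarrow> real) \<Rightarrow> 'a set \<Rightarrow> bool" where
  "Ck_on_closure k f U \<longleftrightarrow>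
     continuous_on (closure U) f \<and> Ck_on k f U \<and>
     (\<forall>bs. set bs \<subseteq> Basis \<and> length bs \<le> k \<longrightarrow>
        (\<exists>F. continuous_on (closure U) F \<and> (\<forall>x\<in>U. F x = iter_partial bs f x)))"

definition laplacian :: "('a::euclidean_space \<Rightarrow> real) \<Rightarrow> 'a \<Rightarrow> real" where
  "laplacian f x = (\<Sum>b\<in>Basis. iter_partial [b, b] f x)"

text \<open>A function of the variables orthogonal to the unit vector \<open>\<nu>\<close>, represented as a function
  on the whole space that is constant along \<open>\<nu>\<close>. Its graph over the hyperplane orthogonal
  to \<open>\<nu>\<close> is \<open>{x. x \<bullet> \<nu> = h x}\<close>.\<close>

definition constant_along :: "'a::euclidean_space \<Rightarrow> ('a \<Rightarrow> real) \<Rightarrow> bool" where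
  "constant_along \<nu> h \<longleftrightarrow> (\<forall>x t. h (x + t *\<^sub>R \<nu>) = h x)"

text \<open>\<open>C\<^sup>\<infinity>\<close> boundary: near each boundary point, after a rotation of the axes, the set is the
  region on one side of the graph of a smooth function.\<close>

definition smooth_boundary :: "'a::euclidean_space set \<Rightarrow> bool" where
  "smooth_boundary \<Omega> \<longleftrightarrow>
     (\<forall>p\<in>frontier \<Omega>. \<exists>\<nu> h r. norm \<nu> = 1 \<and> 0 < r \<and>
        constant_along \<nu> h \<and> (\<forall>k. Ck_on k h UNIV) \<and>
        \<Omega> \<inter> ball p r = {x \<in> ball p r. h x < x \<bullet> \<nu>})"

text \<open>\<open>\<sigma>\<close> is the surface measure (\<open>(n-1)\<close>-dimensional area) on \<open>S\<close>: a Borel measure with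
  space \<open>S\<close> which in graph coordinates is \<open>sqrt (1 + |\<nabla>h|\<^sup>2) dy'\<close>. The
  \<open>(n-1)\<close>-dimensional Lebesgue measure \<open>dy'\<close> on the hyperplane orthogonal to \<open>\<nu>\<close> is written as
  \<open>n\<close>-dimensional Lebesgue measure on cylinders of height 1 along \<open>\<nu>\<close>: the point
  \<open>y + (h y - y \<bullet> \<nu>) \<nu>\<close> of the graph and the integrand depend only on the projection of
  \<open>y\<close> to that hyperplane. For \<open>n = 1\<close> this yields counting measure. On a compact smooth
  hypersurface exactly one measure satisfies this, namely the restriction of
  \<open>(n-1)\<close>-dimensional Hausdorff measure.\<close>

definition is_surface_measure :: "'a::euclidean_space set \<Rightarrow> 'a measure \<Rightarrow> bool" where
  "is_surface_measure S \<sigma> \<longleftrightarrow>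
     sets \<sigma> = sets (restrict_space borel S) \<and>
     (\<forall>\<nu> h A. norm \<nu> = 1 \<and> constant_along \<nu> h \<and> Ck_on 1 h UNIV \<and>
        A \<in> sets \<sigma> \<and> A \<subseteq> {x. x \<bullet> \<nu> = h x} \<longrightarrow>
        emeasure \<sigma> A =
          (\<integral>\<^sup>+y\<in>{y. 0 \<le> y \<bullet> \<nu> \<and> y \<bullet> \<nu> \<le> 1 \<and> y + (h y - y \<bullet> \<nu>) *\<^sub>R \<nu> \<in> A}.
             ennreal (sqrt (1 + (\<Sum>b\<in>Basis. (iter_partial [b] h y)\<^sup>2))) \<partial>lborel))"

definition Rbar :: "(real \<Rightarrow> real) \<Rightarrow> real \<Rightarrow> real" where
  "Rbar R r = set_lebesgue_integral lborel {r..} R"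

text \<open>\<open>R\<^sub>\<delta>\<close> is \<open>rescaled_kernel \<alpha> R \<delta>\<close>, and the kernel built from the integrated profile is
  \<open>rescaled_kernel \<alpha> (Rbar R) \<delta>\<close>.\<close>

definition rescaled_kernel ::
  "real \<Rightarrow> (real \<Rightarrow> real) \<Rightarrow> real \<Rightarrow> 'a::euclidean_space \<Rightarrow> 'a \<Rightarrow> real" where
  "rescaled_kernel \<alpha> K \<delta> x y = \<alpha> / \<delta> ^ DIM('a) * K ((norm (x - y))\<^sup>2 / (4 * \<delta>\<^sup>2))"

definition \<mu>_weight :: "'a::euclidean_space set \<Rightarrow> real \<Rightarrow> 'a \<Rightarrow> real" where
  "\<mu>_weight \<Omega> \<delta> x = min (2 * \<delta>) (max (\<delta>\<^sup>2) (infdist x (frontier \<Omega>)))"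

definition L2_on :: "'a::euclidean_space set \<Rightarrow> ('a \<Rightarrow> real) \<Rightarrow> bool" where
  "L2_on \<Omega> v \<longleftrightarrow> v \<in> borel_measurable (lebesgue_on \<Omega>) \<and>
     integrable (lebesgue_on \<Omega>) (\<lambda>x. (v x)\<^sup>2)"

definition solves_poisson ::
  "'a::euclidean_space set \<Rightarrow> ('a \<Rightarrow> real) \<Rightarrow> ('a \<Rightarrow> real) \<Rightarrow> ('a \<Rightarrow> real) \<Rightarrow> bool" where
  "solves_poisson \<Omega> f g u \<longleftrightarrow>
     (\<forall>x\<in>\<Omega>. - laplacian u x = f x) \<and> (\<forall>x\<in>frontier \<Omega>. u x = g x)"

definition solves_nonlocal ::
  "'a::euclidean_space set \<Rightarrow> 'a measure \<Rightarrow> (real \<Rightarrow> real) \<Rightarrow> real \<Rightarrow>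
   ('a \<Rightarrow> real) \<Rightarrow> ('a \<Rightarrow> real) \<Rightarrow> real \<Rightarrow> ('a \<Rightarrow> real) \<Rightarrow> bool" where
  "solves_nonlocal \<Omega> \<sigma> R \<alpha> f g \<delta> v \<longleftrightarrow> L2_on \<Omega> v \<and>
     (\<forall>x\<in>\<Omega>.
        1 / \<delta>\<^sup>2 * (\<integral>y. rescaled_kernel \<alpha> R \<delta> x y * (v x - v y) \<partial>lebesgue_on \<Omega>) +
        2 / \<mu>_weight \<Omega> \<delta> x *
          (\<integral>y. rescaled_kernel \<alpha> (Rbar R) \<delta> x y * (v x - g y) \<partial>\<sigma>) =
        (\<integral>y. rescaled_kernel \<alpha> (Rbar R) \<delta> x y * f y \<partial>lebesgue_on \<Omega>))"

end

theory Submission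
  imports Defs
begin

text \<open>The error \<open>e = u - u\<^sub>\<delta>\<close> solves the nonlocal equation with \<open>g = 0\<close> and the truncation error of
  \<open>u\<close> as right-hand side, and the nonlocal operator obeys a comparison principle, so it suffices
  to bound the truncation error by \<open>\<delta>\<^sup>2\<close> times the operator applied to a bounded supersolution.

  Since \<open>R\<^sub>\<delta>(x,y) (y - x)\<close> is \<open>-2 \<delta>\<^sup>2\<close> times the \<open>y\<close>-gradient of the kernel of \<open>Rbar R\<close>, a local
  divergence theorem turns the moments of \<open>R\<^sub>\<delta>\<close> over \<open>\<Omega>\<close> into boundary integrals. Inserted into
  the Taylor expansion of \<open>u\<close> of order four, the bulk terms cancel by \<open>-\<Delta>u = f\<close>, and the
  leading boundary term cancels because \<open>\<mu>(x) N(y) - (y - x)\<close> has an average of size \<open>\<delta>\<^sup>2\<close> near \<open>x\<close>,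
  \<open>N\<close> being the outer normal and \<open>\<mu>(x)\<close> the truncated distance to the boundary. What remains is
  \<open>O(\<delta>\<^sup>2) (1 + B/\<mu>)\<close>, where \<open>B\<close> is the boundary mass of the kernel of \<open>Rbar R\<close>. For small \<open>\<delta>\<close> a
  supersolution of this size is \<open>K - |x|\<^sup>2/2\<close>. For \<open>\<delta>\<close> bounded below the truncation error need
  only be bounded, and a constant minus an exponential is a supersolution uniformly in \<open>\<delta>\<close>.\<close>

section \<open>Divergence theorem over subgraphs\<close>

text \<open>\<open>R\<close> may jump at 1, so the kernel of \<open>Rbar R\<close> is only
  Lipschitz, and the surface measure is known only through its density on graphs. The divergence
  theorem is therefore proved for compactly supported Lipschitz functions with an almost everywhere
  derivative, one chart at a time; for small \<delta> the kernel support, of radius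
  \<open>2 * \<delta>\<close>, fits into one chart. The delicate scaling is at the boundary:
  \<open>B\<close> can be of size \<open>1/\<delta>\<close> and \<open>1/\<mu>\<close> of size
  \<open>1/\<delta>^2\<close>, so boundary errors cannot be bounded by \<open>\<delta>^2\<close>
  alone. They are measured against \<open>B/\<mu>\<close>, and the operator applied to a constant
  \<open>K\<close> is exactly \<open>2 * K * B/\<mu>\<close>. Where \<open>B\<close> vanishes the
  term \<open>- |x|^2/2\<close> has to do the work; it contributes the dimension times the mass of
  the kernel of \<open>Rbar R\<close> over the domain, which is bounded below up to the boundary
  because the domain contains a ball of radius comparable to \<delta> near each of its points. For
  \<delta> bounded below the truncation error is of the size of the kernel factor
  \<open>\<alpha> / \<delta>^n\<close>, up to multiples of \<open>B/\<mu>\<close>; an exponential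
  with a large rate gains a multiple of that same factor.\<close>

definition slab :: "'a::euclidean_space \<Rightarrow> 'a set" where
  "slab \<nu> = {y. 0 \<le> y \<bullet> \<nu> \<and> y \<bullet> \<nu> \<le> 1}"

lemma slab_borel [measurable]: "slab \<nu> \<in> sets borel"
  unfolding slab_def by measurable

lemma sigma_finite_density_indicator:
  assumes [measurable]: "A \<in> sets borel"
  shows "sigma_finite_measure (density (lborel :: 'a::euclidean_space measure) (indicator A))"
proof -
  have "sigma_finite_measure (density (lborel :: 'a measure) (\<lambda>x. indicator A x))"
    by (subst sigma_finite_measure.sigma_finite_iff_density_finite'[OF lborel.sigma_finite_measure_axioms]) (auto simp: indicator_def)
  then show ?thesis by simp
qed

text \<open>Translation invariance and Tonelli alone give this disintegration along \<open>\<nu>\<close>, so no rotation of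
  the axes is needed.\<close>

lemma lborel_slab:
  fixes \<nu> :: "'a::euclidean_space"
  assumes \<nu>: "norm \<nu> = 1"
  shows "distr (density lborel (indicator (slab \<nu>)) \<Otimes>\<^sub>M (lborel :: real measure)) borel
           (\<lambda>(y, t). y + t *\<^sub>R \<nu>) = lborel"
    (is "distr (?M \<Otimes>\<^sub>M _) _ ?g = _")
proof (rule measure_eqI)
  show "sets (distr (?M \<Otimes>\<^sub>M (lborel :: real measure)) borel ?g) = sets lborel" by simp
next
  fix A assume "A \<in> sets (distr (?M \<Otimes>\<^sub>M (lborel :: real measure)) borel ?g)"
  then have A[measurable]: "A \<in> sets borel" by simp
  interpret M: sigma_finite_measure ?M by (rule sigma_finite_density_indicator) simp
  interpret P: pair_sigma_finite ?M "lborel :: real measure" ..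
  have g[measurable]: "?g \<in> (?M \<Otimes>\<^sub>M (lborel :: real measure)) \<rightarrow>\<^sub>M borel"
    by measurable
  have nn: "\<nu> \<bullet> \<nu> = 1" using \<nu> by (simp add: dot_square_norm)
  have "emeasure (distr (?M \<Otimes>\<^sub>M (lborel :: real measure)) borel ?g) A
      = (\<integral>\<^sup>+z. indicator A z \<partial>distr (?M \<Otimes>\<^sub>M (lborel :: real measure)) borel ?g)"
    by simp
  also have "\<dots> = (\<integral>\<^sup>+z. indicator A (?g z) \<partial>(?M \<Otimes>\<^sub>M (lborel :: real measure)))"
    by (rule nn_integral_distr) simp_all
  also have "\<dots> = (\<integral>\<^sup>+t. \<integral>\<^sup>+y. indicator A (y + t *\<^sub>R \<nu>) \<partial>?M \<partial>lborel)"
    by (subst P.nn_integral_snd[symmetric]) auto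
  also have "\<dots> = (\<integral>\<^sup>+t. \<integral>\<^sup>+y. indicator (slab \<nu>) y * indicator A (y + t *\<^sub>R \<nu>) \<partial>lborel \<partial>lborel)"
    by (subst nn_integral_density) auto
  also have "\<dots> = (\<integral>\<^sup>+t. \<integral>\<^sup>+y. indicator (slab \<nu>) (y - t *\<^sub>R \<nu>) * indicator A y \<partial>lborel \<partial>lborel)"
  proof (rule nn_integral_cong)
    fix t :: real
    have "(\<integral>\<^sup>+y. indicator (slab \<nu>) (y - t *\<^sub>R \<nu>) * indicator A y \<partial>(lborel::'a measure))
        = (\<integral>\<^sup>+y. indicator (slab \<nu>) (y - t *\<^sub>R \<nu>) * indicator A y \<partial>distr (lborel::'a measure) borel ((+) (t *\<^sub>R \<nu>)))"
      by (simp add: lborel_distr_plus)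
    also have "\<dots> = (\<integral>\<^sup>+y. indicator (slab \<nu>) y * indicator A (y + t *\<^sub>R \<nu>) \<partial>lborel)"
      by (subst nn_integral_distr) (auto simp: algebra_simps)
    finally show "(\<integral>\<^sup>+y. indicator (slab \<nu>) y * indicator A (y + t *\<^sub>R \<nu>) \<partial>(lborel::'a measure)) =
         (\<integral>\<^sup>+y. indicator (slab \<nu>) (y - t *\<^sub>R \<nu>) * indicator A y \<partial>(lborel::'a measure))"
      by simp
  qed
  also have "\<dots> = (\<integral>\<^sup>+y. \<integral>\<^sup>+t. indicator (slab \<nu>) (y - t *\<^sub>R \<nu>) * indicator A y \<partial>lborel \<partial>lborel)"
    by (rule lborel_pair.Fubini') measurable
  also have "\<dots> = (\<integral>\<^sup>+y. indicator A y \<partial>(lborel::'a measure))"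
  proof (rule nn_integral_cong)
    \<comment> \<open>The \<open>t\<close> with \<open>y - t *\<^sub>R \<nu>\<close> in the slab
      form an interval of length 1, so integrating the slab indicator over \<open>t\<close> gives
      1.\<close>
    fix y :: 'a
    have "(\<integral>\<^sup>+t. indicator (slab \<nu>) (y - t *\<^sub>R \<nu>) * indicator A y \<partial>(lborel::real measure))
        = (\<integral>\<^sup>+t. indicator {y \<bullet> \<nu> - 1 .. y \<bullet> \<nu>} t * indicator A y \<partial>(lborel::real measure))"
      by (intro nn_integral_cong)
        (auto simp: slab_def indicator_def nn algebra_simps)
    also have "\<dots> = indicator A y"
      by (subst nn_integral_multc) auto
    finally show "(\<integral>\<^sup>+t. indicator (slab \<nu>) (y - t *\<^sub>R \<nu>) * indicator A y \<partial>(lborel::real measure))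
         = indicator A y" .
  qed
  finally show "emeasure (distr (?M \<Otimes>\<^sub>M (lborel :: real measure)) borel ?g) A = emeasure lborel A"
    by simp
qed

text \<open>By translation invariance the line through \<open>y\<close> may be parametrised from any
  origin. With \<open>c\<close> the height of \<open>y\<close> above a graph, \<open>s\<close>
  becomes the height above that graph.\<close>

lemma integral_slab:
  fixes \<nu> :: "'a::euclidean_space" and \<Phi> :: "'a \<Rightarrow> real" and c :: "'a \<Rightarrow> real"
  assumes \<nu>: "norm \<nu> = 1" and \<Phi>: "integrable lborel \<Phi>"
  shows "(\<integral>y. \<Phi> y \<partial>lborel) =
           (\<integral>y. indicator (slab \<nu>) y * (\<integral>s. \<Phi> (y + (s - c y) *\<^sub>R \<nu>) \<partial>lborel) \<partial>lborel)"
proof -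
  let ?M = "density (lborel::'a measure) (indicator (slab \<nu>))"
  let ?g = "\<lambda>(y, t). y + t *\<^sub>R \<nu>"
  interpret M: sigma_finite_measure ?M by (rule sigma_finite_density_indicator) simp
  interpret P: pair_sigma_finite ?M "lborel :: real measure" ..
  have [measurable]: "\<Phi> \<in> borel_measurable borel" using \<Phi> by (simp add: borel_measurable_integrable)
  have g[measurable]: "?g \<in> (?M \<Otimes>\<^sub>M (lborel :: real measure)) \<rightarrow>\<^sub>M borel"
    by measurable
  have int: "integrable (?M \<Otimes>\<^sub>M (lborel :: real measure)) (\<lambda>z. \<Phi> (?g z))"
    using \<Phi> by (subst integrable_distr_eq[symmetric, where N=borel]) (auto simp: lborel_slab[OF \<nu>])
  have "(\<integral>y. \<Phi> y \<partial>lborel) = (\<integral>y. \<Phi> y \<partial>distr (?M \<Otimes>\<^sub>M (lborel :: real measure)) borel ?g)"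
    by (simp add: lborel_slab[OF \<nu>])
  also have "\<dots> = (\<integral>z. \<Phi> (?g z) \<partial>(?M \<Otimes>\<^sub>M (lborel :: real measure)))"
    by (rule integral_distr) auto
  also have "\<dots> = (\<integral>y. \<integral>t. \<Phi> (y + t *\<^sub>R \<nu>) \<partial>lborel \<partial>?M)"
    using P.integral_fst'[OF int] by simp
  also have "\<dots> = (\<integral>y. indicator (slab \<nu>) y * (\<integral>t. \<Phi> (y + t *\<^sub>R \<nu>) \<partial>lborel) \<partial>lborel)"
    using integral_density[of "\<lambda>y. \<integral>t. \<Phi> (y + t *\<^sub>R \<nu>) \<partial>lborel" "lborel::'a measure" "indicator (slab \<nu>)"]
    by (simp add: ennreal_indicator)
  also have "\<dots> = (\<integral>y. indicator (slab \<nu>) y * (\<integral>s. \<Phi> (y + (s - c y) *\<^sub>R \<nu>) \<partial>lborel) \<partial>lborel)"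
  proof -
    have "(\<integral>t. \<Phi> (y + t *\<^sub>R \<nu>) \<partial>lborel) = (\<integral>s. \<Phi> (y + (s - c y) *\<^sub>R \<nu>) \<partial>lborel)" for y :: 'a
      by (subst lborel_integral_real_affine[of 1 _ "- c y"]) (auto simp: algebra_simps)
    then show ?thesis by simp
  qed
  finally show ?thesis .
qed

lemma directional_difference_quotient_tendsto:
  fixes F :: "'a::euclidean_space \<Rightarrow> real"
  assumes "(F has_derivative D) (at y)" and "t \<longlonglongrightarrow> 0" and "\<And>k. t k \<noteq> 0"
  shows "(\<lambda>k. (F (y + t k *\<^sub>R e) - F y) / t k) \<longlonglongrightarrow> D e"
proof -
  have lin: "linear D" using assms(1) by (rule has_derivative_linear)
  have "((\<lambda>s. F (y + s *\<^sub>R e)) has_derivative (\<lambda>s. D (s *\<^sub>R e))) (at 0)"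
    by (rule has_derivative_compose[where f = "\<lambda>s. y + s *\<^sub>R e"])
      (auto intro!: derivative_eq_intros simp: assms(1))
  then have "((\<lambda>s. F (y + s *\<^sub>R e)) has_real_derivative D e) (at 0)"
    by (simp add: has_field_derivative_def linear_cmul[OF lin] mult.commute[of _ "D e"] cong: if_cong)
  then have "((\<lambda>s. (F (y + s *\<^sub>R e) - F y) / s) \<longlongrightarrow> D e) (at 0)"
    by (simp add: DERIV_def)
  moreover have "filterlim t (at 0) sequentially"
    using assms(2,3) by (simp add: filterlim_at)
  ultimately show ?thesis by (rule filterlim_compose)
qed

lemma integrable_indicator_cball [simp]:
  "integrable lborel (indicator (cball x r) :: 'a::euclidean_space \<Rightarrow> real)"
  using emeasure_bounded_finite[of "cball x r"] by (auto simp: integrable_indicator_iff)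

text \<open>The derivative at \<open>t = 0\<close> of the integral of \<open>F (y + t e)\<close> over the subgraph, computed once under
  the integral sign and once by moving the domain.\<close>

lemma green_subgraph:
  fixes \<nu> e x\<^sub>0 :: "'a::euclidean_space" and h F :: "'a \<Rightarrow> real"
    and dh :: "'a \<Rightarrow> 'a" and F' :: "'a \<Rightarrow> 'a \<Rightarrow> real"
  assumes \<nu>: "norm \<nu> = 1" and h\<nu>: "constant_along \<nu> h"
    and dh: "\<And>y. (h has_derivative (\<lambda>k. dh y \<bullet> k)) (at y)" and cdh: "continuous_on UNIV dh"
    and supp: "\<And>y. r < norm (y - x\<^sub>0) \<Longrightarrow> F y = 0" and "0 \<le> r"
    and bnd: "\<And>y. \<bar>F y\<bar> \<le> M" and "0 \<le> L"
    and lip: "\<And>y z. norm (y - z) \<le> 1 \<Longrightarrow> \<bar>F y - F z\<bar> \<le> L * norm (y - z)"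
    and F': "AE y in lborel. (F has_derivative F' y) (at y)"
    and meas [measurable]: "(\<lambda>y. F' y e) \<in> borel_measurable borel"
  defines "\<rho> \<equiv> \<lambda>y. y \<bullet> \<nu> - h y"
  shows "(\<integral>y. indicator {y. 0 < \<rho> y} y * F' y e \<partial>lborel) =
         - (\<integral>y. indicator (slab \<nu>) y * (F (y - \<rho> y *\<^sub>R \<nu>) * (e \<bullet> \<nu> - dh y \<bullet> e)) \<partial>lborel)"
proof -
  have nn: "\<nu> \<bullet> \<nu> = 1" using \<nu> by (simp add: dot_square_norm)
  have ch: "continuous_on UNIV h"
    using dh by (meson continuous_at_imp_continuous_on has_derivative_continuous)
  have cF: "continuous_on UNIV F"
  proof (rule continuous_at_imp_continuous_on, rule ballI)
    fix y :: 'a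
    have "((\<lambda>z. L * norm (z - y)) \<longlongrightarrow> L * norm (y - y)) (at y)" by (intro tendsto_intros)
    then have "((\<lambda>z. L * norm (z - y)) \<longlongrightarrow> 0) (at y)" by simp
    moreover have "\<forall>\<^sub>F z in at y. norm (F z - F y) \<le> L * norm (z - y)"
      unfolding eventually_at using lip
      by (intro exI[of _ 1]) (auto simp: dist_norm)
    ultimately have "((\<lambda>z. F z - F y) \<longlongrightarrow> 0) (at y)" by (rule Lim_null_comparison[rotated])
    then show "isCont F y" by (simp add: isCont_def LIM_zero_iff)
  qed
  have [measurable]: "h \<in> borel_measurable borel" "F \<in> borel_measurable borel" "dh \<in> borel_measurable borel"
    using ch cF cdh by (auto intro: borel_measurable_continuous_onI)
  have [measurable]: "\<rho> \<in> borel_measurable borel" unfolding \<rho>_def by measurable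
  have \<rho>_shift: "\<rho> (y + a *\<^sub>R \<nu>) = \<rho> y + a" for y :: 'a and a
    using h\<nu> by (simp add: \<rho>_def inner_add_left nn constant_along_def)
  define P where "P = (\<lambda>y. y - \<rho> y *\<^sub>R \<nu>)"
  \<comment> \<open>The factor \<open>1 + norm e\<close> keeps every shift
    \<open>t k *\<^sub>R e\<close> within length 1, the range in which \<open>lip\<close>
    applies.\<close>
  define t where "t = (\<lambda>k. 1 / (real (Suc k) * (1 + norm e)))"
  have t0: "t k > 0" for k unfolding t_def by (simp add: add_pos_nonneg)
  have tne: "t k * norm e \<le> 1" for k
  proof -
    have "norm e \<le> real (Suc k) * (1 + norm e)"
      using mult_mono[of 1 "real (Suc k)" "norm e" "1 + norm e"] by simp
    then show ?thesis unfolding t_def by (simp add: divide_le_eq add_pos_nonneg)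
  qed
  have tlim: "t \<longlonglongrightarrow> 0"
  proof -
    have "(\<lambda>k. (1 / (1 + norm e)) * inverse (real (Suc k))) \<longlonglongrightarrow> (1 / (1 + norm e)) * 0"
      by (intro tendsto_intros LIMSEQ_inverse_real_of_nat)
    then show ?thesis by (simp add: t_def field_simps)
  qed
  define G where "G = (\<lambda>k y. (F (y + t k *\<^sub>R e) - F y) / t k)"
  have [measurable]: "G k \<in> borel_measurable borel" for k unfolding G_def by measurable
  \<comment> \<open>First evaluation: the difference quotients converge almost everywhere and are
    dominated through the Lipschitz constant on a ball enlarged by the largest shift.\<close>
  have lim1: "(\<lambda>k. \<integral>y. indicator {y. 0 < \<rho> y} y * G k y \<partial>lborel)
      \<longlonglongrightarrow> (\<integral>y. indicator {y. 0 < \<rho> y} y * F' y e \<partial>lborel)"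
  proof (rule integral_dominated_convergence[where w = "\<lambda>y. indicator (cball x\<^sub>0 (r+1)) y * (L * norm e)"])
    show "AE y in lborel. (\<lambda>k. indicator {y. 0 < \<rho> y} y * G k y) \<longlonglongrightarrow> indicator {y. 0 < \<rho> y} y * F' y e"
      using F'
    proof eventually_elim
      case (elim y)
      show ?case unfolding G_def using t0
        by (intro tendsto_intros directional_difference_quotient_tendsto[OF elim tlim]) (metis less_irrefl)
    qed
    show "AE y in lborel. norm (indicator {y. 0 < \<rho> y} y * G k y) \<le> indicator (cball x\<^sub>0 (r+1)) y * (L * norm e)" for k
    proof (rule AE_I2)
      fix y :: 'a
      have "\<bar>G k y\<bar> \<le> L * norm e"
      proof -
        have "\<bar>F (y + t k *\<^sub>R e) - F y\<bar> \<le> L * norm (t k *\<^sub>R e)"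
          using lip[of "y + t k *\<^sub>R e" y] tne[of k] t0[of k] by simp
        then show ?thesis using t0[of k] by (simp add: G_def abs_divide divide_le_eq mult_ac)
      qed
      moreover have "G k y = 0" if "y \<notin> cball x\<^sub>0 (r+1)"
      proof -
        have "norm (y - x\<^sub>0) > r + 1" using that by (simp add: dist_norm norm_minus_commute)
        moreover have "norm (y - x\<^sub>0) \<le> norm (y + t k *\<^sub>R e - x\<^sub>0) + norm (t k *\<^sub>R e)"
          using norm_triangle_ineq4[of "y + t k *\<^sub>R e - x\<^sub>0" "t k *\<^sub>R e"] by (simp add: algebra_simps)
        ultimately have "r < norm (y + t k *\<^sub>R e - x\<^sub>0)" "r < norm (y - x\<^sub>0)"
          using tne[of k] t0[of k] by auto
        then show ?thesis by (simp add: G_def supp)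
      qed
      ultimately show "norm (indicator {y. 0 < \<rho> y} y * G k y) \<le> indicator (cball x\<^sub>0 (r+1)) y * (L * norm e)"
        using \<open>0 \<le> L\<close> by (auto simp: indicator_def)
    qed
  qed (auto intro: borel_measurable_integrable)
  \<comment> \<open>Second evaluation: the shift is moved from \<open>F\<close> to the domain, so
    only the thin layer between the graph and its translate contributes.\<close>
  define \<Phi> where "\<Phi> = (\<lambda>k y. F y * (indicator {y. 0 < \<rho> y} (y - t k *\<^sub>R e) - indicator {y. 0 < \<rho> y} y) / t k)"
  have \<Phi>_meas[measurable]: "\<Phi> k \<in> borel_measurable borel" for k unfolding \<Phi>_def by measurable
  have M0: "0 \<le> M" using bnd[of x\<^sub>0] by linarith
  have \<Phi>_int: "integrable lborel (\<Phi> k)" for k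
  proof (rule Bochner_Integration.integrable_bound)
    show "AE y in lborel. norm (\<Phi> k y) \<le> norm (indicator (cball x\<^sub>0 r) y * (M / t k))"
    proof (rule AE_I2)
      fix y :: 'a
      show "norm (\<Phi> k y) \<le> norm (indicator (cball x\<^sub>0 r) y * (M / t k))"
      proof (cases "y \<in> cball x\<^sub>0 r")
        case True
        then show ?thesis using bnd[of y] t0[of k] M0
          by (auto simp: \<Phi>_def indicator_def abs_mult divide_right_mono)
      next
        case False
        then have "F y = 0" by (intro supp) (simp add: dist_norm norm_minus_commute)
        then show ?thesis by (simp add: \<Phi>_def)
      qed
    qed
  qed simp_all
  have F_int: "integrable lborel (\<lambda>y. w y * F y)" if [measurable]: "w \<in> borel_measurable borel"
    and w: "\<And>y. \<bar>w y\<bar> \<le> 1" for w :: "'a \<Rightarrow> real"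
  proof (rule Bochner_Integration.integrable_bound[where f="\<lambda>y. indicator (cball x\<^sub>0 r) y * M"])
    show "AE y in lborel. norm (w y * F y) \<le> norm (indicator (cball x\<^sub>0 r) y * M)"
    proof (rule AE_I2)
      fix y :: 'a
      show "norm (w y * F y) \<le> norm (indicator (cball x\<^sub>0 r) y * M)"
      proof (cases "y \<in> cball x\<^sub>0 r")
        case True
        then show ?thesis using mult_mono[OF w[of y] bnd[of y]] M0
          by (auto simp: abs_mult)
      next
        case False
        then have "F y = 0" by (intro supp) (simp add: dist_norm norm_minus_commute)
        then show ?thesis by simp
      qed
    qed
  qed simp_all
  define I where "I = (\<lambda>k y. \<integral>s. \<Phi> k (y + (s - \<rho> y) *\<^sub>R \<nu>) \<partial>lborel)"
  have [measurable]: "I k \<in> borel_measurable borel" for k unfolding I_def by measurable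
  have eq: "(\<integral>y. indicator {y. 0 < \<rho> y} y * G k y \<partial>lborel) = (\<integral>y. indicator (slab \<nu>) y * I k y \<partial>lborel)" for k
  proof -
    let ?i = "indicator {y. 0 < \<rho> y} :: 'a \<Rightarrow> real"
    have shift: "(\<integral>y. ?i y * F (y + t k *\<^sub>R e) \<partial>lborel) = (\<integral>y. ?i (y - t k *\<^sub>R e) * F y \<partial>lborel)"
    proof -
      have "(\<integral>y. ?i (y - t k *\<^sub>R e) * F y \<partial>lborel)
          = (\<integral>y. ?i (y - t k *\<^sub>R e) * F y \<partial>distr (lborel::'a measure) borel ((+) (t k *\<^sub>R e)))"
        by (simp add: lborel_distr_plus)
      also have "\<dots> = (\<integral>y. ?i y * F (y + t k *\<^sub>R e) \<partial>lborel)"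
        by (subst integral_distr) (auto simp: algebra_simps)
      finally show ?thesis by simp
    qed
    have int1: "integrable lborel (\<lambda>y. ?i (y - t k *\<^sub>R e) * F y)"
      by (rule F_int) (auto simp: indicator_def)
    have int2: "integrable lborel (\<lambda>y. ?i y * F y)" by (rule F_int) (auto simp: indicator_def)
    have int3: "integrable lborel (\<lambda>y. ?i y * F (y + t k *\<^sub>R e))"
    proof -
      have "integrable (distr (lborel::'a measure) borel ((+) (t k *\<^sub>R e))) (\<lambda>y. ?i (y - t k *\<^sub>R e) * F y)"
        using int1 by (simp add: lborel_distr_plus)
      then show ?thesis by (subst (asm) integrable_distr_eq) (auto simp: algebra_simps)
    qed
    have "(\<integral>y. ?i y * G k y \<partial>lborel) = (\<integral>y. (?i y * F (y + t k *\<^sub>R e) - ?i y * F y) / t k \<partial>lborel)"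
      by (intro Bochner_Integration.integral_cong refl) (simp add: G_def algebra_simps diff_divide_distrib)
    also have "\<dots> = ((\<integral>y. ?i y * F (y + t k *\<^sub>R e) \<partial>lborel) - (\<integral>y. ?i y * F y \<partial>lborel)) / t k"
      using int2 int3 by simp
    also have "\<dots> = (\<integral>y. (?i (y - t k *\<^sub>R e) * F y - ?i y * F y) / t k \<partial>lborel)"
      unfolding shift using int1 int2 by simp
    also have "\<dots> = (\<integral>y. \<Phi> k y \<partial>lborel)"
      by (intro Bochner_Integration.integral_cong refl) (simp add: \<Phi>_def algebra_simps diff_divide_distrib)
    also have "\<dots> = (\<integral>y. indicator (slab \<nu>) y * I k y \<partial>lborel)"
      unfolding I_def by (rule integral_slab[OF \<nu> \<Phi>_int])
    finally show ?thesis .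
  qed
  \<comment> \<open>On the line over \<open>P y\<close>, in the height variable \<open>s\<close>,
    the translated domain is \<open>c k y < s\<close> and the original one is \<open>0 < s\<close>.
    \<open>\<kappa>\<close> is the difference of the two indicators divided by \<open>t k\<close>: a
    signed interval of length \<open>\<bar>c k y\<bar>\<close>.\<close>
  define c where "c = (\<lambda>k y. \<rho> y - \<rho> (y - t k *\<^sub>R e))"
  define \<kappa> where "\<kappa> = (\<lambda>k y s. (indicator {c k y<..0} s - indicator {0<..c k y} s) / t k :: real)"
  have \<Phi>_eq: "\<Phi> k (y + (s - \<rho> y) *\<^sub>R \<nu>) = F (P y + s *\<^sub>R \<nu>) * \<kappa> k y s" for k y s
  proof -
    have 1: "\<rho> (y + (s - \<rho> y) *\<^sub>R \<nu>) = s" by (simp add: \<rho>_shift)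
    have 2: "\<rho> (y + (s - \<rho> y) *\<^sub>R \<nu> - t k *\<^sub>R e) = s - c k y"
      using \<rho>_shift[of "y - t k *\<^sub>R e" "s - \<rho> y"] by (simp add: c_def algebra_simps)
    have 3: "y + (s - \<rho> y) *\<^sub>R \<nu> = P y + s *\<^sub>R \<nu>" by (simp add: P_def algebra_simps)
    show ?thesis using 1 2 unfolding \<Phi>_def \<kappa>_def 3
      by (auto simp: indicator_def)
  qed
  have i_int: "integrable lborel (indicat_real {a<..b})" for a b :: real
    by (cases "a \<le> b") (auto simp: integrable_indicator_iff)
  have m_val: "measure lborel {a<..b} = (if a \<le> b then b - a else 0)" for a b :: real
    by (simp add: measure_def)
  have \<kappa>_int: "integrable lborel (\<kappa> k y)" for k y
    unfolding \<kappa>_def by (intro integrable_divide Bochner_Integration.integrable_diff i_int)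
  have \<kappa>_val: "(\<integral>s. \<kappa> k y s \<partial>lborel) = - (c k y / t k)" for k y
    unfolding \<kappa>_def by (subst Bochner_Integration.integral_divide_zero, subst Bochner_Integration.integral_diff) (use i_int in \<open>auto simp: m_val\<close>)
  have \<kappa>_abs: "(\<integral>s. \<bar>\<kappa> k y s\<bar> \<partial>lborel) = \<bar>c k y\<bar> / t k" for k y
  proof -
    have "\<bar>\<kappa> k y s\<bar> = (if c k y < 0 then \<kappa> k y s else - \<kappa> k y s)" for s
      using t0[of k] by (auto simp: \<kappa>_def indicator_def)
    then show ?thesis using \<kappa>_val[of k y] by (cases "c k y < 0") auto
  qed
  define q where "q = (\<lambda>y. e \<bullet> \<nu> - dh y \<bullet> e)"
  have clim: "(\<lambda>k. c k y / t k) \<longlonglongrightarrow> q y" for y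
  proof -
    have "(\<lambda>k. (h (y + t k *\<^sub>R (- e)) - h y) / t k) \<longlonglongrightarrow> dh y \<bullet> (- e)"
      by (rule directional_difference_quotient_tendsto[OF dh tlim]) (metis t0 less_irrefl)
    then have "(\<lambda>k. e \<bullet> \<nu> + (h (y + t k *\<^sub>R (- e)) - h y) / t k) \<longlonglongrightarrow> e \<bullet> \<nu> + dh y \<bullet> (- e)"
      by (intro tendsto_intros)
    moreover have "c k y / t k = e \<bullet> \<nu> + (h (y + t k *\<^sub>R (- e)) - h y) / t k" for k
      using t0[of k] by (simp add: c_def \<rho>_def inner_diff_left field_simps)
    ultimately show ?thesis by (simp add: q_def)
  qed
  have c0: "(\<lambda>k. c k y) \<longlonglongrightarrow> 0" for y
  proof -
    have "(\<lambda>k. c k y / t k * t k) \<longlonglongrightarrow> q y * 0" by (intro tendsto_mult clim tlim)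
    then show ?thesis using t0 by (simp add: less_imp_neq[THEN not_sym])
  qed
  have prod_int: "integrable lborel (\<lambda>s. F (P y + s *\<^sub>R \<nu>) * \<kappa> k y s)" for k y
  proof (rule Bochner_Integration.integrable_bound[where f="\<lambda>s. M * \<kappa> k y s"])
    show "AE s in lborel. norm (F (P y + s *\<^sub>R \<nu>) * \<kappa> k y s) \<le> norm (M * \<kappa> k y s)"
      using bnd M0 by (auto simp: abs_mult mult_right_mono)
    show "(\<lambda>s. F (P y + s *\<^sub>R \<nu>) * \<kappa> k y s) \<in> borel_measurable lborel"
      using borel_measurable_integrable[OF \<kappa>_int] by measurable
  qed (use \<kappa>_int in simp)
  have I_lim: "(\<lambda>k. I k y) \<longlonglongrightarrow> - (F (P y) * q y)" for y
  proof -
    \<comment> \<open>On the layer \<open>F\<close> differs from its value on the graph by at most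
      \<open>L * \<bar>c k y\<bar>\<close>, which tends to 0, while the thickness divided by
      \<open>t k\<close> converges.\<close>
    have est: "\<bar>I k y + F (P y) * (c k y / t k)\<bar> \<le> L * \<bar>c k y\<bar> * \<bar>c k y / t k\<bar>" if "\<bar>c k y\<bar> \<le> 1" for k
    proof -
      have "I k y + F (P y) * (c k y / t k) = (\<integral>s. F (P y + s *\<^sub>R \<nu>) * \<kappa> k y s \<partial>lborel) - (\<integral>s. F (P y) * \<kappa> k y s \<partial>lborel)"
        unfolding I_def \<Phi>_eq using \<kappa>_val[of k y] by simp
      also have "\<dots> = (\<integral>s. F (P y + s *\<^sub>R \<nu>) * \<kappa> k y s - F (P y) * \<kappa> k y s \<partial>lborel)"
        by (rule Bochner_Integration.integral_diff[symmetric]) (use prod_int \<kappa>_int in auto)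
      finally have eq: "I k y + F (P y) * (c k y / t k) = \<dots>" .
      have "\<bar>\<integral>s. F (P y + s *\<^sub>R \<nu>) * \<kappa> k y s - F (P y) * \<kappa> k y s \<partial>lborel\<bar>
          \<le> (\<integral>s. \<bar>F (P y + s *\<^sub>R \<nu>) * \<kappa> k y s - F (P y) * \<kappa> k y s\<bar> \<partial>lborel)"
        by (rule integral_abs_bound)
      also have "\<dots> \<le> (\<integral>s. L * \<bar>c k y\<bar> * \<bar>\<kappa> k y s\<bar> \<partial>lborel)"
      proof (rule integral_mono)
        show "integrable lborel (\<lambda>s. \<bar>F (P y + s *\<^sub>R \<nu>) * \<kappa> k y s - F (P y) * \<kappa> k y s\<bar>)"
          using prod_int[of y k] \<kappa>_int[of k y] by auto
        show "integrable lborel (\<lambda>s. L * \<bar>c k y\<bar> * \<bar>\<kappa> k y s\<bar>)" using \<kappa>_int[of k y] by auto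
        fix s :: real
        show "\<bar>F (P y + s *\<^sub>R \<nu>) * \<kappa> k y s - F (P y) * \<kappa> k y s\<bar> \<le> L * \<bar>c k y\<bar> * \<bar>\<kappa> k y s\<bar>"
        proof (cases "\<kappa> k y s = 0")
          case False
          then have "s \<in> {c k y<..0} \<or> s \<in> {0<..c k y}" by (rule contrapos_np) (simp add: \<kappa>_def)
          then have s: "\<bar>s\<bar> \<le> \<bar>c k y\<bar>" by auto
          then have "\<bar>F (P y + s *\<^sub>R \<nu>) - F (P y)\<bar> \<le> L * \<bar>s\<bar>"
            using lip[of "P y + s *\<^sub>R \<nu>" "P y"] that \<nu> by simp
          also have "\<dots> \<le> L * \<bar>c k y\<bar>" using s \<open>0 \<le> L\<close> by (rule mult_left_mono)
          finally show ?thesis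
            by (simp add: left_diff_distrib[symmetric] abs_mult mult_right_mono)
        qed simp
      qed
      also have "\<dots> = L * \<bar>c k y\<bar> * \<bar>c k y / t k\<bar>" using \<kappa>_abs[of k y] t0[of k] by simp
      finally show ?thesis unfolding eq .
    qed
    have "(\<lambda>k. L * \<bar>c k y\<bar> * \<bar>c k y / t k\<bar>) \<longlonglongrightarrow> L * \<bar>0\<bar> * \<bar>q y\<bar>"
      by (intro tendsto_intros c0 clim)
    then have "(\<lambda>k. L * \<bar>c k y\<bar> * \<bar>c k y / t k\<bar>) \<longlonglongrightarrow> 0" by simp
    moreover have "\<forall>\<^sub>F k in sequentially. norm (I k y + F (P y) * (c k y / t k)) \<le> L * \<bar>c k y\<bar> * \<bar>c k y / t k\<bar>"
    proof -
      have "\<forall>\<^sub>F k in sequentially. dist (c k y) 0 < 1" using c0[of y] by (rule tendstoD) simp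
      then show ?thesis by eventually_elim (use est in auto)
    qed
    ultimately have "(\<lambda>k. I k y + F (P y) * (c k y / t k)) \<longlonglongrightarrow> 0" by (rule Lim_null_comparison[rotated])
    then have "(\<lambda>k. (I k y + F (P y) * (c k y / t k)) - F (P y) * (c k y / t k)) \<longlonglongrightarrow> 0 - F (P y) * q y"
      by (intro tendsto_intros clim)
    then show ?thesis by simp
  qed
  \<comment> \<open>If \<open>y\<close> is in the slab and its line meets the support at
    \<open>z\<close>, then \<open>\<bar>z \<bullet> \<nu>\<bar> \<le> r + norm x\<^sub>0\<close> and
    \<open>\<bar>y \<bullet> \<nu>\<bar> \<le> 1\<close>, so \<open>y\<close> is within
    \<open>r + (1 + r + norm x\<^sub>0)\<close> of \<open>x\<^sub>0\<close>. This confines the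
    dominating function to a ball.\<close>
  define r2 where "r2 = 2 * r + 1 + norm x\<^sub>0"
  obtain \<Lambda> where \<Lambda>: "\<And>y. y \<in> cball x\<^sub>0 (r2 + 1) \<Longrightarrow> norm (dh y) \<le> \<Lambda>"
  proof -
    have "bounded (dh ` cball x\<^sub>0 (r2 + 1))"
      by (intro compact_imp_bounded compact_continuous_image continuous_on_subset[OF cdh]) auto
    then show thesis using that unfolding bounded_iff by blast
  qed
  have r20: "0 \<le> r2" using \<open>0 \<le> r\<close> by (simp add: r2_def)
  have \<Lambda>0: "0 \<le> \<Lambda>" using order_trans[OF norm_ge_zero \<Lambda>[of x\<^sub>0]] r20 by simp
  have lim2: "(\<lambda>k. \<integral>y. indicator (slab \<nu>) y * I k y \<partial>lborel)
      \<longlonglongrightarrow> (\<integral>y. indicator (slab \<nu>) y * - (F (P y) * q y) \<partial>lborel)"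
  proof (rule integral_dominated_convergence[where w = "\<lambda>y. indicator (cball x\<^sub>0 r2) y * (M * (norm e * (1 + \<Lambda>)))"])
    show "AE y in lborel. (\<lambda>k. indicator (slab \<nu>) y * I k y) \<longlonglongrightarrow> indicator (slab \<nu>) y * - (F (P y) * q y)"
      by (intro AE_I2 tendsto_intros I_lim)
    show "(\<lambda>y. indicator (slab \<nu>) y * - (F (P y) * q y)) \<in> borel_measurable lborel"
      unfolding P_def q_def by measurable
    show "AE y in lborel. norm (indicator (slab \<nu>) y * I k y) \<le> indicator (cball x\<^sub>0 r2) y * (M * (norm e * (1 + \<Lambda>)))" for k
    proof (rule AE_I2)
      fix y :: 'a
      have zero: "I k y = 0" if y: "y \<in> slab \<nu>" "y \<notin> cball x\<^sub>0 r2"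
      proof -
        have "F (P y + s *\<^sub>R \<nu>) = 0" for s
        proof (rule supp, rule ccontr)
          assume "\<not> r < norm (P y + s *\<^sub>R \<nu> - x\<^sub>0)"
          then have le: "norm (P y + s *\<^sub>R \<nu> - x\<^sub>0) \<le> r" by simp
          define z where "z = P y + s *\<^sub>R \<nu>"
          have yz: "y = z + (y \<bullet> \<nu> - z \<bullet> \<nu>) *\<^sub>R \<nu>"
            by (simp add: z_def P_def inner_add_left inner_diff_left nn algebra_simps)
          have "norm z \<le> r + norm x\<^sub>0" using le norm_triangle_ineq[of "z - x\<^sub>0" x\<^sub>0] by (simp add: z_def)
          then have "\<bar>z \<bullet> \<nu>\<bar> \<le> r + norm x\<^sub>0" using Cauchy_Schwarz_ineq2[of z \<nu>] \<nu> by simp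
          then have "\<bar>y \<bullet> \<nu> - z \<bullet> \<nu>\<bar> \<le> 1 + r + norm x\<^sub>0" using y(1) by (auto simp: slab_def)
          moreover have "norm (y - x\<^sub>0) \<le> norm (z - x\<^sub>0) + \<bar>y \<bullet> \<nu> - z \<bullet> \<nu>\<bar>"
          proof -
            have "norm (y - x\<^sub>0) = norm ((z - x\<^sub>0) + (y \<bullet> \<nu> - z \<bullet> \<nu>) *\<^sub>R \<nu>)" by (subst yz) (simp add: algebra_simps)
            also have "\<dots> \<le> norm (z - x\<^sub>0) + norm ((y \<bullet> \<nu> - z \<bullet> \<nu>) *\<^sub>R \<nu>)" by (rule norm_triangle_ineq)
            finally show ?thesis using \<nu> by simp
          qed
          ultimately have "norm (y - x\<^sub>0) \<le> r2" using le by (simp add: r2_def z_def)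
          then show False using y(2) by (simp add: dist_norm norm_minus_commute)
        qed
        then show ?thesis unfolding I_def \<Phi>_eq by simp
      qed
      have "\<bar>I k y\<bar> \<le> M * (norm e * (1 + \<Lambda>))" if y: "y \<in> cball x\<^sub>0 r2"
      proof -
        have sub: "closed_segment (y - t k *\<^sub>R e) y \<subseteq> cball x\<^sub>0 (r2 + 1)"
        proof (rule closed_segment_subset)
          have "norm (t k *\<^sub>R e) \<le> 1" using tne[of k] t0[of k] by simp
          then have "dist x\<^sub>0 (y - t k *\<^sub>R e) \<le> dist x\<^sub>0 y + 1"
            using norm_triangle_ineq[of "x\<^sub>0 - y" "t k *\<^sub>R e"] by (simp add: dist_norm algebra_simps)
          then show "y - t k *\<^sub>R e \<in> cball x\<^sub>0 (r2 + 1)" using y by simp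
        qed (use y in auto)
        have "norm (h y - h (y - t k *\<^sub>R e)) \<le> \<Lambda> * norm (y - (y - t k *\<^sub>R e))"
        proof (rule differentiable_bound[where S="closed_segment (y - t k *\<^sub>R e) y" and f'="\<lambda>y k. dh y \<bullet> k"])
          fix z assume "z \<in> closed_segment (y - t k *\<^sub>R e) y"
          then have "norm (dh z) \<le> \<Lambda>" using sub \<Lambda> by blast
          then show "onorm ((\<bullet>) (dh z)) \<le> \<Lambda>"
            by (intro onorm_le) (auto intro!: order_trans[OF Cauchy_Schwarz_ineq2] mult_right_mono)
        qed (use dh in \<open>auto intro: has_derivative_at_withinI\<close>)
        then have "\<bar>h y - h (y - t k *\<^sub>R e)\<bar> \<le> t k * (\<Lambda> * norm e)" using t0[of k] by (simp add: mult_ac)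
        moreover have "\<bar>t k * (e \<bullet> \<nu>)\<bar> \<le> t k * norm e"
          using t0[of k] Cauchy_Schwarz_ineq2[of e \<nu>] \<nu> by (simp add: abs_mult)
        moreover have "c k y = t k * (e \<bullet> \<nu>) - (h y - h (y - t k *\<^sub>R e))"
          by (simp add: c_def \<rho>_def inner_diff_left)
        ultimately have "\<bar>c k y\<bar> \<le> t k * (norm e * (1 + \<Lambda>))" by (simp add: algebra_simps)
        then have ct: "\<bar>c k y\<bar> / t k \<le> norm e * (1 + \<Lambda>)" using t0[of k] by (simp add: divide_le_eq mult_ac)
        have "\<bar>I k y\<bar> \<le> (\<integral>s. \<bar>F (P y + s *\<^sub>R \<nu>) * \<kappa> k y s\<bar> \<partial>lborel)"
          unfolding I_def \<Phi>_eq by (rule integral_abs_bound)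
        also have "\<dots> \<le> (\<integral>s. M * \<bar>\<kappa> k y s\<bar> \<partial>lborel)"
        proof (rule integral_mono)
          show "integrable lborel (\<lambda>s. \<bar>F (P y + s *\<^sub>R \<nu>) * \<kappa> k y s\<bar>)"
            by (rule integrable_abs) (rule prod_int)
          show "integrable lborel (\<lambda>s. M * \<bar>\<kappa> k y s\<bar>)" using \<kappa>_int[of k y] by auto
        qed (use bnd in \<open>auto simp: abs_mult mult_right_mono\<close>)
        also have "\<dots> = M * (\<bar>c k y\<bar> / t k)" using \<kappa>_abs by simp
        also have "\<dots> \<le> M * (norm e * (1 + \<Lambda>))" using ct M0 by (rule mult_left_mono)
        finally show ?thesis .
      qed
      moreover have "0 \<le> M * (norm e * (1 + \<Lambda>))" using M0 \<Lambda>0 by simp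
      ultimately show "norm (indicator (slab \<nu>) y * I k y) \<le> indicator (cball x\<^sub>0 r2) y * (M * (norm e * (1 + \<Lambda>)))"
        using zero by (auto simp: indicator_def)
    qed
  qed simp_all
  have "(\<integral>y. indicator {y. 0 < \<rho> y} y * F' y e \<partial>lborel) = (\<integral>y. indicator (slab \<nu>) y * - (F (P y) * q y) \<partial>lborel)"
    using LIMSEQ_unique[OF lim1] lim2 unfolding eq by blast
  then show ?thesis by (simp add: P_def q_def)
qed

section \<open>Boundary charts and surface measure\<close>

definition grad :: "('a::euclidean_space \<Rightarrow> real) \<Rightarrow> 'a \<Rightarrow> 'a" where
  "grad f x = (\<Sum>b\<in>Basis. iter_partial [b] f x *\<^sub>R b)"

lemma grad_inner_Basis: "b \<in> Basis \<Longrightarrow> grad f x \<bullet> b = iter_partial [b] f x"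
  unfolding grad_def by (rule inner_sum_left_Basis)

lemma norm_grad_squared: "(norm (grad f x))\<^sup>2 = (\<Sum>b\<in>Basis. (iter_partial [b] f x)\<^sup>2)"
  unfolding power2_norm_eq_inner
  by (subst euclidean_inner) (simp add: grad_inner_Basis power2_eq_square del: iter_partial.simps)

lemma iter_partial_has_derivative:
  fixes f :: "'a::euclidean_space \<Rightarrow> real"
  assumes "iter_partial bs f differentiable (at x)"
  shows "(iter_partial bs f has_derivative (\<lambda>k. \<Sum>b\<in>Basis. (k \<bullet> b) * iter_partial (b # bs) f x)) (at x)"
proof -
  let ?D = "frechet_derivative (iter_partial bs f) (at x)"
  have D: "(iter_partial bs f has_derivative ?D) (at x)"
    using assms by (simp add: frechet_derivative_works)
  have "?D k = (\<Sum>b\<in>Basis. (k \<bullet> b) * iter_partial (b # bs) f x)" for k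
  proof -
    have lin: "linear ?D" using D by (rule has_derivative_linear)
    have "?D k = ?D (\<Sum>b\<in>Basis. (k \<bullet> b) *\<^sub>R b)" by (simp add: euclidean_representation)
    also have "\<dots> = (\<Sum>b\<in>Basis. (k \<bullet> b) * ?D b)"
      by (simp add: linear_sum[OF lin] linear_cmul[OF lin])
    finally show ?thesis by simp
  qed
  then have "?D = (\<lambda>k. \<Sum>b\<in>Basis. (k \<bullet> b) * iter_partial (b # bs) f x)" by (rule ext)
  then show ?thesis using D by simp
qed

lemma Ck_on_continuous:
  "Ck_on k f U \<Longrightarrow> set bs \<subseteq> Basis \<Longrightarrow> length bs \<le> k \<Longrightarrow> continuous_on U (iter_partial bs f)"
  unfolding Ck_on_def by blast

lemma Ck_on_differentiable:
  "Ck_on k f U \<Longrightarrow> set bs \<subseteq> Basis \<Longrightarrow> length bs < k \<Longrightarrow> x \<in> U \<Longrightarrow>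
    iter_partial bs f differentiable (at x)"
  unfolding Ck_on_def by blast

lemma grad_has_derivative:
  assumes "f differentiable (at x)"
  shows "(f has_derivative (\<lambda>k. grad f x \<bullet> k)) (at x)"
proof -
  have "(\<Sum>b\<in>Basis. (k \<bullet> b) * iter_partial [b] f x) = grad f x \<bullet> k" for k
    by (simp add: grad_def inner_sum_left inner_commute[of k] mult.commute del: iter_partial.simps)
  then show ?thesis using iter_partial_has_derivative[of "[]" f x] assms by (simp del: iter_partial.simps(2))
qed

text \<open>Of the smooth boundary only this is kept: a graph over a ball of radius
  \<open>lam\<close> whose gradient is bounded and Lipschitz with constant \<open>\<Lambda>\<close>.
  Both numbers are later shared by all boundary points, which makes every geometric constant
  uniform.\<close>

locale boundary_chart =
  fixes \<Omega> :: "'a::euclidean_space set" and p :: 'a and lam \<Lambda> :: real and \<nu> :: 'a and h :: "'a \<Rightarrow> real"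
  assumes \<nu>: "norm \<nu> = 1" and h\<nu>: "constant_along \<nu> h" and C1: "Ck_on 1 h UNIV"
    and lam: "0 < lam" and \<Lambda>1: "1 \<le> \<Lambda>" and openO: "open \<Omega>" and p: "p \<in> frontier \<Omega>"
    and chart: "\<Omega> \<inter> ball p lam = {x \<in> ball p lam. h x < x \<bullet> \<nu>}"
    and gradb: "\<And>y. y \<in> ball p lam \<Longrightarrow> norm (grad h y) \<le> \<Lambda>"
    and gradl: "\<And>y z. y \<in> ball p lam \<Longrightarrow> z \<in> ball p lam \<Longrightarrow> norm (grad h y - grad h z) \<le> \<Lambda> * norm (y - z)"
begin

text \<open>\<open>rho\<close> is the height above the graph, positive inside the domain, and
  \<open>proj\<close> the projection onto the graph along \<open>\<nu>\<close>. \<open>drho\<close>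
  is the gradient of \<open>rho\<close>, and its length \<open>J\<close> is the area density of the
  graph (\<open>J_eq\<close>).\<close>

definition rho :: "'a \<Rightarrow> real" where "rho y = y \<bullet> \<nu> - h y"
definition proj :: "'a \<Rightarrow> 'a" where "proj y = y - rho y *\<^sub>R \<nu>"
definition drho :: "'a \<Rightarrow> 'a" where "drho y = \<nu> - grad h y"
definition J :: "'a \<Rightarrow> real" where "J y = norm (drho y)"

lemma \<nu>\<nu>: "\<nu> \<bullet> \<nu> = 1" using \<nu> by (simp add: dot_square_norm)

lemma h_deriv: "(h has_derivative (\<lambda>k. grad h y \<bullet> k)) (at y)"
  using Ck_on_differentiable[OF C1, of "[]"] by (intro grad_has_derivative) simp

lemma grad_cont: "continuous_on UNIV (grad h)"
  unfolding grad_def using C1 by (intro continuous_intros Ck_on_continuous) auto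

lemma h_cont: "continuous_on UNIV h"
  using h_deriv by (meson continuous_at_imp_continuous_on has_derivative_continuous)

lemma h_shift: "h (y + t *\<^sub>R \<nu>) = h y" using h\<nu> by (simp add: constant_along_def)

lemma rho_shift: "rho (y + t *\<^sub>R \<nu>) = rho y + t"
  by (simp add: rho_def inner_add_left \<nu>\<nu> h_shift)

lemma rho_proj: "rho (proj y) = 0"
  using rho_shift[of y "- rho y"] by (simp add: proj_def)

lemma proj_shift: "proj (y + t *\<^sub>R \<nu>) = proj y"
  by (simp add: proj_def rho_shift algebra_simps)

lemma grad_shift: "grad h (y + t *\<^sub>R \<nu>) = grad h y"
proof -
  have "((\<lambda>z. h (z + t *\<^sub>R \<nu>)) has_derivative (\<lambda>k. grad h (y + t *\<^sub>R \<nu>) \<bullet> k)) (at y)"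
    by (rule has_derivative_compose[where f = "\<lambda>z. z + t *\<^sub>R \<nu>"])
      (auto intro!: derivative_eq_intros simp: h_deriv)
  then have "(h has_derivative (\<lambda>k. grad h (y + t *\<^sub>R \<nu>) \<bullet> k)) (at y)" by (simp add: h_shift)
  then have "(\<lambda>k. grad h (y + t *\<^sub>R \<nu>) \<bullet> k) = (\<lambda>k. grad h y \<bullet> k)"
    using h_deriv has_derivative_unique by blast
  then have "grad h (y + t *\<^sub>R \<nu>) \<bullet> k = grad h y \<bullet> k" for k by (rule fun_cong)
  then show ?thesis using vector_eq_rdot by blast
qed

lemma grad_proj: "grad h (proj y) = grad h y"
  using grad_shift[of y "- rho y"] by (simp add: proj_def)

lemma drho_proj: "drho (proj y) = drho y" by (simp add: drho_def grad_proj)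

lemma grad_orth: "grad h y \<bullet> \<nu> = 0"
proof -
  have "((\<lambda>t. h (y + t *\<^sub>R \<nu>)) has_derivative (\<lambda>t. grad h y \<bullet> (t *\<^sub>R \<nu>))) (at 0)"
    by (rule has_derivative_compose[where f = "\<lambda>t. y + t *\<^sub>R \<nu>"])
      (auto intro!: derivative_eq_intros simp: h_deriv)
  then have "((\<lambda>t::real. h y) has_derivative (\<lambda>t. grad h y \<bullet> (t *\<^sub>R \<nu>))) (at 0)"
    by (simp add: h_shift)
  moreover have "((\<lambda>t::real. h y) has_derivative (\<lambda>t. 0)) (at 0)" by simp
  ultimately have "(\<lambda>t. grad h y \<bullet> (t *\<^sub>R \<nu>)) = (\<lambda>t::real. 0)" by (rule has_derivative_unique)
  then show ?thesis by (metis scaleR_one)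
qed

lemma J_eq: "J y = sqrt (1 + (\<Sum>b\<in>Basis. (iter_partial [b] h y)\<^sup>2))"
proof -
  have orth': "\<nu> \<bullet> grad h y = 0" using grad_orth[of y] by (simp add: inner_commute)
  have "(J y)\<^sup>2 = 1 + (norm (grad h y))\<^sup>2"
    unfolding J_def drho_def power2_norm_eq_inner
    by (simp add: inner_diff_left inner_diff_right grad_orth orth' \<nu>\<nu>)
  moreover have "0 \<le> J y" by (simp add: J_def)
  ultimately show ?thesis by (simp add: norm_grad_squared real_sqrt_unique)
qed

lemma J_ge1: "1 \<le> J y" unfolding J_eq by (simp add: sum_nonneg)

lemma J_proj: "J (proj y) = J y" by (simp add: J_def drho_proj)

lemma J_le: "y \<in> ball p lam \<Longrightarrow> J y \<le> 1 + \<Lambda>"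
  unfolding J_def drho_def using norm_triangle_ineq4[of \<nu> "grad h y"] gradb[of y] \<nu> by simp

lemma rho_deriv: "(rho has_derivative (\<lambda>k. drho y \<bullet> k)) (at y)"
proof -
  have "((\<lambda>y. y \<bullet> \<nu> - h y) has_derivative (\<lambda>k. k \<bullet> \<nu> - grad h y \<bullet> k)) (at y)"
    by (rule has_derivative_diff[OF bounded_linear_imp_has_derivative[OF bounded_linear_inner_left] h_deriv])
  then show ?thesis by (simp only: rho_def[abs_def] drho_def inner_diff_left inner_commute[of \<nu>])
qed

lemma rho_cont: "continuous_on UNIV rho"
  unfolding rho_def[abs_def] by (intro continuous_intros h_cont)

lemma rho_meas [measurable]: "rho \<in> borel_measurable borel"
  by (intro borel_measurable_continuous_onI rho_cont)

lemma proj_cont: "continuous_on UNIV proj"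
  unfolding proj_def[abs_def] by (intro continuous_intros rho_cont)

lemma proj_meas [measurable]: "proj \<in> borel_measurable borel"
  by (intro borel_measurable_continuous_onI proj_cont)

lemma drho_cont: "continuous_on UNIV drho"
  unfolding drho_def[abs_def] by (rule continuous_on_diff[OF continuous_on_const grad_cont])

lemma drho_meas [measurable]: "drho \<in> borel_measurable borel"
  by (intro borel_measurable_continuous_onI drho_cont)

lemma J_meas [measurable]: "J \<in> borel_measurable borel"
  unfolding J_def[abs_def] by (intro borel_measurable_continuous_onI continuous_on_norm drho_cont)

lemma mem_iff: "y \<in> ball p lam \<Longrightarrow> y \<in> \<Omega> \<longleftrightarrow> 0 < rho y"
proof -
  assume y: "y \<in> ball p lam"
  have "y \<in> \<Omega> \<inter> ball p lam \<longleftrightarrow> y \<in> {x \<in> ball p lam. h x < x \<bullet> \<nu>}" by (simp only: chart)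
  then show ?thesis using y by (simp add: rho_def)
qed

text \<open>The points with negative \<open>rho\<close> form an open set that misses
  \<open>\<Omega>\<close>, and a zero of \<open>rho\<close> is approached from
  \<open>\<Omega>\<close> along \<open>\<nu>\<close>.\<close>

lemma frontier_iff: "y \<in> ball p lam \<Longrightarrow> y \<in> frontier \<Omega> \<longleftrightarrow> rho y = 0"
proof
  assume y: "y \<in> ball p lam" and "y \<in> frontier \<Omega>"
  then have nO: "y \<notin> \<Omega>" and cl: "y \<in> closure \<Omega>"
    using openO by (auto simp: frontier_def interior_open)
  then have "rho y \<le> 0" using mem_iff[OF y] by simp
  moreover have "\<not> rho y < 0"
  proof
    assume neg: "rho y < 0"
    have "open (ball p lam \<inter> rho -` {..<0})"
      by (intro open_Int open_ball open_vimage rho_cont) auto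
    moreover have "y \<in> ball p lam \<inter> rho -` {..<0} \<inter> closure \<Omega>" using y neg cl by auto
    ultimately obtain z where "z \<in> \<Omega>" "z \<in> ball p lam \<inter> rho -` {..<0}"
      using open_Int_closure_eq_empty[of "ball p lam \<inter> rho -` {..<0}" \<Omega>] by blast
    then show False using mem_iff[of z] by auto
  qed
  ultimately show "rho y = 0" by simp
next
  assume y: "y \<in> ball p lam" and "rho y = 0"
  then have "y \<notin> \<Omega>" using mem_iff[OF y] by simp
  moreover have "y \<in> closure \<Omega>"
    unfolding closure_approachable
  proof (intro allI impI)
    fix e :: real assume "0 < e"
    define t where "t = min (e/2) ((lam - dist p y)/2)"
    have t: "0 < t" "t < e" "t < lam - dist p y" using y \<open>0 < e\<close> by (auto simp: t_def min_def)
    have "dist y (y + t *\<^sub>R \<nu>) = t" using t(1) \<nu> by (simp add: dist_norm)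
    then have "y + t *\<^sub>R \<nu> \<in> ball p lam" using t(3) dist_triangle[of p "y + t *\<^sub>R \<nu>" y] by simp
    then have "y + t *\<^sub>R \<nu> \<in> \<Omega>" using mem_iff rho_shift[of y t] \<open>rho y = 0\<close> t(1) by simp
    then show "\<exists>z\<in>\<Omega>. dist z y < e" using t(2) \<open>dist y (y + t *\<^sub>R \<nu>) = t\<close>
      by (intro bexI[of _ "y + t *\<^sub>R \<nu>"]) (simp_all add: dist_commute)
  qed
  ultimately show "y \<in> frontier \<Omega>" using openO by (simp add: frontier_def interior_open)
qed

lemma rho_p: "rho p = 0" using frontier_iff[of p] p lam by simp

end

section \<open>Surface measure in graph coordinates\<close>

locale surface_measure =
  fixes \<Omega> :: "'a::euclidean_space set" and \<sigma> :: "'a measure"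
  assumes surf: "is_surface_measure (frontier \<Omega>) \<sigma>"
begin

lemma sets_\<sigma>: "sets \<sigma> = sets (restrict_space borel (frontier \<Omega>))"
  using surf by (simp add: is_surface_measure_def)

lemma space_\<sigma>: "space \<sigma> = frontier \<Omega>"
  using sets_eq_imp_space_eq[OF sets_\<sigma>] by (simp add: space_restrict_space)

lemma borel_in_\<sigma>: "A \<in> sets borel \<Longrightarrow> A \<inter> frontier \<Omega> \<in> sets \<sigma>"
  unfolding sets_\<sigma> by (auto simp: sets_restrict_space)

end

locale surface_chart = boundary_chart + surface_measure
begin

lemma id_meas_\<sigma> [measurable]: "(\<lambda>x. x) \<in> \<sigma> \<rightarrow>\<^sub>M borel"
  using borel_in_\<sigma> by (auto intro!: measurableI simp: space_\<sigma> vimage_def Int_def)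

lemma emeasure_\<sigma>_ball:
  assumes [measurable]: "A \<in> sets borel"
  shows "emeasure \<sigma> (A \<inter> (frontier \<Omega> \<inter> ball p lam)) =
     (\<integral>\<^sup>+y. ennreal (J y * indicator (slab \<nu>) y * indicator (ball p lam) (proj y)) * indicator A (proj y) \<partial>lborel)"
proof -
  let ?B = "A \<inter> (frontier \<Omega> \<inter> ball p lam)"
  have "?B = (A \<inter> ball p lam) \<inter> frontier \<Omega>" by auto
  then have B: "?B \<in> sets \<sigma>" using borel_in_\<sigma>[of "A \<inter> ball p lam"] by simp
  have sub: "?B \<subseteq> {x. x \<bullet> \<nu> = h x}"
    using frontier_iff by (auto simp: rho_def)
  have "emeasure \<sigma> ?B =
          (\<integral>\<^sup>+y\<in>{y. 0 \<le> y \<bullet> \<nu> \<and> y \<bullet> \<nu> \<le> 1 \<and> y + (h y - y \<bullet> \<nu>) *\<^sub>R \<nu> \<in> ?B}.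
             ennreal (sqrt (1 + (\<Sum>b\<in>Basis. (iter_partial [b] h y)\<^sup>2))) \<partial>lborel)"
    using surf \<nu> h\<nu> C1 B sub unfolding is_surface_measure_def by blast
  also have "\<dots> = (\<integral>\<^sup>+y. ennreal (J y * indicator (slab \<nu>) y * indicator (ball p lam) (proj y)) * indicator A (proj y) \<partial>lborel)"
  proof (rule nn_integral_cong)
    fix y
    have pr: "y + (h y - y \<bullet> \<nu>) *\<^sub>R \<nu> = proj y" by (simp add: proj_def rho_def algebra_simps)
    show "ennreal (sqrt (1 + (\<Sum>b\<in>Basis. (iter_partial [b] h y)\<^sup>2))) *
         indicator {y. 0 \<le> y \<bullet> \<nu> \<and> y \<bullet> \<nu> \<le> 1 \<and> y + (h y - y \<bullet> \<nu>) *\<^sub>R \<nu> \<in> ?B} y =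
         ennreal (J y * indicator (slab \<nu>) y * indicator (ball p lam) (proj y)) * indicator A (proj y)"
      unfolding J_eq[symmetric] pr using frontier_iff[of "proj y"] rho_proj[of y]
      by (auto simp: indicator_def slab_def pr)
  qed
  finally show ?thesis .
qed

text \<open>On the chart ball \<open>\<sigma>\<close> is the image under \<open>proj\<close> of
  Lebesgue measure with density \<open>w\<close> (fact \<open>Q\<close>). The defining formula gives
  this for sets; the rules for densities and image measures carry it over to functions.\<close>

lemma surface_integral:
  fixes \<phi> :: "'a \<Rightarrow> real"
  assumes [measurable]: "\<phi> \<in> borel_measurable borel" and supp: "\<And>y. y \<notin> ball p lam \<Longrightarrow> \<phi> y = 0"
  shows "(\<integral>y. \<phi> y \<partial>\<sigma>) = (\<integral>y. indicator (slab \<nu>) y * (J y * \<phi> (proj y)) \<partial>lborel)"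
    and "integrable \<sigma> \<phi> \<longleftrightarrow> integrable lborel (\<lambda>y. indicator (slab \<nu>) y * (J y * \<phi> (proj y)))"
proof -
  let ?T = "frontier \<Omega> \<inter> ball p lam"
  define w where "w = (\<lambda>y. J y * indicator (slab \<nu>) y * indicator (ball p lam) (proj y))"
  have [measurable]: "(\<lambda>y. indicator (ball p lam) (proj y) :: real) \<in> borel_measurable borel"
    by (rule measurable_compose[OF proj_meas]) (rule borel_measurable_indicator, simp)
  have [measurable]: "w \<in> borel_measurable borel" unfolding w_def by measurable
  have w0: "0 \<le> w y" for y using J_ge1[of y] by (simp add: w_def)
  have \<phi>\<sigma>[measurable]: "\<phi> \<in> borel_measurable \<sigma>"
    using measurable_compose[OF id_meas_\<sigma>, of \<phi> borel] by simp
  have [measurable]: "ball p lam \<inter> frontier \<Omega> \<in> sets \<sigma>" by (intro borel_in_\<sigma>) simp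
  have im[measurable]: "(indicator (ball p lam) :: 'a \<Rightarrow> real) \<in> borel_measurable \<sigma>"
    by (rule measurable_compose[OF id_meas_\<sigma>]) (rule borel_measurable_indicator, simp)
  have Q: "distr (density \<sigma> (indicator (ball p lam) :: 'a \<Rightarrow> real)) borel (\<lambda>x. x) = distr (density lborel w) borel proj"
  proof (rule measure_eqI)
    fix A assume "A \<in> sets (distr (density \<sigma> (indicator (ball p lam) :: 'a \<Rightarrow> real)) borel (\<lambda>x. x))"
    then have A[measurable]: "A \<in> sets borel" by simp
    have "emeasure (distr (density \<sigma> (indicator (ball p lam) :: 'a \<Rightarrow> real)) borel (\<lambda>x. x)) A
       = emeasure (density \<sigma> (indicator (ball p lam) :: 'a \<Rightarrow> real)) (A \<inter> frontier \<Omega>)"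
      by (subst emeasure_distr) (auto simp: space_\<sigma>)
    also have "\<dots> = (\<integral>\<^sup>+y. ennreal (indicator (ball p lam) y) * indicator (A \<inter> frontier \<Omega>) y \<partial>\<sigma>)"
      by (subst emeasure_density) (auto simp: borel_in_\<sigma>)
    also have "\<dots> = (\<integral>\<^sup>+y. indicator (A \<inter> ?T) y \<partial>\<sigma>)"
      by (intro nn_integral_cong) (auto simp: indicator_def)
    also have "\<dots> = emeasure \<sigma> (A \<inter> ?T)"
      using borel_in_\<sigma>[of "A \<inter> ball p lam"] by (intro nn_integral_indicator) (simp add: Int_ac)
    also have "\<dots> = (\<integral>\<^sup>+y. ennreal (w y) * indicator A (proj y) \<partial>lborel)"
      unfolding w_def by (rule emeasure_\<sigma>_ball) simp
    also have "\<dots> = emeasure (distr (density lborel w) borel proj) A"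
    proof -
      have "proj -` A \<in> sets borel" using measurable_sets[OF proj_meas A] by simp
      then show ?thesis
        by (subst emeasure_distr) (auto simp: emeasure_density indicator_def intro!: nn_integral_cong)
    qed
    finally show "emeasure (distr (density \<sigma> (indicator (ball p lam) :: 'a \<Rightarrow> real)) borel (\<lambda>x. x)) A
        = emeasure (distr (density lborel w) borel proj) A" .
  qed simp
  have ind: "indicator (ball p lam) y * \<phi> y = \<phi> y" for y using supp[of y] by (auto simp: indicator_def)
  have wp: "w y * \<phi> (proj y) = indicator (slab \<nu>) y * (J y * \<phi> (proj y))" for y
    using supp[of "proj y"] by (auto simp: w_def indicator_def)
  have "(\<integral>y. \<phi> y \<partial>\<sigma>) = (\<integral>y. \<phi> y \<partial>density \<sigma> (indicator (ball p lam) :: 'a \<Rightarrow> real))"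
    by (subst integral_density) (auto simp: ind)
  also have "\<dots> = (\<integral>y. \<phi> y \<partial>distr (density \<sigma> (indicator (ball p lam) :: 'a \<Rightarrow> real)) borel (\<lambda>x. x))"
    by (subst integral_distr) auto
  also have "\<dots> = (\<integral>y. \<phi> (proj y) \<partial>density lborel w)"
    unfolding Q by (subst integral_distr) auto
  also have "\<dots> = (\<integral>y. w y * \<phi> (proj y) \<partial>lborel)"
    using w0 by (subst integral_density) auto
  finally show "(\<integral>y. \<phi> y \<partial>\<sigma>) = (\<integral>y. indicator (slab \<nu>) y * (J y * \<phi> (proj y)) \<partial>lborel)"
    by (simp add: wp)
  have "integrable \<sigma> \<phi> \<longleftrightarrow> integrable (density \<sigma> (indicator (ball p lam) :: 'a \<Rightarrow> real)) \<phi>"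
    by (subst integrable_density) (auto simp: ind)
  also have "\<dots> \<longleftrightarrow> integrable (distr (density \<sigma> (indicator (ball p lam) :: 'a \<Rightarrow> real)) borel (\<lambda>x. x)) \<phi>"
    by (subst integrable_distr_eq) auto
  also have "\<dots> \<longleftrightarrow> integrable (density lborel w) (\<lambda>y. \<phi> (proj y))"
    unfolding Q by (subst integrable_distr_eq) auto
  also have "\<dots> \<longleftrightarrow> integrable lborel (\<lambda>y. w y * \<phi> (proj y))"
    using w0 by (subst integrable_density) auto
  finally show "integrable \<sigma> \<phi> \<longleftrightarrow> integrable lborel (\<lambda>y. indicator (slab \<nu>) y * (J y * \<phi> (proj y)))"
    by (simp add: wp)
qed

end

text \<open>The difference is \<open>(a - b) /\<^sub>R norm b\<close> plus a multiple of
  \<open>a\<close> that accounts for the change of length. Each part is at most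
  \<open>norm (a - b)\<close> because \<open>norm b\<close> is at least 1.\<close>

lemma norm_normalize_diff_le:
  fixes a b :: "'a::real_normed_vector"
  assumes "a \<noteq> 0" and b: "1 \<le> norm b"
  shows "norm (a /\<^sub>R norm a - b /\<^sub>R norm b) \<le> 2 * norm (a - b)"
proof -
  have b0: "0 < norm b" and a0: "0 < norm a" using assms by auto
  have "a /\<^sub>R norm a - b /\<^sub>R norm b = (a - b) /\<^sub>R norm b + (inverse (norm a) - inverse (norm b)) *\<^sub>R a"
    by (simp add: algebra_simps)
  also have "norm \<dots> \<le> norm ((a - b) /\<^sub>R norm b) + norm ((inverse (norm a) - inverse (norm b)) *\<^sub>R a)"
    by (rule norm_triangle_ineq)
  also have "norm ((a - b) /\<^sub>R norm b) \<le> norm (a - b)"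
    using b b0 by (simp add: divide_inverse[symmetric] mult.commute[of "inverse _"] divide_le_eq mult_le_cancel_left1)
  also have "norm ((inverse (norm a) - inverse (norm b)) *\<^sub>R a) \<le> norm (a - b)"
  proof -
    have "norm ((inverse (norm a) - inverse (norm b)) *\<^sub>R a) = \<bar>norm b - norm a\<bar> / norm b"
      using a0 b0 by (simp add: inverse_eq_divide diff_frac_eq abs_mult field_simps abs_divide)
    also have "\<dots> \<le> \<bar>norm b - norm a\<bar>" using b b0 by (simp add: divide_le_eq mult_le_cancel_left1)
    also have "\<dots> \<le> norm (a - b)" using norm_triangle_ineq3[of b a] by (simp add: norm_minus_commute)
    finally show ?thesis .
  qed
  finally show ?thesis by simp
qed

section \<open>Taylor estimates, distance to the boundary and paths in a chart\<close>

context boundary_chart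
begin

lemma h_lip: "\<lbrakk>y \<in> ball p lam; z \<in> ball p lam\<rbrakk> \<Longrightarrow> \<bar>h y - h z\<bar> \<le> \<Lambda> * norm (y - z)"
proof -
  assume y: "y \<in> ball p lam" and z: "z \<in> ball p lam"
  have "norm (h y - h z) \<le> \<Lambda> * norm (y - z)"
  proof (rule differentiable_bound[where S="ball p lam" and f'="\<lambda>y k. grad h y \<bullet> k"])
    fix w assume "w \<in> ball p lam"
    then show "onorm ((\<bullet>) (grad h w)) \<le> \<Lambda>"
      using gradb by (intro onorm_le) (auto intro!: order_trans[OF Cauchy_Schwarz_ineq2] mult_right_mono)
  qed (use y z in \<open>auto intro: has_derivative_at_withinI[OF h_deriv]\<close>)
  then show ?thesis by simp
qed

lemma rho_lip: "\<lbrakk>y \<in> ball p lam; z \<in> ball p lam\<rbrakk> \<Longrightarrow> \<bar>rho y - rho z\<bar> \<le> (1 + \<Lambda>) * norm (y - z)"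
proof -
  assume yz: "y \<in> ball p lam" "z \<in> ball p lam"
  have "rho y - rho z = (y - z) \<bullet> \<nu> - (h y - h z)" by (simp add: rho_def inner_diff_left)
  moreover have "\<bar>(y - z) \<bullet> \<nu>\<bar> \<le> norm (y - z)" using Cauchy_Schwarz_ineq2[of "y - z" \<nu>] \<nu> by simp
  ultimately show ?thesis using h_lip[OF yz] by (simp add: algebra_simps)
qed

text \<open>Subtracting the linear part at \<open>y\<close> leaves a function whose gradient on the
  segment is at most \<open>\<Lambda> * norm (z - y)\<close>; the mean value inequality then gives
  the square.\<close>

lemma rho_taylor:
  assumes y: "y \<in> ball p lam" and z: "z \<in> ball p lam"
  shows "\<bar>rho z - rho y - drho y \<bullet> (z - y)\<bar> \<le> \<Lambda> * (norm (z - y))\<^sup>2"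
proof -
  define k where "k = (\<lambda>w. rho w - drho y \<bullet> w)"
  have "norm (k z - k y) \<le> (\<Lambda> * norm (z - y)) * norm (z - y)"
  proof (rule differentiable_bound[where S="closed_segment y z" and f'="\<lambda>w k. (drho w - drho y) \<bullet> k"])
    fix w assume w: "w \<in> closed_segment y z"
    show "(k has_derivative (\<bullet>) (drho w - drho y)) (at w within closed_segment y z)"
    proof -
      have "(k has_derivative (\<lambda>k. drho w \<bullet> k - drho y \<bullet> k)) (at w)"
        unfolding k_def
        by (rule has_derivative_diff[OF rho_deriv bounded_linear_imp_has_derivative[OF bounded_linear_inner_right]])
      then show ?thesis by (simp add: inner_diff_left[symmetric] has_derivative_at_withinI)
    qed
    have "w \<in> ball p lam" using closed_segment_subset[OF y z] w by auto
    then have "norm (drho w - drho y) \<le> \<Lambda> * norm (w - y)"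
      using gradl[of y w] y by (simp add: drho_def norm_minus_commute)
    also have "\<dots> \<le> \<Lambda> * norm (z - y)"
      using segment_bound1[OF w] \<Lambda>1 by (simp add: mult_left_mono)
    finally have "norm (drho w - drho y) \<le> \<Lambda> * norm (z - y)" .
    then show "onorm ((\<bullet>) (drho w - drho y)) \<le> \<Lambda> * norm (z - y)"
      by (intro onorm_le) (auto intro!: order_trans[OF Cauchy_Schwarz_ineq2] mult_right_mono)
  qed auto
  then show ?thesis by (simp add: k_def inner_diff_right power2_eq_square algebra_simps)
qed

definition nrm :: "'a \<Rightarrow> 'a" where "nrm y = - (drho y /\<^sub>R J y)"

lemma nrm_meas [measurable]: "nrm \<in> borel_measurable borel"
  unfolding nrm_def[abs_def] by measurable

lemma norm_nrm: "norm (nrm y) = 1"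
proof -
  have "0 < norm (drho y)" using J_ge1[of y] by (simp only: J_def)
  then show ?thesis by (simp add: nrm_def J_def)
qed

lemma nrm_lip:
  assumes y: "y \<in> ball p lam" and z: "z \<in> ball p lam"
  shows "norm (nrm y - nrm z) \<le> 2 * \<Lambda> * norm (y - z)"
proof -
  have "norm (nrm y - nrm z) = norm (drho y /\<^sub>R norm (drho y) - drho z /\<^sub>R norm (drho z))"
    by (simp add: nrm_def J_def norm_minus_commute)
  also have "\<dots> \<le> 2 * norm (drho y - drho z)"
    using J_ge1[of y] J_ge1[of z] by (intro norm_normalize_diff_le) (auto simp: J_def)
  also have "\<dots> \<le> 2 * (\<Lambda> * norm (y - z))"
    using gradl[OF y z] by (simp add: drho_def norm_minus_commute)
  finally show ?thesis by simp
qed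

text \<open>\<open>rho x / J x\<close> is bounded above by a Taylor expansion towards the nearest
  boundary point, where \<open>rho\<close> vanishes. It is bounded below because a walk from
  \<open>x\<close> along the outer normal that is slightly longer than \<open>rho x / J x\<close>
  has left \<open>\<Omega>\<close> and hence crossed the frontier.\<close>

lemma signed_distance:
  assumes x: "x \<in> \<Omega>" and near: "dist p x + 4 * \<delta> < lam" and \<delta>: "0 < \<delta>" "10 * \<Lambda> * \<delta> \<le> 1"
    and d: "infdist x (frontier \<Omega>) < 2 * \<delta>"
  shows "\<bar>rho x / J x - infdist x (frontier \<Omega>)\<bar> \<le> 16 * \<Lambda> * \<delta>\<^sup>2"
proof -
  let ?d = "infdist x (frontier \<Omega>)"
  have J1: "1 \<le> J x" by (rule J_ge1)
  have xb: "x \<in> ball p lam" using near \<delta> by simp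
  have fne: "frontier \<Omega> \<noteq> {}" using p by auto
  obtain z where z: "z \<in> frontier \<Omega>" "?d = dist x z"
    using infdist_attains_inf[OF frontier_closed fne] by metis
  have zb: "z \<in> ball p lam" using near d z \<delta> dist_triangle[of p z x] by auto
  have "\<bar>0 - rho x - drho x \<bullet> (z - x)\<bar> \<le> \<Lambda> * (norm (z - x))\<^sup>2"
    using rho_taylor[OF xb zb] frontier_iff[OF zb] z by simp
  moreover have "\<bar>drho x \<bullet> (z - x)\<bar> \<le> J x * norm (z - x)"
    unfolding J_def by (rule Cauchy_Schwarz_ineq2)
  moreover have nz: "norm (z - x) = ?d" using z by (simp add: dist_norm norm_minus_commute)
  ultimately have "rho x \<le> J x * ?d + \<Lambda> * ?d\<^sup>2" unfolding nz by linarith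
  also have "\<Lambda> * ?d\<^sup>2 \<le> \<Lambda> * (4 * \<delta>\<^sup>2)"
    using power_mono[of ?d "2 * \<delta>" 2] d \<Lambda>1 infdist_nonneg[of x "frontier \<Omega>"]
    by (intro mult_left_mono) (auto simp: power_mult_distrib)
  also have "\<dots> \<le> J x * (\<Lambda> * (4 * \<delta>\<^sup>2))" using J1 \<Lambda>1 mult_right_mono[of 1 "J x" "\<Lambda> * (4 * \<delta>\<^sup>2)"] by simp
  finally have "rho x \<le> (?d + 4 * \<Lambda> * \<delta>\<^sup>2) * J x" by (simp add: algebra_simps)
  then have up: "rho x / J x \<le> ?d + 4 * \<Lambda> * \<delta>\<^sup>2" using J1 by (simp add: divide_le_eq)
  \<comment> \<open>Since \<open>s \<le> 4 * \<delta>\<close>, the Taylor error along the walk is at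
    most \<open>16 * \<Lambda> * \<delta>\<^sup>2\<close>; the surplus length pays for it because
    \<open>J x \<ge> 1\<close>.\<close>
  define s where "s = rho x / J x + 16 * \<Lambda> * \<delta>\<^sup>2"
  have rx: "0 < rho x" using mem_iff[OF xb] x by simp
  have s0: "0 < s" using rx J1 \<Lambda>1 \<delta> by (auto simp: s_def intro!: add_pos_nonneg divide_pos_pos)
  have "20 * \<Lambda> * \<delta>\<^sup>2 \<le> 2 * \<delta>"
    using mult_right_mono[OF \<delta>(2), of "2 * \<delta>"] \<delta>(1) by (simp add: power2_eq_square algebra_simps)
  then have s4: "s \<le> 4 * \<delta>" using up d by (simp add: s_def)
  define w where "w = x + s *\<^sub>R nrm x"
  have nw: "norm (w - x) = s" using s0 norm_nrm by (simp add: w_def)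
  have wb: "w \<in> ball p lam"
    using near s4 nw dist_triangle[of p w x] by (simp add: dist_norm norm_minus_commute)
  have "0 < norm (drho x)" using J1 by (simp only: J_def)
  then have dn: "drho x \<bullet> nrm x = - J x"
    by (simp add: nrm_def J_def dot_square_norm power2_eq_square)
  have "rho w \<le> rho x + drho x \<bullet> (w - x) + \<Lambda> * (norm (w - x))\<^sup>2"
    using rho_taylor[OF xb wb] by linarith
  moreover have "drho x \<bullet> (w - x) = - (s * J x)" by (simp add: w_def dn)
  moreover have "s * J x = rho x + 16 * \<Lambda> * \<delta>\<^sup>2 * J x" using J1 by (simp add: s_def algebra_simps)
  moreover have "\<Lambda> * s\<^sup>2 \<le> 16 * \<Lambda> * \<delta>\<^sup>2"
    using power_mono[of s "4 * \<delta>" 2] s0 s4 \<Lambda>1 mult_left_mono[of "s\<^sup>2" "16 * \<delta>\<^sup>2" \<Lambda>] by (simp add: power_mult_distrib)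
  moreover have "16 * \<Lambda> * \<delta>\<^sup>2 \<le> 16 * \<Lambda> * \<delta>\<^sup>2 * J x" using J1 \<Lambda>1 mult_left_mono[of 1 "J x" "16 * \<Lambda> * \<delta>\<^sup>2"] by simp
  ultimately have "rho w \<le> 0" unfolding nw by linarith
  then have wO: "w \<notin> \<Omega>" using mem_iff[OF wb] by simp
  have "closed_segment x w \<inter> frontier \<Omega> \<noteq> {}"
    using x wO by (intro connected_Int_frontier) auto
  then obtain v where v: "v \<in> closed_segment x w" "v \<in> frontier \<Omega>" by auto
  have "?d \<le> dist x v" using v(2) by (rule infdist_le)
  also have "\<dots> \<le> s" using segment_bound1[OF v(1)] nw by (simp add: dist_norm norm_minus_commute)
  finally have "?d \<le> rho x / J x + 16 * \<Lambda> * \<delta>\<^sup>2" by (simp add: s_def)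
  moreover have "4 * \<Lambda> * \<delta>\<^sup>2 \<le> 16 * \<Lambda> * \<delta>\<^sup>2" using \<Lambda>1 by simp
  ultimately show ?thesis using up by linarith
qed

text \<open>The expansion of \<open>rho\<close> at \<open>x\<close> must vanish at \<open>y\<close>,
  up to \<open>4 * \<Lambda> * \<delta>\<^sup>2\<close>; replacing \<open>rho x / J x\<close> by the
  distance costs another \<open>16 * \<Lambda> * \<delta>\<^sup>2\<close>.\<close>

lemma normal_component:
  assumes x: "x \<in> \<Omega>" and near: "dist p x + 4 * \<delta> < lam" and \<delta>: "0 < \<delta>" "10 * \<Lambda> * \<delta> \<le> 1"
    and d: "infdist x (frontier \<Omega>) < 2 * \<delta>"
    and y: "y \<in> frontier \<Omega>" "norm (y - x) < 2 * \<delta>"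
  shows "\<bar>(y - x) \<bullet> nrm x - infdist x (frontier \<Omega>)\<bar> \<le> 20 * \<Lambda> * \<delta>\<^sup>2"
proof -
  have J1: "1 \<le> J x" by (rule J_ge1)
  have xb: "x \<in> ball p lam" using near \<delta> by simp
  have yb: "y \<in> ball p lam" using near \<delta> y(2) dist_triangle[of p y x] by (auto simp: dist_norm norm_minus_commute)
  have "\<bar>0 - rho x - drho x \<bullet> (y - x)\<bar> \<le> \<Lambda> * (norm (y - x))\<^sup>2"
    using rho_taylor[OF xb yb] frontier_iff[OF yb] y(1) by simp
  also have "\<dots> \<le> \<Lambda> * (4 * \<delta>\<^sup>2)"
    using power_mono[of "norm (y - x)" "2 * \<delta>" 2] y(2) \<Lambda>1
    by (intro mult_left_mono) (auto simp: power_mult_distrib)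
  finally have "\<bar>- drho x \<bullet> (y - x) - rho x\<bar> / J x \<le> \<Lambda> * (4 * \<delta>\<^sup>2) / 1"
    using J1 \<Lambda>1 by (intro frac_le) auto
  moreover have "(y - x) \<bullet> nrm x = - drho x \<bullet> (y - x) / J x"
    by (simp add: nrm_def inner_commute divide_inverse)
  moreover have "- drho x \<bullet> (y - x) / J x - rho x / J x = (- drho x \<bullet> (y - x) - rho x) / J x"
    by (rule diff_divide_distrib[symmetric])
  ultimately have "\<bar>(y - x) \<bullet> nrm x - rho x / J x\<bar> \<le> 4 * \<Lambda> * \<delta>\<^sup>2"
    using J1 by (simp only: abs_divide)
  then show ?thesis using signed_distance[OF x near \<delta> d] by linarith
qed

text \<open>\<open>\<Omega>\<close> is not convex near the boundary, so segments are replaced by three-segment paths that first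
  move inwards along \<open>\<nu>\<close>.\<close>

lemma vertical_path:
  assumes x: "x \<in> \<Omega>" and y: "y \<in> \<Omega>" and yx: "norm (y - x) < r" and near: "dist p x + (3 + \<Lambda>) * r < lam"
  defines "s \<equiv> (1 + \<Lambda>) * r"
  shows "closed_segment x (x + s *\<^sub>R \<nu>) \<union> closed_segment (x + s *\<^sub>R \<nu>) (y + s *\<^sub>R \<nu>) \<union>
         closed_segment (y + s *\<^sub>R \<nu>) y \<subseteq> \<Omega> \<inter> ball x ((3 + \<Lambda>) * r)"
proof -
  have r0: "0 < r" using yx norm_ge_zero[of "y - x"] by linarith
  have s0: "0 < s" using r0 \<Lambda>1 by (simp add: s_def)
  have rs: "r + s < (3 + \<Lambda>) * r" using r0 by (simp add: s_def algebra_simps)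
  have B: "ball x ((3 + \<Lambda>) * r) \<subseteq> ball p lam"
  proof
    fix w assume "w \<in> ball x ((3 + \<Lambda>) * r)"
    then show "w \<in> ball p lam" using near dist_triangle[of p w x] by simp
  qed
  have "0 < (3 + \<Lambda>) * r" using r0 \<Lambda>1 by simp
  then have xb: "x \<in> ball p lam" using B centre_in_ball[of x] by blast
  have r3: "r < (3 + \<Lambda>) * r" using r0 s0 rs by linarith
  have yb: "y \<in> ball x ((3 + \<Lambda>) * r)" using yx r3 by (simp add: dist_norm norm_minus_commute)
  have mid: "x + t *\<^sub>R (y - x) + a *\<^sub>R \<nu> \<in> \<Omega> \<inter> ball x ((3 + \<Lambda>) * r)"
    if t: "0 \<le> t" "t \<le> 1" and a: "0 \<le> a" "a \<le> s" and at: "a = s \<or> t = 0 \<or> t = 1" for t a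
  proof -
    let ?m = "x + t *\<^sub>R (y - x)"
    have nm: "norm (t *\<^sub>R (y - x)) < r" using t yx mult_left_le_one_le[of "norm (y - x)" t] by simp
    have "?m \<in> ball x ((3 + \<Lambda>) * r)" using nm r3 by (simp add: dist_norm)
    then have mb: "?m \<in> ball p lam" using B by blast
    have "norm (t *\<^sub>R (y - x) + a *\<^sub>R \<nu>) < r + s"
      using norm_triangle_ineq[of "t *\<^sub>R (y - x)" "a *\<^sub>R \<nu>"] nm a \<nu> by simp
    then have "norm ((?m + a *\<^sub>R \<nu>) - x) < (3 + \<Lambda>) * r" using rs by (simp add: add.assoc)
    then have wb: "?m + a *\<^sub>R \<nu> \<in> ball x ((3 + \<Lambda>) * r)" by (simp only: mem_ball dist_norm norm_minus_commute)
    moreover have "0 < rho (?m + a *\<^sub>R \<nu>)"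
      using at
    proof (elim disjE)
      \<comment> \<open>The climb \<open>s\<close> exceeds the largest possible drop of
        \<open>rho\<close> over a displacement shorter than \<open>r\<close>, so the middle leg
        stays above the graph. The two legs along \<open>\<nu>\<close> only raise \<open>rho\<close>
        above its positive values at \<open>x\<close> and \<open>y\<close>.\<close>
      assume "a = s"
      have "\<bar>rho ?m - rho x\<bar> \<le> (1 + \<Lambda>) * norm (t *\<^sub>R (y - x))" using rho_lip[OF mb xb] by simp
      also have "\<dots> < s" unfolding s_def using nm \<Lambda>1 by simp
      finally show ?thesis using mem_iff[OF xb] x \<open>a = s\<close> by (simp add: rho_shift)
    next
      assume "t = 0" then show ?thesis using mem_iff[OF xb] x a by (simp add: rho_shift)
    next
      assume "t = 1" then show ?thesis using mem_iff[of y] y yb B a by (auto simp: rho_shift)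
    qed
    ultimately show ?thesis using mem_iff B by blast
  qed
  have 1: "closed_segment x (x + s *\<^sub>R \<nu>) \<subseteq> \<Omega> \<inter> ball x ((3 + \<Lambda>) * r)"
  proof
    fix w assume "w \<in> closed_segment x (x + s *\<^sub>R \<nu>)"
    then obtain u where "0 \<le> u" "u \<le> 1" "w = (1 - u) *\<^sub>R x + u *\<^sub>R (x + s *\<^sub>R \<nu>)"
      by (auto simp: in_segment)
    moreover from this have "w = x + 0 *\<^sub>R (y - x) + (u * s) *\<^sub>R \<nu>" by (simp add: algebra_simps)
    ultimately show "w \<in> \<Omega> \<inter> ball x ((3 + \<Lambda>) * r)"
      using mid[of 0 "u * s"] s0 by (simp add: mult_left_le_one_le)
  qed
  have 2: "closed_segment (y + s *\<^sub>R \<nu>) y \<subseteq> \<Omega> \<inter> ball x ((3 + \<Lambda>) * r)"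
  proof
    fix w assume "w \<in> closed_segment (y + s *\<^sub>R \<nu>) y"
    then obtain u where "0 \<le> u" "u \<le> 1" "w = (1 - u) *\<^sub>R (y + s *\<^sub>R \<nu>) + u *\<^sub>R y"
      by (auto simp: in_segment)
    moreover from this have "w = x + 1 *\<^sub>R (y - x) + ((1 - u) * s) *\<^sub>R \<nu>" by (simp add: algebra_simps)
    ultimately show "w \<in> \<Omega> \<inter> ball x ((3 + \<Lambda>) * r)"
      using mid[of 1 "(1 - u) * s"] s0 by (simp add: mult_left_le_one_le)
  qed
  have 3: "closed_segment (x + s *\<^sub>R \<nu>) (y + s *\<^sub>R \<nu>) \<subseteq> \<Omega> \<inter> ball x ((3 + \<Lambda>) * r)"
  proof
    fix w assume "w \<in> closed_segment (x + s *\<^sub>R \<nu>) (y + s *\<^sub>R \<nu>)"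
    then obtain u where "0 \<le> u" "u \<le> 1" "w = (1 - u) *\<^sub>R (x + s *\<^sub>R \<nu>) + u *\<^sub>R (y + s *\<^sub>R \<nu>)"
      by (auto simp: in_segment)
    moreover from this have "w = x + u *\<^sub>R (y - x) + s *\<^sub>R \<nu>" by (simp add: algebra_simps)
    ultimately show "w \<in> \<Omega> \<inter> ball x ((3 + \<Lambda>) * r)"
      using mid[of u s] s0 by simp
  qed
  show ?thesis using 1 2 3 by blast
qed

text \<open>Moving inwards by \<open>r/2\<close> raises \<open>rho\<close> by \<open>r/2\<close>,
  and within a ball of radius \<open>r / (4 * (1 + \<Lambda>))\<close> it changes by at most
  \<open>r/4\<close>.\<close>

lemma corkscrew:
  assumes x: "x \<in> \<Omega>" and r: "0 < r" and near: "dist p x + r < lam"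
  shows "ball (x + (r/2) *\<^sub>R \<nu>) (r / (4 * (1 + \<Lambda>))) \<subseteq> \<Omega> \<inter> ball x r"
proof
  fix w assume "w \<in> ball (x + (r/2) *\<^sub>R \<nu>) (r / (4 * (1 + \<Lambda>)))"
  then have w: "norm (w - (x + (r/2) *\<^sub>R \<nu>)) < r / (4 * (1 + \<Lambda>))"
    by (simp add: dist_norm norm_minus_commute)
  have "r / (4 * (1 + \<Lambda>)) \<le> r / 4" using r \<Lambda>1 by (intro divide_left_mono) auto
  then have "norm (w - (x + (r/2) *\<^sub>R \<nu>)) < r / 4" using w by linarith
  moreover have "norm (w - x) \<le> norm (w - (x + (r/2) *\<^sub>R \<nu>)) + r / 2"
    using norm_triangle_ineq[of "w - (x + (r/2) *\<^sub>R \<nu>)" "(r/2) *\<^sub>R \<nu>"] \<nu> r by simp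
  ultimately have wx: "norm (w - x) < r" using r by linarith
  then have wxb: "w \<in> ball x r" by (simp add: dist_norm norm_minus_commute)
  have wb: "w \<in> ball p lam" using wxb near dist_triangle[of p w x] by simp
  have cb: "x + (r/2) *\<^sub>R \<nu> \<in> ball p lam"
    using near r \<nu> dist_triangle[of p "x + (r/2) *\<^sub>R \<nu>" x] by (simp add: dist_norm)
  have xb: "x \<in> ball p lam" using near r by simp
  have "\<bar>rho w - rho (x + (r/2) *\<^sub>R \<nu>)\<bar> \<le> (1 + \<Lambda>) * (r / (4 * (1 + \<Lambda>)))"
    using rho_lip[OF wb cb] w \<Lambda>1 by (smt (verit) mult_left_mono)
  also have "\<dots> = r / 4" using \<Lambda>1 by (simp add: field_simps)
  finally have "0 < rho w" using mem_iff[OF xb] x r unfolding rho_shift by linarith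
  then show "w \<in> \<Omega> \<inter> ball x r" using mem_iff[OF wb] wxb by simp
qed

end

section \<open>Mass bounds and divergence theorem for the surface measure\<close>

context surface_chart
begin

text \<open>The mass of a graph piece is the Lebesgue measure of the part of the slab over it,
  weighted by \<open>J \<ge> 1\<close>. That part contains a ball around \<open>p\<close> moved to
  height 1/2: a radius of at most 1/2 keeps the ball in the slab, and one of at most
  \<open>\<epsilon> / (4 * (1 + \<Lambda>))\<close> keeps its projection within
  \<open>\<epsilon>\<close> of \<open>p\<close>.\<close>

lemma \<sigma>_lower:
  assumes \<epsilon>: "0 < \<epsilon>" "\<epsilon> \<le> lam"
  shows "ennreal (measure lborel (ball (0::'a) (min (\<epsilon> / (4 * (1 + \<Lambda>))) (1/2)))) \<le> emeasure \<sigma> (frontier \<Omega> \<inter> ball p \<epsilon>)"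
proof -
  define c where "c = min (\<epsilon> / (4 * (1 + \<Lambda>))) (1/2)"
  define z0 where "z0 = p + (1/2 - p \<bullet> \<nu>) *\<^sub>R \<nu>"
  have c0: "0 < c" using \<epsilon> \<Lambda>1 by (simp add: c_def)
  have in1: "y \<in> slab \<nu> \<and> proj y \<in> ball p \<epsilon>" if "y \<in> ball z0 c" for y
  proof
    have yz: "norm (y - z0) < c" using that by (simp add: dist_norm norm_minus_commute)
    have z0\<nu>: "z0 \<bullet> \<nu> = 1/2" by (simp add: z0_def inner_add_left \<nu>\<nu>)
    have yv: "\<bar>(y - z0) \<bullet> \<nu>\<bar> < c" using Cauchy_Schwarz_ineq2[of "y - z0" \<nu>] \<nu> yz by simp
    moreover have "c \<le> 1/2" unfolding c_def by (rule min.cobounded2)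
    moreover have "(y - z0) \<bullet> \<nu> = y \<bullet> \<nu> - 1/2" using z0\<nu> by (simp add: inner_diff_left)
    ultimately show "y \<in> slab \<nu>" unfolding slab_def mem_Collect_eq by linarith
    define q where "q = y + (p \<bullet> \<nu> - y \<bullet> \<nu>) *\<^sub>R \<nu>"
    have "q - p = (y - z0) - ((y - z0) \<bullet> \<nu>) *\<^sub>R \<nu>"
      by (simp add: q_def z0_def inner_diff_left inner_add_left \<nu>\<nu> algebra_simps)
    then have "norm (q - p) \<le> norm (y - z0) + \<bar>(y - z0) \<bullet> \<nu>\<bar>"
      using norm_triangle_ineq4[of "y - z0" "((y - z0) \<bullet> \<nu>) *\<^sub>R \<nu>"] \<nu> by simp
    then have qp: "norm (q - p) < 2 * c" using yz yv by linarith
    have c4: "c * (4 * (1 + \<Lambda>)) \<le> \<epsilon>"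
    proof -
      have "c \<le> \<epsilon> / (4 * (1 + \<Lambda>))" by (simp add: c_def)
      then show ?thesis using \<Lambda>1 by (simp add: le_divide_eq)
    qed
    have "0 \<le> c * \<Lambda>" using c0 \<Lambda>1 by simp
    then have c4': "4 * c \<le> \<epsilon>" using c4 by (simp add: distrib_left)
    have qb: "q \<in> ball p lam" using qp c4' \<epsilon> c0 by (simp add: dist_norm norm_minus_commute)
    have pq: "proj q = proj y" by (simp add: q_def proj_shift)
    have pb: "p \<in> ball p lam" using lam by simp
    have "\<bar>rho q\<bar> \<le> (1 + \<Lambda>) * norm (q - p)"
      using rho_lip[OF qb pb] rho_p by simp
    moreover have "norm (proj q - p) \<le> norm (q - p) + \<bar>rho q\<bar>"
      using norm_triangle_ineq4[of "q - p" "rho q *\<^sub>R \<nu>"] \<nu> by (simp add: proj_def algebra_simps)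
    ultimately have "norm (proj q - p) \<le> (2 + \<Lambda>) * norm (q - p)" by (simp add: algebra_simps)
    also have "\<dots> < (2 + \<Lambda>) * (2 * c)" using qp \<Lambda>1 by simp
    also have "\<dots> \<le> \<epsilon>"
    proof -
      have e1: "(2 + \<Lambda>) * (2 * c) = 4 * c + 2 * (c * \<Lambda>)" by algebra
      have e2: "c * (4 * (1 + \<Lambda>)) = 4 * c + 4 * (c * \<Lambda>)" by algebra
      show ?thesis using c4 \<open>0 \<le> c * \<Lambda>\<close> unfolding e1 e2 by linarith
    qed
    finally show "proj y \<in> ball p \<epsilon>" using pq by (simp add: dist_norm norm_minus_commute)
  qed
  have "ennreal (measure lborel (ball (0::'a) c)) = ennreal (measure lborel (ball z0 c))"
    using c0 by (simp add: content_ball)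
  also have "\<dots> = emeasure lborel (ball z0 c)"
    using emeasure_eq_ennreal_measure[of lborel "ball z0 c"] emeasure_bounded_finite[of "ball z0 c"] by (simp add: less_top)
  also have "\<dots> = (\<integral>\<^sup>+y. indicator (ball z0 c) y \<partial>lborel)" by simp
  also have "\<dots> \<le> (\<integral>\<^sup>+y. ennreal (J y * indicator (slab \<nu>) y * indicator (ball p lam) (proj y)) * indicator (ball p \<epsilon>) (proj y) \<partial>lborel)"
  proof (intro nn_integral_mono)
    fix y
    show "indicator (ball z0 c) y \<le> ennreal (J y * indicator (slab \<nu>) y * indicator (ball p lam) (proj y)) * indicator (ball p \<epsilon>) (proj y)"
      using in1[of y] J_ge1[of y] \<epsilon> by (auto simp: indicator_def)
  qed
  also have "\<dots> = emeasure \<sigma> (ball p \<epsilon> \<inter> (frontier \<Omega> \<inter> ball p lam))"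
    by (rule emeasure_\<sigma>_ball[symmetric]) simp
  also have "ball p \<epsilon> \<inter> (frontier \<Omega> \<inter> ball p lam) = frontier \<Omega> \<inter> ball p \<epsilon>" using \<epsilon> by auto
  finally show ?thesis by (simp add: c_def)
qed

text \<open>The points of the slab that project into the chart ball form a bounded set, on which
  \<open>J\<close> is at most \<open>1 + \<Lambda>\<close>.\<close>

lemma \<sigma>_finite: "emeasure \<sigma> (frontier \<Omega> \<inter> ball p lam) < \<infinity>"
proof -
  define N where "N = norm p + lam"
  have bd: "y \<in> cball 0 (1 + 2 * N)" if "y \<in> slab \<nu>" "proj y \<in> ball p lam" for y
  proof -
    have n: "norm (proj y) \<le> N"
      using that(2) norm_triangle_ineq[of "proj y - p" p] by (simp add: N_def dist_norm norm_minus_commute)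
    have "y = proj y + (y \<bullet> \<nu> - proj y \<bullet> \<nu>) *\<^sub>R \<nu>"
      by (simp add: proj_def inner_diff_left \<nu>\<nu>)
    then have "norm y \<le> norm (proj y) + \<bar>y \<bullet> \<nu> - proj y \<bullet> \<nu>\<bar>"
      using norm_triangle_ineq[of "proj y" "(y \<bullet> \<nu> - proj y \<bullet> \<nu>) *\<^sub>R \<nu>"] \<nu> by simp
    moreover have "\<bar>proj y \<bullet> \<nu>\<bar> \<le> N" using Cauchy_Schwarz_ineq2[of "proj y" \<nu>] \<nu> n by simp
    moreover have "\<bar>y \<bullet> \<nu>\<bar> \<le> 1" using that(1) by (auto simp: slab_def)
    ultimately show ?thesis using n by simp
  qed
  have "emeasure \<sigma> (frontier \<Omega> \<inter> ball p lam) = emeasure \<sigma> (UNIV \<inter> (frontier \<Omega> \<inter> ball p lam))" by simp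
  also have "\<dots> = (\<integral>\<^sup>+y. ennreal (J y * indicator (slab \<nu>) y * indicator (ball p lam) (proj y)) * indicator UNIV (proj y) \<partial>lborel)"
    by (rule emeasure_\<sigma>_ball) simp
  also have "\<dots> \<le> (\<integral>\<^sup>+y. ennreal (1 + \<Lambda>) * indicator (cball (0::'a) (1 + 2 * N)) y \<partial>lborel)"
  proof (intro nn_integral_mono)
    fix y
    show "ennreal (J y * indicator (slab \<nu>) y * indicator (ball p lam) (proj y)) * indicator UNIV (proj y)
       \<le> ennreal (1 + \<Lambda>) * indicator (cball (0::'a) (1 + 2 * N)) y"
      using bd[of y] J_le[of "proj y"] by (auto simp: indicator_def J_proj intro!: ennreal_leI)
  qed
  also have "\<dots> = ennreal (1 + \<Lambda>) * emeasure lborel (cball (0::'a) (1 + 2 * N))"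
    by (rule nn_integral_cmult_indicator) simp
  also have "\<dots> < \<infinity>"
    using emeasure_bounded_finite[of "cball (0::'a) (1 + 2 * N)"] by (simp add: ennreal_mult_less_top)
  finally show ?thesis .
qed

text \<open>\<open>F\<close> and, almost everywhere, \<open>F'\<close> vanish outside the chart
  ball, where \<open>\<Omega>\<close> and the region above the graph may differ; so
  \<open>green_subgraph\<close> applies. The factor \<open>J\<close> of the surface integral cancels
  the normalisation of \<open>nrm\<close>.\<close>

lemma green_surface:
  fixes F :: "'a \<Rightarrow> real" and F' :: "'a \<Rightarrow> 'a \<Rightarrow> real"
  assumes supp: "\<And>y. r < norm (y - x) \<Longrightarrow> F y = 0" and r: "0 \<le> r" "dist p x + r < lam"
    and bnd: "\<And>y. \<bar>F y\<bar> \<le> M" and L: "0 \<le> L"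
    and lip: "\<And>y z. norm (y - z) \<le> 1 \<Longrightarrow> \<bar>F y - F z\<bar> \<le> L * norm (y - z)"
    and F': "AE y in lborel. (F has_derivative F' y) (at y)"
    and meas [measurable]: "(\<lambda>y. F' y e) \<in> borel_measurable borel" "F \<in> borel_measurable borel"
  shows "(\<integral>y. indicator \<Omega> y * F' y e \<partial>lborel) = (\<integral>y. F y * (nrm y \<bullet> e) \<partial>\<sigma>)"
proof -
  have F0: "F y = 0" if "y \<notin> ball p lam" for y
    using that r dist_triangle[of p y x] by (intro supp) (simp add: dist_norm norm_minus_commute)
  have [measurable]: "\<Omega> \<in> sets borel" using openO by simp
  have "(\<integral>y. indicator \<Omega> y * F' y e \<partial>lborel) = (\<integral>y. indicator {y. 0 < rho y} y * F' y e \<partial>lborel)"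
  proof (rule integral_cong_AE)
    show "AE y in lborel. indicator \<Omega> y * F' y e = indicator {y. 0 < rho y} y * F' y e"
      using F'
    proof eventually_elim
      case (elim y)
      show ?case
      proof (cases "y \<in> ball p lam")
        case True
        then show ?thesis using mem_iff by (simp add: indicator_def)
      next
        case False
        then have "r < norm (y - x)" using r dist_triangle[of p y x] by (simp add: dist_norm norm_minus_commute)
        then have yo: "y \<in> - cball x r" by (simp add: dist_norm norm_minus_commute)
        have "(F has_derivative (\<lambda>k. 0)) (at y)"
        proof (rule has_derivative_transform_within_open[of "\<lambda>y. 0" _ _ _ "- cball x r"])
          show "0 = F z" if "z \<in> - cball x r" for z
            using that by (intro supp[symmetric]) (simp add: dist_norm norm_minus_commute)
        qed (use yo in auto)
        then have "F' y = (\<lambda>k. 0)" using elim has_derivative_unique by blast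
        then show ?thesis by simp
      qed
    qed
    have [measurable]: "{y. 0 < rho y} \<in> sets borel" by measurable
    show "(\<lambda>y. indicator \<Omega> y * F' y e) \<in> borel_measurable lborel"
      using meas(1) by (intro borel_measurable_times borel_measurable_indicator) auto
    show "(\<lambda>y. indicator {y. 0 < rho y} y * F' y e) \<in> borel_measurable lborel"
      using meas(1) by (intro borel_measurable_times borel_measurable_indicator) auto
  qed
  also have "\<dots> = - (\<integral>y. indicator (slab \<nu>) y * (F (y - rho y *\<^sub>R \<nu>) * (e \<bullet> \<nu> - grad h y \<bullet> e)) \<partial>lborel)"
    unfolding rho_def by (rule green_subgraph[OF \<nu> h\<nu> h_deriv grad_cont supp r(1) bnd L lip F' meas(1)])
  also have "\<dots> = (\<integral>y. indicator (slab \<nu>) y * (J y * (F (proj y) * (nrm (proj y) \<bullet> e))) \<partial>lborel)"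
  proof -
    have "- (indicator (slab \<nu>) y * (F (y - rho y *\<^sub>R \<nu>) * (e \<bullet> \<nu> - grad h y \<bullet> e))) =
      indicator (slab \<nu>) y * (J y * (F (proj y) * (nrm (proj y) \<bullet> e)))" for y
    proof -
      have "J y * (nrm (proj y) \<bullet> e) = - (drho y \<bullet> e)"
        using J_ge1[of y] by (simp add: nrm_def drho_proj J_proj)
      also have "\<dots> = - (e \<bullet> \<nu> - grad h y \<bullet> e)" by (simp add: drho_def inner_commute[of _ e] inner_diff_right)
      finally have *: "J y * (nrm (proj y) \<bullet> e) = - (e \<bullet> \<nu> - grad h y \<bullet> e)" .
      have "J y * (F (proj y) * (nrm (proj y) \<bullet> e)) = F (proj y) * - (e \<bullet> \<nu> - grad h y \<bullet> e)"
        unfolding *[symmetric] by simp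
      then show ?thesis by (simp only: proj_def mult_minus_right)
    qed
    then show ?thesis by (simp only: Bochner_Integration.integral_minus[symmetric])
  qed
  also have "\<dots> = (\<integral>y. F y * (nrm y \<bullet> e) \<partial>\<sigma>)"
    by (rule surface_integral(1)[symmetric]) (auto simp: F0)
  finally show ?thesis .
qed

end

section \<open>Taylor expansion on quasiconvex sets\<close>

lemma has_derivative_along_line:
  fixes f :: "'a::euclidean_space \<Rightarrow> real"
  assumes "(f has_derivative D) (at (z + t *\<^sub>R a))"
  shows "((\<lambda>t. f (z + t *\<^sub>R a)) has_real_derivative D a) (at t)"
proof -
  have lin: "linear D" using assms by (rule has_derivative_linear)
  have "((\<lambda>s. f (z + s *\<^sub>R a)) has_derivative (\<lambda>s. D (s *\<^sub>R a))) (at t)"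
    by (rule has_derivative_compose[where f = "\<lambda>s. z + s *\<^sub>R a", OF _ assms])
      (auto intro!: derivative_eq_intros)
  then show ?thesis
    by (simp add: has_field_derivative_def linear_cmul[OF lin] mult.commute[of _ "D a"] cong: if_cong)
qed

lemma second_difference_mvt:
  fixes f :: "'a::euclidean_space \<Rightarrow> real"
  assumes s: "0 < s" and ab: "norm a = 1" "norm b = 1"
    and f: "\<And>z. norm (z - x) \<le> 2 * s \<Longrightarrow> (f has_derivative Df z) (at z)"
    and g: "\<And>z. norm (z - x) \<le> 2 * s \<Longrightarrow> ((\<lambda>z. Df z a) has_derivative Dg z) (at z)"
  shows "\<exists>z. norm (z - x) \<le> 2 * s \<and>
    f (x + s *\<^sub>R a + s *\<^sub>R b) - f (x + s *\<^sub>R a) - f (x + s *\<^sub>R b) + f x = s\<^sup>2 * Dg z b"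
proof -
  have near: "norm (t *\<^sub>R a + r *\<^sub>R b) \<le> 2 * s" if "0 \<le> t" "t \<le> s" "0 \<le> r" "r \<le> s" for t r
    using norm_triangle_ineq[of "t *\<^sub>R a" "r *\<^sub>R b"] that ab by simp
  define \<phi> where "\<phi> = (\<lambda>t. f ((x + s *\<^sub>R b) + t *\<^sub>R a) - f (x + t *\<^sub>R a))"
  have "\<exists>t. 0 < t \<and> t < s \<and> \<phi> s - \<phi> 0 = (s - 0) * (Df (x + s *\<^sub>R b + t *\<^sub>R a) a - Df (x + t *\<^sub>R a) a)"
  proof (rule MVT2[OF s])
    fix t :: real assume t: "0 \<le> t" "t \<le> s"
    show "(\<phi> has_real_derivative Df (x + s *\<^sub>R b + t *\<^sub>R a) a - Df (x + t *\<^sub>R a) a) (at t)"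
      unfolding \<phi>_def
    proof (rule DERIV_diff)
      show "((\<lambda>t. f (x + s *\<^sub>R b + t *\<^sub>R a)) has_real_derivative Df (x + s *\<^sub>R b + t *\<^sub>R a) a) (at t)"
        using near[OF t, of s] s by (intro has_derivative_along_line[OF f]) (simp add: add.commute)
      show "((\<lambda>t. f (x + t *\<^sub>R a)) has_real_derivative Df (x + t *\<^sub>R a) a) (at t)"
        using t ab by (intro has_derivative_along_line[OF f]) simp
    qed
  qed
  then obtain t where t: "0 < t" "t < s"
    and eq1: "\<phi> s - \<phi> 0 = s * (Df (x + s *\<^sub>R b + t *\<^sub>R a) a - Df (x + t *\<^sub>R a) a)" by auto
  have "\<exists>r. 0 < r \<and> r < s \<and> Df ((x + t *\<^sub>R a) + s *\<^sub>R b) a - Df ((x + t *\<^sub>R a) + 0 *\<^sub>R b) a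
     = (s - 0) * Dg ((x + t *\<^sub>R a) + r *\<^sub>R b) b"
  proof (rule MVT2[OF s])
    fix r :: real assume r: "0 \<le> r" "r \<le> s"
    show "((\<lambda>r. Df ((x + t *\<^sub>R a) + r *\<^sub>R b) a) has_real_derivative Dg ((x + t *\<^sub>R a) + r *\<^sub>R b) b) (at r)"
      using near[of t r] t r by (intro has_derivative_along_line[OF g]) (simp add: add.assoc)
  qed
  then obtain r where r: "0 < r" "r < s"
    and eq2: "Df ((x + t *\<^sub>R a) + s *\<^sub>R b) a - Df (x + t *\<^sub>R a) a = s * Dg ((x + t *\<^sub>R a) + r *\<^sub>R b) b" by auto
  have "f (x + s *\<^sub>R a + s *\<^sub>R b) - f (x + s *\<^sub>R a) - f (x + s *\<^sub>R b) + f x = \<phi> s - \<phi> 0"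
    by (simp add: \<phi>_def algebra_simps)
  also have "\<dots> = s\<^sup>2 * Dg ((x + t *\<^sub>R a) + r *\<^sub>R b) b"
    using eq1 eq2 by (simp add: power2_eq_square algebra_simps)
  finally show ?thesis using near[of t r] t r
    by (intro exI[of _ "x + t *\<^sub>R a + r *\<^sub>R b"]) (simp add: add.assoc)
qed

text \<open>Schwarz's theorem: one second difference, taken in the two orders by
  \<open>second_difference_mvt\<close>, equals \<open>s\<^sup>2\<close> times either mixed
  derivative at some point near \<open>x\<close>; continuity brings both to
  \<open>x\<close>.\<close>

lemma iter_partial_swap:
  fixes f :: "'a::euclidean_space \<Rightarrow> real"
  assumes C: "Ck_on k f U" and U: "open U" "x \<in> U" and k: "length bs + 2 \<le> k"
    and B: "set bs \<subseteq> Basis" "a \<in> Basis" "b \<in> Basis"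
  shows "iter_partial (a # b # bs) f x = iter_partial (b # a # bs) f x"
proof -
  have D: "(iter_partial cs f has_derivative frechet_derivative (iter_partial cs f) (at z)) (at z)"
    if "set cs \<subseteq> Basis" "length cs < k" "z \<in> U" for cs z
    using Ck_on_differentiable[OF C that] by (simp add: frechet_derivative_works)
  let ?p = "iter_partial (a # b # bs) f" and ?q = "iter_partial (b # a # bs) f"
  have cp: "isCont ?p x" and cq: "isCont ?q x"
    using Ck_on_continuous[OF C, of "a # b # bs"] Ck_on_continuous[OF C, of "b # a # bs"] k B U
    by (auto simp: continuous_on_eq_continuous_at simp del: iter_partial.simps)
  have "\<bar>?p x - ?q x\<bar> \<le> 0 + e" if e: "0 < e" for e
  proof -
    obtain d1 where d1: "d1 > 0" "\<And>z. dist z x < d1 \<Longrightarrow> dist (?p z) (?p x) < e/2"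
      using cp e unfolding continuous_at_eps_delta by (metis half_gt_zero)
    obtain d2 where d2: "d2 > 0" "\<And>z. dist z x < d2 \<Longrightarrow> dist (?q z) (?q x) < e/2"
      using cq e unfolding continuous_at_eps_delta by (metis half_gt_zero)
    obtain d3 where d3: "d3 > 0" "ball x d3 \<subseteq> U" using U by (meson openE)
    define s where "s = min d1 (min d2 d3) / 4"
    have s: "0 < s" "2 * s < d1" "2 * s < d2" "2 * s < d3" using d1 d2 d3 by (auto simp: s_def)
    have inU: "z \<in> U" if "norm (z - x) \<le> 2 * s" for z
      using that s d3 by (auto simp: subset_iff dist_norm norm_minus_commute)
    have "\<exists>z. norm (z - x) \<le> 2 * s \<and>
      iter_partial bs f (x + s *\<^sub>R a + s *\<^sub>R b) - iter_partial bs f (x + s *\<^sub>R a) - iter_partial bs f (x + s *\<^sub>R b) + iter_partial bs f x = s\<^sup>2 * ?q z"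
      using second_difference_mvt[of s a b x "iter_partial bs f" "\<lambda>z. frechet_derivative (iter_partial bs f) (at z)"
         "\<lambda>z. frechet_derivative (iter_partial (a # bs) f) (at z)"] s(1) B k D[of bs] D[of "a # bs"] inU by simp
    then obtain z1 where z1: "norm (z1 - x) \<le> 2 * s" "iter_partial bs f (x + s *\<^sub>R a + s *\<^sub>R b) - iter_partial bs f (x + s *\<^sub>R a) - iter_partial bs f (x + s *\<^sub>R b) + iter_partial bs f x = s\<^sup>2 * ?q z1"
      by blast
    have "\<exists>z. norm (z - x) \<le> 2 * s \<and>
      iter_partial bs f (x + s *\<^sub>R b + s *\<^sub>R a) - iter_partial bs f (x + s *\<^sub>R b) - iter_partial bs f (x + s *\<^sub>R a) + iter_partial bs f x = s\<^sup>2 * ?p z"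
      using second_difference_mvt[of s b a x "iter_partial bs f" "\<lambda>z. frechet_derivative (iter_partial bs f) (at z)"
         "\<lambda>z. frechet_derivative (iter_partial (b # bs) f) (at z)"] s(1) B k D[of bs] D[of "b # bs"] inU by simp
    then obtain z2 where z2: "norm (z2 - x) \<le> 2 * s" "iter_partial bs f (x + s *\<^sub>R b + s *\<^sub>R a) - iter_partial bs f (x + s *\<^sub>R b) - iter_partial bs f (x + s *\<^sub>R a) + iter_partial bs f x = s\<^sup>2 * ?p z2"
      by blast
    have "s\<^sup>2 * ?p z2 = s\<^sup>2 * ?q z1" using z1(2) z2(2) by (simp only: add.assoc add.commute[of "s *\<^sub>R a"]) 
    then have "?p z2 = ?q z1" using s(1) by simp
    moreover have "dist (?p z2) (?p x) < e/2" using z2(1) s by (intro d1) (simp add: dist_norm)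
    moreover have "dist (?q z1) (?q x) < e/2" using z1(1) s by (intro d2) (simp add: dist_norm)
    ultimately show ?thesis unfolding dist_real_def by linarith
  qed
  then have "\<bar>?p x - ?q x\<bar> \<le> 0" by (rule field_le_epsilon)
  then show ?thesis by linarith
qed

text \<open>The identity of \<open>iter_partial_swap\<close> holds on all of the open set
  \<open>U\<close> and may therefore be differentiated once more.\<close>

lemma iter_partial_swap_inner:
  fixes f :: "'a::euclidean_space \<Rightarrow> real"
  assumes C: "Ck_on k f U" and U: "open U" "x \<in> U" and k: "length bs + 3 \<le> k"
    and B: "set bs \<subseteq> Basis" "a \<in> Basis" "b \<in> Basis" "c \<in> Basis"
  shows "iter_partial (c # a # b # bs) f x = iter_partial (c # b # a # bs) f x"
proof -
  have "(iter_partial (a # b # bs) f) differentiable (at x)"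
    using Ck_on_differentiable[OF C, of "a # b # bs" x] U B k by simp
  then have D: "(iter_partial (a # b # bs) f has_derivative frechet_derivative (iter_partial (a # b # bs) f) (at x)) (at x)"
    by (simp only: frechet_derivative_works)
  have "(iter_partial (b # a # bs) f has_derivative frechet_derivative (iter_partial (a # b # bs) f) (at x)) (at x)"
    using k B by (intro has_derivative_transform_within_open[OF D U(1,2)])
      (rule iter_partial_swap[OF C U(1)], auto)
  then have "frechet_derivative (iter_partial (a # b # bs) f) (at x) = frechet_derivative (iter_partial (b # a # bs) f) (at x)"
    by (rule frechet_derivative_at)
  then show ?thesis by (simp only: iter_partial.simps(2)[of c])
qed

lemma quadratic_form_has_derivative:
  fixes x z :: "'a::euclidean_space"
  assumes sym: "\<And>i j. i \<in> Basis \<Longrightarrow> j \<in> Basis \<Longrightarrow> c i j = c j i"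
  shows "((\<lambda>z. \<Sum>i\<in>Basis. \<Sum>j\<in>Basis. c i j * ((z - x) \<bullet> i) * ((z - x) \<bullet> j)) has_derivative
     (\<lambda>w. 2 * (\<Sum>i\<in>Basis. (w \<bullet> i) * (\<Sum>j\<in>Basis. c i j * ((z - x) \<bullet> j))))) (at z)"
proof -
  have D: "((\<lambda>z. \<Sum>i\<in>Basis. \<Sum>j\<in>Basis. c i j * ((z - x) \<bullet> i) * ((z - x) \<bullet> j)) has_derivative
     (\<lambda>w. \<Sum>i\<in>Basis. \<Sum>j\<in>Basis. c i j * ((z - x) \<bullet> i) * (w \<bullet> j) + c i j * (w \<bullet> i) * ((z - x) \<bullet> j))) (at z)"
    by (auto intro!: derivative_eq_intros sum.cong simp: algebra_simps)
  have "(\<Sum>i\<in>Basis. \<Sum>j\<in>Basis. c i j * ((z - x) \<bullet> i) * (w \<bullet> j)) =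
        (\<Sum>i\<in>Basis. \<Sum>j\<in>Basis. c i j * (w \<bullet> i) * ((z - x) \<bullet> j))" for w
    by (subst sum.swap) (auto intro!: sum.cong simp: sym mult_ac)
  moreover have "(\<Sum>i\<in>Basis. \<Sum>j\<in>Basis. c i j * (w \<bullet> i) * ((z - x) \<bullet> j)) =
     (\<Sum>i\<in>Basis. (w \<bullet> i) * (\<Sum>j\<in>Basis. c i j * ((z - x) \<bullet> j)))" for w
    by (simp add: sum_distrib_left mult_ac)
  ultimately show ?thesis using D by (simp add: sum.distrib)
qed

lemma cubic_form_has_derivative:
  fixes x z :: "'a::euclidean_space"
  assumes sym: "\<And>i j k. i \<in> Basis \<Longrightarrow> j \<in> Basis \<Longrightarrow> k \<in> Basis \<Longrightarrow> c i j k = c j i k"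
    "\<And>i j k. i \<in> Basis \<Longrightarrow> j \<in> Basis \<Longrightarrow> k \<in> Basis \<Longrightarrow> c i j k = c i k j"
  shows "((\<lambda>z. \<Sum>i\<in>Basis. \<Sum>j\<in>Basis. \<Sum>k\<in>Basis. c i j k * ((z - x) \<bullet> i) * ((z - x) \<bullet> j) * ((z - x) \<bullet> k)) has_derivative
     (\<lambda>w. 3 * (\<Sum>i\<in>Basis. (w \<bullet> i) * (\<Sum>j\<in>Basis. \<Sum>k\<in>Basis. c i j k * ((z - x) \<bullet> j) * ((z - x) \<bullet> k))))) (at z)"
proof -
  let ?h = "\<lambda>i. (z - x) \<bullet> i"
  have D: "((\<lambda>z. \<Sum>i\<in>Basis. \<Sum>j\<in>Basis. \<Sum>k\<in>Basis. c i j k * ((z - x) \<bullet> i) * ((z - x) \<bullet> j) * ((z - x) \<bullet> k)) has_derivative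
     (\<lambda>w. \<Sum>i\<in>Basis. \<Sum>j\<in>Basis. \<Sum>k\<in>Basis. c i j k * ?h i * ?h j * (w \<bullet> k) + c i j k * ?h i * (w \<bullet> j) * ?h k + c i j k * (w \<bullet> i) * ?h j * ?h k)) (at z)"
    by (auto intro!: derivative_eq_intros sum.cong simp: algebra_simps)
  have 1: "(\<Sum>i\<in>Basis. \<Sum>j\<in>Basis. \<Sum>k\<in>Basis. c i j k * ?h i * (w \<bullet> j) * ?h k) =
        (\<Sum>i\<in>Basis. \<Sum>j\<in>Basis. \<Sum>k\<in>Basis. c i j k * (w \<bullet> i) * ?h j * ?h k)" for w
    by (subst sum.swap) (auto intro!: sum.cong simp: sym(1) mult_ac)
  have 2: "(\<Sum>i\<in>Basis. \<Sum>j\<in>Basis. \<Sum>k\<in>Basis. c i j k * ?h i * ?h j * (w \<bullet> k)) =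
        (\<Sum>i\<in>Basis. \<Sum>j\<in>Basis. \<Sum>k\<in>Basis. c i j k * ?h i * (w \<bullet> j) * ?h k)" for w
  proof (rule sum.cong[OF refl])
    fix i :: 'a assume i: "i \<in> Basis"
    show "(\<Sum>j\<in>Basis. \<Sum>k\<in>Basis. c i j k * ?h i * ?h j * (w \<bullet> k)) = (\<Sum>j\<in>Basis. \<Sum>k\<in>Basis. c i j k * ?h i * (w \<bullet> j) * ?h k)"
      using i by (subst sum.swap) (auto intro!: sum.cong simp: sym(2)[of i] mult_ac)
  qed
  have 3: "(\<Sum>i\<in>Basis. \<Sum>j\<in>Basis. \<Sum>k\<in>Basis. c i j k * (w \<bullet> i) * ?h j * ?h k) =
     (\<Sum>i\<in>Basis. (w \<bullet> i) * (\<Sum>j\<in>Basis. \<Sum>k\<in>Basis. c i j k * ?h j * ?h k))" for w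
    by (simp add: sum_distrib_left mult_ac)
  show ?thesis using D by (simp add: sum.distrib 1 2 3)
qed

text \<open>Three segments are what \<open>vertical_path\<close> provides. The path stays in a ball
  of radius proportional to \<open>r\<close>, so that derivative bounds near \<open>x\<close>
  suffice; the strict inequality makes \<open>r\<close> positive even for
  \<open>y = x\<close>.\<close>

definition quasiconvex :: "'a::euclidean_space set \<Rightarrow> real \<Rightarrow> real \<Rightarrow> bool" where
  "quasiconvex \<Omega> C \<epsilon> \<longleftrightarrow> (\<forall>x\<in>\<Omega>. \<forall>y\<in>\<Omega>. \<forall>r. norm (y - x) < r \<and> r \<le> \<epsilon> \<longrightarrow>
     (\<exists>a b. closed_segment x a \<union> closed_segment a b \<union> closed_segment b y \<subseteq> \<Omega> \<inter> ball x (C * r)))"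

text \<open>Each of the three segments has its ends in \<open>ball x (C * r)\<close> and thus length
  at most \<open>2 * C * r\<close>, which gives the factor 6.\<close>

lemma quasiconvex_growth:
  fixes v :: "'a::euclidean_space \<Rightarrow> real"
  assumes q: "quasiconvex \<Omega> C \<epsilon>" and xy: "x \<in> \<Omega>" "y \<in> \<Omega>" "norm (y - x) < r" "r \<le> \<epsilon>"
    and D: "\<And>z. z \<in> \<Omega> \<Longrightarrow> norm (z - x) < C * r \<Longrightarrow> (v has_derivative D z) (at z)"
    and m: "\<And>z w. z \<in> \<Omega> \<Longrightarrow> norm (z - x) < C * r \<Longrightarrow> \<bar>D z w\<bar> \<le> m * norm w" and m0: "0 \<le> m"
  shows "\<bar>v y - v x\<bar> \<le> 6 * C * m * r"
proof -
  obtain a b where ab: "closed_segment x a \<union> closed_segment a b \<union> closed_segment b y \<subseteq> \<Omega> \<inter> ball x (C * r)"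
    using q xy unfolding quasiconvex_def by blast
  have seg: "\<bar>v q - v p\<bar> \<le> m * (2 * (C * r))" if pq: "closed_segment p q \<subseteq> \<Omega> \<inter> ball x (C * r)" for p q
  proof -
    have "norm (v q - v p) \<le> m * norm (q - p)"
    proof (rule differentiable_bound[where S="closed_segment p q" and f'=D])
      fix z assume z: "z \<in> closed_segment p q"
      then have z': "z \<in> \<Omega>" "norm (z - x) < C * r" using pq by (auto simp: dist_norm norm_minus_commute)
      show "(v has_derivative D z) (at z within closed_segment p q)"
        by (rule has_derivative_at_withinI[OF D[OF z']])
      show "onorm (D z) \<le> m" using m[OF z'] by (intro onorm_le) simp
    qed auto
    also have "norm (q - p) \<le> 2 * (C * r)"
    proof -
      have "p \<in> ball x (C * r)" "q \<in> ball x (C * r)" using pq by auto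
      then have "dist x p < C * r" "dist x q < C * r" by auto
      moreover have "norm (q - p) \<le> dist x q + dist x p"
        using dist_triangle3[of q p x] by (simp add: dist_norm)
      ultimately show ?thesis by linarith
    qed
    finally show ?thesis using m0 by (simp add: mult_left_mono)
  qed
  have "\<bar>v a - v x\<bar> \<le> m * (2 * (C * r))" "\<bar>v b - v a\<bar> \<le> m * (2 * (C * r))" "\<bar>v y - v b\<bar> \<le> m * (2 * (C * r))"
    using ab by (auto intro!: seg)
  then show ?thesis by (simp add: algebra_simps)
qed

text \<open>The induction step of Taylor's formula: a derivative of order \<open>j\<close> in the
  distance from \<open>x\<close> forces a function that vanishes at \<open>x\<close> to be of order
  \<open>j + 1\<close>.\<close>

lemma quasiconvex_growth_power:
  fixes v :: "'a::euclidean_space \<Rightarrow> real"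
  assumes q: "quasiconvex \<Omega> C \<epsilon>" and C: "1 \<le> C" and xy: "x \<in> \<Omega>" "y \<in> \<Omega>" "norm (y - x) < R" "R \<le> \<epsilon>"
    and D: "\<And>z. z \<in> \<Omega> \<Longrightarrow> norm (z - x) < C * R \<Longrightarrow> (v has_derivative D z) (at z)"
    and m: "\<And>z w. z \<in> \<Omega> \<Longrightarrow> norm (z - x) < C * R \<Longrightarrow> \<bar>D z w\<bar> \<le> m * norm (z - x) ^ j * norm w" and m0: "0 \<le> m"
    and v0: "v x = 0"
  shows "\<bar>v y\<bar> \<le> 12 * C * (2 * C) ^ j * m * norm (y - x) ^ Suc j"
proof (cases "y = x")
  case True then show ?thesis using v0 by simp
next
  case False
  \<comment> \<open>A radius strictly above \<open>norm (y - x)\<close> is required; twice that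
    distance, capped at \<open>R\<close>, costs only a factor \<open>2 ^ Suc j\<close>.\<close>
  define r where "r = min (2 * norm (y - x)) R"
  have h0: "0 < norm (y - x)" using False by simp
  have r: "norm (y - x) < r" "r \<le> R" "r \<le> 2 * norm (y - x)" using h0 xy by (auto simp: r_def)
  have r0: "0 < r" using h0 r by linarith
  have Cr: "C * r \<le> C * R" using r C by simp
  have "\<bar>v y - v x\<bar> \<le> 6 * C * (m * (C * r) ^ j) * r"
  proof (rule quasiconvex_growth[OF q xy(1,2) r(1)])
    fix z w assume z: "z \<in> \<Omega>" "norm (z - x) < C * r"
    then show "(v has_derivative D z) (at z)" using D Cr by auto
    have "\<bar>D z w\<bar> \<le> m * norm (z - x) ^ j * norm w" using m z Cr by auto
    also have "\<dots> \<le> m * (C * r) ^ j * norm w"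
      using z m0 by (intro mult_right_mono mult_left_mono power_mono) auto
    finally show "\<bar>D z w\<bar> \<le> m * (C * r) ^ j * norm w" .
  qed (use r xy m0 C r0 in auto)
  also have "\<dots> \<le> 6 * C * (m * (C * (2 * norm (y - x))) ^ j) * (2 * norm (y - x))"
    using C m0 r r0 by (intro mult_mono mult_left_mono power_mono mult_nonneg_nonneg) auto
  also have "\<dots> = 12 * C * (2 * C) ^ j * m * norm (y - x) ^ Suc j"
    by (simp add: power_mult_distrib mult_ac)
  finally show ?thesis using v0 by simp
qed

lemma abs_sum_Basis_le:
  fixes w :: "'a::euclidean_space"
  assumes "\<And>b. b \<in> Basis \<Longrightarrow> \<bar>c b\<bar> \<le> m"
  shows "\<bar>\<Sum>b\<in>Basis. (w \<bullet> b) * c b\<bar> \<le> real DIM('a) * m * norm w"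
proof -
  have "\<bar>\<Sum>b\<in>Basis. (w \<bullet> b) * c b\<bar> \<le> (\<Sum>b\<in>(Basis::'a set). norm w * m)"
  proof (rule sum_abs[THEN order_trans], rule sum_mono)
    fix b :: 'a assume b: "b \<in> Basis"
    show "\<bar>(w \<bullet> b) * c b\<bar> \<le> norm w * m"
      unfolding abs_mult using assms[OF b] Basis_le_norm[OF b] by (intro mult_mono) auto
  qed
  then show ?thesis by (simp add: mult_ac)
qed

lemma has_derivative_divide_const:
  fixes f :: "'a::real_normed_vector \<Rightarrow> real"
  shows "(f has_derivative f') F \<Longrightarrow> ((\<lambda>x. f x / c) has_derivative (\<lambda>x. f' x / c)) F"
  by (rule bounded_linear.has_derivative[OF bounded_linear_divide])

text \<open>The boundary integral evaluates \<open>u\<close> on the frontier, which paths inside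
  \<open>\<Omega>\<close> do not reach; the estimate there is the limit of the one inside.\<close>

lemma closed_linear_remainder:
  fixes u :: "'a::euclidean_space \<Rightarrow> real"
  assumes cu: "continuous_on (closure \<Omega>) u"
    and T: "\<And>y. y \<in> \<Omega> \<Longrightarrow> norm (y - x) < R \<Longrightarrow> \<bar>u y - u x - p \<bullet> (y - x)\<bar> \<le> K * (norm (y - x))\<^sup>2"
    and y: "y \<in> closure \<Omega>" "norm (y - x) < R"
  shows "\<bar>u y - u x - p \<bullet> (y - x)\<bar> \<le> K * (norm (y - x))\<^sup>2"
proof -
  obtain s where s: "\<And>k. s k \<in> \<Omega>" "s \<longlonglongrightarrow> y" using y by (auto simp: closure_sequential)
  have us: "(\<lambda>k. u (s k)) \<longlonglongrightarrow> u y"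
    using cu s y closure_subset[of \<Omega>] unfolding continuous_on_sequentially by (auto simp: o_def)
  have n: "(\<lambda>k. norm (s k - x)) \<longlonglongrightarrow> norm (y - x)" by (intro tendsto_intros s)
  have ev: "\<forall>\<^sub>F k in sequentially. norm (s k - x) < R"
    using n y(2) by (rule order_tendstoD)
  show ?thesis
  proof (rule tendsto_le[OF sequentially_bot])
    show "(\<lambda>k. K * (norm (s k - x))\<^sup>2) \<longlonglongrightarrow> K * (norm (y - x))\<^sup>2" by (intro tendsto_intros s)
    show "(\<lambda>k. \<bar>u (s k) - u x - p \<bullet> (s k - x)\<bar>) \<longlonglongrightarrow> \<bar>u y - u x - p \<bullet> (y - x)\<bar>"
      by (intro tendsto_intros s us)
    show "\<forall>\<^sub>F k in sequentially. \<bar>u (s k) - u x - p \<bullet> (s k - x)\<bar> \<le> K * (norm (s k - x))\<^sup>2"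
      using ev by eventually_elim (use T s in auto)
  qed
qed

section \<open>Taylor remainders with explicit constants\<close>

locale C4_data =
  fixes \<Omega> :: "'a::euclidean_space set" and C \<epsilon> M :: real and u :: "'a \<Rightarrow> real"
  assumes openO: "open \<Omega>" and q: "quasiconvex \<Omega> C \<epsilon>" and C: "1 \<le> C" and \<epsilon>: "0 < \<epsilon>"
    and C4: "Ck_on 4 u \<Omega>"
    and bound: "\<And>bs x. set bs \<subseteq> Basis \<Longrightarrow> length bs \<le> 4 \<Longrightarrow> x \<in> \<Omega> \<Longrightarrow> \<bar>iter_partial bs u x\<bar> \<le> M"
    and M: "0 \<le> M" and cu: "continuous_on (closure \<Omega>) u"
begin

abbreviation U :: "'a list \<Rightarrow> 'a \<Rightarrow> real" where "U bs \<equiv> iter_partial bs u"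

definition n where "n = real DIM('a)"

lemma n0: "0 \<le> n" by (simp add: n_def)

lemma D: "set bs \<subseteq> Basis \<Longrightarrow> length bs < 4 \<Longrightarrow> x \<in> \<Omega> \<Longrightarrow>
   (U bs has_derivative (\<lambda>w. \<Sum>b\<in>Basis. (w \<bullet> b) * U (b # bs) x)) (at x)"
  by (rule iter_partial_has_derivative[OF Ck_on_differentiable[OF C4]])

lemma swap2: "i \<in> Basis \<Longrightarrow> j \<in> Basis \<Longrightarrow> set bs \<subseteq> Basis \<Longrightarrow> length bs \<le> 2 \<Longrightarrow> x \<in> \<Omega> \<Longrightarrow>
   U (i # j # bs) x = U (j # i # bs) x"
  by (rule iter_partial_swap[OF C4 openO]) auto

lemma swap3: "i \<in> Basis \<Longrightarrow> j \<in> Basis \<Longrightarrow> k \<in> Basis \<Longrightarrow> x \<in> \<Omega> \<Longrightarrow>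
   U [i, j, k] x = U [i, k, j] x"
  by (rule iter_partial_swap_inner[OF C4 openO]) auto

text \<open>Each constant is that of \<open>quasiconvex_growth_power\<close> with the previous one,
  starting from \<open>M\<close>, times the dimension as bound for the derivative. Each step uses
  the previous estimate on a ball \<open>C\<close> times larger, so the radii of validity shrink
  from \<open>\<epsilon>\<close> to \<open>\<epsilon> / C / C / C\<close>.\<close>

definition K1 where "K1 = 12 * C * (2 * C) ^ 0 * (n * M)"
definition K2 where "K2 = 12 * C * (2 * C) ^ 1 * (n * K1)"
definition K3 where "K3 = 12 * C * (2 * C) ^ 2 * (n * K2)"
definition K4 where "K4 = 12 * C * (2 * C) ^ 3 * (n * K3)"

lemma K_nonneg: "0 \<le> K1" "0 \<le> K2" "0 \<le> K3" "0 \<le> K4"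
  unfolding K1_def K2_def K3_def K4_def using C n0 M by simp_all

lemma linear_part_derivative:
  "((\<lambda>z. \<Sum>i\<in>Basis. c i * ((z - x) \<bullet> i)) has_derivative (\<lambda>w. \<Sum>i\<in>Basis. (w \<bullet> i) * c i)) (at z)"
  by (auto intro!: derivative_eq_intros sum.cong simp: algebra_simps)

lemma remainder1:
  assumes "x \<in> \<Omega>" "y \<in> \<Omega>" "norm (y - x) < \<epsilon>" and bs: "set bs \<subseteq> Basis" "length bs \<le> 3"
  shows "\<bar>U bs y - U bs x\<bar> \<le> K1 * norm (y - x)"
proof -
  have "\<bar>U bs y - U bs x\<bar> \<le> 12 * C * (2 * C) ^ 0 * (n * M) * norm (y - x) ^ Suc 0"
  proof (rule quasiconvex_growth_power[OF q C, where v="\<lambda>z. U bs z - U bs x" and R=\<epsilon>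
        and D="\<lambda>z w. \<Sum>b\<in>Basis. (w \<bullet> b) * U (b # bs) z"])
    fix z assume z: "z \<in> \<Omega>"
    show "((\<lambda>z. U bs z - U bs x) has_derivative (\<lambda>w. \<Sum>b\<in>Basis. (w \<bullet> b) * U (b # bs) z)) (at z)"
      using has_derivative_diff[OF D[OF bs(1) _ z] has_derivative_const[of "U bs x"]] bs by simp
    show "\<bar>\<Sum>b\<in>Basis. (w \<bullet> b) * U (b # bs) z\<bar> \<le> n * M * norm (z - x) ^ 0 * norm w" for w
      using abs_sum_Basis_le[of "\<lambda>b. U (b # bs) z" M w] bound[of "_ # bs", OF _ _ z] bs
      by (simp add: n_def del: iter_partial.simps)
  qed (use assms n0 M in auto)
  then show ?thesis by (simp add: K1_def)
qed

text \<open>The partial derivatives of this remainder are remainders of one order less for the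
  functions \<open>U (b # bs)\<close>, to which \<open>remainder1\<close> applies.\<close>

lemma remainder2:
  assumes "x \<in> \<Omega>" "y \<in> \<Omega>" "norm (y - x) < \<epsilon> / C" and bs: "set bs \<subseteq> Basis" "length bs \<le> 2"
  shows "\<bar>U bs y - U bs x - (\<Sum>i\<in>Basis. U (i # bs) x * ((y - x) \<bullet> i))\<bar> \<le> K2 * norm (y - x) ^ 2"
proof -
  have "\<bar>U bs y - U bs x - (\<Sum>i\<in>Basis. U (i # bs) x * ((y - x) \<bullet> i))\<bar> \<le> 12 * C * (2 * C) ^ 1 * (n * K1) * norm (y - x) ^ Suc 1"
  proof (rule quasiconvex_growth_power[OF q C, where v="\<lambda>z. U bs z - U bs x - (\<Sum>i\<in>Basis. U (i # bs) x * ((z - x) \<bullet> i))" and R="\<epsilon> / C"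
        and D="\<lambda>z w. \<Sum>b\<in>Basis. (w \<bullet> b) * (U (b # bs) z - U (b # bs) x)"])
    fix z assume z: "z \<in> \<Omega>" and zx: "norm (z - x) < C * (\<epsilon> / C)"
    have "((\<lambda>z. U bs z - U bs x - (\<Sum>i\<in>Basis. U (i # bs) x * ((z - x) \<bullet> i))) has_derivative
       (\<lambda>w. (\<Sum>b\<in>Basis. (w \<bullet> b) * U (b # bs) z) - 0 - (\<Sum>b\<in>Basis. (w \<bullet> b) * U (b # bs) x))) (at z)"
      using bs by (intro has_derivative_diff D z has_derivative_const linear_part_derivative) auto
    then show "((\<lambda>z. U bs z - U bs x - (\<Sum>i\<in>Basis. U (i # bs) x * ((z - x) \<bullet> i))) has_derivative
       (\<lambda>w. \<Sum>b\<in>Basis. (w \<bullet> b) * (U (b # bs) z - U (b # bs) x))) (at z)"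
      by (simp add: right_diff_distrib sum_subtractf del: iter_partial.simps)
    have "\<bar>U (b # bs) z - U (b # bs) x\<bar> \<le> K1 * norm (z - x)" if "b \<in> Basis" for b
      using that zx bs C by (intro remainder1 assms z) auto
    then show "\<bar>\<Sum>b\<in>Basis. (w \<bullet> b) * (U (b # bs) z - U (b # bs) x)\<bar> \<le> n * K1 * norm (z - x) ^ 1 * norm w" for w
      using abs_sum_Basis_le[of "\<lambda>b. U (b # bs) z - U (b # bs) x" "K1 * norm (z - x)" w]
      by (simp add: n_def mult.assoc del: iter_partial.simps)
  qed (use assms n0 K_nonneg C \<epsilon> in \<open>auto simp: divide_le_eq\<close>)
  then show ?thesis by (simp add: K2_def power2_eq_square del: iter_partial.simps)
qed

text \<open>As for \<open>remainder2\<close>, except that differentiating the quadratic form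
  produces \<open>U (b # j # bs)\<close> where the remainder of \<open>U (b # bs)\<close> has
  \<open>U (j # b # bs)\<close>; the symmetry of second derivatives reconciles them.\<close>

lemma remainder3:
  assumes x: "x \<in> \<Omega>" and "y \<in> \<Omega>" "norm (y - x) < \<epsilon> / C / C" and bs: "set bs \<subseteq> Basis" "length bs \<le> 1"
  shows "\<bar>U bs y - U bs x - (\<Sum>i\<in>Basis. U (i # bs) x * ((y - x) \<bullet> i))
     - (\<Sum>i\<in>Basis. \<Sum>j\<in>Basis. U (i # j # bs) x * ((y - x) \<bullet> i) * ((y - x) \<bullet> j)) / 2\<bar> \<le> K3 * norm (y - x) ^ 3"
proof -
  let ?v = "\<lambda>z. U bs z - U bs x - (\<Sum>i\<in>Basis. U (i # bs) x * ((z - x) \<bullet> i))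
     - (\<Sum>i\<in>Basis. \<Sum>j\<in>Basis. U (i # j # bs) x * ((z - x) \<bullet> i) * ((z - x) \<bullet> j)) / 2"
  let ?r = "\<lambda>b z. U (b # bs) z - U (b # bs) x - (\<Sum>i\<in>Basis. U (i # b # bs) x * ((z - x) \<bullet> i))"
  have "\<bar>?v y\<bar> \<le> 12 * C * (2 * C) ^ 2 * (n * K2) * norm (y - x) ^ Suc 2"
  proof (rule quasiconvex_growth_power[OF q C, where v="?v" and R="\<epsilon> / C / C"
        and D="\<lambda>z w. \<Sum>b\<in>Basis. (w \<bullet> b) * ?r b z"])
    fix z assume z: "z \<in> \<Omega>" and zx: "norm (z - x) < C * (\<epsilon> / C / C)"
    have sw: "U (i # j # bs) x = U (j # i # bs) x" if "i \<in> Basis" "j \<in> Basis" for i j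
      using that bs x by (intro swap2) auto
    have Dv: "(?v has_derivative
       (\<lambda>w. (\<Sum>b\<in>Basis. (w \<bullet> b) * U (b # bs) z) - 0 - (\<Sum>b\<in>Basis. (w \<bullet> b) * U (b # bs) x)
         - (2 * (\<Sum>i\<in>Basis. (w \<bullet> i) * (\<Sum>j\<in>Basis. U (i # j # bs) x * ((z - x) \<bullet> j)))) / 2)) (at z)"
      using bs by (intro has_derivative_diff D z has_derivative_const linear_part_derivative
        has_derivative_divide_const quadratic_form_has_derivative sw) auto
    have eq: "(\<Sum>b\<in>Basis. (w \<bullet> b) * U (b # bs) z) - 0 - (\<Sum>b\<in>Basis. (w \<bullet> b) * U (b # bs) x)
         - (2 * (\<Sum>i\<in>Basis. (w \<bullet> i) * (\<Sum>j\<in>Basis. U (i # j # bs) x * ((z - x) \<bullet> j)))) / 2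
       = (\<Sum>b\<in>Basis. (w \<bullet> b) * ?r b z)" for w
    proof -
      have "(\<Sum>i\<in>Basis. (w \<bullet> i) * (\<Sum>j\<in>Basis. U (i # j # bs) x * ((z - x) \<bullet> j))) =
        (\<Sum>i\<in>Basis. (w \<bullet> i) * (\<Sum>j\<in>Basis. U (j # i # bs) x * ((z - x) \<bullet> j)))"
        by (intro sum.cong refl arg_cong2[where f="(*)"] sw)
      then show ?thesis by (simp add: right_diff_distrib sum_subtractf del: iter_partial.simps)
    qed
    show "(?v has_derivative (\<lambda>w. \<Sum>b\<in>Basis. (w \<bullet> b) * ?r b z)) (at z)"
      using Dv unfolding eq .
    have "\<bar>?r b z\<bar> \<le> K2 * norm (z - x) ^ 2" if "b \<in> Basis" for b
      using that zx bs C by (intro remainder2 assms z) auto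
    then show "\<bar>\<Sum>b\<in>Basis. (w \<bullet> b) * ?r b z\<bar> \<le> n * K2 * norm (z - x) ^ 2 * norm w" for w
      using abs_sum_Basis_le[of "\<lambda>b. ?r b z" "K2 * norm (z - x) ^ 2" w]
      by (simp add: n_def mult.assoc del: iter_partial.simps)
  next
    have "\<epsilon> / C / C \<le> \<epsilon>" using C \<epsilon> mult_mono[of 1 C 1 C] by (simp add: divide_le_eq)
    then show "\<epsilon> / C / C \<le> \<epsilon>" .
  qed (use assms n0 K_nonneg in auto)
  then show ?thesis by (simp add: K3_def eval_nat_numeral)
qed

lemma remainder4:
  assumes x: "x \<in> \<Omega>" and "y \<in> \<Omega>" "norm (y - x) < \<epsilon> / C / C / C"
  shows "\<bar>u y - u x - (\<Sum>i\<in>Basis. U [i] x * ((y - x) \<bullet> i))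
     - (\<Sum>i\<in>Basis. \<Sum>j\<in>Basis. U [i, j] x * ((y - x) \<bullet> i) * ((y - x) \<bullet> j)) / 2
     - (\<Sum>i\<in>Basis. \<Sum>j\<in>Basis. \<Sum>k\<in>Basis. U [i, j, k] x * ((y - x) \<bullet> i) * ((y - x) \<bullet> j) * ((y - x) \<bullet> k)) / 6\<bar>
     \<le> K4 * norm (y - x) ^ 4"
proof -
  let ?v = "\<lambda>z. U [] z - U [] x - (\<Sum>i\<in>Basis. U [i] x * ((z - x) \<bullet> i))
     - (\<Sum>i\<in>Basis. \<Sum>j\<in>Basis. U [i, j] x * ((z - x) \<bullet> i) * ((z - x) \<bullet> j)) / 2
     - (\<Sum>i\<in>Basis. \<Sum>j\<in>Basis. \<Sum>k\<in>Basis. U [i, j, k] x * ((z - x) \<bullet> i) * ((z - x) \<bullet> j) * ((z - x) \<bullet> k)) / 6"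
  let ?r = "\<lambda>b z. U [b] z - U [b] x - (\<Sum>i\<in>Basis. U [i, b] x * ((z - x) \<bullet> i))
     - (\<Sum>i\<in>Basis. \<Sum>j\<in>Basis. U [i, j, b] x * ((z - x) \<bullet> i) * ((z - x) \<bullet> j)) / 2"
  have "\<bar>?v y\<bar> \<le> 12 * C * (2 * C) ^ 3 * (n * K3) * norm (y - x) ^ Suc 3"
  proof (rule quasiconvex_growth_power[OF q C, where v="?v" and R="\<epsilon> / C / C / C"
        and D="\<lambda>z w. \<Sum>b\<in>Basis. (w \<bullet> b) * ?r b z"])
    fix z assume z: "z \<in> \<Omega>" and zx: "norm (z - x) < C * (\<epsilon> / C / C / C)"
    have sw: "U [i, j] x = U [j, i] x" if "i \<in> Basis" "j \<in> Basis" for i j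
      using that x by (intro swap2) auto
    have sw1: "U [i, j, k] x = U [j, i, k] x" if "i \<in> Basis" "j \<in> Basis" "k \<in> Basis" for i j k
      using that x by (intro swap2) auto
    have sw2: "U [i, j, k] x = U [i, k, j] x" if "i \<in> Basis" "j \<in> Basis" "k \<in> Basis" for i j k
      using that x by (intro swap3) auto
    \<comment> \<open>The direction \<open>b\<close> of the new derivative has to be carried past
      both directions of the quadratic form.\<close>
    have sw3: "U [b, i, j] x = U [i, j, b] x" if "b \<in> Basis" "i \<in> Basis" "j \<in> Basis" for b i j
      using sw1[of b i j] sw2[of i b j] that by simp
    have Dv: "(?v has_derivative
       (\<lambda>w. (\<Sum>b\<in>Basis. (w \<bullet> b) * U [b] z) - 0 - (\<Sum>b\<in>Basis. (w \<bullet> b) * U [b] x)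
         - (2 * (\<Sum>i\<in>Basis. (w \<bullet> i) * (\<Sum>j\<in>Basis. U [i, j] x * ((z - x) \<bullet> j)))) / 2
         - (3 * (\<Sum>i\<in>Basis. (w \<bullet> i) * (\<Sum>j\<in>Basis. \<Sum>k\<in>Basis. U [i, j, k] x * ((z - x) \<bullet> j) * ((z - x) \<bullet> k)))) / 6)) (at z)"
      by (intro has_derivative_diff D z has_derivative_const linear_part_derivative
        has_derivative_divide_const quadratic_form_has_derivative cubic_form_has_derivative sw sw1 sw2) auto
    have eq: "(\<Sum>b\<in>Basis. (w \<bullet> b) * U [b] z) - 0 - (\<Sum>b\<in>Basis. (w \<bullet> b) * U [b] x)
         - (2 * (\<Sum>i\<in>Basis. (w \<bullet> i) * (\<Sum>j\<in>Basis. U [i, j] x * ((z - x) \<bullet> j)))) / 2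
         - (3 * (\<Sum>i\<in>Basis. (w \<bullet> i) * (\<Sum>j\<in>Basis. \<Sum>k\<in>Basis. U [i, j, k] x * ((z - x) \<bullet> j) * ((z - x) \<bullet> k)))) / 6
       = (\<Sum>b\<in>Basis. (w \<bullet> b) * ?r b z)" for w
    proof -
      have e1: "(\<Sum>i\<in>Basis. (w \<bullet> i) * (\<Sum>j\<in>Basis. U [i, j] x * ((z - x) \<bullet> j))) =
        (\<Sum>i\<in>Basis. (w \<bullet> i) * (\<Sum>j\<in>Basis. U [j, i] x * ((z - x) \<bullet> j)))"
        by (intro sum.cong refl arg_cong2[where f="(*)"] sw)
      have e2: "(\<Sum>b\<in>Basis. (w \<bullet> b) * (\<Sum>i\<in>Basis. \<Sum>j\<in>Basis. U [b, i, j] x * ((z - x) \<bullet> i) * ((z - x) \<bullet> j))) =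
        (\<Sum>b\<in>Basis. (w \<bullet> b) * (\<Sum>i\<in>Basis. \<Sum>j\<in>Basis. U [i, j, b] x * ((z - x) \<bullet> i) * ((z - x) \<bullet> j)))"
        by (intro sum.cong refl arg_cong2[where f="(*)"] sw3)
      have dist: "(\<Sum>b\<in>Basis. (w \<bullet> b) * (c1 b - c2 b - c3 b - c4 b / 2)) =
        (\<Sum>b\<in>Basis. (w \<bullet> b) * c1 b) - (\<Sum>b\<in>Basis. (w \<bullet> b) * c2 b) - (\<Sum>b\<in>Basis. (w \<bullet> b) * c3 b)
        - (\<Sum>b\<in>Basis. (w \<bullet> b) * c4 b) / 2" for c1 c2 c3 c4
        by (simp add: right_diff_distrib sum_subtractf sum_divide_distrib)
      have "(\<Sum>b\<in>Basis. (w \<bullet> b) * ?r b z) =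
        (\<Sum>b\<in>Basis. (w \<bullet> b) * U [b] z) - (\<Sum>b\<in>Basis. (w \<bullet> b) * U [b] x)
        - (\<Sum>i\<in>Basis. (w \<bullet> i) * (\<Sum>j\<in>Basis. U [j, i] x * ((z - x) \<bullet> j)))
        - (\<Sum>b\<in>Basis. (w \<bullet> b) * (\<Sum>i\<in>Basis. \<Sum>j\<in>Basis. U [i, j, b] x * ((z - x) \<bullet> i) * ((z - x) \<bullet> j))) / 2"
        by (rule dist)
      then show ?thesis unfolding e1 e2 by simp
    qed
    show "(?v has_derivative (\<lambda>w. \<Sum>b\<in>Basis. (w \<bullet> b) * ?r b z)) (at z)"
      using Dv unfolding eq .
    have "\<bar>?r b z\<bar> \<le> K3 * norm (z - x) ^ 3" if "b \<in> Basis" for b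
      using that zx C by (intro remainder3 assms z) auto
    then show "\<bar>\<Sum>b\<in>Basis. (w \<bullet> b) * ?r b z\<bar> \<le> n * K3 * norm (z - x) ^ 3 * norm w" for w
      using abs_sum_Basis_le[of "\<lambda>b. ?r b z" "K3 * norm (z - x) ^ 3" w]
      by (simp add: n_def mult.assoc del: iter_partial.simps)
  next
    have "1 \<le> C * C * C" using C mult_mono[of 1 C 1 C] mult_mono[of 1 "C * C" 1 C] by simp
    then show "\<epsilon> / C / C / C \<le> \<epsilon>" using C \<epsilon> by (simp add: divide_le_eq)
  qed (use assms n0 K_nonneg in auto)
  then show ?thesis by (simp add: K4_def eval_nat_numeral)
qed

lemma remainder_boundary:
  assumes x: "x \<in> \<Omega>" and y: "y \<in> closure \<Omega>" "norm (y - x) < \<epsilon> / C"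
  shows "\<bar>u y - u x - grad u x \<bullet> (y - x)\<bar> \<le> K2 * (norm (y - x))\<^sup>2"
proof (rule closed_linear_remainder[OF cu _ y])
  fix z assume z: "z \<in> \<Omega>" "norm (z - x) < \<epsilon> / C"
  have "(\<Sum>i\<in>Basis. U [i] x * ((z - x) \<bullet> i)) = grad u x \<bullet> (z - x)"
    by (simp add: grad_def inner_sum_left inner_commute[of "z - x"] del: iter_partial.simps)
  then show "\<bar>u z - u x - grad u x \<bullet> (z - x)\<bar> \<le> K2 * (norm (z - x))\<^sup>2"
    using remainder2[OF x z, of "[]"] by (simp del: iter_partial.simps(2))
qed

lemma remainder_laplacian:
  assumes x: "x \<in> \<Omega>" and y: "y \<in> \<Omega>" "norm (y - x) < \<epsilon> / C"
  shows "\<bar>laplacian u y - laplacian u x - (\<Sum>k\<in>Basis. (\<Sum>i\<in>Basis. U [k, i, i] x) * ((y - x) \<bullet> k))\<bar> \<le> n * K2 * (norm (y - x))\<^sup>2"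
proof -
  have "(\<Sum>k\<in>Basis. (\<Sum>i\<in>Basis. U [k, i, i] x) * ((y - x) \<bullet> k)) = (\<Sum>i\<in>Basis. \<Sum>k\<in>Basis. U [k, i, i] x * ((y - x) \<bullet> k))"
    by (simp only: sum_distrib_right) (rule sum.swap)
  then have "laplacian u y - laplacian u x - (\<Sum>k\<in>Basis. (\<Sum>i\<in>Basis. U [k, i, i] x) * ((y - x) \<bullet> k))
    = (\<Sum>i\<in>Basis. U [i, i] y - U [i, i] x - (\<Sum>k\<in>Basis. U [k, i, i] x * ((y - x) \<bullet> k)))"
    unfolding laplacian_def by (simp only: sum_subtractf)
  also have "\<bar>\<dots>\<bar> \<le> (\<Sum>i\<in>(Basis::'a set). K2 * (norm (y - x))\<^sup>2)"
    by (rule sum_abs[THEN order_trans], rule sum_mono, rule remainder2[OF x y]) auto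
  also have "\<dots> = n * K2 * (norm (y - x))\<^sup>2" by (simp add: n_def)
  finally show ?thesis .
qed

end

section \<open>Uniform charts\<close>

lemma finite_family_uniform_bound:
  assumes "finite A" and "\<And>a. a \<in> A \<Longrightarrow> \<exists>M. \<forall>x\<in>S. \<bar>f a x\<bar> \<le> (M::real)"
  shows "\<exists>M\<ge>0. \<forall>a\<in>A. \<forall>x\<in>S. \<bar>f a x\<bar> \<le> M"
  using assms
proof (induction A rule: finite_induct)
  case empty
  show ?case by (intro exI[of _ 0]) simp
next
  case (insert a A)
  then obtain M1 where M1: "0 \<le> M1" "\<forall>a\<in>A. \<forall>x\<in>S. \<bar>f a x\<bar> \<le> M1" by auto
  obtain M2 where M2: "\<forall>x\<in>S. \<bar>f a x\<bar> \<le> M2" using insert.prems[of a] by auto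
  show ?case
    using M1 M2 by (intro exI[of _ "max M1 M2"]) (auto intro: max.coboundedI1 max.coboundedI2)
qed

lemma finite_Basis_lists: "finite {bs. set bs \<subseteq> (Basis::'a::euclidean_space set) \<and> length bs \<le> k}"
  by (rule finite_lists_length_le) simp

lemma compact_continuous_bound:
  fixes f :: "'a::topological_space \<Rightarrow> real"
  assumes "compact K" "continuous_on K f"
  shows "\<exists>M. \<forall>x\<in>K. \<bar>f x\<bar> \<le> M"
  using compact_imp_bounded[OF compact_continuous_image[OF assms(2,1)]]
  unfolding bounded_iff by auto

lemma grad_bounds_on_ball:
  fixes h :: "'a::euclidean_space \<Rightarrow> real"
  assumes C: "Ck_on 2 h UNIV"
  shows "\<exists>\<Lambda>. \<forall>y\<in>ball p r. norm (grad h y) \<le> \<Lambda> \<and> (\<forall>z\<in>ball p r. norm (grad h y - grad h z) \<le> \<Lambda> * norm (y - z))"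
proof -
  have "\<exists>M\<ge>0. \<forall>bs\<in>{bs. set bs \<subseteq> (Basis::'a set) \<and> length bs \<le> 2}. \<forall>x\<in>cball p r. \<bar>iter_partial bs h x\<bar> \<le> M"
    by (intro finite_family_uniform_bound finite_Basis_lists compact_continuous_bound
        continuous_on_subset[OF Ck_on_continuous[OF C]]) auto
  then obtain M where M: "0 \<le> M" "\<And>bs x. set bs \<subseteq> (Basis::'a set) \<Longrightarrow> length bs \<le> 2 \<Longrightarrow> x \<in> cball p r \<Longrightarrow> \<bar>iter_partial bs h x\<bar> \<le> M"
    by blast
  define n where "n = real DIM('a)"
  have n: "0 \<le> n" by (simp add: n_def)
  have 1: "norm (grad h y) \<le> n * M" if "y \<in> ball p r" for y
  proof -
    have "norm (grad h y) \<le> (\<Sum>b\<in>Basis. \<bar>grad h y \<bullet> b\<bar>)" by (rule norm_le_l1)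
    also have "\<dots> \<le> (\<Sum>b\<in>(Basis::'a set). M)"
      using that by (intro sum_mono) (simp add: grad_inner_Basis M(2) del: iter_partial.simps)
    finally show ?thesis by (simp add: n_def)
  qed
  have 2: "norm (grad h y - grad h z) \<le> n * (n * M) * norm (y - z)" if y: "y \<in> ball p r" and z: "z \<in> ball p r" for y z
  proof -
    have c: "\<bar>iter_partial [b] h y - iter_partial [b] h z\<bar> \<le> n * M * norm (y - z)" if b: "b \<in> Basis" for b
    proof -
      have "norm (iter_partial [b] h y - iter_partial [b] h z) \<le> n * M * norm (y - z)"
      proof (rule differentiable_bound[where S="ball p r" and f'="\<lambda>x k. \<Sum>c\<in>Basis. (k \<bullet> c) * iter_partial [c, b] h x"])
        fix x assume x: "x \<in> ball p r"
        show "(iter_partial [b] h has_derivative (\<lambda>k. \<Sum>c\<in>Basis. (k \<bullet> c) * iter_partial [c, b] h x)) (at x within ball p r)"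
          by (rule has_derivative_at_withinI, rule iter_partial_has_derivative, rule Ck_on_differentiable[OF C]) (use b in auto)
        have "\<bar>iter_partial [c, b] h x\<bar> \<le> M" if "c \<in> Basis" for c
          using that b x by (intro M(2)) auto
        then show "onorm (\<lambda>k. \<Sum>c\<in>Basis. (k \<bullet> c) * iter_partial [c, b] h x) \<le> n * M"
          using abs_sum_Basis_le[of "\<lambda>c. iter_partial [c, b] h x" M]
          by (intro onorm_le) (simp add: n_def del: iter_partial.simps)
      qed (use y z in auto)
      then show ?thesis by simp
    qed
    have "norm (grad h y - grad h z) \<le> (\<Sum>b\<in>Basis. \<bar>(grad h y - grad h z) \<bullet> b\<bar>)" by (rule norm_le_l1)
    also have "\<dots> \<le> (\<Sum>b\<in>(Basis::'a set). n * M * norm (y - z))"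
      by (intro sum_mono) (simp add: inner_diff_left grad_inner_Basis c del: iter_partial.simps)
    finally show ?thesis by (simp add: n_def)
  qed
  show ?thesis
  proof (intro exI ballI conjI)
    fix y z assume yz: "y \<in> ball p r" "z \<in> ball p r"
    have "0 \<le> n * (n * M)" using n M(1) by simp
    then show "norm (grad h y) \<le> n * M + n * (n * M)" using 1[OF yz(1)] by linarith
    have "n * (n * M) \<le> n * M + n * (n * M)" using n M(1) by simp
    then show "norm (grad h y - grad h z) \<le> (n * M + n * (n * M)) * norm (y - z)"
      using 2[OF yz] by (meson mult_right_mono norm_ge_zero order_trans)
  qed
qed

text \<open>Finitely many balls of half the chart radius cover the compact frontier. A point of such
  a half ball has its ball of radius \<open>lam\<close> inside the full chart ball, so the chart of
  the centre serves it, with constants taken over the finite family.\<close>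

lemma uniform_charts:
  fixes \<Omega> :: "'a::euclidean_space set"
  assumes openO: "open \<Omega>" and "bounded \<Omega>" and sm: "smooth_boundary \<Omega>"
  shows "\<exists>lam \<Lambda>. 0 < lam \<and> 1 \<le> \<Lambda> \<and> (\<forall>p\<in>frontier \<Omega>. \<exists>\<nu> h. boundary_chart \<Omega> p lam \<Lambda> \<nu> h)"
proof -
  define Q where "Q = (\<lambda>p r \<Lambda>. \<exists>\<nu> h. norm \<nu> = 1 \<and> constant_along \<nu> h \<and> Ck_on 1 h UNIV \<and>
     \<Omega> \<inter> ball p r = {x \<in> ball p r. h x < x \<bullet> \<nu>} \<and>
     (\<forall>y\<in>ball p r. norm (grad h y) \<le> \<Lambda> \<and> (\<forall>z\<in>ball p r. norm (grad h y - grad h z) \<le> \<Lambda> * norm (y - z))))"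
  have "\<exists>r \<Lambda>. 0 < r \<and> Q p r \<Lambda>" if p: "p \<in> frontier \<Omega>" for p
  proof -
    obtain \<nu> h r where h: "norm \<nu> = 1" "0 < r" "constant_along \<nu> h" "\<forall>k. Ck_on k h UNIV"
      "\<Omega> \<inter> ball p r = {x \<in> ball p r. h x < x \<bullet> \<nu>}"
      using sm p unfolding smooth_boundary_def by blast
    obtain \<Lambda> where "\<forall>y\<in>ball p r. norm (grad h y) \<le> \<Lambda> \<and> (\<forall>z\<in>ball p r. norm (grad h y - grad h z) \<le> \<Lambda> * norm (y - z))"
      using grad_bounds_on_ball[of h p r] h(4) by blast
    then show ?thesis unfolding Q_def using h by blast
  qed
  then obtain r \<Lambda> where r: "\<And>p. p \<in> frontier \<Omega> \<Longrightarrow> 0 < r p" and Q: "\<And>p. p \<in> frontier \<Omega> \<Longrightarrow> Q p (r p) (\<Lambda> p)"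
    by metis
  have cF: "compact (frontier \<Omega>)" using assms(2) by (simp add: compact_frontier_bounded)
  have cov: "frontier \<Omega> \<subseteq> (\<Union>p\<in>frontier \<Omega>. ball p (r p / 2))"
  proof
    fix p assume "p \<in> frontier \<Omega>" then show "p \<in> (\<Union>p\<in>frontier \<Omega>. ball p (r p / 2))"
      using r[of p] by (intro UN_I[of p]) auto
  qed
  obtain D where D: "D \<subseteq> frontier \<Omega>" "finite D" "frontier \<Omega> \<subseteq> (\<Union>p\<in>D. ball p (r p / 2))"
    by (rule compactE_image[OF cF _ cov]) simp_all
  define lam where "lam = Min (insert 1 ((\<lambda>p. r p / 2) ` D))"
  define L where "L = Max (insert 1 (\<Lambda> ` D))"
  have lam0: "0 < lam" unfolding lam_def using D r by (subst Min_gr_iff) auto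
  have lamr: "lam \<le> r p / 2" if "p \<in> D" for p unfolding lam_def using that D by (intro Min_le) auto
  have L1: "1 \<le> L" unfolding L_def using D by (intro Max_ge) auto
  have LL: "\<Lambda> p \<le> L" if "p \<in> D" for p unfolding L_def using that D by (intro Max_ge) auto
  have "\<exists>\<nu> h. boundary_chart \<Omega> p lam L \<nu> h" if p: "p \<in> frontier \<Omega>" for p
  proof -
    obtain c where c: "c \<in> D" "p \<in> ball c (r c / 2)" using D(3) p by blast
    have cf: "c \<in> frontier \<Omega>" using c D by blast
    obtain \<nu> h where h: "norm \<nu> = 1" "constant_along \<nu> h" "Ck_on 1 h UNIV"
      "\<Omega> \<inter> ball c (r c) = {x \<in> ball c (r c). h x < x \<bullet> \<nu>}"
      "\<And>y. y \<in> ball c (r c) \<Longrightarrow> norm (grad h y) \<le> \<Lambda> c"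
      "\<And>y z. y \<in> ball c (r c) \<Longrightarrow> z \<in> ball c (r c) \<Longrightarrow> norm (grad h y - grad h z) \<le> \<Lambda> c * norm (y - z)"
      using Q[OF cf] unfolding Q_def by blast
    have sub: "ball p lam \<subseteq> ball c (r c)"
    proof
      fix y assume "y \<in> ball p lam"
      then show "y \<in> ball c (r c)" using c lamr[OF c(1)] dist_triangle[of c y p] by auto
    qed
    have ch: "\<Omega> \<inter> ball p lam = {x \<in> ball p lam. h x < x \<bullet> \<nu>}"
    proof -
      have "\<Omega> \<inter> ball p lam = (\<Omega> \<inter> ball c (r c)) \<inter> ball p lam" using sub by auto
      also have "\<dots> = {x \<in> ball p lam. h x < x \<bullet> \<nu>}" unfolding h(4) using sub by auto
      finally show ?thesis .
    qed
    have "boundary_chart \<Omega> p lam L \<nu> h"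
    proof
      fix y z assume y: "y \<in> ball p lam"
      show "norm (grad h y) \<le> L" using order_trans[OF h(5) LL[OF c(1)]] sub y by blast
      assume z: "z \<in> ball p lam"
      have "norm (grad h y - grad h z) \<le> \<Lambda> c * norm (y - z)" by (rule h(6)) (use sub y z in blast)+
      also have "\<dots> \<le> L * norm (y - z)" using LL[OF c(1)] by (intro mult_right_mono) auto
      finally show "norm (grad h y - grad h z) \<le> L * norm (y - z)" .
    qed (rule h(1) h(2) h(3) lam0 L1 openO p ch)+
    then show ?thesis by blast
  qed
  then show ?thesis using lam0 L1 by blast
qed

text \<open>The functions to which the divergence theorem will be applied. The derivative is a
  separate argument and exists almost everywhere only, since a jump of \<open>R\<close> at 1 gives
  the kernel of \<open>Rbar R\<close> a kink along a sphere.\<close>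

definition admissible :: "'a::euclidean_space \<Rightarrow> real \<Rightarrow> ('a \<Rightarrow> real) \<Rightarrow> ('a \<Rightarrow> 'a \<Rightarrow> real) \<Rightarrow> bool" where
  "admissible x r F F' \<longleftrightarrow> F \<in> borel_measurable borel \<and> (\<forall>y. r < norm (y - x) \<longrightarrow> F y = 0) \<and>
     (\<exists>M. \<forall>y. \<bar>F y\<bar> \<le> M) \<and>
     (\<exists>L\<ge>0. \<forall>y z. norm (y - z) \<le> 1 \<longrightarrow> \<bar>F y - F z\<bar> \<le> L * norm (y - z)) \<and>
     (AE y in lborel. (F has_derivative F' y) (at y)) \<and>
     (\<forall>e. (\<lambda>y. F' y e) \<in> borel_measurable borel)"

lemma admissible_derivative_zero:
  assumes "admissible x r F F'"
  shows "AE y in lborel. r < norm (y - x) \<longrightarrow> F' y e = 0"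
proof -
  have "AE y in lborel. (F has_derivative F' y) (at y)" using assms by (simp add: admissible_def)
  then show ?thesis
  proof eventually_elim
    case (elim y)
    show ?case
    proof
      assume y: "r < norm (y - x)"
      then have yo: "y \<in> - cball x r" by (simp add: dist_norm norm_minus_commute)
      have "(F has_derivative (\<lambda>k. 0)) (at y)"
      proof (rule has_derivative_transform_within_open[of "\<lambda>y. 0" _ _ _ "- cball x r"])
        show "0 = F z" if "z \<in> - cball x r" for z
          using that assms unfolding admissible_def by (simp add: dist_norm norm_minus_commute)
      qed (use yo in auto)
      then have "F' y = (\<lambda>k. 0)" using elim has_derivative_unique by blast
      then show "F' y e = 0" by simp
    qed
  qed
qed

text \<open>This is \<open>green_subgraph\<close> for a half-space containing the support: its
  bounding hyperplane is at distance \<open>r + 1\<close> from \<open>x\<close>, where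
  \<open>F\<close> vanishes.\<close>

lemma integral_derivative_zero:
  fixes x :: "'a::euclidean_space"
  assumes a: "admissible x r F F'" and r: "0 \<le> r"
  shows "(\<integral>y. F' y e \<partial>lborel) = 0"
proof -
  obtain \<nu> :: 'a where \<nu>: "\<nu> \<in> Basis" using nonempty_Basis by blast
  have n1: "norm \<nu> = 1" using \<nu> by simp
  define c where "c = x \<bullet> \<nu> - r - 1"
  obtain M L where bnds: "\<And>y. \<bar>F y\<bar> \<le> M" "0 \<le> L" "\<And>y z. norm (y - z) \<le> 1 \<Longrightarrow> \<bar>F y - F z\<bar> \<le> L * norm (y - z)"
    using a unfolding admissible_def by blast
  have zero: "F y = 0" if "r < norm (y - x)" for y using a that by (simp add: admissible_def)
  have meas: "(\<lambda>y. F' y e) \<in> borel_measurable borel" using a by (simp add: admissible_def)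
  have vanish: "F (y - (y \<bullet> \<nu> - c) *\<^sub>R \<nu>) = 0" for y
  proof (rule zero)
    have "\<bar>(y - (y \<bullet> \<nu> - c) *\<^sub>R \<nu> - x) \<bullet> \<nu>\<bar> \<le> norm (y - (y \<bullet> \<nu> - c) *\<^sub>R \<nu> - x)"
      using Cauchy_Schwarz_ineq2[of "y - (y \<bullet> \<nu> - c) *\<^sub>R \<nu> - x" \<nu>] n1 by simp
    moreover have "(y - (y \<bullet> \<nu> - c) *\<^sub>R \<nu> - x) \<bullet> \<nu> = - r - 1"
      using n1 by (simp add: inner_diff_left c_def dot_square_norm)
    ultimately show "r < norm (y - (y \<bullet> \<nu> - c) *\<^sub>R \<nu> - x)" using r by simp
  qed
  have "(\<integral>y. F' y e \<partial>lborel) = (\<integral>y. indicator {y. 0 < y \<bullet> \<nu> - c} y * F' y e \<partial>lborel)"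
  proof (rule integral_cong_AE)
    show "(\<lambda>y. F' y e) \<in> borel_measurable lborel" using meas by simp
    have "{y. 0 < y \<bullet> \<nu> - c} \<in> sets borel" by measurable
    then show "(\<lambda>y. indicator {y. 0 < y \<bullet> \<nu> - c} y * F' y e) \<in> borel_measurable lborel"
      using meas by (intro borel_measurable_times borel_measurable_indicator) auto
    show "AE y in lborel. F' y e = indicator {y. 0 < y \<bullet> \<nu> - c} y * F' y e"
      using admissible_derivative_zero[OF a, of e]
    proof eventually_elim
      case (elim y)
      show ?case
      proof (cases "r < norm (y - x)")
        case False
        then have "\<bar>(y - x) \<bullet> \<nu>\<bar> \<le> r" using Cauchy_Schwarz_ineq2[of "y - x" \<nu>] n1 by simp
        then have "0 < y \<bullet> \<nu> - c" by (simp add: c_def inner_diff_left)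
        then show ?thesis by simp
      qed (use elim in simp)
    qed
  qed
  also have "\<dots> = - (\<integral>y. indicator (slab \<nu>) y * (F (y - (y \<bullet> \<nu> - c) *\<^sub>R \<nu>) * (e \<bullet> \<nu> - 0 \<bullet> e)) \<partial>lborel)"
    using a bnds zero r meas n1
    by (intro green_subgraph[where h="\<lambda>_. c" and dh="\<lambda>_. 0" and r=r and x\<^sub>0=x and M=M and L=L])
      (auto simp: constant_along_def admissible_def)
  also have "\<dots> = 0" by (simp add: vanish)
  finally show ?thesis .
qed

section \<open>Global consequences of uniform charts\<close>

locale smooth_domain = surface_measure +
  fixes lam \<Lambda> :: real
  assumes openO: "open \<Omega>" and bdd: "bounded \<Omega>" and lam: "0 < lam" and \<Lambda>1: "1 \<le> \<Lambda>"
    and charts: "\<And>p. p \<in> frontier \<Omega> \<Longrightarrow> \<exists>\<nu> h. boundary_chart \<Omega> p lam \<Lambda> \<nu> h"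
begin

lemma frontier_compact: "compact (frontier \<Omega>)" using bdd by (simp add: compact_frontier_bounded)

lemma surface_chart_exists:
  assumes "p \<in> frontier \<Omega>"
  obtains \<nu> h where "surface_chart \<Omega> p lam \<Lambda> \<nu> h \<sigma>"
  using charts[OF assms] surface_measure_axioms by (metis surface_chart.intro)

lemma borel_measurable_\<sigma>: "f \<in> borel_measurable borel \<Longrightarrow> f \<in> borel_measurable \<sigma>"
  using measurable_restrict_space1[of f borel borel "frontier \<Omega>"] measurable_cong_sets[OF sets_\<sigma> refl] by blast

lemma ball_subset_or_frontier:
  assumes "x \<in> \<Omega>" "0 < r"
  shows "ball x r \<subseteq> \<Omega> \<or> (\<exists>p\<in>frontier \<Omega>. dist p x < r)"
proof (rule disjCI)
  assume no: "\<not> (\<exists>p\<in>frontier \<Omega>. dist p x < r)"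
  show "ball x r \<subseteq> \<Omega>"
  proof (rule ccontr)
    assume "\<not> ball x r \<subseteq> \<Omega>"
    moreover have "x \<in> ball x r \<inter> \<Omega>" using assms by simp
    ultimately have "ball x r \<inter> frontier \<Omega> \<noteq> {}"
      by (intro connected_Int_frontier) blast+
    then show False using no by (auto simp: dist_commute)
  qed
qed

lemma ball_infdist_subset:
  assumes x: "x \<in> \<Omega>" and r: "0 < r" "r \<le> infdist x (frontier \<Omega>)"
  shows "ball x r \<subseteq> \<Omega>"
proof -
  have "\<not> dist p x < r" if "p \<in> frontier \<Omega>" for p
    using infdist_le[OF that, of x] r by (simp add: dist_commute)
  then show ?thesis using ball_subset_or_frontier[OF x r(1)] by blast
qed

lemma frontier_nonempty: "x \<in> \<Omega> \<Longrightarrow> frontier \<Omega> \<noteq> {}"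
  using bdd frontier_eq_empty[of \<Omega>] not_bounded_UNIV by auto

text \<open>If the ball around \<open>x\<close> leaves \<open>\<Omega>\<close>, some boundary point
  is closer than \<open>r\<close> and its chart supplies the path;
  \<open>(4 + \<Lambda>) * r \<le> lam\<close> leaves room for radius
  \<open>(3 + \<Lambda>) * r\<close> around \<open>x\<close>.\<close>

lemma quasiconvex: "quasiconvex \<Omega> (3 + \<Lambda>) (lam / (4 + \<Lambda>))"
  unfolding quasiconvex_def
proof (intro ballI allI impI)
  fix x y r assume x: "x \<in> \<Omega>" and y: "y \<in> \<Omega>" and "norm (y - x) < r \<and> r \<le> lam / (4 + \<Lambda>)"
  then have r: "norm (y - x) < r" "r \<le> lam / (4 + \<Lambda>)" by auto
  have r0: "0 < r" using r(1) norm_ge_zero[of "y - x"] by linarith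
  show "\<exists>a b. closed_segment x a \<union> closed_segment a b \<union> closed_segment b y \<subseteq> \<Omega> \<inter> ball x ((3 + \<Lambda>) * r)"
  proof (cases "ball x r \<subseteq> \<Omega>")
    case True
    have "1 * r \<le> (3 + \<Lambda>) * r" using r0 \<Lambda>1 by (intro mult_right_mono) auto
    then have "ball x r \<subseteq> ball x ((3 + \<Lambda>) * r)" by (simp add: subset_ball)
    moreover have "closed_segment x y \<subseteq> ball x r"
      using r r0 by (intro closed_segment_subset) (auto simp: dist_norm norm_minus_commute)
    ultimately show ?thesis using True x r0 by (intro exI[of _ x]) (auto simp: subset_iff)
  next
    case False
    then obtain p where p: "p \<in> frontier \<Omega>" "dist p x < r" using ball_subset_or_frontier[OF x r0] by blast
    obtain \<nu> h where ch: "boundary_chart \<Omega> p lam \<Lambda> \<nu> h" using charts[OF p(1)] by blast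
    have "(4 + \<Lambda>) * r \<le> lam" using r(2) \<Lambda>1 by (simp add: le_divide_eq mult.commute)
    moreover have "(4 + \<Lambda>) * r = r + (3 + \<Lambda>) * r" by (simp add: algebra_simps)
    ultimately have "dist p x + (3 + \<Lambda>) * r < lam" using p(2) by linarith
    from boundary_chart.vertical_path[OF ch x y r(1) this] show ?thesis by blast
  qed
qed

lemma corkscrew:
  assumes x: "x \<in> \<Omega>" and r: "0 < r" "2 * r \<le> lam"
  shows "\<exists>z. ball z (r / (4 * (1 + \<Lambda>))) \<subseteq> \<Omega> \<inter> ball x r"
proof (cases "ball x r \<subseteq> \<Omega>")
  case True
  have "r / (4 * (1 + \<Lambda>)) \<le> r / 1" using r \<Lambda>1 by (intro divide_left_mono) auto
  then have "ball x (r / (4 * (1 + \<Lambda>))) \<subseteq> ball x r" by (simp add: subset_ball)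
  then show ?thesis using True by blast
next
  case False
  then obtain p where p: "p \<in> frontier \<Omega>" "dist p x < r" using ball_subset_or_frontier[OF x r(1)] by blast
  obtain \<nu> h where ch: "boundary_chart \<Omega> p lam \<Lambda> \<nu> h" using charts[OF p(1)] by blast
  have "dist p x + r < lam" using p(2) r by linarith
  from boundary_chart.corkscrew[OF ch x r(1) this] show ?thesis by blast
qed

lemma finite_\<sigma>: "finite_measure \<sigma>"
proof
  have "frontier \<Omega> \<subseteq> (\<Union>p\<in>frontier \<Omega>. ball p lam)" using lam by auto
  then obtain D where D: "D \<subseteq> frontier \<Omega>" "finite D" "frontier \<Omega> \<subseteq> (\<Union>p\<in>D. ball p lam)"
    using compactE_image[OF frontier_compact, of "frontier \<Omega>" "\<lambda>p. ball p lam"] by auto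
  have m: "frontier \<Omega> \<inter> ball p lam \<in> sets \<sigma>" for p using borel_in_\<sigma>[of "ball p lam"] by (simp add: Int_commute)
  have "emeasure \<sigma> (space \<sigma>) \<le> emeasure \<sigma> (\<Union>p\<in>D. frontier \<Omega> \<inter> ball p lam)"
    unfolding space_\<sigma> using D m by (intro emeasure_mono sets.finite_UN) auto
  also have "\<dots> \<le> (\<Sum>p\<in>D. emeasure \<sigma> (frontier \<Omega> \<inter> ball p lam))"
    using D m by (intro emeasure_subadditive_finite) auto
  also have "\<dots> < \<infinity>"
    unfolding infinity_ennreal_def
  proof (subst ennreal_sum_less_top)
    show "\<forall>p\<in>D. emeasure \<sigma> (frontier \<Omega> \<inter> ball p lam) < top"
    proof
      fix p assume "p \<in> D"
      then obtain \<nu> h where "surface_chart \<Omega> p lam \<Lambda> \<nu> h \<sigma>" using D surface_chart_exists by blast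
      then show "emeasure \<sigma> (frontier \<Omega> \<inter> ball p lam) < top"
        using surface_chart.\<sigma>_finite by fastforce
    qed
  qed (use D in auto)
  finally show "emeasure \<sigma> (space \<sigma>) \<noteq> \<infinity>" by simp
qed

lemma \<sigma>_ball_lower:
  assumes e: "0 < e"
  shows "\<exists>c>0. \<forall>p\<in>frontier \<Omega>. c \<le> measure \<sigma> (frontier \<Omega> \<inter> ball p e)"
proof -
  interpret finite_measure \<sigma> by (rule finite_\<sigma>)
  define e' where "e' = min e lam"
  have e': "0 < e'" "e' \<le> lam" "e' \<le> e" using e lam by (auto simp: e'_def)
  define c where "c = measure lborel (ball (0::'a) (min (e' / (4 * (1 + \<Lambda>))) (1/2)))"
  have "0 < c" unfolding c_def using e' \<Lambda>1 by (subst content_ball_gt_0_iff) auto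
  moreover have "c \<le> measure \<sigma> (frontier \<Omega> \<inter> ball p e)" if p: "p \<in> frontier \<Omega>" for p
  proof -
    obtain \<nu> h where ch: "surface_chart \<Omega> p lam \<Lambda> \<nu> h \<sigma>" using p surface_chart_exists by blast
    have "ennreal c \<le> emeasure \<sigma> (frontier \<Omega> \<inter> ball p e')"
      unfolding c_def by (rule surface_chart.\<sigma>_lower[OF ch e'(1,2)])
    also have "\<dots> \<le> emeasure \<sigma> (frontier \<Omega> \<inter> ball p e)"
      using e' borel_in_\<sigma>[of "ball p e"] by (intro emeasure_mono) (auto simp: Int_commute)
    finally show ?thesis by (simp add: emeasure_eq_measure)
  qed
  ultimately show ?thesis by blast
qed

text \<open>What the moment computations use about the boundary near \<open>x\<close>: a divergence
  theorem with normal field \<open>N\<close>, a frozen unit vector \<open>N\<^sub>0\<close> close to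
  \<open>N\<close>, and nearly constant height of the nearby boundary along
  \<open>N\<^sub>0\<close>. The bound on \<open>N\<close> is an inequality so that
  \<open>N = 0\<close> fits points far from the frontier.\<close>

definition boundary_normal :: "'a \<Rightarrow> real \<Rightarrow> ('a \<Rightarrow> 'a) \<Rightarrow> 'a \<Rightarrow> bool" where
  "boundary_normal x \<delta> N N\<^sub>0 \<longleftrightarrow> N \<in> borel_measurable borel \<and> (\<forall>y. norm (N y) \<le> 1) \<and> norm N\<^sub>0 = 1 \<and>
     (\<forall>F F' e. admissible x (2 * \<delta>) F F' \<longrightarrow>
        (\<integral>y. indicator \<Omega> y * F' y e \<partial>lborel) = (\<integral>y. F y * (N y \<bullet> e) \<partial>\<sigma>)) \<and>
     (\<forall>y\<in>frontier \<Omega>. norm (y - x) < 2 * \<delta> \<longrightarrow> norm (N y - N\<^sub>0) \<le> 20 * \<Lambda> * \<delta> \<and>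
        \<bar>(y - x) \<bullet> N\<^sub>0 - infdist x (frontier \<Omega>)\<bar> \<le> 20 * \<Lambda> * \<delta>\<^sup>2)"

text \<open>Within \<open>3 * \<delta>\<close> of the frontier the chart of the nearest point works,
  since \<open>7 * \<delta> < lam\<close>. Farther inside, the support lies in
  \<open>\<Omega>\<close>: no boundary term arises, and the conditions on boundary points within
  \<open>2 * \<delta>\<close> are void.\<close>

lemma boundary_normal_exists:
  assumes x: "x \<in> \<Omega>" and \<delta>: "0 < \<delta>" "7 * \<delta> < lam" "10 * \<Lambda> * \<delta> \<le> 1"
  shows "\<exists>N N\<^sub>0. boundary_normal x \<delta> N N\<^sub>0"
proof (cases "infdist x (frontier \<Omega>) < 3 * \<delta>")
  case True
  obtain p where p: "p \<in> frontier \<Omega>" "infdist x (frontier \<Omega>) = dist x p"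
    using infdist_attains_inf[OF frontier_closed frontier_nonempty[OF x]] by metis
  obtain \<nu> h where "surface_chart \<Omega> p lam \<Lambda> \<nu> h \<sigma>" using p surface_chart_exists by blast
  then interpret ch: surface_chart \<Omega> p lam \<Lambda> \<nu> h \<sigma> .
  have near: "dist p x + 4 * \<delta> < lam" using p True \<delta> by (simp add: dist_commute)
  have "boundary_normal x \<delta> ch.nrm (ch.nrm x)"
    unfolding boundary_normal_def
  proof (intro conjI allI impI ballI)
    show "ch.nrm \<in> borel_measurable borel" by simp
    show "norm (ch.nrm y) \<le> 1" for y by (simp add: ch.norm_nrm)
    show "norm (ch.nrm x) = 1" by (simp add: ch.norm_nrm)
  next
    fix F F' e assume a: "admissible x (2 * \<delta>) F F'"
    obtain M L where bnds: "\<And>y. \<bar>F y\<bar> \<le> M" "0 \<le> L" "\<And>y z. norm (y - z) \<le> 1 \<Longrightarrow> \<bar>F y - F z\<bar> \<le> L * norm (y - z)"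
      using a unfolding admissible_def by blast
    show "(\<integral>y. indicator \<Omega> y * F' y e \<partial>lborel) = (\<integral>y. F y * (ch.nrm y \<bullet> e) \<partial>\<sigma>)"
      using a near \<delta> bnds by (intro ch.green_surface[where r="2 * \<delta>" and x=x and M=M and L=L]) (auto simp: admissible_def)
  next
    fix y assume y: "y \<in> frontier \<Omega>" "norm (y - x) < 2 * \<delta>"
    have xb: "x \<in> ball p lam" using near \<delta> by simp
    have yb: "y \<in> ball p lam" using near \<delta> y(2) dist_triangle[of p y x] by (auto simp: dist_norm norm_minus_commute)
    have "norm (ch.nrm y - ch.nrm x) \<le> 2 * \<Lambda> * norm (y - x)" by (rule ch.nrm_lip[OF yb xb])
    also have "\<dots> \<le> 2 * \<Lambda> * (2 * \<delta>)" using y(2) \<Lambda>1 by (intro mult_left_mono) auto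
    also have "\<dots> \<le> 20 * \<Lambda> * \<delta>" using \<Lambda>1 \<delta> by simp
    finally show "norm (ch.nrm y - ch.nrm x) \<le> 20 * \<Lambda> * \<delta>" .
    have "infdist x (frontier \<Omega>) < 2 * \<delta>"
      using infdist_le[OF y(1), of x] y(2) by (simp add: dist_norm norm_minus_commute)
    then show "\<bar>(y - x) \<bullet> ch.nrm x - infdist x (frontier \<Omega>)\<bar> \<le> 20 * \<Lambda> * \<delta>\<^sup>2"
      by (rule ch.normal_component[OF x near \<delta>(1,3) _ y])
  qed
  then show ?thesis by blast
next
  case False
  obtain b :: 'a where b: "b \<in> Basis" using nonempty_Basis by blast
  have sub: "ball x (3 * \<delta>) \<subseteq> \<Omega>" using False \<delta> by (intro ball_infdist_subset[OF x]) auto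
  have "boundary_normal x \<delta> (\<lambda>_. 0) b"
    unfolding boundary_normal_def
  proof (intro conjI allI impI ballI)
    fix F F' e assume a: "admissible x (2 * \<delta>) F F'"
    have meas: "(\<lambda>y. F' y e) \<in> borel_measurable borel" using a by (simp add: admissible_def)
    have "(\<integral>y. indicator \<Omega> y * F' y e \<partial>lborel) = (\<integral>y. F' y e \<partial>lborel)"
    proof (rule integral_cong_AE)
      show "(\<lambda>y. indicator \<Omega> y * F' y e) \<in> borel_measurable lborel"
        using meas openO by (intro borel_measurable_times borel_measurable_indicator) auto
      show "AE y in lborel. indicator \<Omega> y * F' y e = F' y e"
        using admissible_derivative_zero[OF a, of e]
      proof eventually_elim
        case (elim y)
        show ?case
        proof (cases "y \<in> \<Omega>")
          case False
          then have "y \<notin> ball x (3 * \<delta>)" using sub by blast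
          then have "2 * \<delta> < norm (y - x)" using \<delta> by (simp add: dist_norm norm_minus_commute)
          then show ?thesis using elim by simp
        qed simp
      qed
    qed (use meas in simp)
    then show "(\<integral>y. indicator \<Omega> y * F' y e \<partial>lborel) = (\<integral>y. F y * (0 \<bullet> e) \<partial>\<sigma>)"
      using integral_derivative_zero[OF a, of e] \<delta> by simp
  next
    fix y assume y: "y \<in> frontier \<Omega>" "norm (y - x) < 2 * \<delta>"
    then have "infdist x (frontier \<Omega>) < 3 * \<delta>"
      using infdist_le[OF y(1), of x] \<delta> by (simp add: dist_norm norm_minus_commute)
    then show "norm (0 - b) \<le> 20 * \<Lambda> * \<delta>" "\<bar>(y - x) \<bullet> b - infdist x (frontier \<Omega>)\<bar> \<le> 20 * \<Lambda> * \<delta>\<^sup>2"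
      using False by auto
  qed (use b in auto)
  then show ?thesis by blast
qed

end

section \<open>Kernels\<close>

text \<open>Satisfied by \<open>R\<close> and again by \<open>Rbar R\<close>, so that the lemmas
  below also cover the twice integrated profile.\<close>

definition bounded_profile :: "real \<Rightarrow> (real \<Rightarrow> real) \<Rightarrow> bool" where
  "bounded_profile M K \<longleftrightarrow> K \<in> borel_measurable borel \<and> (\<forall>s. \<bar>K s\<bar> \<le> M) \<and> (\<forall>s>1. K s = 0)"

context
  fixes M :: real and K :: "real \<Rightarrow> real"
  assumes bp: "bounded_profile M K"
begin

private lemma Kmeas: "K \<in> borel_measurable borel" using bp by (simp add: bounded_profile_def)
private lemma Kb: "\<bar>K s\<bar> \<le> M" using bp by (simp add: bounded_profile_def)
private lemma K1: "1 < s \<Longrightarrow> K s = 0" using bp by (simp add: bounded_profile_def)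
private lemma M0: "0 \<le> M" using Kb[of 0] by linarith

lemma profile_integrable:
  assumes [measurable]: "A \<in> sets borel" and A: "A \<subseteq> {r..}"
  shows "integrable lborel (\<lambda>s. indicator A s * K s)"
proof (rule Bochner_Integration.integrable_bound[where f="\<lambda>s. indicator {r..1} s * M"])
  note [measurable] = Kmeas
  show "AE s in lborel. norm (indicator A s * K s) \<le> norm (indicator {r..1} s * M)"
    using Kb K1 M0 A by (intro AE_I2) (auto simp: indicator_def subset_iff not_le)
  show "integrable lborel (\<lambda>s. indicator {r..1} s * M)"
    by (cases "r \<le> 1") (auto simp: integrable_indicator_iff)
  show "(\<lambda>s. indicator A s * K s) \<in> borel_measurable lborel" by measurable
qed

lemma Rbar_eq: "Rbar K r = (\<integral>s. indicator {r..} s * K s \<partial>lborel)"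
  by (simp add: Rbar_def set_lebesgue_integral_def)

lemma Rbar_diff:
  assumes "a \<le> b"
  shows "Rbar K a - Rbar K b = (\<integral>s. indicator {a..<b} s * K s \<partial>lborel)"
proof -
  have "Rbar K a - Rbar K b = (\<integral>s. indicator {a..} s * K s - indicator {b..} s * K s \<partial>lborel)"
    unfolding Rbar_eq using profile_integrable[of "{a..}" a] profile_integrable[of "{b..}" b] by simp
  also have "\<dots> = (\<integral>s. indicator {a..<b} s * K s \<partial>lborel)"
    using assms by (intro Bochner_Integration.integral_cong) (auto simp: indicator_def)
  finally show ?thesis .
qed

text \<open>One estimate with several uses: \<open>c = 0\<close> gives the Lipschitz bound,
  \<open>c = K r\<close> the derivative, and the midpoint of the range of \<open>K\<close> a bound
  from below.\<close>

lemma Rbar_diff_approx: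
  assumes ab: "a \<le> b" and e: "\<And>s. a \<le> s \<Longrightarrow> s < b \<Longrightarrow> \<bar>K s - c\<bar> \<le> e"
  shows "\<bar>Rbar K a - Rbar K b - c * (b - a)\<bar> \<le> e * (b - a)"
proof -
  have i: "integrable lborel (\<lambda>s. indicator {a..<b} s * d)" for d :: real
    using ab by (auto simp: integrable_indicator_iff)
  have m: "(\<integral>s. indicator {a..<b} s * d \<partial>lborel) = d * (b - a)" for d :: real
    using ab by (simp add: measure_def)
  have k: "integrable lborel (\<lambda>s. indicator {a..<b} s * K s)" by (rule profile_integrable[of _ a]) auto
  have "(\<integral>s. indicator {a..<b} s * K s - indicator {a..<b} s * c \<partial>lborel) = Rbar K a - Rbar K b - c * (b - a)"
    using Bochner_Integration.integral_diff[OF k i[of c]] unfolding m Rbar_diff[OF ab] .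
  then have "Rbar K a - Rbar K b - c * (b - a) = (\<integral>s. indicator {a..<b} s * K s - indicator {a..<b} s * c \<partial>lborel)" ..
  also have "\<bar>\<dots>\<bar> \<le> (\<integral>s. \<bar>indicator {a..<b} s * K s - indicator {a..<b} s * c\<bar> \<partial>lborel)"
    by (rule integral_abs_bound)
  also have "\<dots> \<le> (\<integral>s. indicator {a..<b} s * e \<partial>lborel)"
    by (intro integral_mono integrable_abs Bochner_Integration.integrable_diff k i) (use e in \<open>auto simp: indicator_def\<close>)
  finally show ?thesis unfolding m .
qed

lemma Rbar_lipschitz: "\<bar>Rbar K a - Rbar K b\<bar> \<le> M * \<bar>a - b\<bar>"
proof (induction a b rule: linorder_wlog)
  case (le a b)
  show ?case using Rbar_diff_approx[OF le, of 0 M] Kb le by simp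
next
  case (sym a b)
  then show ?case by (simp add: abs_minus_commute)
qed

lemma Rbar_gt1: "1 < r \<Longrightarrow> Rbar K r = 0"
proof -
  assume "1 < r"
  then have "(\<lambda>s. indicator {r..} s * K s) = (\<lambda>s. 0)" using K1 by (auto simp: indicator_def)
  then show ?thesis unfolding Rbar_eq by simp
qed

text \<open>At \<open>r = 1\<close>, where \<open>K\<close> itself may be nonzero, the value is
  obtained as a limit from the right through the Lipschitz bound.\<close>

lemma Rbar_ge1: "1 \<le> r \<Longrightarrow> Rbar K r = 0"
proof -
  assume r: "1 \<le> r"
  have "\<bar>Rbar K r\<bar> \<le> 0 + e" if "0 < e" for e
  proof -
    define t where "t = e / (M + 1)"
    have t: "0 < t" "M * t \<le> e" using that M0 by (auto simp: t_def field_simps)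
    have "\<bar>Rbar K r - Rbar K (r + t)\<bar> \<le> M * \<bar>r - (r + t)\<bar>" by (rule Rbar_lipschitz)
    then show ?thesis using Rbar_gt1[of "r + t"] r t by simp
  qed
  then have "\<bar>Rbar K r\<bar> \<le> 0" by (rule field_le_epsilon)
  then show ?thesis by simp
qed

lemma Rbar_abs_le: "\<bar>Rbar K r\<bar> \<le> M * max (1 - r) 0"
  using Rbar_lipschitz[of r 1] Rbar_ge1[of 1] Rbar_ge1[of r] by (cases "r \<le> 1") auto

lemma Rbar_continuous: "continuous_on UNIV (Rbar K)"
proof -
  have "isCont (Rbar K) r" for r
  proof -
    have "((\<lambda>s. M * \<bar>s - r\<bar>) \<longlongrightarrow> M * \<bar>r - r\<bar>) (at r)" by (intro tendsto_intros)
    then have "((\<lambda>s. M * \<bar>s - r\<bar>) \<longlongrightarrow> 0) (at r)" by simp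
    moreover have "\<forall>\<^sub>F s in at r. norm (Rbar K s - Rbar K r) \<le> M * \<bar>s - r\<bar>"
      using Rbar_lipschitz by (simp add: always_eventually)
    ultimately have "((\<lambda>s. Rbar K s - Rbar K r) \<longlongrightarrow> 0) (at r)" by (rule Lim_null_comparison[rotated])
    then show ?thesis by (simp add: isCont_def LIM_zero_iff)
  qed
  then show ?thesis by (simp add: continuous_at_imp_continuous_on)
qed

lemma Rbar_has_derivative:
  assumes c: "isCont K r"
  shows "(Rbar K has_derivative (\<lambda>h. - K r * h)) (at r)"
  unfolding has_derivative_at_alt
proof (intro conjI allI impI)
  show "bounded_linear (\<lambda>h. - K r * h)" by (rule bounded_linear_mult_right)
  fix e :: real assume "0 < e"
  then obtain d where d: "d > 0" "\<And>s. dist s r < d \<Longrightarrow> dist (K s) (K r) < e"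
    using c unfolding continuous_at_eps_delta by metis
  show "\<exists>d>0. \<forall>y. norm (y - r) < d \<longrightarrow> norm (Rbar K y - Rbar K r - - K r * (y - r)) \<le> e * norm (y - r)"
  proof (intro exI[of _ d] conjI allI impI d(1))
    fix y assume y: "norm (y - r) < d"
    show "norm (Rbar K y - Rbar K r - - K r * (y - r)) \<le> e * norm (y - r)"
    proof (cases "y \<le> r")
      case True
      have "\<bar>Rbar K y - Rbar K r - K r * (r - y)\<bar> \<le> e * (r - y)"
      proof (rule Rbar_diff_approx[OF True])
        fix s assume "y \<le> s" "s < r"
        then show "\<bar>K s - K r\<bar> \<le> e" using d(2)[of s] y True by (simp add: dist_real_def)
      qed
      then show ?thesis using True by (simp add: algebra_simps)
    next
      case False
      have "\<bar>Rbar K r - Rbar K y - K r * (y - r)\<bar> \<le> e * (y - r)"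
      proof (rule Rbar_diff_approx)
        fix s assume "r \<le> s" "s < y"
        then show "\<bar>K s - K r\<bar> \<le> e" using d(2)[of s] y False by (simp add: dist_real_def)
      qed (use False in simp)
      then have "\<bar>- (Rbar K r - Rbar K y - K r * (y - r))\<bar> \<le> e * (y - r)" by simp
      then show ?thesis using False by (simp add: algebra_simps)
    qed
  qed
qed

lemma Rbar_antimono:
  assumes "\<And>s. a \<le> s \<Longrightarrow> 0 \<le> K s" "a \<le> b"
  shows "Rbar K b \<le> Rbar K a"
proof -
  have "0 \<le> (\<integral>s. indicator {a..<b} s * K s \<partial>lborel)"
    using assms by (intro Bochner_Integration.integral_nonneg) (auto simp: indicator_def)
  then show ?thesis using Rbar_diff[OF assms(2)] by simp
qed

end

text \<open>For \<open>r = 2 * \<delta>\<close> the exceptional points are those whose profile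
  argument is 0 or 1, where \<open>R\<close> may be discontinuous.\<close>

lemma AE_off_sphere: "AE y in (lborel :: 'a::euclidean_space measure). y \<noteq> x \<and> norm (y - x) \<noteq> r"
proof -
  have null: "S \<in> null_sets lborel" if "negligible S" "S \<in> sets borel" for S :: "'a set"
    using that by (simp add: negligible_iff_null_sets null_sets_completion_iff)
  have "{x} \<in> null_sets lborel" by (rule null) auto
  moreover have "sphere x r \<in> null_sets lborel" by (rule null) (auto simp: negligible_sphere)
  ultimately have "AE y in lborel. y \<notin> {x} \<union> sphere x r"
    by (intro AE_not_in null_sets.Un)
  then show ?thesis by eventually_elim (auto simp: dist_norm norm_minus_commute)
qed

lemma rescaled_argument_le_1: "0 < \<delta> \<Longrightarrow> norm (y - x) \<le> 2 * \<delta> \<longleftrightarrow> (norm (x - y))\<^sup>2 / (4 * \<delta>\<^sup>2) \<le> 1"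
  using power2_le_iff_abs_le[of "2 * \<delta>" "norm (y - x)"]
  by (simp add: divide_le_eq power_mult_distrib norm_minus_commute)

lemma rescaled_kernel_zero:
  assumes "bounded_profile M K" "0 < \<delta>" "2 * \<delta> < norm (y - x)"
  shows "rescaled_kernel \<alpha> K \<delta> x y = 0"
  using assms rescaled_argument_le_1[of \<delta> y x] by (simp add: rescaled_kernel_def bounded_profile_def not_le[symmetric])

lemma rescaled_kernel_measurable:
  assumes [measurable]: "K \<in> borel_measurable borel"
  shows "(\<lambda>y. rescaled_kernel \<alpha> K \<delta> x y) \<in> borel_measurable borel"
  unfolding rescaled_kernel_def by measurable

text \<open>The product rule: the profile argument has gradient
  \<open>(y - x) / (2 * \<delta>\<^sup>2)\<close> and \<open>Rbar K\<close> has derivative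
  \<open>- K\<close>, so differentiating the kernel of \<open>Rbar K\<close> brings back the kernel
  of \<open>K\<close> with a factor \<open>y - x\<close>.\<close>

definition kernel_weight_deriv :: "real \<Rightarrow> (real \<Rightarrow> real) \<Rightarrow> real \<Rightarrow> 'a \<Rightarrow> ('a::euclidean_space \<Rightarrow> real) \<Rightarrow> ('a \<Rightarrow> 'a \<Rightarrow> real) \<Rightarrow> 'a \<Rightarrow> 'a \<Rightarrow> real" where
  "kernel_weight_deriv \<alpha> K \<delta> x q q' y k =
     - (rescaled_kernel \<alpha> K \<delta> x y * ((y - x) \<bullet> k) / (2 * \<delta>\<^sup>2)) * q y + rescaled_kernel \<alpha> (Rbar K) \<delta> x y * q' y k"

text \<open>Two points at distance at most 1, one of them in the support, both lie within
  \<open>2 * \<delta> + 1\<close> of \<open>x\<close>; hence bounds on the weight \<open>q\<close>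
  are asked there only.\<close>

lemma admissible_kernel_times:
  fixes x :: "'a::euclidean_space"
  assumes bp: "bounded_profile M K" and cont: "\<And>s. s \<noteq> 0 \<Longrightarrow> s \<noteq> 1 \<Longrightarrow> isCont K s"
    and \<delta>: "0 < \<delta>" and \<alpha>: "0 < \<alpha>"
    and q: "\<And>y. (q has_derivative q' y) (at y)" and q'm: "\<And>e. (\<lambda>y. q' y e) \<in> borel_measurable borel"
    and Q0: "0 \<le> Q" and Qb: "\<And>y. norm (y - x) \<le> 2 * \<delta> + 1 \<Longrightarrow> \<bar>q y\<bar> \<le> Q"
    and Ql: "\<And>y z. norm (y - x) \<le> 2 * \<delta> + 1 \<Longrightarrow> norm (z - x) \<le> 2 * \<delta> + 1 \<Longrightarrow> \<bar>q y - q z\<bar> \<le> Q * norm (y - z)"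
  shows "admissible x (2 * \<delta>) (\<lambda>y. rescaled_kernel \<alpha> (Rbar K) \<delta> x y * q y) (kernel_weight_deriv \<alpha> K \<delta> x q q')"
proof -
  let ?k = "\<lambda>y. rescaled_kernel \<alpha> (Rbar K) \<delta> x y"
  define \<kappa> where "\<kappa> = \<alpha> / \<delta> ^ DIM('a)"
  have \<kappa>: "0 < \<kappa>" using \<alpha> \<delta> by (simp add: \<kappa>_def)
  have Km: "K \<in> borel_measurable borel" using bp by (simp add: bounded_profile_def)
  have M0: "0 \<le> M" using bp unfolding bounded_profile_def by (metis abs_ge_zero order_trans)
  have Rm: "Rbar K \<in> borel_measurable borel"
    by (intro borel_measurable_continuous_onI Rbar_continuous[OF bp])
  have qc: "continuous_on UNIV q" using q by (meson continuous_at_imp_continuous_on has_derivative_continuous)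
  have qm: "q \<in> borel_measurable borel" by (intro borel_measurable_continuous_onI qc)
  have k0: "?k y = 0" if "2 * \<delta> < norm (y - x)" for y
  proof -
    have "1 \<le> (norm (x - y))\<^sup>2 / (4 * \<delta>\<^sup>2)" using rescaled_argument_le_1[OF \<delta>, of y x] that by linarith
    then show ?thesis by (simp add: rescaled_kernel_def Rbar_ge1[OF bp])
  qed
  have kb: "\<bar>?k y\<bar> \<le> \<kappa> * M" for y
  proof -
    have "max (1 - (norm (x - y))\<^sup>2 / (4 * \<delta>\<^sup>2)) 0 \<le> 1" by simp
    then have "\<bar>Rbar K ((norm (x - y))\<^sup>2 / (4 * \<delta>\<^sup>2))\<bar> \<le> M"
      using Rbar_abs_le[OF bp] M0 by (meson mult_left_le order_trans)
    then show ?thesis using \<kappa> by (simp add: rescaled_kernel_def \<kappa>_def[symmetric] abs_mult)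
  qed
  define L where "L = \<kappa> * (M * (2 * (2 * \<delta> + 1) / (4 * \<delta>\<^sup>2)))"
  have L0: "0 \<le> L" unfolding L_def using \<kappa> M0 \<delta> by simp
  have kl: "\<bar>?k y - ?k z\<bar> \<le> L * norm (y - z)"
    if y: "norm (y - x) \<le> 2 * \<delta> + 1" and z: "norm (z - x) \<le> 2 * \<delta> + 1" for y z
  proof -
    have "(norm (x - y))\<^sup>2 - (norm (x - z))\<^sup>2 = (norm (x - y) + norm (x - z)) * (norm (x - y) - norm (x - z))"
      by (simp add: power2_eq_square algebra_simps)
    then have "\<bar>(norm (x - y))\<^sup>2 - (norm (x - z))\<^sup>2\<bar> = (norm (x - y) + norm (x - z)) * \<bar>norm (x - y) - norm (x - z)\<bar>"
      by (simp add: abs_mult)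
    also have "\<dots> \<le> (2 * (2 * \<delta> + 1)) * norm (y - z)"
    proof (rule mult_mono)
      show "\<bar>norm (x - y) - norm (x - z)\<bar> \<le> norm (y - z)"
        using norm_triangle_ineq3[of "x - y" "x - z"] by (simp add: norm_minus_commute)
    qed (use y z \<delta> in \<open>auto simp: norm_minus_commute\<close>)
    finally have sq: "\<bar>(norm (x - y))\<^sup>2 / (4 * \<delta>\<^sup>2) - (norm (x - z))\<^sup>2 / (4 * \<delta>\<^sup>2)\<bar> \<le> 2 * (2 * \<delta> + 1) / (4 * \<delta>\<^sup>2) * norm (y - z)"
      using \<delta> by (simp add: diff_divide_distrib[symmetric] abs_divide divide_right_mono)
    have "?k y - ?k z = \<kappa> * (Rbar K ((norm (x - y))\<^sup>2 / (4 * \<delta>\<^sup>2)) - Rbar K ((norm (x - z))\<^sup>2 / (4 * \<delta>\<^sup>2)))"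
      by (simp add: rescaled_kernel_def \<kappa>_def right_diff_distrib)
    then have "\<bar>?k y - ?k z\<bar> = \<kappa> * \<bar>Rbar K ((norm (x - y))\<^sup>2 / (4 * \<delta>\<^sup>2)) - Rbar K ((norm (x - z))\<^sup>2 / (4 * \<delta>\<^sup>2))\<bar>"
      using \<kappa> by (simp add: abs_mult)
    also have "\<dots> \<le> \<kappa> * (M * (2 * (2 * \<delta> + 1) / (4 * \<delta>\<^sup>2) * norm (y - z)))"
      using Rbar_lipschitz[OF bp] sq M0 \<kappa> by (meson mult_left_mono less_imp_le order_trans)
    finally show ?thesis by (simp add: L_def mult.assoc)
  qed
  show ?thesis
    unfolding admissible_def
  proof (intro conjI allI impI)
    show "(\<lambda>y. ?k y * q y) \<in> borel_measurable borel"
      by (intro borel_measurable_times rescaled_kernel_measurable Rm qm)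
    show "?k y * q y = 0" if "2 * \<delta> < norm (y - x)" for y using k0[OF that] by simp
    show "\<exists>B. \<forall>y. \<bar>?k y * q y\<bar> \<le> B"
    proof (intro exI allI)
      fix y show "\<bar>?k y * q y\<bar> \<le> \<kappa> * M * Q"
      proof (cases "2 * \<delta> < norm (y - x)")
        case True then show ?thesis using k0 \<kappa> M0 Q0 by simp
      next
        case False
        then show ?thesis unfolding abs_mult using kb Qb[of y] \<kappa> M0 Q0 by (intro mult_mono) auto
      qed
    qed
    show "\<exists>L\<ge>0. \<forall>y z. norm (y - z) \<le> 1 \<longrightarrow> \<bar>?k y * q y - ?k z * q z\<bar> \<le> L * norm (y - z)"
    proof (intro exI[of _ "\<kappa> * M * Q + L * Q"] conjI allI impI)
      show "0 \<le> \<kappa> * M * Q + L * Q" using \<kappa> M0 Q0 L0 by simp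
      fix y z :: 'a assume yz: "norm (y - z) \<le> 1"
      show "\<bar>?k y * q y - ?k z * q z\<bar> \<le> (\<kappa> * M * Q + L * Q) * norm (y - z)"
      proof (cases "2 * \<delta> < norm (y - x) \<and> 2 * \<delta> < norm (z - x)")
        case True
        then show ?thesis using k0 \<open>0 \<le> \<kappa> * M * Q + L * Q\<close> by simp
      next
        case False
        have "norm (y - x) \<le> norm (z - x) + 1" "norm (z - x) \<le> norm (y - x) + 1"
          using yz norm_triangle_ineq[of "y - z" "z - x"] norm_triangle_ineq[of "z - y" "y - x"]
          by (auto simp: norm_minus_commute)
        then have y: "norm (y - x) \<le> 2 * \<delta> + 1" and z: "norm (z - x) \<le> 2 * \<delta> + 1" using False by auto
        have "?k y * q y - ?k z * q z = ?k y * (q y - q z) + (?k y - ?k z) * q z" by (simp add: algebra_simps)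
        also have "\<bar>\<dots>\<bar> \<le> \<bar>?k y * (q y - q z)\<bar> + \<bar>(?k y - ?k z) * q z\<bar>" by (rule abs_triangle_ineq)
        also have "\<bar>?k y * (q y - q z)\<bar> \<le> (\<kappa> * M) * (Q * norm (y - z))"
          unfolding abs_mult using kb Ql[OF y z] \<kappa> M0 by (intro mult_mono) auto
        also have "\<bar>(?k y - ?k z) * q z\<bar> \<le> (L * norm (y - z)) * Q"
          unfolding abs_mult using kl[OF y z] Qb[OF z] L0 by (intro mult_mono) auto
        finally show ?thesis by (simp add: algebra_simps)
      qed
    qed
    show "(\<lambda>y. kernel_weight_deriv \<alpha> K \<delta> x q q' y e) \<in> borel_measurable borel" for e
      unfolding kernel_weight_deriv_def
      by (intro borel_measurable_add borel_measurable_times borel_measurable_uminus borel_measurable_divide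
          rescaled_kernel_measurable Rm Km qm q'm) auto
    show "AE y in lborel. ((\<lambda>y. ?k y * q y) has_derivative kernel_weight_deriv \<alpha> K \<delta> x q q' y) (at y)"
      using AE_off_sphere[of x "2 * \<delta>"]
    proof eventually_elim
      case (elim y)
      let ?s = "\<lambda>y. (norm (x - y))\<^sup>2 / (4 * \<delta>\<^sup>2)"
      have s0: "?s y \<noteq> 0" using elim \<delta> by auto
      have s1: "?s y \<noteq> 1"
      proof
        assume "?s y = 1"
        then have "(norm (y - x))\<^sup>2 = (2 * \<delta>)\<^sup>2" using \<delta> by (simp add: power_mult_distrib norm_minus_commute)
        then have "norm (y - x) = 2 * \<delta>" by (rule power2_eq_imp_eq) (use \<delta> in auto)
        then show False using elim by simp
      qed
      have ds: "(?s has_derivative (\<lambda>k. 2 * ((y - x) \<bullet> k) / (4 * \<delta>\<^sup>2))) (at y)"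
      proof -
        have "((\<lambda>y. ((x - y) \<bullet> (x - y)) / (4 * \<delta>\<^sup>2)) has_derivative (\<lambda>k. ((x - y) \<bullet> (- k) + (- k) \<bullet> (x - y)) / (4 * \<delta>\<^sup>2))) (at y)"
          by (rule has_derivative_divide_const, rule has_derivative_inner)
            (auto intro!: derivative_eq_intros)
        then show ?thesis by (simp add: power2_norm_eq_inner inner_diff_left inner_diff_right inner_commute algebra_simps)
      qed
      have "((\<lambda>y. Rbar K (?s y)) has_derivative (\<lambda>k. - K (?s y) * (2 * ((y - x) \<bullet> k) / (4 * \<delta>\<^sup>2)))) (at y)"
        by (rule has_derivative_compose[OF ds Rbar_has_derivative[OF bp cont[OF s0 s1]]])
      then have dk: "(?k has_derivative (\<lambda>k. \<kappa> * (- K (?s y) * (2 * ((y - x) \<bullet> k) / (4 * \<delta>\<^sup>2))))) (at y)"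
        unfolding rescaled_kernel_def \<kappa>_def[symmetric]
        by (rule bounded_linear.has_derivative[OF bounded_linear_mult_right])
      have "((\<lambda>y. ?k y * q y) has_derivative (\<lambda>k. ?k y * q' y k + (\<kappa> * (- K (?s y) * (2 * ((y - x) \<bullet> k) / (4 * \<delta>\<^sup>2)))) * q y)) (at y)"
        by (rule has_derivative_mult[OF dk q])
      moreover have "(\<lambda>k. ?k y * q' y k + (\<kappa> * (- K (?s y) * (2 * ((y - x) \<bullet> k) / (4 * \<delta>\<^sup>2)))) * q y) = kernel_weight_deriv \<alpha> K \<delta> x q q' y"
        using \<delta> by (intro ext) (simp add: kernel_weight_deriv_def rescaled_kernel_def \<kappa>_def[symmetric] field_simps)
      ultimately show ?case by simp
    qed
  qed
qed

section \<open>The profile and its iterated integrals\<close>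

locale profile =
  fixes R :: "real \<Rightarrow> real" and M \<gamma> :: real
  assumes R_out: "\<And>s. s < 0 \<or> 1 < s \<Longrightarrow> R s = 0" and R_nonneg: "\<And>s. 0 \<le> R s" and R_le: "\<And>s. R s \<le> M"
    and R_cont: "continuous_on {0..1} R" and \<gamma>: "0 < \<gamma>" and R_\<gamma>: "\<And>s. 0 \<le> s \<Longrightarrow> s \<le> 1/2 \<Longrightarrow> \<gamma> \<le> R s"
begin

abbreviation RR :: "real \<Rightarrow> real" where "RR \<equiv> Rbar R"
abbreviation R3 :: "real \<Rightarrow> real" where "R3 \<equiv> Rbar (Rbar R)"

lemma M0: "0 \<le> M" using R_nonneg[of 0] R_le[of 0] by linarith

lemma R_meas: "R \<in> borel_measurable borel"
proof -
  have "(\<lambda>s. indicator {0..1} s *\<^sub>R R s) \<in> borel_measurable borel"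
    by (rule borel_measurable_continuous_on_indicator) (auto simp: R_cont)
  moreover have "indicator {0..1} s *\<^sub>R R s = R s" for s
    by (cases "s < 0 \<or> 1 < s") (auto simp: R_out indicator_def)
  ultimately show ?thesis by (simp only:)
qed

lemma R_profile: "bounded_profile M R"
  unfolding bounded_profile_def using R_meas R_out R_nonneg R_le by auto

lemma RR_nonneg: "0 \<le> RR r"
  using Rbar_antimono[OF R_profile, of r "max r 1"] Rbar_ge1[OF R_profile, of "max r 1"] R_nonneg by simp

lemma RR_antimono: "a \<le> b \<Longrightarrow> RR b \<le> RR a"
  by (rule Rbar_antimono[OF R_profile R_nonneg])

lemma RR_le: "RR r \<le> M"
proof (cases "0 \<le> r")
  case True
  then show ?thesis using Rbar_abs_le[OF R_profile, of r] M0 mult_left_le[of "max (1 - r) 0" M] by simp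
next
  case False
  have "RR r - RR 0 = (\<integral>s. indicator {r..<0} s * R s \<partial>lborel)"
    using False by (intro Rbar_diff[OF R_profile]) simp
  also have "\<dots> = (\<integral>s. 0 \<partial>(lborel::real measure))"
    by (intro Bochner_Integration.integral_cong) (auto simp: indicator_def R_out)
  finally have "RR r = RR 0" by simp
  then show ?thesis using Rbar_abs_le[OF R_profile, of 0] by simp
qed

lemma RR_profile: "bounded_profile M RR"
  unfolding bounded_profile_def
  using Rbar_continuous[OF R_profile] Rbar_ge1[OF R_profile] RR_nonneg RR_le
  by (auto intro: borel_measurable_continuous_onI)

text \<open>The interval from \<open>r\<close> to 1/2 has length at least 1/4, and \<open>R\<close>
  is at least \<open>\<gamma>\<close> on it.\<close>

lemma RR_lower: "0 \<le> r \<Longrightarrow> r \<le> 1/4 \<Longrightarrow> \<gamma> / 4 \<le> RR r"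
proof -
  assume r: "0 \<le> r" "r \<le> 1/4"
  have b: "\<gamma> \<le> M" using R_\<gamma>[of 0] R_le[of 0] by simp
  \<comment> \<open>On this interval \<open>R\<close> lies between \<open>\<gamma>\<close> and
    \<open>M\<close>; taking the midpoint and the half-width turns the two-sided estimate into the
    lower bound \<open>\<gamma> * (1/2 - r)\<close>.\<close>
  have "\<bar>RR r - RR (1/2) - (\<gamma> + M) / 2 * (1/2 - r)\<bar> \<le> (M - \<gamma>) / 2 * (1/2 - r)"
  proof (rule Rbar_diff_approx[OF R_profile])
    fix s assume s: "r \<le> s" "s < 1/2"
    have "\<gamma> \<le> R s" "R s \<le> M" using R_\<gamma>[of s] R_le[of s] r s by auto
    then show "\<bar>R s - (\<gamma> + M) / 2\<bar> \<le> (M - \<gamma>) / 2" by (simp add: abs_le_iff field_simps)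
  qed (use r in simp)
  then have "(\<gamma> + M) / 2 * (1/2 - r) - (M - \<gamma>) / 2 * (1/2 - r) \<le> RR r - RR (1/2)" by linarith
  moreover have "(\<gamma> + M) / 2 * (1/2 - r) - (M - \<gamma>) / 2 * (1/2 - r) = \<gamma> * (1/2 - r)"
    by (simp add: field_simps)
  moreover have "\<gamma> * (1/4) \<le> \<gamma> * (1/2 - r)" using r \<gamma> by (intro mult_left_mono) auto
  ultimately show ?thesis using RR_nonneg[of "1/2"] by linarith
qed

lemma R3_nonneg: "0 \<le> R3 r"
  using Rbar_antimono[OF RR_profile, of r "max r 1"] Rbar_ge1[OF RR_profile, of "max r 1"] RR_nonneg by simp

text \<open>\<open>Rbar R\<close> is decreasing and vanishes from 1 on, so its integral from
  \<open>r\<close> is at most \<open>(1 - r) * RR r\<close>. This lets boundary integrals with the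
  kernel of \<open>R3\<close> be bounded by \<open>B\<close>.\<close>

lemma R3_le_RR: "0 \<le> r \<Longrightarrow> R3 r \<le> RR r"
proof (cases "r \<le> 1")
  case True
  assume r: "0 \<le> r"
  have "\<bar>R3 r - R3 1 - RR r / 2 * (1 - r)\<bar> \<le> RR r / 2 * (1 - r)"
  proof (rule Rbar_diff_approx[OF RR_profile True])
    fix s assume "r \<le> s" "s < 1"
    then show "\<bar>RR s - RR r / 2\<bar> \<le> RR r / 2" using RR_nonneg[of s] RR_antimono[of r s] unfolding abs_le_iff by linarith
  qed
  then have "R3 r - R3 1 \<le> RR r / 2 * (1 - r) + RR r / 2 * (1 - r)" by linarith
  then have "R3 r - R3 1 \<le> RR r * (1 - r)" by (simp add: field_simps)
  also have "\<dots> \<le> RR r * 1" using r RR_nonneg[of r] by (intro mult_left_mono) auto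
  finally show ?thesis using Rbar_ge1[OF RR_profile, of 1] by simp
next
  case False
  then show ?thesis using Rbar_ge1[OF RR_profile, of r] RR_nonneg[of r] by simp
qed

lemma R_isCont: "s \<noteq> 0 \<Longrightarrow> s \<noteq> 1 \<Longrightarrow> isCont R s"
proof -
  assume s: "s \<noteq> 0" "s \<noteq> 1"
  show ?thesis
  proof (cases "s \<in> {0<..<1}")
    case True
    have "continuous_on {0<..<1} R" by (rule continuous_on_subset[OF R_cont]) auto
    then show ?thesis using True by (auto simp: continuous_on_eq_continuous_at)
  next
    case False
    define A where "A = - {0..1::real}"
    have "open A" "s \<in> A" using False s by (auto simp: A_def)
    moreover have "continuous_on A R"
      by (rule continuous_on_eq[of _ "\<lambda>_. 0"]) (auto simp: A_def R_out)
    ultimately show ?thesis by (simp add: continuous_on_eq_continuous_at)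
  qed
qed

lemma RR_isCont: "isCont RR s"
  using Rbar_continuous[OF R_profile] by (simp add: continuous_on_eq_continuous_at)

end

section \<open>Kernel integrals over the domain and its boundary\<close>

locale nonlocal_setting = smooth_domain \<Omega> \<sigma> lam \<Lambda> + profile R M \<gamma>
  for \<Omega> :: "'a::euclidean_space set" and \<sigma> lam \<Lambda> R M \<gamma> +
  fixes \<alpha> :: real
  assumes \<alpha>: "0 < \<alpha>"
begin

abbreviation kR :: "real \<Rightarrow> 'a \<Rightarrow> 'a \<Rightarrow> real" where "kR \<equiv> rescaled_kernel \<alpha> R"
abbreviation kB :: "real \<Rightarrow> 'a \<Rightarrow> 'a \<Rightarrow> real" where "kB \<equiv> rescaled_kernel \<alpha> RR"
abbreviation k3 :: "real \<Rightarrow> 'a \<Rightarrow> 'a \<Rightarrow> real" where "k3 \<equiv> rescaled_kernel \<alpha> R3"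

definition B :: "real \<Rightarrow> 'a \<Rightarrow> real" where "B \<delta> x = (\<integral>y. kB \<delta> x y \<partial>\<sigma>)"

text \<open>Bounds the mass of \<open>kR\<close> and of \<open>kB\<close>: the largest kernel value
  times the volume of a ball of radius \<open>2 * \<delta>\<close>, in which the powers of
  \<open>\<delta>\<close> cancel.\<close>

definition A\<^sub>0 :: real where "A\<^sub>0 = \<alpha> * M * (2 ^ DIM('a) * unit_ball_vol (real DIM('a)))"

lemma A0_nonneg: "0 \<le> A\<^sub>0" unfolding A\<^sub>0_def using \<alpha> M0 by simp

lemma RR_meas: "RR \<in> borel_measurable borel" and R3_meas: "R3 \<in> borel_measurable borel"
  by (intro borel_measurable_continuous_onI Rbar_continuous[OF R_profile])
    (intro borel_measurable_continuous_onI Rbar_continuous[OF RR_profile])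

lemma kR_meas: "(\<lambda>y. kR \<delta> x y) \<in> borel_measurable borel"
  and kB_meas: "(\<lambda>y. kB \<delta> x y) \<in> borel_measurable borel"
  and k3_meas: "(\<lambda>y. k3 \<delta> x y) \<in> borel_measurable borel"
  by (intro rescaled_kernel_measurable R_meas RR_meas R3_meas)+

lemma factor_pos: "0 < \<delta> \<Longrightarrow> 0 < \<alpha> / \<delta> ^ DIM('a)" using \<alpha> by simp

lemma kR_nonneg: "0 < \<delta> \<Longrightarrow> 0 \<le> kR \<delta> x y"
  and kB_nonneg: "0 < \<delta> \<Longrightarrow> 0 \<le> kB \<delta> x y"
  and k3_nonneg: "0 < \<delta> \<Longrightarrow> 0 \<le> k3 \<delta> x y"
  unfolding rescaled_kernel_def
  by (intro mult_nonneg_nonneg less_imp_le[OF factor_pos] R_nonneg RR_nonneg R3_nonneg; assumption)+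

lemma k3_le_kB: "0 < \<delta> \<Longrightarrow> k3 \<delta> x y \<le> kB \<delta> x y"
  unfolding rescaled_kernel_def using factor_pos[of \<delta>] by (intro mult_left_mono R3_le_RR) auto

lemma kR_le: "0 < \<delta> \<Longrightarrow> kR \<delta> x y \<le> \<alpha> / \<delta> ^ DIM('a) * M"
  and kB_le: "0 < \<delta> \<Longrightarrow> kB \<delta> x y \<le> \<alpha> / \<delta> ^ DIM('a) * M"
  unfolding rescaled_kernel_def using factor_pos[of \<delta>] by (intro mult_left_mono R_le RR_le; simp)+

text \<open>The sphere itself is included because \<open>Rbar R\<close> vanishes at 1; boundary
  integrands then need bounds on the open ball only, which is what \<open>boundary_normal\<close>
  supplies.\<close>

lemma kB_zero: "0 < \<delta> \<Longrightarrow> 2 * \<delta> \<le> norm (y - x) \<Longrightarrow> kB \<delta> x y = 0"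
proof -
  assume \<delta>: "0 < \<delta>" and h: "2 * \<delta> \<le> norm (y - x)"
  have "(2 * \<delta>)\<^sup>2 \<le> (norm (x - y))\<^sup>2" using \<delta> h by (intro power_mono) (auto simp: norm_minus_commute)
  then have "1 \<le> (norm (x - y))\<^sup>2 / (4 * \<delta>\<^sup>2)" using \<delta> by (simp add: power_mult_distrib)
  then show ?thesis by (simp add: rescaled_kernel_def Rbar_ge1[OF R_profile])
qed

lemma kR_zero: "0 < \<delta> \<Longrightarrow> 2 * \<delta> < norm (y - x) \<Longrightarrow> kR \<delta> x y = 0"
  by (rule rescaled_kernel_zero[OF R_profile])

lemma \<sigma>_integrable:
  assumes \<delta>: "0 < \<delta>" and [measurable]: "\<phi> \<in> borel_measurable \<sigma>"
    and c: "\<And>y. y \<in> frontier \<Omega> \<Longrightarrow> norm (y - x) < 2 * \<delta> \<Longrightarrow> \<bar>\<phi> y\<bar> \<le> c" and c0: "0 \<le> c"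
  shows "integrable \<sigma> (\<lambda>y. kB \<delta> x y * \<phi> y)" and "\<bar>\<integral>y. kB \<delta> x y * \<phi> y \<partial>\<sigma>\<bar> \<le> c * B \<delta> x"
    and "\<bar>\<integral>y. k3 \<delta> x y * \<phi> y \<partial>\<sigma>\<bar> \<le> c * B \<delta> x"
proof -
  interpret finite_measure \<sigma> by (rule finite_\<sigma>)
  note [measurable] = borel_measurable_\<sigma>[OF kB_meas[of \<delta> x]] borel_measurable_\<sigma>[OF k3_meas[of \<delta> x]]
  have kb: "integrable \<sigma> (\<lambda>y. kB \<delta> x y)"
    using kB_nonneg[OF \<delta>, of x] kB_le[OF \<delta>, of x] by (intro integrable_const_bound[where B="\<alpha> / \<delta> ^ DIM('a) * M"]) auto
  have le: "\<bar>kB \<delta> x y * \<phi> y\<bar> \<le> c * kB \<delta> x y" "\<bar>k3 \<delta> x y * \<phi> y\<bar> \<le> c * kB \<delta> x y" if y: "y \<in> space \<sigma>" for y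
  proof -
    have p: "\<bar>\<phi> y\<bar> * kB \<delta> x y \<le> c * kB \<delta> x y"
    proof (cases "norm (y - x) < 2 * \<delta>")
      case True
      then show ?thesis using c y kB_nonneg[OF \<delta>] by (intro mult_right_mono) (auto simp: space_\<sigma>)
    qed (simp add: kB_zero[OF \<delta>])
    then show "\<bar>kB \<delta> x y * \<phi> y\<bar> \<le> c * kB \<delta> x y"
      using kB_nonneg[OF \<delta>, of x y] by (simp add: abs_mult mult.commute)
    have "k3 \<delta> x y * \<bar>\<phi> y\<bar> \<le> kB \<delta> x y * \<bar>\<phi> y\<bar>" by (intro mult_right_mono k3_le_kB[OF \<delta>]) simp
    then show "\<bar>k3 \<delta> x y * \<phi> y\<bar> \<le> c * kB \<delta> x y"
      using p k3_nonneg[OF \<delta>, of x y] by (simp add: abs_mult mult.commute)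
  qed
  have ic: "integrable \<sigma> (\<lambda>y. c * kB \<delta> x y)" using kb by simp
  show i1: "integrable \<sigma> (\<lambda>y. kB \<delta> x y * \<phi> y)"
    by (rule Bochner_Integration.integrable_bound[OF ic]) (use le(1) in \<open>auto intro!: AE_I2 intro: order_trans[OF _ abs_ge_self]\<close>)
  have i3: "integrable \<sigma> (\<lambda>y. k3 \<delta> x y * \<phi> y)"
    by (rule Bochner_Integration.integrable_bound[OF ic]) (use le(2) in \<open>auto intro!: AE_I2 intro: order_trans[OF _ abs_ge_self]\<close>)
  have cB: "(\<integral>y. c * kB \<delta> x y \<partial>\<sigma>) = c * B \<delta> x" by (simp add: B_def)
  show "\<bar>\<integral>y. kB \<delta> x y * \<phi> y \<partial>\<sigma>\<bar> \<le> c * B \<delta> x"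
    using integral_abs_bound[of \<sigma> "\<lambda>y. kB \<delta> x y * \<phi> y"] integral_mono[OF integrable_abs[OF i1] ic le(1)]
    unfolding cB by linarith
  show "\<bar>\<integral>y. k3 \<delta> x y * \<phi> y \<partial>\<sigma>\<bar> \<le> c * B \<delta> x"
    using integral_abs_bound[of \<sigma> "\<lambda>y. k3 \<delta> x y * \<phi> y"] integral_mono[OF integrable_abs[OF i3] ic le(2)]
    unfolding cB by linarith
qed

lemma B_nonneg: "0 < \<delta> \<Longrightarrow> 0 \<le> B \<delta> x"
  unfolding B_def by (intro Bochner_Integration.integral_nonneg kB_nonneg)

lemma \<Omega>_integrable:
  assumes \<delta>: "0 < \<delta>" and \<phi>: "(\<lambda>y. indicator \<Omega> y * \<phi> y) \<in> borel_measurable borel"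
    and c: "\<And>y. y \<in> \<Omega> \<Longrightarrow> norm (y - x) \<le> 2 * \<delta> \<Longrightarrow> \<bar>\<phi> y\<bar> \<le> c" and c0: "0 \<le> c"
    and K: "K = R \<or> K = RR"
  shows "integrable lborel (\<lambda>y. indicator \<Omega> y * (rescaled_kernel \<alpha> K \<delta> x y * \<phi> y))"
    and "\<bar>\<integral>y. indicator \<Omega> y * (rescaled_kernel \<alpha> K \<delta> x y * \<phi> y) \<partial>lborel\<bar> \<le> c * A\<^sub>0"
proof -
  let ?k = "rescaled_kernel \<alpha> K \<delta> x"
  define C where "C = c * (\<alpha> / \<delta> ^ DIM('a) * M)"
  have k: "0 \<le> ?k y" "?k y \<le> \<alpha> / \<delta> ^ DIM('a) * M" "2 * \<delta> < norm (y - x) \<Longrightarrow> ?k y = 0" for y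
    using K kR_nonneg[OF \<delta>] kB_nonneg[OF \<delta>] kR_le[OF \<delta>] kB_le[OF \<delta>] kR_zero[OF \<delta>] kB_zero[OF \<delta>] by auto
  have m: "(\<lambda>y. indicator \<Omega> y * (?k y * \<phi> y)) \<in> borel_measurable borel"
  proof -
    have "(\<lambda>y. ?k y * (indicator \<Omega> y * \<phi> y)) \<in> borel_measurable borel"
      using K kR_meas kB_meas by (intro borel_measurable_times \<phi>) auto
    then show ?thesis by (simp add: mult.left_commute)
  qed
  have C0: "0 \<le> C" using c0 \<alpha> M0 \<delta> by (simp add: C_def)
  have le: "\<bar>indicator \<Omega> y * (?k y * \<phi> y)\<bar> \<le> indicator (cball x (2 * \<delta>)) y * C" for y
  proof (cases "y \<in> \<Omega> \<and> norm (y - x) \<le> 2 * \<delta>")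
    case True
    have "?k y * \<bar>\<phi> y\<bar> \<le> (\<alpha> / \<delta> ^ DIM('a) * M) * c" using k True c \<alpha> M0 \<delta> by (intro mult_mono) auto
    then show ?thesis using True k(1) by (simp add: abs_mult C_def dist_norm norm_minus_commute mult.commute)
  next
    case False
    then show ?thesis using k(3)[of y] C0 by (auto simp: not_le)
  qed
  have ib: "integrable lborel (\<lambda>y. indicator (cball x (2 * \<delta>)) y * C)" by simp
  show i: "integrable lborel (\<lambda>y. indicator \<Omega> y * (?k y * \<phi> y))"
    by (rule Bochner_Integration.integrable_bound[OF ib]) (use le m in \<open>auto intro!: AE_I2 intro: order_trans[OF _ abs_ge_self]\<close>)
  have "(\<integral>y. indicator (cball x (2 * \<delta>)) y * C \<partial>lborel) = measure lborel (cball x (2 * \<delta>)) * C" by simp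
  also have "\<dots> = c * A\<^sub>0"
    using \<delta> by (simp add: content_cball C_def A\<^sub>0_def power_mult_distrib)
  finally have "(\<integral>y. indicator (cball x (2 * \<delta>)) y * C \<partial>lborel) = c * A\<^sub>0" .
  then show "\<bar>\<integral>y. indicator \<Omega> y * (?k y * \<phi> y) \<partial>lborel\<bar> \<le> c * A\<^sub>0"
    using integral_abs_bound[of lborel "\<lambda>y. indicator \<Omega> y * (?k y * \<phi> y)"] integral_mono[OF integrable_abs[OF i] ib le]
    by linarith
qed

lemma borel_indicator_\<Omega>: "\<phi> \<in> borel_measurable borel \<Longrightarrow> (\<lambda>y. indicator \<Omega> y * \<phi> y :: real) \<in> borel_measurable borel"
  using openO by (intro borel_measurable_times borel_measurable_indicator) auto

lemma continuous_indicator_\<Omega>: "continuous_on \<Omega> \<phi> \<Longrightarrow> (\<lambda>y. indicator \<Omega> y * \<phi> y :: real) \<in> borel_measurable borel"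
  using borel_measurable_continuous_on_indicator[of \<Omega> \<phi>] openO by simp

lemma integral_lebesgue_on_\<Omega>:
  fixes \<phi> :: "'a \<Rightarrow> real"
  assumes "(\<lambda>y. indicator \<Omega> y * \<phi> y) \<in> borel_measurable borel"
  shows "(\<integral>y. \<phi> y \<partial>lebesgue_on \<Omega>) = (\<integral>y. indicator \<Omega> y * \<phi> y \<partial>lborel)"
proof -
  have "\<Omega> \<inter> space lebesgue \<in> sets lebesgue" using openO by simp
  then have "(\<integral>y. \<phi> y \<partial>lebesgue_on \<Omega>) = (\<integral>y. indicator \<Omega> y *\<^sub>R \<phi> y \<partial>lebesgue)"
    by (rule integral_restrict_space)
  also have "\<dots> = (\<integral>y. indicator \<Omega> y * \<phi> y \<partial>lborel)"
    using assms by (simp add: integral_completion)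
  finally show ?thesis .
qed

lemma inner_power_meas:
  "(\<lambda>y. (y - x) \<bullet> e) \<in> borel_measurable borel"
  by (intro borel_measurable_continuous_onI continuous_intros)

end

section \<open>Moments of the kernels\<close>

locale interior_point = nonlocal_setting +
  fixes x :: 'a and \<delta> :: real and N :: "'a \<Rightarrow> 'a" and N\<^sub>0 :: 'a
  assumes x: "x \<in> \<Omega>" and \<delta>: "0 < \<delta>" and bn: "boundary_normal x \<delta> N N\<^sub>0"
begin

definition V :: "('a \<Rightarrow> real) \<Rightarrow> real" where "V q = (\<integral>y. indicator \<Omega> y * (kR \<delta> x y * q y) \<partial>lborel)"
definition VB :: "('a \<Rightarrow> real) \<Rightarrow> real" where "VB q = (\<integral>y. indicator \<Omega> y * (kB \<delta> x y * q y) \<partial>lborel)"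
definition S :: "('a \<Rightarrow> real) \<Rightarrow> real" where "S q = (\<integral>y. kB \<delta> x y * q y \<partial>\<sigma>)"

lemma N_meas: "(\<lambda>y. N y \<bullet> e) \<in> borel_measurable borel"
  using bn unfolding boundary_normal_def by (intro borel_measurable_inner) auto

lemma N_le: "\<bar>N y \<bullet> e\<bar> \<le> norm e"
proof -
  have "norm (N y) \<le> 1" using bn by (simp add: boundary_normal_def)
  then show ?thesis using Cauchy_Schwarz_ineq2[of "N y" e] mult_right_mono[of "norm (N y)" 1 "norm e"] by simp
qed

lemma h_le: "norm (y - x) \<le> r \<Longrightarrow> \<bar>(y - x) \<bullet> e\<bar> \<le> r * norm e"
  using Cauchy_Schwarz_ineq2[of "y - x" e] mult_right_mono[of "norm (y - x)" r "norm e"] by simp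

lemma green:
  assumes K: "K = R \<or> K = RR"
    and q: "\<And>y. (q has_derivative q' y) (at y)" and q'm: "\<And>e. (\<lambda>y. q' y e) \<in> borel_measurable borel"
    and Q0: "0 \<le> Q" and Qb: "\<And>y. norm (y - x) \<le> 2 * \<delta> + 1 \<Longrightarrow> \<bar>q y\<bar> \<le> Q"
    and Ql: "\<And>y z. norm (y - x) \<le> 2 * \<delta> + 1 \<Longrightarrow> norm (z - x) \<le> 2 * \<delta> + 1 \<Longrightarrow> \<bar>q y - q z\<bar> \<le> Q * norm (y - z)"
  shows "(\<integral>y. indicator \<Omega> y * kernel_weight_deriv \<alpha> K \<delta> x q q' y e \<partial>lborel) =
     (\<integral>y. rescaled_kernel \<alpha> (Rbar K) \<delta> x y * q y * (N y \<bullet> e) \<partial>\<sigma>)"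
proof -
  have "admissible x (2 * \<delta>) (\<lambda>y. rescaled_kernel \<alpha> (Rbar K) \<delta> x y * q y) (kernel_weight_deriv \<alpha> K \<delta> x q q')"
  proof (rule admissible_kernel_times[OF _ _ \<delta> \<alpha> q q'm Q0 Qb Ql])
    show "bounded_profile M K" using K R_profile RR_profile by auto
    show "isCont K s" if "s \<noteq> 0" "s \<noteq> 1" for s using K R_isCont[OF that] RR_isCont by auto
  qed auto
  then show ?thesis using bn unfolding boundary_normal_def by blast
qed

text \<open>Integration by parts: a factor \<open>(y - x) \<bullet> e\<close> in front of
  \<open>kR\<close> is traded for \<open>2 * \<delta>\<^sup>2\<close> times a derivative of the
  remaining weight and a boundary term. The moments of \<open>kR\<close> follow by choosing
  \<open>q\<close>.\<close>

lemma V_green: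
  assumes q: "\<And>y. (q has_derivative q' y) (at y)" and q'm: "\<And>e. (\<lambda>y. q' y e) \<in> borel_measurable borel"
    and Q0: "0 \<le> Q" and Qb: "\<And>y. norm (y - x) \<le> 2 * \<delta> + 1 \<Longrightarrow> \<bar>q y\<bar> \<le> Q"
    and Ql: "\<And>y z. norm (y - x) \<le> 2 * \<delta> + 1 \<Longrightarrow> norm (z - x) \<le> 2 * \<delta> + 1 \<Longrightarrow> \<bar>q y - q z\<bar> \<le> Q * norm (y - z)"
    and Q'b: "\<And>y. norm (y - x) \<le> 2 * \<delta> \<Longrightarrow> \<bar>q' y e\<bar> \<le> Q'" and Q'0: "0 \<le> Q'"
  shows "V (\<lambda>y. ((y - x) \<bullet> e) * q y) = 2 * \<delta>\<^sup>2 * (VB (\<lambda>y. q' y e) - S (\<lambda>y. q y * (N y \<bullet> e)))"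
proof -
  have qc: "continuous_on UNIV q" using q by (meson continuous_at_imp_continuous_on has_derivative_continuous)
  have qm: "q \<in> borel_measurable borel" by (intro borel_measurable_continuous_onI qc)
  have bq: "\<bar>((y - x) \<bullet> e) * q y\<bar> \<le> (2 * \<delta> * norm e) * Q" if "norm (y - x) \<le> 2 * \<delta>" for y
    unfolding abs_mult using h_le[OF that] Qb[of y] that \<delta> by (intro mult_mono) auto
  have i1: "integrable lborel (\<lambda>y. indicator \<Omega> y * (kR \<delta> x y * (((y - x) \<bullet> e) * q y)))"
    by (rule \<Omega>_integrable(1)[OF \<delta> _ bq])
      (use \<delta> Q0 in \<open>auto intro!: borel_indicator_\<Omega> borel_measurable_times inner_power_meas qm\<close>)
  have split: "indicator \<Omega> y * kernel_weight_deriv \<alpha> R \<delta> x q q' y e =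
     indicator \<Omega> y * (kB \<delta> x y * q' y e) - (indicator \<Omega> y * (kR \<delta> x y * (((y - x) \<bullet> e) * q y))) / (2 * \<delta>\<^sup>2)" for y
    by (simp add: kernel_weight_deriv_def algebra_simps)
  have i2: "integrable lborel (\<lambda>y. indicator \<Omega> y * (kB \<delta> x y * q' y e))"
    by (rule \<Omega>_integrable(1)[OF \<delta> _ Q'b Q'0]) (auto intro!: borel_indicator_\<Omega> q'm)
  have "(\<integral>y. indicator \<Omega> y * kernel_weight_deriv \<alpha> R \<delta> x q q' y e \<partial>lborel) =
     (\<integral>y. kB \<delta> x y * q y * (N y \<bullet> e) \<partial>\<sigma>)"
    by (rule green[OF _ q q'm Q0 Qb Ql]) simp
  then have "VB (\<lambda>y. q' y e) - V (\<lambda>y. ((y - x) \<bullet> e) * q y) / (2 * \<delta>\<^sup>2) = S (\<lambda>y. q y * (N y \<bullet> e))"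
    using i1 i2 unfolding split V_def VB_def S_def by (simp add: mult.assoc)
  then show "V (\<lambda>y. ((y - x) \<bullet> e) * q y) = 2 * \<delta>\<^sup>2 * (VB (\<lambda>y. q' y e) - S (\<lambda>y. q y * (N y \<bullet> e)))"
    using \<delta> by (simp add: field_simps)
qed

lemma V1: "V (\<lambda>y. (y - x) \<bullet> e) = - (2 * \<delta>\<^sup>2) * S (\<lambda>y. N y \<bullet> e)"
proof -
  have "V (\<lambda>y. ((y - x) \<bullet> e) * 1) = 2 * \<delta>\<^sup>2 * (VB (\<lambda>y. 0) - S (\<lambda>y. 1 * (N y \<bullet> e)))"
    by (rule V_green[where q="\<lambda>_. 1" and q'="\<lambda>_ _. 0" and Q=1 and Q'=0]) auto
  then show ?thesis by (simp add: VB_def)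
qed

text \<open>The same one level up: \<open>kB\<close> times \<open>y - x\<close> is a multiple of a
  gradient of \<open>k3\<close>, so the first moment of \<open>kB\<close> is a pure boundary term
  with a factor \<open>\<delta>\<^sup>2\<close>.\<close>

lemma VB1: "VB (\<lambda>y. (y - x) \<bullet> e) = - (2 * \<delta>\<^sup>2) * (\<integral>y. k3 \<delta> x y * (N y \<bullet> e) \<partial>\<sigma>)"
proof -
  have "(\<integral>y. indicator \<Omega> y * kernel_weight_deriv \<alpha> RR \<delta> x (\<lambda>_. 1) (\<lambda>_ _. 0) y e \<partial>lborel) =
     (\<integral>y. k3 \<delta> x y * 1 * (N y \<bullet> e) \<partial>\<sigma>)"
    by (rule green[where Q=1]) auto
  moreover have "indicator \<Omega> y * kernel_weight_deriv \<alpha> RR \<delta> x (\<lambda>_. 1) (\<lambda>_ _. 0) y e =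
     indicator \<Omega> y * (kB \<delta> x y * ((y - x) \<bullet> e)) / - (2 * \<delta>\<^sup>2)" for y
    by (simp add: kernel_weight_deriv_def)
  ultimately show ?thesis using \<delta> by (simp add: VB_def field_simps)
qed

lemma V2: "V (\<lambda>y. ((y - x) \<bullet> e) * ((y - x) \<bullet> a)) = 2 * \<delta>\<^sup>2 * ((a \<bullet> e) * VB (\<lambda>y. 1) - S (\<lambda>y. ((y - x) \<bullet> a) * (N y \<bullet> e)))"
proof -
  define Q where "Q = norm a * (2 * \<delta> + 1) + norm a"
  have "V (\<lambda>y. ((y - x) \<bullet> e) * ((y - x) \<bullet> a)) = 2 * \<delta>\<^sup>2 * (VB (\<lambda>y. e \<bullet> a) - S (\<lambda>y. ((y - x) \<bullet> a) * (N y \<bullet> e)))"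
  proof (rule V_green[where q="\<lambda>y. (y - x) \<bullet> a" and q'="\<lambda>_ k. k \<bullet> a" and Q=Q and Q'="\<bar>e \<bullet> a\<bar>"])
    show "((\<lambda>y. (y - x) \<bullet> a) has_derivative (\<lambda>k. k \<bullet> a)) (at y)" for y
      by (auto intro!: derivative_eq_intros)
    show "0 \<le> Q" using \<delta> by (simp add: Q_def)
    show "\<bar>(y - x) \<bullet> a\<bar> \<le> Q" if "norm (y - x) \<le> 2 * \<delta> + 1" for y
    proof -
      have "\<bar>(y - x) \<bullet> a\<bar> \<le> (2 * \<delta> + 1) * norm a" by (rule h_le[OF that])
      also have "\<dots> \<le> Q" by (simp add: Q_def mult.commute)
      finally show ?thesis .
    qed
    show "\<bar>(y - x) \<bullet> a - (z - x) \<bullet> a\<bar> \<le> Q * norm (y - z)" for y z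
    proof -
      have "(y - x) \<bullet> a - (z - x) \<bullet> a = (y - z) \<bullet> a" by (simp add: inner_diff_left)
      then have "\<bar>(y - x) \<bullet> a - (z - x) \<bullet> a\<bar> \<le> norm a * norm (y - z)"
        using Cauchy_Schwarz_ineq2[of "y - z" a] by (simp add: mult.commute)
      also have "\<dots> \<le> Q * norm (y - z)" using \<delta> by (intro mult_right_mono) (auto simp: Q_def)
      finally show ?thesis .
    qed
  qed auto
  moreover have "VB (\<lambda>y. e \<bullet> a) = (a \<bullet> e) * VB (\<lambda>y. 1)"
  proof -
    have "VB (\<lambda>y. e \<bullet> a) = (\<integral>y. (a \<bullet> e) * (indicator \<Omega> y * (kB \<delta> x y * 1)) \<partial>lborel)"
      unfolding VB_def by (intro Bochner_Integration.integral_cong refl) (simp add: inner_commute)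
    then show ?thesis unfolding VB_def by simp
  qed
  ultimately show ?thesis by simp
qed

text \<open>Green's formula applied to one second moment in two ways. With \<open>a\<close> tangential and \<open>e = N\<^sub>0\<close> it bounds
  the tangential part of \<open>y - x\<close>, which has no pointwise bound of order \<open>\<delta>\<^sup>2\<close>.\<close>

lemma S_symmetric: "S (\<lambda>y. ((y - x) \<bullet> a) * (N y \<bullet> e)) = S (\<lambda>y. ((y - x) \<bullet> e) * (N y \<bullet> a))"
proof -
  have "V (\<lambda>y. ((y - x) \<bullet> e) * ((y - x) \<bullet> a)) = V (\<lambda>y. ((y - x) \<bullet> a) * ((y - x) \<bullet> e))"
    by (simp only: mult.commute)
  then show ?thesis unfolding V2 using \<delta> by (simp add: inner_commute)
qed

lemma S_bound:
  assumes "\<phi> \<in> borel_measurable \<sigma>" and "\<And>y. y \<in> frontier \<Omega> \<Longrightarrow> norm (y - x) < 2 * \<delta> \<Longrightarrow> \<bar>\<phi> y\<bar> \<le> c" and "0 \<le> c"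
  shows "integrable \<sigma> (\<lambda>y. kB \<delta> x y * \<phi> y)" and "\<bar>S \<phi>\<bar> \<le> c * B \<delta> x"
  unfolding S_def using \<sigma>_integrable[OF \<delta> assms] by blast+

lemma VB1_bound: "\<bar>VB (\<lambda>y. (y - x) \<bullet> e)\<bar> \<le> 2 * \<delta>\<^sup>2 * norm e * B \<delta> x"
proof -
  have "\<bar>\<integral>y. k3 \<delta> x y * (N y \<bullet> e) \<partial>\<sigma>\<bar> \<le> norm e * B \<delta> x"
    by (rule \<sigma>_integrable(3)[OF \<delta>]) (auto intro: borel_measurable_\<sigma> N_meas N_le)
  then show ?thesis unfolding VB1 using \<delta> by (simp add: abs_mult mult.assoc)
qed

text \<open>\<open>V_green\<close> with a quadratic weight. Its derivative leaves two first moments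
  of \<open>kB\<close>, each at most \<open>2 * \<delta>\<^sup>2 * B \<delta> x\<close> by
  \<open>VB1_bound\<close>, and the boundary term is at most
  \<open>4 * \<delta>\<^sup>2 * B \<delta> x\<close>; the prefactor
  \<open>2 * \<delta>\<^sup>2\<close> makes 16.\<close>

lemma V3_bound:
  assumes e: "norm e \<le> 1" and a: "norm a \<le> 1" and b: "norm b \<le> 1"
  shows "\<bar>V (\<lambda>y. ((y - x) \<bullet> e) * (((y - x) \<bullet> a) * ((y - x) \<bullet> b)))\<bar> \<le> 16 * \<delta>^4 * B \<delta> x"
proof -
  define r where "r = 2 * \<delta> + 1"
  have r0: "0 \<le> r" using \<delta> by (simp add: r_def)
  define Q where "Q = r * r + 2 * r"
  have hl: "\<bar>(y - x) \<bullet> c\<bar> \<le> s" if "norm (y - x) \<le> s" "norm c \<le> 1" for y c s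
    using h_le[OF that(1), of c] that mult_left_mono[OF that(2), of s] norm_ge_zero[of "y - x"] by linarith
  have ab: "\<bar>e \<bullet> a\<bar> \<le> 1" "\<bar>e \<bullet> b\<bar> \<le> 1"
    using Cauchy_Schwarz_ineq2[of e a] Cauchy_Schwarz_ineq2[of e b] e a b
      mult_mono[of "norm e" 1 "norm a" 1] mult_mono[of "norm e" 1 "norm b" 1] by auto
  have B0: "0 \<le> B \<delta> x" by (rule B_nonneg[OF \<delta>])
  have eq: "V (\<lambda>y. ((y - x) \<bullet> e) * (((y - x) \<bullet> a) * ((y - x) \<bullet> b))) =
     2 * \<delta>\<^sup>2 * (VB (\<lambda>y. ((y - x) \<bullet> a) * (e \<bullet> b) + (e \<bullet> a) * ((y - x) \<bullet> b)) - S (\<lambda>y. (((y - x) \<bullet> a) * ((y - x) \<bullet> b)) * (N y \<bullet> e)))"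
  proof (rule V_green[where q="\<lambda>y. ((y - x) \<bullet> a) * ((y - x) \<bullet> b)"
      and q'="\<lambda>y k. ((y - x) \<bullet> a) * (k \<bullet> b) + (k \<bullet> a) * ((y - x) \<bullet> b)" and Q=Q and Q'="2 * \<delta> * 1 + 1 * (2 * \<delta>)"])
    show "((\<lambda>y. ((y - x) \<bullet> a) * ((y - x) \<bullet> b)) has_derivative (\<lambda>k. ((y - x) \<bullet> a) * (k \<bullet> b) + (k \<bullet> a) * ((y - x) \<bullet> b))) (at y)" for y
      by (auto intro!: derivative_eq_intros)
    show "(\<lambda>y. ((y - x) \<bullet> a) * (k \<bullet> b) + (k \<bullet> a) * ((y - x) \<bullet> b)) \<in> borel_measurable borel" for k
      by (intro borel_measurable_continuous_onI continuous_intros)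
    show "0 \<le> Q" using r0 by (simp add: Q_def)
    show "\<bar>((y - x) \<bullet> a) * ((y - x) \<bullet> b)\<bar> \<le> Q" if "norm (y - x) \<le> 2 * \<delta> + 1" for y
    proof -
      have "\<bar>((y - x) \<bullet> a) * ((y - x) \<bullet> b)\<bar> \<le> r * r"
        unfolding abs_mult using hl[of y r a] hl[of y r b] that a b r0 by (intro mult_mono) (auto simp: r_def)
      also have "\<dots> \<le> Q" using r0 by (simp add: Q_def)
      finally show ?thesis .
    qed
    show "\<bar>((y - x) \<bullet> a) * ((y - x) \<bullet> b) - ((z - x) \<bullet> a) * ((z - x) \<bullet> b)\<bar> \<le> Q * norm (y - z)"
      if "norm (y - x) \<le> 2 * \<delta> + 1" "norm (z - x) \<le> 2 * \<delta> + 1" for y z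
    proof -
      have d: "\<bar>(y - z) \<bullet> c\<bar> \<le> norm (y - z)" if "norm c \<le> 1" for c
        using Cauchy_Schwarz_ineq2[of "y - z" c] mult_left_mono[OF that, of "norm (y - z)"] by simp
      have "((y - x) \<bullet> a) * ((y - x) \<bullet> b) - ((z - x) \<bullet> a) * ((z - x) \<bullet> b) =
        ((y - x) \<bullet> a) * ((y - z) \<bullet> b) + ((y - z) \<bullet> a) * ((z - x) \<bullet> b)"
        by (simp add: inner_diff_left algebra_simps)
      also have "\<bar>\<dots>\<bar> \<le> \<bar>((y - x) \<bullet> a) * ((y - z) \<bullet> b)\<bar> + \<bar>((y - z) \<bullet> a) * ((z - x) \<bullet> b)\<bar>" by (rule abs_triangle_ineq)
      also have "\<dots> \<le> r * norm (y - z) + norm (y - z) * r"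
        unfolding abs_mult using hl[of y r a] hl[of z r b] d[OF a] d[OF b] that a b r0
        by (intro add_mono mult_mono) (auto simp: r_def)
      also have "\<dots> \<le> Q * norm (y - z)" using r0 by (simp add: Q_def algebra_simps)
      finally show ?thesis .
    qed
    show "\<bar>((y - x) \<bullet> a) * (e \<bullet> b) + (e \<bullet> a) * ((y - x) \<bullet> b)\<bar> \<le> 2 * \<delta> * 1 + 1 * (2 * \<delta>)" if "norm (y - x) \<le> 2 * \<delta>" for y
    proof -
      have "\<bar>((y - x) \<bullet> a) * (e \<bullet> b)\<bar> \<le> 2 * \<delta> * 1"
        unfolding abs_mult using hl[OF that a] ab \<delta> by (intro mult_mono) auto
      moreover have "\<bar>(e \<bullet> a) * ((y - x) \<bullet> b)\<bar> \<le> 1 * (2 * \<delta>)"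
        unfolding abs_mult using hl[OF that b] ab \<delta> by (intro mult_mono) auto
      ultimately show ?thesis by linarith
    qed
  qed (use \<delta> in auto)
  have "VB (\<lambda>y. ((y - x) \<bullet> a) * (e \<bullet> b) + (e \<bullet> a) * ((y - x) \<bullet> b)) = (e \<bullet> b) * VB (\<lambda>y. (y - x) \<bullet> a) + (e \<bullet> a) * VB (\<lambda>y. (y - x) \<bullet> b)"
  proof -
    have i: "integrable lborel (\<lambda>y. indicator \<Omega> y * (kB \<delta> x y * ((y - x) \<bullet> c)))" if "norm c \<le> 1" for c
      by (rule \<Omega>_integrable(1)[OF \<delta>, where c="2 * \<delta>"]) (use \<delta> hl that in \<open>auto intro!: borel_indicator_\<Omega> inner_power_meas\<close>)
    have "VB (\<lambda>y. ((y - x) \<bullet> a) * (e \<bullet> b) + (e \<bullet> a) * ((y - x) \<bullet> b)) =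
      (\<integral>y. (e \<bullet> b) * (indicator \<Omega> y * (kB \<delta> x y * ((y - x) \<bullet> a))) + (e \<bullet> a) * (indicator \<Omega> y * (kB \<delta> x y * ((y - x) \<bullet> b))) \<partial>lborel)"
      unfolding VB_def by (intro Bochner_Integration.integral_cong refl) (simp add: algebra_simps)
    then show ?thesis unfolding VB_def using i[OF a] i[OF b] by simp
  qed
  moreover have "\<bar>(e \<bullet> b) * VB (\<lambda>y. (y - x) \<bullet> a)\<bar> \<le> 1 * (2 * \<delta>\<^sup>2 * 1 * B \<delta> x)"
    unfolding abs_mult using ab \<delta> B0 a
    by (intro mult_mono order_trans[OF VB1_bound]) (auto intro!: mult_right_mono mult_left_mono)
  moreover have "\<bar>(e \<bullet> a) * VB (\<lambda>y. (y - x) \<bullet> b)\<bar> \<le> 1 * (2 * \<delta>\<^sup>2 * 1 * B \<delta> x)"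
    unfolding abs_mult using ab \<delta> B0 b
    by (intro mult_mono order_trans[OF VB1_bound]) (auto intro!: mult_right_mono mult_left_mono)
  moreover have "\<bar>S (\<lambda>y. (((y - x) \<bullet> a) * ((y - x) \<bullet> b)) * (N y \<bullet> e))\<bar> \<le> (4 * \<delta>\<^sup>2) * B \<delta> x"
  proof (rule S_bound(2))
    show "(\<lambda>y. (((y - x) \<bullet> a) * ((y - x) \<bullet> b)) * (N y \<bullet> e)) \<in> borel_measurable \<sigma>"
      by (intro borel_measurable_\<sigma> borel_measurable_times inner_power_meas N_meas)
    fix y assume "norm (y - x) < 2 * \<delta>"
    then have n: "norm (y - x) \<le> 2 * \<delta>" by simp
    have "\<bar>N y \<bullet> e\<bar> \<le> 1" using N_le[of y e] e by linarith
    then have "\<bar>(((y - x) \<bullet> a) * ((y - x) \<bullet> b)) * (N y \<bullet> e)\<bar> \<le> ((2 * \<delta>) * (2 * \<delta>)) * 1"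
      unfolding abs_mult using hl[OF n a] hl[OF n b] \<delta> by (intro mult_mono) auto
    then show "\<bar>(((y - x) \<bullet> a) * ((y - x) \<bullet> b)) * (N y \<bullet> e)\<bar> \<le> 4 * \<delta>\<^sup>2" by (simp add: power2_eq_square)
  qed (use \<delta> in simp)
  ultimately have "\<bar>VB (\<lambda>y. ((y - x) \<bullet> a) * (e \<bullet> b) + (e \<bullet> a) * ((y - x) \<bullet> b)) - S (\<lambda>y. (((y - x) \<bullet> a) * ((y - x) \<bullet> b)) * (N y \<bullet> e))\<bar> \<le> 8 * \<delta>\<^sup>2 * B \<delta> x"
    by linarith
  then have "\<bar>V (\<lambda>y. ((y - x) \<bullet> e) * (((y - x) \<bullet> a) * ((y - x) \<bullet> b)))\<bar> \<le> 2 * \<delta>\<^sup>2 * (8 * \<delta>\<^sup>2 * B \<delta> x)"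
    unfolding eq abs_mult by (intro mult_mono) auto
  also have "\<dots> = 16 * \<delta>^4 * B \<delta> x" by (simp add: power2_eq_square eval_nat_numeral)
  finally show ?thesis .
qed

lemma \<mu>_pos: "0 < \<mu>_weight \<Omega> \<delta> x" using \<delta> by (simp add: \<mu>_weight_def less_max_iff_disj)
lemma \<mu>_le: "\<mu>_weight \<Omega> \<delta> x \<le> 2 * \<delta>" by (simp add: \<mu>_weight_def)

text \<open>Near \<open>x\<close> the numbers \<open>\<mu>\<close> and
  \<open>(y - x) \<bullet> N\<^sub>0\<close> both agree with the distance up to order
  \<open>\<delta>\<^sup>2\<close>, and \<open>\<mu> * (N y - N\<^sub>0)\<close> is of that order
  too. The tangential part of \<open>y - x\<close> is only of order \<open>\<delta>\<close>
  pointwise; in the average \<open>S_symmetric\<close> exchanges it for the normal part times the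
  tangential part of \<open>N\<close>, which is itself of order \<open>\<delta>\<close>.\<close>

lemma boundary_cancellation:
  assumes \<delta>2: "\<delta> \<le> 2"
  shows "\<bar>S (\<lambda>y. p \<bullet> (\<mu>_weight \<Omega> \<delta> x *\<^sub>R N y - (y - x)))\<bar> \<le> norm p * \<delta>\<^sup>2 * (140 * \<Lambda> + 1) * B \<delta> x"
proof -
  define \<mu> where "\<mu> = \<mu>_weight \<Omega> \<delta> x"
  define D where "D = 20 * \<Lambda>"
  have D0: "0 \<le> D" using \<Lambda>1 by (simp add: D_def)
  define d where "d = infdist x (frontier \<Omega>)"
  have N0: "norm N\<^sub>0 = 1" using bn by (simp add: boundary_normal_def)
  have NN: "N\<^sub>0 \<bullet> N\<^sub>0 = 1" using N0 by (simp add: dot_square_norm)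
  have near: "norm (N y - N\<^sub>0) \<le> D * \<delta>" "\<bar>(y - x) \<bullet> N\<^sub>0 - d\<bar> \<le> D * \<delta>\<^sup>2" "\<bar>\<mu> - d\<bar> \<le> \<delta>\<^sup>2"
    if y: "y \<in> frontier \<Omega>" "norm (y - x) < 2 * \<delta>" for y
  proof -
    show "norm (N y - N\<^sub>0) \<le> D * \<delta>" "\<bar>(y - x) \<bullet> N\<^sub>0 - d\<bar> \<le> D * \<delta>\<^sup>2"
      using bn y unfolding boundary_normal_def d_def D_def by blast+
    have "d \<le> dist x y" unfolding d_def by (rule infdist_le[OF y(1)])
    then have "d < 2 * \<delta>" using y(2) by (simp add: dist_norm norm_minus_commute)
    moreover have "0 \<le> d" by (simp add: d_def infdist_nonneg)
    \<comment> \<open>Hence for a distance below \<open>2 * \<delta>\<close> the cap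
      \<open>2 * \<delta>\<close> is inactive, and \<open>\<mu>\<close> is the larger of
      \<open>\<delta>\<^sup>2\<close> and the distance.\<close>
    moreover have "\<delta>\<^sup>2 \<le> 2 * \<delta>" using \<delta>2 \<delta> by (simp add: power2_eq_square)
    ultimately show "\<bar>\<mu> - d\<bar> \<le> \<delta>\<^sup>2" unfolding \<mu>_def \<mu>_weight_def d_def[symmetric] by (auto simp: max_def min_def)
  qed
  define \<tau> where "\<tau> = p - (p \<bullet> N\<^sub>0) *\<^sub>R N\<^sub>0"
  have \<tau>0: "N\<^sub>0 \<bullet> \<tau> = 0" by (simp add: \<tau>_def inner_diff_right NN inner_commute)
  have \<tau>p: "norm \<tau> \<le> norm p"
  proof -
    have "(norm \<tau>)\<^sup>2 = (norm p)\<^sup>2 - (p \<bullet> N\<^sub>0)\<^sup>2"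
      unfolding power2_norm_eq_inner \<tau>_def
      by (simp add: inner_diff_left inner_diff_right NN inner_commute power2_eq_square)
    then have "(norm \<tau>)\<^sup>2 \<le> (norm p)\<^sup>2" by simp
    then show ?thesis by (simp add: power2_le_iff_abs_le)
  qed
  have pN: "\<bar>p \<bullet> N\<^sub>0\<bar> \<le> norm p" using Cauchy_Schwarz_ineq2[of p N\<^sub>0] N0 by simp
  have \<mu>2: "0 < \<mu>" "\<mu> \<le> 2 * \<delta>" using \<mu>_pos \<mu>_le by (simp_all add: \<mu>_def)
  \<comment> \<open>\<open>?a\<close> is small pointwise. \<open>?b\<close> is the tangential part
    with a factor \<open>N y \<bullet> N\<^sub>0\<close> inserted so that \<open>S_symmetric\<close>
    applies; the last summand of \<open>?a\<close> corrects for that factor.\<close>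
  let ?a = "\<lambda>y. \<mu> * ((N y - N\<^sub>0) \<bullet> p) + (p \<bullet> N\<^sub>0) * (\<mu> - (y - x) \<bullet> N\<^sub>0) - ((y - x) \<bullet> \<tau>) * ((N\<^sub>0 - N y) \<bullet> N\<^sub>0)"
  let ?b = "\<lambda>y. ((y - x) \<bullet> \<tau>) * (N y \<bullet> N\<^sub>0)"
  have split: "p \<bullet> (\<mu> *\<^sub>R N y - (y - x)) = ?a y - ?b y" for y
    by (simp add: \<tau>_def inner_diff_left inner_diff_right NN inner_commute algebra_simps)
  have hl: "\<bar>(y - x) \<bullet> c\<bar> \<le> 2 * \<delta> * norm c" if "norm (y - x) < 2 * \<delta>" for y c
    using h_le[of y "2 * \<delta>" c] that by simp
  have ma: "?a \<in> borel_measurable \<sigma>" and mb: "?b \<in> borel_measurable \<sigma>"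
    unfolding inner_diff_left[of "N _"] inner_diff_left[of N\<^sub>0]
    by (intro borel_measurable_\<sigma> borel_measurable_times borel_measurable_add borel_measurable_diff borel_measurable_const inner_power_meas N_meas)+
  have ba: "\<bar>?a y\<bar> \<le> norm p * \<delta>\<^sup>2 * (5 * D + 1)" if y: "y \<in> frontier \<Omega>" "norm (y - x) < 2 * \<delta>" for y
  proof -
    note n = near[OF y]
    have t1: "\<bar>\<mu> * ((N y - N\<^sub>0) \<bullet> p)\<bar> \<le> (2 * \<delta>) * ((D * \<delta>) * norm p)"
      unfolding abs_mult using \<mu>2 n(1) D0 \<delta>
      by (intro mult_mono order_trans[OF Cauchy_Schwarz_ineq2]) (auto intro!: mult_right_mono)
    have "\<bar>\<mu> - (y - x) \<bullet> N\<^sub>0\<bar> \<le> (D + 1) * \<delta>\<^sup>2" using n(2,3) by (simp add: algebra_simps)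
    then have t2: "\<bar>(p \<bullet> N\<^sub>0) * (\<mu> - (y - x) \<bullet> N\<^sub>0)\<bar> \<le> norm p * ((D + 1) * \<delta>\<^sup>2)"
      unfolding abs_mult using pN by (intro mult_mono) auto
    have "\<bar>(N\<^sub>0 - N y) \<bullet> N\<^sub>0\<bar> \<le> D * \<delta>"
      using Cauchy_Schwarz_ineq2[of "N\<^sub>0 - N y" N\<^sub>0] N0 n(1) by (simp add: norm_minus_commute)
    moreover have "\<bar>(y - x) \<bullet> \<tau>\<bar> \<le> 2 * \<delta> * norm p"
      using hl[OF y(2), of \<tau>] mult_left_mono[OF \<tau>p, of "2 * \<delta>"] \<delta> by linarith
    ultimately have t3: "\<bar>((y - x) \<bullet> \<tau>) * ((N\<^sub>0 - N y) \<bullet> N\<^sub>0)\<bar> \<le> (2 * \<delta> * norm p) * (D * \<delta>)"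
      unfolding abs_mult using \<delta> by (intro mult_mono) auto
    have "\<bar>?a y\<bar> \<le> (2 * \<delta>) * ((D * \<delta>) * norm p) + norm p * ((D + 1) * \<delta>\<^sup>2) + (2 * \<delta> * norm p) * (D * \<delta>)"
      using t1 t2 t3 by linarith
    also have "\<dots> = norm p * \<delta>\<^sup>2 * (5 * D + 1)" by (simp add: power2_eq_square algebra_simps)
    finally show ?thesis .
  qed
  have bb: "\<bar>?b y\<bar> \<le> 2 * \<delta> * norm \<tau>" if "y \<in> frontier \<Omega>" "norm (y - x) < 2 * \<delta>" for y
  proof -
    have "\<bar>?b y\<bar> \<le> (2 * \<delta> * norm \<tau>) * 1"
      unfolding abs_mult using hl[OF that(2), of \<tau>] N_le[of y N\<^sub>0] N0 \<delta> by (intro mult_mono) auto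
    then show ?thesis by simp
  qed
  have p0: "0 \<le> norm p * \<delta>\<^sup>2 * (5 * D + 1)" using D0 by simp
  have dist: "kB \<delta> x y * (?a y - ?b y) = kB \<delta> x y * ?a y - kB \<delta> x y * ?b y" for y
    by (rule right_diff_distrib)
  have "S (\<lambda>y. p \<bullet> (\<mu> *\<^sub>R N y - (y - x))) = S ?a - S ?b"
    unfolding split S_def dist
    by (rule Bochner_Integration.integral_diff) (use S_bound(1)[OF ma ba p0] S_bound(1)[OF mb bb] \<delta> in auto)
  moreover have "\<bar>S ?a\<bar> \<le> norm p * \<delta>\<^sup>2 * (5 * D + 1) * B \<delta> x" by (rule S_bound(2)[OF ma ba p0])
  \<comment> \<open>After the exchange the integrand contains \<open>N y \<bullet> \<tau>\<close>,
    which equals \<open>(N y - N\<^sub>0) \<bullet> \<tau>\<close> and so gains a factor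
    \<open>\<delta>\<close>.\<close>
  moreover have "\<bar>S ?b\<bar> \<le> norm p * \<delta>\<^sup>2 * (2 * D) * B \<delta> x"
    unfolding S_symmetric[of \<tau>]
  proof (rule S_bound(2))
    show "(\<lambda>y. ((y - x) \<bullet> N\<^sub>0) * (N y \<bullet> \<tau>)) \<in> borel_measurable \<sigma>"
      by (intro borel_measurable_\<sigma> borel_measurable_times inner_power_meas N_meas)
    fix y assume y: "y \<in> frontier \<Omega>" "norm (y - x) < 2 * \<delta>"
    have "N y \<bullet> \<tau> = (N y - N\<^sub>0) \<bullet> \<tau>" by (simp add: inner_diff_left \<tau>0)
    then have "\<bar>N y \<bullet> \<tau>\<bar> \<le> norm (N y - N\<^sub>0) * norm \<tau>" by (simp add: Cauchy_Schwarz_ineq2)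
    also have "\<dots> \<le> (D * \<delta>) * norm p" using near(1)[OF y] \<tau>p D0 \<delta> by (intro mult_mono) auto
    finally have "\<bar>((y - x) \<bullet> N\<^sub>0) * (N y \<bullet> \<tau>)\<bar> \<le> (2 * \<delta> * 1) * ((D * \<delta>) * norm p)"
      unfolding abs_mult using hl[OF y(2), of N\<^sub>0] N0 \<delta> by (intro mult_mono) auto
    then show "\<bar>((y - x) \<bullet> N\<^sub>0) * (N y \<bullet> \<tau>)\<bar> \<le> norm p * \<delta>\<^sup>2 * (2 * D)"
      by (simp add: power2_eq_square algebra_simps)
  qed (use D0 in simp)
  ultimately have "\<bar>S (\<lambda>y. p \<bullet> (\<mu> *\<^sub>R N y - (y - x)))\<bar> \<le> norm p * \<delta>\<^sup>2 * (5 * D + 1) * B \<delta> x + norm p * \<delta>\<^sup>2 * (2 * D) * B \<delta> x"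
    by linarith
  also have "\<dots> = norm p * \<delta>\<^sup>2 * (140 * \<Lambda> + 1) * B \<delta> x" by (simp add: D_def algebra_simps)
  finally show ?thesis unfolding \<mu>_def .
qed

end

section \<open>The residual, and a supersolution for small \<delta>\<close>

context nonlocal_setting
begin

text \<open>The defect of \<open>u\<close> in the nonlocal equation, with the data expressed through
  \<open>u\<close> itself: \<open>g\<close> by its boundary values and \<open>f\<close> by minus its
  Laplacian.\<close>

definition resid :: "('a \<Rightarrow> real) \<Rightarrow> real \<Rightarrow> 'a \<Rightarrow> real" where
  "resid u \<delta> x = 1 / \<delta>\<^sup>2 * (\<integral>y. kR \<delta> x y * (u x - u y) \<partial>lebesgue_on \<Omega>) +
     2 / \<mu>_weight \<Omega> \<delta> x * (\<integral>y. kB \<delta> x y * (u x - u y) \<partial>\<sigma>) +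
     (\<integral>y. kB \<delta> x y * laplacian u y \<partial>lebesgue_on \<Omega>)"

end

context interior_point
begin

lemma V_integrable:
  assumes "continuous_on UNIV q"
  shows "integrable lborel (\<lambda>y. indicator \<Omega> y * (kR \<delta> x y * q y))"
    and "integrable lborel (\<lambda>y. indicator \<Omega> y * (kB \<delta> x y * q y))"
proof -
  have "\<exists>c. \<forall>y\<in>cball x (2 * \<delta>). \<bar>q y\<bar> \<le> c"
    by (rule compact_continuous_bound[OF compact_cball continuous_on_subset[OF assms subset_UNIV]])
  then obtain c where c_all: "\<forall>y\<in>cball x (2 * \<delta>). \<bar>q y\<bar> \<le> c" ..
  have c: "\<bar>q y\<bar> \<le> c" if "y \<in> cball x (2 * \<delta>)" for y using c_all that by (rule bspec)
  have c0: "0 \<le> c" using c[of x] \<delta> abs_ge_zero[of "q x"] by (simp del: abs_ge_zero)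
  have m: "(\<lambda>y. indicator \<Omega> y * q y) \<in> borel_measurable borel"
    using assms by (intro borel_indicator_\<Omega> borel_measurable_continuous_onI)
  have c': "\<bar>q y\<bar> \<le> c" if "norm (y - x) \<le> 2 * \<delta>" for y
    using c[of y] that by (simp add: dist_norm norm_minus_commute)
  show "integrable lborel (\<lambda>y. indicator \<Omega> y * (kR \<delta> x y * q y))"
    by (rule \<Omega>_integrable(1)[OF \<delta> m c' c0]) auto
  show "integrable lborel (\<lambda>y. indicator \<Omega> y * (kB \<delta> x y * q y))"
    by (rule \<Omega>_integrable(1)[OF \<delta> m c' c0]) auto
qed

lemma V_add:
  assumes "continuous_on UNIV q1" "continuous_on UNIV q2"
  shows "V (\<lambda>y. q1 y + q2 y) = V q1 + V q2"
  unfolding V_def using Bochner_Integration.integral_add[OF V_integrable(1)[OF assms(1)] V_integrable(1)[OF assms(2)]]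
  by (simp add: distrib_left)

lemma V_cmult: "V (\<lambda>y. c * q y) = c * V q"
proof -
  have "V (\<lambda>y. c * q y) = (\<integral>y. c * (indicator \<Omega> y * (kR \<delta> x y * q y)) \<partial>lborel)"
    unfolding V_def by (intro Bochner_Integration.integral_cong refl) simp
  then show ?thesis by (simp add: V_def)
qed

lemma V_divide: "V (\<lambda>y. q y / c) = V q / c"
  using V_cmult[of "1 / c" q] by simp

lemma V_sum:
  assumes "\<And>i. i \<in> I \<Longrightarrow> continuous_on UNIV (q i)"
  shows "V (\<lambda>y. \<Sum>i\<in>I. q i y) = (\<Sum>i\<in>I. V (q i))"
  unfolding V_def sum_distrib_left
  by (rule Bochner_Integration.integral_sum) (rule V_integrable(1)[OF assms])

text \<open>Valid up to the boundary: \<open>corkscrew\<close> puts a ball of radius comparable to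
  \<open>\<delta>\<close> into \<open>\<Omega>\<close> near \<open>x\<close>, and on it the profile
  argument is at most 1/4. The powers of \<open>\<delta>\<close> cancel.\<close>

lemma VB_lower:
  assumes "2 * \<delta> \<le> lam"
  shows "\<alpha> * \<gamma> / 4 * (unit_ball_vol (real DIM('a)) / (4 * (1 + \<Lambda>)) ^ DIM('a)) \<le> VB (\<lambda>y. 1)"
proof -
  define \<rho> where "\<rho> = \<delta> / (4 * (1 + \<Lambda>))"
  have \<rho>: "0 < \<rho>" using \<delta> \<Lambda>1 by (simp add: \<rho>_def)
  obtain z where z: "ball z \<rho> \<subseteq> \<Omega> \<inter> ball x \<delta>" using corkscrew[OF x \<delta> assms] unfolding \<rho>_def by blast
  define c where "c = \<alpha> / \<delta> ^ DIM('a) * (\<gamma> / 4)"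
  have le: "indicator (ball z \<rho>) y * c \<le> indicator \<Omega> y * (kB \<delta> x y * 1)" for y
  proof (cases "y \<in> ball z \<rho>")
    case True
    then have y: "y \<in> \<Omega>" "norm (x - y) < \<delta>" using z by (auto simp: dist_norm subset_iff)
    have "(norm (x - y))\<^sup>2 \<le> \<delta>\<^sup>2" using y(2) by (intro power_mono) auto
    then have "(norm (x - y))\<^sup>2 / (4 * \<delta>\<^sup>2) \<le> 1/4" using \<delta> by (simp add: field_simps)
    then have "\<gamma> / 4 \<le> RR ((norm (x - y))\<^sup>2 / (4 * \<delta>\<^sup>2))" by (intro RR_lower) auto
    then have "c \<le> kB \<delta> x y" unfolding c_def rescaled_kernel_def
      using factor_pos[OF \<delta>] by (intro mult_left_mono) auto
    then show ?thesis using True y by simp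
  next
    case False
    then show ?thesis using kB_nonneg[OF \<delta>] by simp
  qed
  have ib: "integrable lborel (indicator (ball z \<rho>) :: 'a \<Rightarrow> real)"
    using emeasure_bounded_finite[of "ball z \<rho>"] by (auto simp: integrable_indicator_iff)
  have "(\<integral>y. indicator (ball z \<rho>) y * c \<partial>lborel) \<le> VB (\<lambda>y. 1)"
    unfolding VB_def by (rule integral_mono[OF _ V_integrable(2) le]) (use ib in auto)
  moreover have "(\<integral>y. indicator (ball z \<rho>) y * c \<partial>lborel) = measure lborel (ball z \<rho>) * c" by simp
  moreover have "measure lborel (ball z \<rho>) * c = \<alpha> * \<gamma> / 4 * (unit_ball_vol (real DIM('a)) / (4 * (1 + \<Lambda>)) ^ DIM('a))"
    using \<rho> \<delta> by (simp add: content_ball c_def \<rho>_def power_divide mult_ac)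
  ultimately show ?thesis by simp
qed

text \<open>For boundary errors that lack the factor \<open>1/\<mu>\<close>: an error of order
  \<open>\<delta> * B\<close> becomes one of order \<open>\<delta>\<^sup>2 * B / \<mu>\<close>, the
  size that the supersolution controls.\<close>

lemma B_le_\<mu>: "B \<delta> x \<le> 2 * \<delta> * (B \<delta> x / \<mu>_weight \<Omega> \<delta> x)"
proof -
  have "B \<delta> x * \<mu>_weight \<Omega> \<delta> x \<le> B \<delta> x * (2 * \<delta>)"
    using \<mu>_le B_nonneg[OF \<delta>] by (intro mult_left_mono)
  then show ?thesis using \<mu>_pos by (simp add: le_divide_eq mult_ac)
qed

text \<open>The difference of the quadratic is \<open>(y - x) \<bullet> x\<close> plus half the
  trace of the second moment, and by \<open>V2\<close> the trace gives the dimension times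
  \<open>VB (\<lambda>y. 1)\<close>. The boundary terms produced by \<open>V1\<close> and
  \<open>V2\<close> are multiples of \<open>B\<close>, hence of \<open>B / \<mu>\<close>; a large
  \<open>K\<close> outweighs them.\<close>

lemma quadratic_supersolution:
  assumes \<delta>1: "\<delta> \<le> 1" "2 * \<delta> \<le> lam"
  shows "real DIM('a) * VB (\<lambda>y. 1) + (B \<delta> x / \<mu>_weight \<Omega> \<delta> x) * (2 * K - (norm x)\<^sup>2 - 4 * norm x - 4 * real DIM('a))
     \<le> 1 / \<delta>\<^sup>2 * V (\<lambda>y. (K - (norm x)\<^sup>2 / 2) - (K - (norm y)\<^sup>2 / 2)) + 2 / \<mu>_weight \<Omega> \<delta> x * (B \<delta> x * (K - (norm x)\<^sup>2 / 2))"
proof -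
  define n where "n = real DIM('a)"
  define \<beta> where "\<beta> = B \<delta> x / \<mu>_weight \<Omega> \<delta> x"
  have \<beta>0: "0 \<le> \<beta>" using B_nonneg[OF \<delta>] \<mu>_pos by (simp add: \<beta>_def)
  have B2: "B \<delta> x \<le> 2 * \<beta>"
  proof -
    have "2 * \<delta> * \<beta> \<le> 2 * 1 * \<beta>" using \<delta>1 \<beta>0 by (intro mult_right_mono) auto
    then show ?thesis using B_le_\<mu> unfolding \<beta>_def by linarith
  qed
  have expand: "(K - (norm x)\<^sup>2 / 2) - (K - (norm y)\<^sup>2 / 2) = (y - x) \<bullet> x + (\<Sum>i\<in>Basis. ((y - x) \<bullet> i) * ((y - x) \<bullet> i)) / 2" for y :: 'a
  proof -
    have "(\<Sum>i\<in>Basis. ((y - x) \<bullet> i) * ((y - x) \<bullet> i)) = (y - x) \<bullet> (y - x)" by (rule euclidean_inner[symmetric])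
    then show ?thesis by (simp add: power2_norm_eq_inner inner_diff_left inner_diff_right inner_commute field_simps)
  qed
  have "V (\<lambda>y. (K - (norm x)\<^sup>2 / 2) - (K - (norm y)\<^sup>2 / 2)) =
     V (\<lambda>y. (y - x) \<bullet> x) + (\<Sum>i\<in>Basis. V (\<lambda>y. ((y - x) \<bullet> i) * ((y - x) \<bullet> i))) / 2"
  proof -
    have c1: "continuous_on UNIV (\<lambda>y::'a. (y - x) \<bullet> x)" by (intro continuous_intros)
    have c2: "continuous_on UNIV (\<lambda>y::'a. (\<Sum>i\<in>Basis. ((y - x) \<bullet> i) * ((y - x) \<bullet> i)) / 2)" by (intro continuous_intros) simp
    have "V (\<lambda>y. \<Sum>i\<in>Basis. ((y - x) \<bullet> i) * ((y - x) \<bullet> i)) = (\<Sum>i\<in>Basis. V (\<lambda>y. ((y - x) \<bullet> i) * ((y - x) \<bullet> i)))"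
      by (rule V_sum) (intro continuous_intros)
    then show ?thesis unfolding expand V_add[OF c1 c2] V_divide by simp
  qed
  also have "(\<Sum>i\<in>Basis. V (\<lambda>y. ((y - x) \<bullet> i) * ((y - x) \<bullet> i)))
     = (\<Sum>i\<in>Basis. 2 * \<delta>\<^sup>2 * (VB (\<lambda>y. 1) - S (\<lambda>y. ((y - x) \<bullet> i) * (N y \<bullet> i))))"
    unfolding V2 by (intro sum.cong refl) simp
  also have "\<dots> = 2 * \<delta>\<^sup>2 * (n * VB (\<lambda>y. 1) - (\<Sum>i\<in>Basis. S (\<lambda>y. ((y - x) \<bullet> i) * (N y \<bullet> i))))"
    by (simp add: sum_distrib_left[symmetric] sum_subtractf n_def)
  finally have "1 / \<delta>\<^sup>2 * V (\<lambda>y. (K - (norm x)\<^sup>2 / 2) - (K - (norm y)\<^sup>2 / 2)) =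
     - 2 * S (\<lambda>y. N y \<bullet> x) + (n * VB (\<lambda>y. 1) - (\<Sum>i\<in>Basis. S (\<lambda>y. ((y - x) \<bullet> i) * (N y \<bullet> i))))"
    unfolding V1 using \<delta> by (simp add: field_simps)
  moreover have "\<bar>S (\<lambda>y. N y \<bullet> x)\<bar> \<le> norm x * (2 * \<beta>)"
  proof -
    have "\<bar>S (\<lambda>y. N y \<bullet> x)\<bar> \<le> norm x * B \<delta> x"
      by (rule S_bound(2)) (auto intro: borel_measurable_\<sigma> N_meas N_le)
    also have "\<dots> \<le> norm x * (2 * \<beta>)" using B2 by (intro mult_left_mono) auto
    finally show ?thesis .
  qed
  moreover have "\<bar>\<Sum>i\<in>Basis. S (\<lambda>y. ((y - x) \<bullet> i) * (N y \<bullet> i))\<bar> \<le> n * (4 * \<beta>)"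
  proof -
    have "\<bar>S (\<lambda>y. ((y - x) \<bullet> i) * (N y \<bullet> i))\<bar> \<le> 4 * \<beta>" if i: "i \<in> Basis" for i
    proof -
      have "\<bar>S (\<lambda>y. ((y - x) \<bullet> i) * (N y \<bullet> i))\<bar> \<le> 2 * B \<delta> x"
      proof (rule S_bound(2))
        show "(\<lambda>y. ((y - x) \<bullet> i) * (N y \<bullet> i)) \<in> borel_measurable \<sigma>"
          by (intro borel_measurable_\<sigma> borel_measurable_times inner_power_meas N_meas)
        fix y assume y: "norm (y - x) < 2 * \<delta>"
        have "\<bar>((y - x) \<bullet> i) * (N y \<bullet> i)\<bar> \<le> 2 * 1"
          unfolding abs_mult using h_le[of y "2 * \<delta>" i] y i \<delta>1 N_le[of y i] by (intro mult_mono) auto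
        then show "\<bar>((y - x) \<bullet> i) * (N y \<bullet> i)\<bar> \<le> 2" by simp
      qed simp
      then show ?thesis using B2 by linarith
    qed
    then have "(\<Sum>i\<in>(Basis::'a set). \<bar>S (\<lambda>y. ((y - x) \<bullet> i) * (N y \<bullet> i))\<bar>) \<le> (\<Sum>i\<in>(Basis::'a set). 4 * \<beta>)"
      by (rule sum_mono)
    also have "\<dots> = n * (4 * \<beta>)" by (simp add: n_def)
    finally show ?thesis by (rule order_trans[OF sum_abs])
  qed
  moreover have "2 / \<mu>_weight \<Omega> \<delta> x * (B \<delta> x * (K - (norm x)\<^sup>2 / 2)) = \<beta> * (2 * K - (norm x)\<^sup>2)"
    using \<mu>_pos by (simp add: \<beta>_def field_simps)
  moreover have "\<beta> * (2 * K - (norm x)\<^sup>2 - 4 * norm x - 4 * n) = \<beta> * (2 * K - (norm x)\<^sup>2) - 2 * (norm x * (2 * \<beta>)) - n * (4 * \<beta>)"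
    by (simp add: algebra_simps)
  ultimately show ?thesis unfolding n_def[symmetric] \<beta>_def[symmetric] by linarith
qed

end

section \<open>Truncation error\<close>

locale poisson_setting = nonlocal_setting + T: C4_data \<Omega> "3 + \<Lambda>" "lam / (4 + \<Lambda>)" Mu u for Mu u
begin

lemma u_continuous: "continuous_on \<Omega> u" using Ck_on_continuous[OF T.C4, of "[]"] by simp

lemma laplacian_continuous: "continuous_on \<Omega> (laplacian u)"
  unfolding laplacian_def[abs_def] by (intro continuous_intros Ck_on_continuous[OF T.C4]) auto

lemma u_meas_\<sigma>: "u \<in> borel_measurable \<sigma>"
proof -
  have "continuous_on (frontier \<Omega>) u" by (rule continuous_on_subset[OF T.cu]) (simp add: frontier_def)
  then have "u \<in> borel_measurable (restrict_space borel (frontier \<Omega>))" by (rule borel_measurable_continuous_on_restrict)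
  then show ?thesis using measurable_cong_sets[OF sets_\<sigma> refl] by blast
qed

end

locale truncation_point = interior_point + poisson_setting +
  assumes \<delta>1: "\<delta> \<le> 1" and \<delta>small: "2 * \<delta> < lam / (4 + \<Lambda>) / (3 + \<Lambda>) / (3 + \<Lambda>) / (3 + \<Lambda>)"
begin

text \<open>The sum of the coefficients of \<open>\<delta>\<^sup>2\<close> and of
  \<open>\<delta>\<^sup>2 * B / \<mu>\<close> that are collected in
  \<open>consistency\<close>.\<close>

definition Cc :: real where
  "Cc = 2 * T.n * Mu * (140 * \<Lambda> + 1) + 8 * T.n^2 * Mu + 6 * T.n^3 * Mu + 8 * T.K2 + 16 * T.K4 * A\<^sub>0 + 4 * T.n * T.K2 * A\<^sub>0"

lemma near_radius:
  assumes "norm (y - x) \<le> 2 * \<delta>"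
  shows "norm (y - x) < lam / (4 + \<Lambda>) / (3 + \<Lambda>)" "norm (y - x) < lam / (4 + \<Lambda>) / (3 + \<Lambda>) / (3 + \<Lambda>) / (3 + \<Lambda>)"
proof -
  have C3: "1 \<le> 3 + \<Lambda>" using \<Lambda>1 by simp
  have e: "0 \<le> lam / (4 + \<Lambda>)" using lam \<Lambda>1 by simp
  have d: "a / (3 + \<Lambda>) \<le> a" if "0 \<le> a" for a
    using that C3 by (simp add: divide_le_eq mult_le_cancel_left1)
  have "lam / (4 + \<Lambda>) / (3 + \<Lambda>) / (3 + \<Lambda>) / (3 + \<Lambda>) \<le> lam / (4 + \<Lambda>) / (3 + \<Lambda>)"
  proof (rule order_trans)
    have n: "0 \<le> a / (3 + \<Lambda>)" if "0 \<le> a" for a using that C3 by simp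
    show "lam / (4 + \<Lambda>) / (3 + \<Lambda>) / (3 + \<Lambda>) / (3 + \<Lambda>) \<le> lam / (4 + \<Lambda>) / (3 + \<Lambda>) / (3 + \<Lambda>)"
      by (intro d n e)
    show "lam / (4 + \<Lambda>) / (3 + \<Lambda>) / (3 + \<Lambda>) \<le> lam / (4 + \<Lambda>) / (3 + \<Lambda>)" by (intro d n e)
  qed
  then show "norm (y - x) < lam / (4 + \<Lambda>) / (3 + \<Lambda>)" "norm (y - x) < lam / (4 + \<Lambda>) / (3 + \<Lambda>) / (3 + \<Lambda>) / (3 + \<Lambda>)"
    using assms \<delta>small by linarith+
qed

lemma U_bound: "set bs \<subseteq> Basis \<Longrightarrow> length bs \<le> 4 \<Longrightarrow> \<bar>T.U bs x\<bar> \<le> Mu"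
  by (rule T.bound[OF _ _ x])

lemma norm_grad_le: "norm (grad u x) \<le> T.n * Mu"
proof -
  have "norm (grad u x) \<le> (\<Sum>b\<in>Basis. \<bar>grad u x \<bullet> b\<bar>)" by (rule norm_le_l1)
  also have "\<dots> \<le> (\<Sum>b\<in>(Basis::'a set). Mu)"
    by (intro sum_mono) (simp add: grad_inner_Basis U_bound del: iter_partial.simps)
  finally show ?thesis by (simp add: T.n_def)
qed

text \<open>The Taylor forms without their factors 1/2 and 1/6, with the products grouped as in
  \<open>V2\<close> and \<open>V3_bound\<close>.\<close>

definition P2 :: "'a \<Rightarrow> real" where
  "P2 y = (\<Sum>i\<in>Basis. \<Sum>j\<in>Basis. T.U [i, j] x * (((y - x) \<bullet> i) * ((y - x) \<bullet> j)))"
definition P3 :: "'a \<Rightarrow> real" where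
  "P3 y = (\<Sum>i\<in>Basis. \<Sum>j\<in>Basis. \<Sum>k\<in>Basis. T.U [i, j, k] x * (((y - x) \<bullet> i) * (((y - x) \<bullet> j) * ((y - x) \<bullet> k))))"

lemma P_cont: "continuous_on UNIV P2" "continuous_on UNIV P3"
  unfolding P2_def[abs_def] P3_def[abs_def] by (intro continuous_intros)+

text \<open>\<open>V2\<close> splits each second moment into a multiple of
  \<open>j \<bullet> i\<close>, which summed against the second derivatives gives the Laplacian, and
  a boundary term of order \<open>\<delta> * B\<close>. In \<open>consistency\<close> the Laplacian
  term cancels against that of \<open>VB_laplacian\<close>.\<close>

lemma V_P2: "\<bar>V P2 - 2 * \<delta>\<^sup>2 * (laplacian u x * VB (\<lambda>y. 1))\<bar> \<le> 2 * \<delta>\<^sup>2 * (T.n^2 * Mu * (2 * \<delta> * B \<delta> x))"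
proof -
  have "V P2 = (\<Sum>i\<in>Basis. \<Sum>j\<in>Basis. T.U [i, j] x * V (\<lambda>y. ((y - x) \<bullet> i) * ((y - x) \<bullet> j)))"
    unfolding P2_def[abs_def]
    by (subst V_sum, intro continuous_intros, rule sum.cong[OF refl], subst V_sum, intro continuous_intros)
      (simp add: V_cmult del: iter_partial.simps)
  also have "\<dots> = (\<Sum>i\<in>Basis. \<Sum>j\<in>Basis. 2 * \<delta>\<^sup>2 * (T.U [i, j] x * (j \<bullet> i) * VB (\<lambda>y. 1)) - 2 * \<delta>\<^sup>2 * (T.U [i, j] x * S (\<lambda>y. ((y - x) \<bullet> j) * (N y \<bullet> i))))"
    unfolding V2 by (intro sum.cong refl) (simp add: algebra_simps del: iter_partial.simps)
  also have "\<dots> = 2 * \<delta>\<^sup>2 * ((\<Sum>i\<in>Basis. \<Sum>j\<in>Basis. T.U [i, j] x * (j \<bullet> i)) * VB (\<lambda>y. 1))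
     - 2 * \<delta>\<^sup>2 * (\<Sum>i\<in>Basis. \<Sum>j\<in>Basis. T.U [i, j] x * S (\<lambda>y. ((y - x) \<bullet> j) * (N y \<bullet> i)))"
    by (simp add: sum_subtractf sum_distrib_left sum_distrib_right del: iter_partial.simps)
  also have "(\<Sum>i\<in>Basis. \<Sum>j\<in>Basis. T.U [i, j] x * (j \<bullet> i)) = laplacian u x"
    unfolding laplacian_def
  proof (rule sum.cong[OF refl])
    fix i :: 'a assume i: "i \<in> Basis"
    have "(\<Sum>j\<in>Basis. T.U [i, j] x * (j \<bullet> i)) = (\<Sum>j\<in>Basis. if j = i then T.U [i, j] x else 0)"
      using i by (intro sum.cong refl) (simp add: inner_Basis del: iter_partial.simps)
    also have "\<dots> = T.U [i, i] x" using i by (simp del: iter_partial.simps)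
    finally show "(\<Sum>j\<in>Basis. T.U [i, j] x * (j \<bullet> i)) = T.U [i, i] x" .
  qed
  finally have eq: "V P2 - 2 * \<delta>\<^sup>2 * (laplacian u x * VB (\<lambda>y. 1)) =
    - (2 * \<delta>\<^sup>2 * (\<Sum>i\<in>Basis. \<Sum>j\<in>Basis. T.U [i, j] x * S (\<lambda>y. ((y - x) \<bullet> j) * (N y \<bullet> i))))" by linarith
  have "\<bar>\<Sum>i\<in>Basis. \<Sum>j\<in>Basis. T.U [i, j] x * S (\<lambda>y. ((y - x) \<bullet> j) * (N y \<bullet> i))\<bar> \<le> (\<Sum>i\<in>(Basis::'a set). \<Sum>j\<in>(Basis::'a set). Mu * (2 * \<delta> * B \<delta> x))"
  proof (intro order_trans[OF sum_abs sum_mono] )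
    fix i j :: 'a assume ij: "i \<in> Basis" "j \<in> Basis"
    have "\<bar>S (\<lambda>y. ((y - x) \<bullet> j) * (N y \<bullet> i))\<bar> \<le> 2 * \<delta> * B \<delta> x"
    proof (rule S_bound(2))
      show "(\<lambda>y. ((y - x) \<bullet> j) * (N y \<bullet> i)) \<in> borel_measurable \<sigma>"
        by (intro borel_measurable_\<sigma> borel_measurable_times inner_power_meas N_meas)
      fix y assume y: "norm (y - x) < 2 * \<delta>"
      have "\<bar>((y - x) \<bullet> j) * (N y \<bullet> i)\<bar> \<le> (2 * \<delta>) * 1"
        unfolding abs_mult using h_le[of y "2 * \<delta>" j] y ij \<delta> N_le[of y i] by (intro mult_mono) auto
      then show "\<bar>((y - x) \<bullet> j) * (N y \<bullet> i)\<bar> \<le> 2 * \<delta>" by simp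
    qed (use \<delta> in simp)
    then show "\<bar>T.U [i, j] x * S (\<lambda>y. ((y - x) \<bullet> j) * (N y \<bullet> i))\<bar> \<le> Mu * (2 * \<delta> * B \<delta> x)"
      unfolding abs_mult using U_bound[of "[i, j]"] ij T.M by (intro mult_mono) auto
  qed
  also have "\<dots> = T.n^2 * Mu * (2 * \<delta> * B \<delta> x)" by (simp add: T.n_def power2_eq_square)
  finally have "\<bar>\<Sum>i\<in>Basis. \<Sum>j\<in>Basis. T.U [i, j] x * S (\<lambda>y. ((y - x) \<bullet> j) * (N y \<bullet> i))\<bar> \<le> T.n^2 * Mu * (2 * \<delta> * B \<delta> x)" .
  then show ?thesis unfolding eq abs_minus_cancel abs_mult by (intro mult_mono) auto
qed

lemma V_P3: "\<bar>V P3\<bar> \<le> T.n^3 * Mu * (16 * \<delta>^4 * B \<delta> x)"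
proof -
  have "V P3 = (\<Sum>i\<in>Basis. \<Sum>j\<in>Basis. \<Sum>k\<in>Basis. T.U [i, j, k] x * V (\<lambda>y. ((y - x) \<bullet> i) * (((y - x) \<bullet> j) * ((y - x) \<bullet> k))))"
    unfolding P3_def[abs_def]
    by (subst V_sum, intro continuous_intros, rule sum.cong[OF refl], subst V_sum, intro continuous_intros,
        rule sum.cong[OF refl], subst V_sum, intro continuous_intros)
      (simp add: V_cmult del: iter_partial.simps)
  also have "\<bar>\<dots>\<bar> \<le> (\<Sum>i\<in>(Basis::'a set). \<Sum>j\<in>(Basis::'a set). \<Sum>k\<in>(Basis::'a set). Mu * (16 * \<delta>^4 * B \<delta> x))"
  proof (intro order_trans[OF sum_abs sum_mono])
    fix i j k :: 'a assume b: "i \<in> Basis" "j \<in> Basis" "k \<in> Basis"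
    show "\<bar>T.U [i, j, k] x * V (\<lambda>y. ((y - x) \<bullet> i) * (((y - x) \<bullet> j) * ((y - x) \<bullet> k)))\<bar> \<le> Mu * (16 * \<delta>^4 * B \<delta> x)"
      unfolding abs_mult[of "T.U _ _"] using U_bound[of "[i, j, k]"] b T.M
      by (intro mult_mono V3_bound) auto
  qed
  also have "\<dots> = T.n^3 * Mu * (16 * \<delta>^4 * B \<delta> x)" by (simp add: T.n_def eval_nat_numeral)
  finally show ?thesis .
qed

text \<open>The linear part of the Laplacian is of order \<open>\<delta>\<close> pointwise; it
  contributes only \<open>\<delta>\<^sup>2 * B\<close> because of \<open>VB1_bound\<close>.\<close>

lemma VB_laplacian:
  "\<bar>VB (laplacian u) - laplacian u x * VB (\<lambda>y. 1)\<bar> \<le> T.n^2 * Mu * (2 * \<delta>\<^sup>2 * B \<delta> x) + (T.n * T.K2 * (4 * \<delta>\<^sup>2)) * A\<^sub>0"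
proof -
  define c where "c = (\<lambda>k. \<Sum>i\<in>Basis. T.U [k, i, i] x)"
  define L where "L = (\<lambda>y. \<Sum>k\<in>Basis. c k * ((y - x) \<bullet> k))"
  define E where "E = (\<lambda>y. laplacian u y - laplacian u x - L y)"
  have cL: "continuous_on UNIV L" unfolding L_def by (intro continuous_intros)
  have mE: "(\<lambda>y. indicator \<Omega> y * E y) \<in> borel_measurable borel"
    unfolding E_def by (intro continuous_indicator_\<Omega> continuous_intros laplacian_continuous continuous_on_subset[OF cL]) auto
  have bE: "\<bar>E y\<bar> \<le> T.n * T.K2 * (4 * \<delta>\<^sup>2)" if y: "y \<in> \<Omega>" "norm (y - x) \<le> 2 * \<delta>" for y
  proof -
    have "\<bar>E y\<bar> \<le> T.n * T.K2 * (norm (y - x))\<^sup>2"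
      unfolding E_def L_def c_def by (rule T.remainder_laplacian[OF x y(1) near_radius(1)[OF y(2)]])
    also have "\<dots> \<le> T.n * T.K2 * (4 * \<delta>\<^sup>2)"
      using power_mono[OF y(2), of 2] T.n0 T.K_nonneg by (intro mult_left_mono) (auto simp: power_mult_distrib)
    finally show ?thesis .
  qed
  have E0: "0 \<le> T.n * T.K2 * (4 * \<delta>\<^sup>2)" using T.n0 T.K_nonneg by simp
  note iE = \<Omega>_integrable[OF \<delta> mE bE E0, where K=RR]
  have "VB (laplacian u) = (\<integral>y. laplacian u x * (indicator \<Omega> y * (kB \<delta> x y * 1)) + indicator \<Omega> y * (kB \<delta> x y * L y) + indicator \<Omega> y * (kB \<delta> x y * E y) \<partial>lborel)"
    unfolding VB_def by (intro Bochner_Integration.integral_cong refl) (simp add: E_def algebra_simps)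
  also have "\<dots> = laplacian u x * VB (\<lambda>y. 1) + VB L + VB E"
    unfolding VB_def using V_integrable(2)[of "\<lambda>_. 1"] V_integrable(2)[OF cL] iE(1) by simp
  also have "VB L = (\<Sum>k\<in>Basis. c k * VB (\<lambda>y. (y - x) \<bullet> k))"
  proof -
    have "VB L = (\<integral>y. (\<Sum>k\<in>Basis. c k * (indicator \<Omega> y * (kB \<delta> x y * ((y - x) \<bullet> k)))) \<partial>lborel)"
      unfolding VB_def L_def by (intro Bochner_Integration.integral_cong refl) (simp add: sum_distrib_left mult_ac)
    also have "\<dots> = (\<Sum>k\<in>Basis. \<integral>y. c k * (indicator \<Omega> y * (kB \<delta> x y * ((y - x) \<bullet> k))) \<partial>lborel)"
      by (rule Bochner_Integration.integral_sum, rule integrable_mult_right, rule V_integrable(2)) (intro continuous_intros)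
    finally show ?thesis by (simp add: VB_def)
  qed
  finally have eq: "VB (laplacian u) - laplacian u x * VB (\<lambda>y. 1) = (\<Sum>k\<in>Basis. c k * VB (\<lambda>y. (y - x) \<bullet> k)) + VB E" by simp
  have "\<bar>\<Sum>k\<in>Basis. c k * VB (\<lambda>y. (y - x) \<bullet> k)\<bar> \<le> (\<Sum>k\<in>(Basis::'a set). (T.n * Mu) * (2 * \<delta>\<^sup>2 * 1 * B \<delta> x))"
  proof (intro order_trans[OF sum_abs sum_mono])
    fix k :: 'a assume k: "k \<in> Basis"
    have "\<bar>c k\<bar> \<le> (\<Sum>i\<in>(Basis::'a set). Mu)"
      unfolding c_def by (intro order_trans[OF sum_abs sum_mono] U_bound) (use k in auto)
    then have "\<bar>c k\<bar> \<le> T.n * Mu" by (simp add: T.n_def)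
    then show "\<bar>c k * VB (\<lambda>y. (y - x) \<bullet> k)\<bar> \<le> (T.n * Mu) * (2 * \<delta>\<^sup>2 * 1 * B \<delta> x)"
      unfolding abs_mult using VB1_bound[of k] k T.n0 T.M by (intro mult_mono) auto
  qed
  also have "\<dots> = T.n^2 * Mu * (2 * \<delta>\<^sup>2 * B \<delta> x)" by (simp add: T.n_def power2_eq_square)
  finally have "\<bar>\<Sum>k\<in>Basis. c k * VB (\<lambda>y. (y - x) \<bullet> k)\<bar> \<le> T.n^2 * Mu * (2 * \<delta>\<^sup>2 * B \<delta> x)" .
  moreover have "\<bar>VB E\<bar> \<le> (T.n * T.K2 * (4 * \<delta>\<^sup>2)) * A\<^sub>0" unfolding VB_def using iE(2) by simp
  ultimately show ?thesis unfolding eq by linarith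
qed

text \<open>The remainder of order four is at most a multiple of \<open>\<delta>^4\<close> on the
  support, and the factor \<open>1 / \<delta>\<^sup>2\<close> of the equation leaves the required
  \<open>\<delta>\<^sup>2\<close>.\<close>

lemma V_u:
  "\<bar>V (\<lambda>y. u x - u y) - (2 * \<delta>\<^sup>2 * S (\<lambda>y. N y \<bullet> grad u x) - V P2 / 2 - V P3 / 6)\<bar> \<le> (T.K4 * (16 * \<delta>^4)) * A\<^sub>0"
proof -
  define P where "P = (\<lambda>y. (y - x) \<bullet> grad u x + P2 y / 2 + P3 y / 6)"
  define E where "E = (\<lambda>y. u y - u x - P y)"
  have cP: "continuous_on UNIV P" unfolding P_def by (intro continuous_intros P_cont) auto
  have mE: "(\<lambda>y. indicator \<Omega> y * E y) \<in> borel_measurable borel"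
    unfolding E_def by (intro continuous_indicator_\<Omega> continuous_intros u_continuous continuous_on_subset[OF cP]) auto
  have bE: "\<bar>E y\<bar> \<le> T.K4 * (16 * \<delta>^4)" if y: "y \<in> \<Omega>" "norm (y - x) \<le> 2 * \<delta>" for y
  proof -
    have "(\<Sum>i\<in>Basis. T.U [i] x * ((y - x) \<bullet> i)) = (y - x) \<bullet> grad u x"
      by (simp add: grad_def inner_sum_right del: iter_partial.simps)
    then have "E y = u y - u x - (\<Sum>i\<in>Basis. T.U [i] x * ((y - x) \<bullet> i))
     - (\<Sum>i\<in>Basis. \<Sum>j\<in>Basis. T.U [i, j] x * ((y - x) \<bullet> i) * ((y - x) \<bullet> j)) / 2
     - (\<Sum>i\<in>Basis. \<Sum>j\<in>Basis. \<Sum>k\<in>Basis. T.U [i, j, k] x * ((y - x) \<bullet> i) * ((y - x) \<bullet> j) * ((y - x) \<bullet> k)) / 6"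
      unfolding E_def P_def P2_def P3_def by (simp only: mult.assoc diff_diff_eq)
    then have "\<bar>E y\<bar> \<le> T.K4 * norm (y - x) ^ 4"
      using T.remainder4[OF x y(1) near_radius(2)[OF y(2)]] by simp
    also have "\<dots> \<le> T.K4 * (16 * \<delta>^4)"
      using power_mono[OF y(2), of 4] T.K_nonneg by (intro mult_left_mono) (auto simp: power_mult_distrib)
    finally show ?thesis .
  qed
  have E0: "0 \<le> T.K4 * (16 * \<delta>^4)" using T.K_nonneg \<delta> by simp
  note iE = \<Omega>_integrable[OF \<delta> mE bE E0, where K=R]
  have "V (\<lambda>y. u x - u y) = (\<integral>y. - (indicator \<Omega> y * (kR \<delta> x y * P y)) - indicator \<Omega> y * (kR \<delta> x y * E y) \<partial>lborel)"
    unfolding V_def by (intro Bochner_Integration.integral_cong refl) (simp add: E_def algebra_simps)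
  also have "\<dots> = - V P - V E"
    unfolding V_def using V_integrable(1)[OF cP] iE(1) by simp
  also have "V P = V (\<lambda>y. (y - x) \<bullet> grad u x) + V P2 / 2 + V P3 / 6"
  proof -
    have c1: "continuous_on UNIV (\<lambda>y. (y - x) \<bullet> grad u x + P2 y / 2)" by (intro continuous_intros P_cont) auto
    have c2: "continuous_on UNIV (\<lambda>y. P3 y / 6)" "continuous_on UNIV (\<lambda>y. P2 y / 2)"
      by (intro continuous_intros P_cont; simp)+
    have c3: "continuous_on UNIV (\<lambda>y. (y - x) \<bullet> grad u x)" by (intro continuous_intros)
    show ?thesis unfolding P_def V_add[OF c1 c2(1)] V_add[OF c3 c2(2)] V_divide ..
  qed
  finally have "V (\<lambda>y. u x - u y) - (2 * \<delta>\<^sup>2 * S (\<lambda>y. N y \<bullet> grad u x) - V P2 / 2 - V P3 / 6) = - V E"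
    unfolding V1 by simp
  moreover have "\<bar>V E\<bar> \<le> (T.K4 * (16 * \<delta>^4)) * A\<^sub>0" unfolding V_def using iE(2) by simp
  ultimately show ?thesis by simp
qed

text \<open>A first-order expansion is precise enough on the boundary: the error
  \<open>\<delta>\<^sup>2 * B\<close> is multiplied by \<open>2/\<mu>\<close> in the equation, which
  is the size that the supersolution controls.\<close>

lemma S_u:
  "\<bar>S (\<lambda>y. u x - u y) + S (\<lambda>y. grad u x \<bullet> (y - x))\<bar> \<le> T.K2 * (4 * \<delta>\<^sup>2) * B \<delta> x"
proof -
  define E where "E = (\<lambda>y. u y - u x - grad u x \<bullet> (y - x))"
  have ip: "(\<lambda>y. grad u x \<bullet> (y - x)) \<in> borel_measurable \<sigma>"
    using inner_power_meas by (intro borel_measurable_\<sigma>) (simp add: inner_commute)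
  have mE: "E \<in> borel_measurable \<sigma>"
    unfolding E_def by (intro borel_measurable_diff u_meas_\<sigma> borel_measurable_const ip)
  have bE: "\<bar>E y\<bar> \<le> T.K2 * (4 * \<delta>\<^sup>2)" if y: "y \<in> frontier \<Omega>" "norm (y - x) < 2 * \<delta>" for y
  proof -
    have cl: "y \<in> closure \<Omega>" using y(1) by (simp add: frontier_def)
    have y2: "norm (y - x) \<le> 2 * \<delta>" using y(2) by simp
    have "\<bar>E y\<bar> \<le> T.K2 * (norm (y - x))\<^sup>2"
      unfolding E_def by (rule T.remainder_boundary[OF x cl near_radius(1)[OF y2]])
    also have "\<dots> \<le> T.K2 * (4 * \<delta>\<^sup>2)"
      using power_mono[OF y2, of 2] T.K_nonneg by (intro mult_left_mono) (auto simp: power_mult_distrib)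
    finally show ?thesis .
  qed
  have E0: "0 \<le> T.K2 * (4 * \<delta>\<^sup>2)" using T.K_nonneg by simp
  have bp: "\<bar>grad u x \<bullet> (y - x)\<bar> \<le> 2 * \<delta> * norm (grad u x)" if "norm (y - x) < 2 * \<delta>" for y
    using h_le[of y "2 * \<delta>" "grad u x"] that by (simp add: inner_commute)
  have i2: "integrable \<sigma> (\<lambda>y. kB \<delta> x y * (grad u x \<bullet> (y - x)))"
    by (rule S_bound(1)[OF ip bp]) (use \<delta> in auto)
  note iE = S_bound[OF mE bE E0]
  have "S (\<lambda>y. u x - u y) = (\<integral>y. - (kB \<delta> x y * (grad u x \<bullet> (y - x))) - kB \<delta> x y * E y \<partial>\<sigma>)"
    unfolding S_def by (intro Bochner_Integration.integral_cong refl) (simp add: E_def algebra_simps)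
  also have "\<dots> = - S (\<lambda>y. grad u x \<bullet> (y - x)) - S E"
    unfolding S_def using iE(1) i2 by simp
  finally show ?thesis using iE(2) by simp
qed

lemma resid_eq:
  "resid u \<delta> x = 1 / \<delta>\<^sup>2 * V (\<lambda>y. u x - u y) + 2 / \<mu>_weight \<Omega> \<delta> x * S (\<lambda>y. u x - u y) + VB (laplacian u)"
proof -
  have "(\<lambda>y. kR \<delta> x y * (indicator \<Omega> y * (u x - u y))) \<in> borel_measurable borel"
    by (intro borel_measurable_times kR_meas continuous_indicator_\<Omega> continuous_intros u_continuous)
  then have m1: "(\<lambda>y. indicator \<Omega> y * (kR \<delta> x y * (u x - u y))) \<in> borel_measurable borel"
    by (simp add: mult.left_commute)
  have "(\<lambda>y. kB \<delta> x y * (indicator \<Omega> y * laplacian u y)) \<in> borel_measurable borel"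
    by (intro borel_measurable_times kB_meas continuous_indicator_\<Omega> laplacian_continuous)
  then have m2: "(\<lambda>y. indicator \<Omega> y * (kB \<delta> x y * laplacian u y)) \<in> borel_measurable borel"
    by (simp add: mult.left_commute)
  show ?thesis
    unfolding resid_def integral_lebesgue_on_\<Omega>[OF m1] integral_lebesgue_on_\<Omega>[OF m2] V_def VB_def S_def ..
qed

text \<open>The first-order term contributes \<open>2 * S (\<lambda>y. N y \<bullet> p)\<close>
  through the interior integral and \<open>- (2/\<mu>) * S (\<lambda>y. p \<bullet> (y - x))\<close>
  through the boundary integral. Each is only of order \<open>\<delta> * B / \<mu>\<close>; their
  sum is \<open>2/\<mu>\<close> times the quantity in \<open>boundary_cancellation\<close>.\<close>

lemma consistency: "\<bar>resid u \<delta> x\<bar> \<le> Cc * \<delta>\<^sup>2 * (1 + B \<delta> x / \<mu>_weight \<Omega> \<delta> x)"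
proof -
  define \<mu> where "\<mu> = \<mu>_weight \<Omega> \<delta> x"
  define \<beta> where "\<beta> = B \<delta> x / \<mu>"
  define p where "p = grad u x"
  define V1' where "V1' = VB (\<lambda>y. 1)"
  define s1 where "s1 = S (\<lambda>y. N y \<bullet> p)"
  define s2 where "s2 = S (\<lambda>y. p \<bullet> (y - x))"
  have \<mu>0: "0 < \<mu>" using \<mu>_pos by (simp add: \<mu>_def)
  have B0: "0 \<le> B \<delta> x" by (rule B_nonneg[OF \<delta>])
  have \<beta>0: "0 \<le> \<beta>" using B0 \<mu>0 by (simp add: \<beta>_def)
  have B\<beta>: "B \<delta> x = \<mu> * \<beta>" using \<mu>0 by (simp add: \<beta>_def)
  have \<delta>B: "\<delta> * B \<delta> x \<le> 2 * \<delta>\<^sup>2 * \<beta>"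
    using mult_left_mono[OF B_le_\<mu>, of \<delta>] \<delta> by (simp add: \<beta>_def \<mu>_def power2_eq_square mult_ac)
  have \<delta>2B: "\<delta>\<^sup>2 * B \<delta> x \<le> 2 * \<delta>\<^sup>2 * \<beta>"
  proof -
    have "\<delta> * (\<delta> * B \<delta> x) \<le> 1 * (\<delta> * B \<delta> x)" using \<delta>1 \<delta> B0 by (intro mult_right_mono) auto
    then show ?thesis using \<delta>B by (simp add: power2_eq_square)
  qed
  define a1 where "a1 = V (\<lambda>y. u x - u y) - (2 * \<delta>\<^sup>2 * s1 - V P2 / 2 - V P3 / 6)"
  define a2 where "a2 = V P2 - 2 * \<delta>\<^sup>2 * (laplacian u x * V1')"
  define a3 where "a3 = S (\<lambda>y. u x - u y) + s2"
  define a4 where "a4 = VB (laplacian u) - laplacian u x * V1'"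
  have a1: "\<bar>a1\<bar> \<le> (T.K4 * (16 * \<delta>^4)) * A\<^sub>0" unfolding a1_def s1_def p_def by (rule V_u)
  have a2: "\<bar>a2\<bar> \<le> 2 * \<delta>\<^sup>2 * (T.n^2 * Mu * (2 * \<delta> * B \<delta> x))" unfolding a2_def V1'_def by (rule V_P2)
  have a3: "\<bar>a3\<bar> \<le> T.K2 * (4 * \<delta>\<^sup>2) * B \<delta> x" unfolding a3_def s2_def p_def by (rule S_u)
  have a4: "\<bar>a4\<bar> \<le> T.n^2 * Mu * (2 * \<delta>\<^sup>2 * B \<delta> x) + (T.n * T.K2 * (4 * \<delta>\<^sup>2)) * A\<^sub>0"
    unfolding a4_def V1'_def by (rule VB_laplacian)
  have s12: "S (\<lambda>y. p \<bullet> (\<mu> *\<^sub>R N y - (y - x))) = \<mu> * s1 - s2"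
  proof -
    have i1: "integrable \<sigma> (\<lambda>y. kB \<delta> x y * (N y \<bullet> p))"
      by (rule S_bound(1)[where c="norm p"]) (auto intro: borel_measurable_\<sigma> N_meas N_le)
    have i2: "integrable \<sigma> (\<lambda>y. kB \<delta> x y * (p \<bullet> (y - x)))"
    proof (rule S_bound(1)[where c="2 * \<delta> * norm p"])
      show "(\<lambda>y. p \<bullet> (y - x)) \<in> borel_measurable \<sigma>"
        using inner_power_meas by (intro borel_measurable_\<sigma>) (simp add: inner_commute)
      show "\<bar>p \<bullet> (y - x)\<bar> \<le> 2 * \<delta> * norm p" if "norm (y - x) < 2 * \<delta>" for y
        using h_le[of y "2 * \<delta>" p] that by (simp add: inner_commute)
    qed (use \<delta> in simp)
    have "S (\<lambda>y. p \<bullet> (\<mu> *\<^sub>R N y - (y - x))) = (\<integral>y. \<mu> * (kB \<delta> x y * (N y \<bullet> p)) - kB \<delta> x y * (p \<bullet> (y - x)) \<partial>\<sigma>)"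
      unfolding S_def by (intro Bochner_Integration.integral_cong refl) (simp add: inner_diff_right inner_commute algebra_simps)
    then show ?thesis unfolding s1_def s2_def S_def using i1 i2 by simp
  qed
  have bc: "\<bar>\<mu> * s1 - s2\<bar> \<le> (T.n * Mu) * \<delta>\<^sup>2 * (140 * \<Lambda> + 1) * B \<delta> x"
  proof -
    have "\<bar>\<mu> * s1 - s2\<bar> \<le> norm p * \<delta>\<^sup>2 * (140 * \<Lambda> + 1) * B \<delta> x"
      using boundary_cancellation[of p] \<delta>1 s12 unfolding \<mu>_def[symmetric] by simp
    also have "\<dots> \<le> (T.n * Mu) * \<delta>\<^sup>2 * (140 * \<Lambda> + 1) * B \<delta> x"
      using norm_grad_le B0 \<Lambda>1 unfolding p_def by (intro mult_right_mono) auto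
    finally show ?thesis .
  qed
  have "resid u \<delta> x = 2 / \<mu> * (\<mu> * s1 - s2) - a2 / (2 * \<delta>\<^sup>2) - V P3 / (6 * \<delta>\<^sup>2) + a1 / \<delta>\<^sup>2 + 2 / \<mu> * a3 + a4"
  proof -
    have e1: "V (\<lambda>y. u x - u y) = 2 * \<delta>\<^sup>2 * s1 - V P2 / 2 - V P3 / 6 + a1" by (simp add: a1_def)
    have e2: "V P2 = 2 * \<delta>\<^sup>2 * (laplacian u x * V1') + a2" by (simp add: a2_def)
    have e3: "S (\<lambda>y. u x - u y) = a3 - s2" by (simp add: a3_def)
    have e4: "VB (laplacian u) = laplacian u x * V1' + a4" by (simp add: a4_def)
    \<comment> \<open>Read with \<open>d = \<delta>\<^sup>2\<close>, \<open>m = \<mu>\<close>,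
      \<open>s = s1\<close>, \<open>k = s2\<close> and \<open>t\<close> the Laplacian times
      \<open>V1'\<close>: the two occurrences of \<open>t\<close> cancel, and \<open>s\<close> and
      \<open>k\<close> combine.\<close>
    have "1 / d * (2 * d * s - (2 * d * t + b) / 2 - w / 6 + c) + 2 / m * (f - k) + (t + g) =
       2 / m * (m * s - k) - b / (2 * d) - w / (6 * d) + c / d + 2 / m * f + g"
      if "d \<noteq> 0" "m \<noteq> 0" for d s t b w c m f k g :: real
      using that by (simp add: field_simps)
    then show ?thesis unfolding resid_eq e1 e2 e3 e4 \<mu>_def[symmetric] using \<delta> \<mu>0 by simp
  qed
  moreover have "\<bar>2 / \<mu> * (\<mu> * s1 - s2)\<bar> \<le> 2 * T.n * Mu * (140 * \<Lambda> + 1) * (\<delta>\<^sup>2 * \<beta>)"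
  proof -
    have "\<bar>2 / \<mu> * (\<mu> * s1 - s2)\<bar> \<le> 2 / \<mu> * ((T.n * Mu) * \<delta>\<^sup>2 * (140 * \<Lambda> + 1) * B \<delta> x)"
      unfolding abs_mult using bc \<mu>0 by (intro mult_mono) auto
    then show ?thesis using \<mu>0 unfolding B\<beta> by (simp add: mult_ac)
  qed
  moreover have "\<bar>a2 / (2 * \<delta>\<^sup>2)\<bar> \<le> 4 * T.n^2 * Mu * (\<delta>\<^sup>2 * \<beta>)"
  proof -
    have "\<bar>a2 / (2 * \<delta>\<^sup>2)\<bar> \<le> T.n^2 * Mu * (2 * \<delta> * B \<delta> x)"
      using a2 \<delta> by (simp add: abs_divide divide_le_eq mult_ac)
    also have "\<dots> = 2 * (T.n^2 * Mu) * (\<delta> * B \<delta> x)" by simp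
    also have "\<dots> \<le> 2 * (T.n^2 * Mu) * (2 * \<delta>\<^sup>2 * \<beta>)" using \<delta>B T.M by (intro mult_left_mono) auto
    finally show ?thesis by (simp add: mult_ac)
  qed
  moreover have "\<bar>V P3 / (6 * \<delta>\<^sup>2)\<bar> \<le> 6 * T.n^3 * Mu * (\<delta>\<^sup>2 * \<beta>)"
  proof -
    have "\<bar>V P3 / (6 * \<delta>\<^sup>2)\<bar> = \<bar>V P3\<bar> / (6 * \<delta>\<^sup>2)" by (simp add: abs_divide)
    also have "\<dots> \<le> (T.n^3 * Mu * (16 * \<delta>^4 * B \<delta> x)) / (6 * \<delta>\<^sup>2)" using V_P3 \<delta> by (intro divide_right_mono) auto
    also have "\<dots> = (8 / 3) * (T.n^3 * Mu) * (\<delta>\<^sup>2 * B \<delta> x)" using \<delta> by (simp add: field_simps eval_nat_numeral)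
    also have "\<dots> \<le> 3 * (T.n^3 * Mu) * (\<delta>\<^sup>2 * B \<delta> x)" using T.M T.n0 B0 by (intro mult_right_mono) auto
    also have "\<dots> \<le> 3 * (T.n^3 * Mu) * (2 * \<delta>\<^sup>2 * \<beta>)" using T.M T.n0 by (intro mult_left_mono \<delta>2B) auto
    finally show ?thesis by (simp add: mult_ac)
  qed
  moreover have "\<bar>a1 / \<delta>\<^sup>2\<bar> \<le> 16 * T.K4 * A\<^sub>0 * \<delta>\<^sup>2"
    using a1 \<delta> by (simp add: abs_divide divide_le_eq eval_nat_numeral mult_ac)
  moreover have "\<bar>2 / \<mu> * a3\<bar> \<le> 8 * T.K2 * (\<delta>\<^sup>2 * \<beta>)"
  proof -
    have "\<bar>2 / \<mu> * a3\<bar> \<le> 2 / \<mu> * (T.K2 * (4 * \<delta>\<^sup>2) * B \<delta> x)"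
      unfolding abs_mult using a3 \<mu>0 by (intro mult_mono) auto
    then show ?thesis using \<mu>0 unfolding B\<beta> by (simp add: mult_ac)
  qed
  moreover have "\<bar>a4\<bar> \<le> 4 * T.n^2 * Mu * (\<delta>\<^sup>2 * \<beta>) + 4 * T.n * T.K2 * A\<^sub>0 * \<delta>\<^sup>2"
  proof -
    have "T.n^2 * Mu * (2 * \<delta>\<^sup>2 * B \<delta> x) = 2 * (T.n^2 * Mu) * (\<delta>\<^sup>2 * B \<delta> x)" by simp
    also have "\<dots> \<le> 2 * (T.n^2 * Mu) * (2 * \<delta>\<^sup>2 * \<beta>)" using \<delta>2B T.M by (intro mult_left_mono) auto
    finally show ?thesis using a4 by (simp add: mult_ac)
  qed
  ultimately have "\<bar>resid u \<delta> x\<bar> \<le> 2 * T.n * Mu * (140 * \<Lambda> + 1) * (\<delta>\<^sup>2 * \<beta>) + 4 * T.n^2 * Mu * (\<delta>\<^sup>2 * \<beta>)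
    + 6 * T.n^3 * Mu * (\<delta>\<^sup>2 * \<beta>) + 16 * T.K4 * A\<^sub>0 * \<delta>\<^sup>2 + 8 * T.K2 * (\<delta>\<^sup>2 * \<beta>)
    + (4 * T.n^2 * Mu * (\<delta>\<^sup>2 * \<beta>) + 4 * T.n * T.K2 * A\<^sub>0 * \<delta>\<^sup>2)" by linarith
  also have "\<dots> = (2 * T.n * Mu * (140 * \<Lambda> + 1) + 8 * T.n^2 * Mu + 6 * T.n^3 * Mu + 8 * T.K2) * (\<delta>\<^sup>2 * \<beta>)
    + (16 * T.K4 * A\<^sub>0 + 4 * T.n * T.K2 * A\<^sub>0) * \<delta>\<^sup>2" by (simp add: algebra_simps)
  also have "\<dots> \<le> Cc * (\<delta>\<^sup>2 * \<beta>) + Cc * \<delta>\<^sup>2"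
  proof -
    define X where "X = 2 * T.n * Mu * (140 * \<Lambda> + 1) + 8 * T.n^2 * Mu + 6 * T.n^3 * Mu + 8 * T.K2"
    define Y where "Y = 16 * T.K4 * A\<^sub>0 + 4 * T.n * T.K2 * A\<^sub>0"
    have X0: "0 \<le> X" unfolding X_def using T.n0 T.M T.K_nonneg \<Lambda>1 by (intro add_nonneg_nonneg mult_nonneg_nonneg) auto
    have Y0: "0 \<le> Y" unfolding Y_def using T.n0 T.K_nonneg A0_nonneg by (intro add_nonneg_nonneg mult_nonneg_nonneg) auto
    have "Cc = X + Y" by (simp add: Cc_def X_def Y_def)
    then have "X * (\<delta>\<^sup>2 * \<beta>) \<le> Cc * (\<delta>\<^sup>2 * \<beta>)" "Y * \<delta>\<^sup>2 \<le> Cc * \<delta>\<^sup>2"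
      using X0 Y0 \<beta>0 by (auto intro!: mult_right_mono)
    then show ?thesis unfolding X_def Y_def by linarith
  qed
  also have "\<dots> = Cc * \<delta>\<^sup>2 * (1 + \<beta>)" by (simp add: algebra_simps)
  finally show ?thesis unfolding \<beta>_def \<mu>_def .
qed

end

section \<open>Comparison principle and supersolutions\<close>

context nonlocal_setting
begin

abbreviation Lint :: "('a \<Rightarrow> real) \<Rightarrow> real" where "Lint f \<equiv> (\<integral>y. f y \<partial>lebesgue_on \<Omega>)"

text \<open>The left-hand side of the nonlocal equation for \<open>g = 0\<close>, where the boundary
  integral reduces to a multiplication by \<open>B \<delta> x\<close>.\<close>

definition Lop :: "real \<Rightarrow> ('a \<Rightarrow> real) \<Rightarrow> 'a \<Rightarrow> real" where
  "Lop \<delta> v x = 1 / \<delta>\<^sup>2 * Lint (\<lambda>y. kR \<delta> x y * (v x - v y)) + 2 / \<mu>_weight \<Omega> \<delta> x * (B \<delta> x * v x)"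

definition m\<^sub>\<Omega> :: real where "m\<^sub>\<Omega> = measure (lebesgue_on \<Omega>) \<Omega>"

lemma finite_lebesgue_on_\<Omega>: "finite_measure (lebesgue_on \<Omega>)"
  using lmeasurable_open[OF bdd openO] by (rule finite_measure_lebesgue_on)

lemma m_nonneg: "0 \<le> m\<^sub>\<Omega>" by (simp add: m\<^sub>\<Omega>_def)

lemma borel_lebesgue_on: "f \<in> borel_measurable borel \<Longrightarrow> f \<in> borel_measurable (lebesgue_on \<Omega>)"
  by (intro measurable_restrict_space1 measurable_completion) simp

lemma weight_lower: "0 < \<delta> \<Longrightarrow> min (2 * \<delta>) (\<delta>\<^sup>2) \<le> \<mu>_weight \<Omega> \<delta> x"
  by (auto simp: \<mu>_weight_def)

lemma weight_pos: "0 < \<delta> \<Longrightarrow> 0 < \<mu>_weight \<Omega> \<delta> x"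
  by (simp add: \<mu>_weight_def less_max_iff_disj)

lemma weight_le: "\<mu>_weight \<Omega> \<delta> x \<le> 2 * \<delta>"
  by (simp add: \<mu>_weight_def)

lemma kernel_integrable:
  assumes \<delta>: "0 < \<delta>" and v: "integrable (lebesgue_on \<Omega>) v" and K: "K = R \<or> K = RR"
  shows "integrable (lebesgue_on \<Omega>) (\<lambda>y. rescaled_kernel \<alpha> K \<delta> x y * v y)"
    and "\<bar>Lint (\<lambda>y. rescaled_kernel \<alpha> K \<delta> x y * v y)\<bar> \<le> \<alpha> / \<delta> ^ DIM('a) * M * Lint (\<lambda>y. \<bar>v y\<bar>)"
proof -
  let ?k = "rescaled_kernel \<alpha> K \<delta> x"
  define c where "c = \<alpha> / \<delta> ^ DIM('a) * M"
  have k: "0 \<le> ?k y" "?k y \<le> c" for y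
    using K kR_nonneg[OF \<delta>] kB_nonneg[OF \<delta>] kR_le[OF \<delta>] kB_le[OF \<delta>] by (auto simp: c_def)
  have m: "?k \<in> borel_measurable (lebesgue_on \<Omega>)" using K kR_meas kB_meas by (intro borel_lebesgue_on) auto
  have le: "\<bar>?k y * v y\<bar> \<le> c * \<bar>v y\<bar>" for y
    unfolding abs_mult using k[of y] by (intro mult_right_mono) auto
  have ib: "integrable (lebesgue_on \<Omega>) (\<lambda>y. c * \<bar>v y\<bar>)" using v by simp
  show i: "integrable (lebesgue_on \<Omega>) (\<lambda>y. ?k y * v y)"
    by (rule Bochner_Integration.integrable_bound[OF ib])
      (use le m borel_measurable_integrable[OF v] in \<open>auto intro!: AE_I2 intro: order_trans[OF _ abs_ge_self]\<close>)
  show "\<bar>Lint (\<lambda>y. ?k y * v y)\<bar> \<le> \<alpha> / \<delta> ^ DIM('a) * M * Lint (\<lambda>y. \<bar>v y\<bar>)"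
    by (rule order_trans[OF integral_abs_bound]) (use integral_mono[OF integrable_abs[OF i] ib le] in \<open>simp add: c_def\<close>)
qed

lemma integrable_const_\<Omega>: "integrable (lebesgue_on \<Omega>) (\<lambda>y. c :: real)"
  using finite_lebesgue_on_\<Omega> by (simp add: finite_measure.integrable_const)

lemma kernel_mass:
  assumes \<delta>: "0 < \<delta>" and K: "K = R \<or> K = RR"
  shows "integrable (lebesgue_on \<Omega>) (\<lambda>y. rescaled_kernel \<alpha> K \<delta> x y)"
    and "0 \<le> Lint (\<lambda>y. rescaled_kernel \<alpha> K \<delta> x y)"
    and "Lint (\<lambda>y. rescaled_kernel \<alpha> K \<delta> x y) \<le> \<alpha> / \<delta> ^ DIM('a) * M * m\<^sub>\<Omega>"
proof -
  show "integrable (lebesgue_on \<Omega>) (\<lambda>y. rescaled_kernel \<alpha> K \<delta> x y)"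
    using kernel_integrable(1)[OF \<delta> integrable_const_\<Omega>[of 1] K] by simp
  show "0 \<le> Lint (\<lambda>y. rescaled_kernel \<alpha> K \<delta> x y)"
    using K kR_nonneg[OF \<delta>] kB_nonneg[OF \<delta>] by (intro Bochner_Integration.integral_nonneg) auto
  have "Lint (\<lambda>y. \<bar>1::real\<bar>) = m\<^sub>\<Omega>" by (simp add: m\<^sub>\<Omega>_def)
  then show "Lint (\<lambda>y. rescaled_kernel \<alpha> K \<delta> x y) \<le> \<alpha> / \<delta> ^ DIM('a) * M * m\<^sub>\<Omega>"
    using kernel_integrable(2)[OF \<delta> integrable_const_\<Omega>[of 1] K, of x] by simp
qed

lemma Lint_difference:
  assumes \<delta>: "0 < \<delta>" and v: "integrable (lebesgue_on \<Omega>) v"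
  shows "Lint (\<lambda>y. kR \<delta> x y * (c - v y)) = c * Lint (kR \<delta> x) - Lint (\<lambda>y. kR \<delta> x y * v y)"
    and "integrable (lebesgue_on \<Omega>) (\<lambda>y. kR \<delta> x y * (c - v y))"
proof -
  have i1: "integrable (lebesgue_on \<Omega>) (\<lambda>y. c * kR \<delta> x y)" using kernel_mass(1)[OF \<delta>, of R x] by simp
  have i2: "integrable (lebesgue_on \<Omega>) (\<lambda>y. kR \<delta> x y * v y)" using kernel_integrable(1)[OF \<delta> v, of R x] by simp
  have eq: "kR \<delta> x y * (c - v y) = c * kR \<delta> x y - kR \<delta> x y * v y" for y by (simp add: algebra_simps)
  show "Lint (\<lambda>y. kR \<delta> x y * (c - v y)) = c * Lint (kR \<delta> x) - Lint (\<lambda>y. kR \<delta> x y * v y)"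
    unfolding eq using i1 i2 by simp
  show "integrable (lebesgue_on \<Omega>) (\<lambda>y. kR \<delta> x y * (c - v y))" unfolding eq using i1 i2 by simp
qed

lemma Lop_alt:
  assumes "0 < \<delta>" "integrable (lebesgue_on \<Omega>) v"
  shows "Lop \<delta> v x = 1 / \<delta>\<^sup>2 * (v x * Lint (kR \<delta> x) - Lint (\<lambda>y. kR \<delta> x y * v y)) + 2 / \<mu>_weight \<Omega> \<delta> x * (B \<delta> x * v x)"
  unfolding Lop_def Lint_difference(1)[OF assms] ..

lemma Lop_diff:
  assumes \<delta>: "0 < \<delta>" and v: "integrable (lebesgue_on \<Omega>) v" and w: "integrable (lebesgue_on \<Omega>) w"
  shows "Lop \<delta> (\<lambda>y. v y - w y) x = Lop \<delta> v x - Lop \<delta> w x"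
proof -
  have vw: "integrable (lebesgue_on \<Omega>) (\<lambda>y. v y - w y)" using v w by simp
  have split: "Lint (\<lambda>y. kR \<delta> x y * (v y - w y)) = Lint (\<lambda>y. kR \<delta> x y * v y) - Lint (\<lambda>y. kR \<delta> x y * w y)"
    unfolding right_diff_distrib using kernel_integrable(1)[OF \<delta> v, of R x] kernel_integrable(1)[OF \<delta> w, of R x] by simp
  show ?thesis unfolding Lop_alt[OF \<delta> v] Lop_alt[OF \<delta> w] Lop_alt[OF \<delta> vw] split by (simp add: algebra_simps diff_divide_distrib add_divide_distrib)
qed

lemma Lop_cmult: "Lop \<delta> (\<lambda>y. c * v y) x = c * Lop \<delta> v x"
proof -
  define I where "I = Lint (\<lambda>y. kR \<delta> x y * (v x - v y))"
  have "Lint (\<lambda>y. kR \<delta> x y * (c * v x - c * v y)) = Lint (\<lambda>y. c * (kR \<delta> x y * (v x - v y)))"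
    by (intro Bochner_Integration.integral_cong refl) (simp add: algebra_simps)
  also have "\<dots> = c * I" unfolding I_def by (rule integral_mult_right_zero)
  finally show ?thesis unfolding Lop_def I_def[symmetric] by (simp add: algebra_simps)
qed

lemma B_le: "0 < \<delta> \<Longrightarrow> B \<delta> x \<le> \<alpha> / \<delta> ^ DIM('a) * M * measure \<sigma> (frontier \<Omega>)"
proof -
  assume \<delta>: "0 < \<delta>"
  interpret finite_measure \<sigma> by (rule finite_\<sigma>)
  have "integrable \<sigma> (\<lambda>y. kB \<delta> x y)"
    using \<sigma>_integrable(1)[OF \<delta>, of "\<lambda>_. 1" x 1] by simp
  then have "B \<delta> x \<le> (\<integral>y. \<alpha> / \<delta> ^ DIM('a) * M \<partial>\<sigma>)"
    unfolding B_def by (rule integral_mono) (use kB_le[OF \<delta>] in auto)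
  then show ?thesis by (simp add: space_\<sigma> mult_ac)
qed

text \<open>The bound depends on \<open>\<delta>\<close>; it only provides finite constants for a
  fixed \<open>\<delta>\<close> in \<open>comparison\<close> and
  \<open>resid_bounded\<close>.\<close>

lemma B_over_weight_bounded:
  assumes \<delta>: "0 < \<delta>"
  shows "\<exists>b\<ge>0. \<forall>x. B \<delta> x / \<mu>_weight \<Omega> \<delta> x \<le> b"
proof (intro exI conjI allI)
  let ?b = "\<alpha> / \<delta> ^ DIM('a) * M * measure \<sigma> (frontier \<Omega>)"
  have b0: "0 \<le> ?b" using \<alpha> M0 \<delta> by simp
  have mm: "0 < min (2 * \<delta>) (\<delta>\<^sup>2)" using \<delta> by simp
  show "0 \<le> ?b / min (2 * \<delta>) (\<delta>\<^sup>2)" using b0 mm by (intro divide_nonneg_pos)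
  show "B \<delta> x / \<mu>_weight \<Omega> \<delta> x \<le> ?b / min (2 * \<delta>) (\<delta>\<^sup>2)" for x
    by (intro frac_le b0 B_le \<delta> mm weight_lower)
qed

text \<open>The strict inequality bounds \<open>z\<close> below its supremum by a fixed amount, so no maximiser, hence no
  continuity of \<open>z\<close>, is needed.\<close>

lemma comparison:
  assumes \<delta>: "0 < \<delta>" and z: "integrable (lebesgue_on \<Omega>) z" and Z: "\<And>x. x \<in> \<Omega> \<Longrightarrow> z x \<le> Z"
    and e: "0 < e" and L: "\<And>x. x \<in> \<Omega> \<Longrightarrow> Lop \<delta> z x \<le> - e" and x: "x \<in> \<Omega>"
  shows "z x \<le> 0"
proof (rule ccontr)
  assume pos: "\<not> z x \<le> 0"
  define s where "s = (SUP y\<in>\<Omega>. z y)"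
  have bdda: "bdd_above (z ` \<Omega>)" by (rule bdd_aboveI2[OF Z])
  have zs: "z y \<le> s" if "y \<in> \<Omega>" for y unfolding s_def using that bdda by (rule cSUP_upper)
  have s0: "0 < s" using zs[OF x] pos by linarith
  obtain b where b: "0 \<le> b" "\<And>x. B \<delta> x / \<mu>_weight \<Omega> \<delta> x \<le> b" using B_over_weight_bounded[OF \<delta>] by blast
  \<comment> \<open>Bounds the coefficient \<open>A / \<delta>\<^sup>2 + 2 * \<beta>\<close> of
    \<open>z y\<close> simultaneously for all \<open>y\<close>; the added 1 makes it
    positive.\<close>
  define a where "a = (\<alpha> / \<delta> ^ DIM('a) * M * m\<^sub>\<Omega>) / \<delta>\<^sup>2 + 2 * b + 1"
  have a0: "0 < a" using \<alpha> M0 m_nonneg b \<delta> by (simp add: a_def add_nonneg_pos)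
  \<comment> \<open>Replacing the values of \<open>z\<close> under the integral by the supremum
    gives \<open>e \<le> (s - z y) * (A / \<delta>\<^sup>2 + 2 * \<beta>)\<close>, hence a gap below
    \<open>s\<close> that is independent of \<open>y\<close>.\<close>
  have step: "z y \<le> s - e / a" if y: "y \<in> \<Omega>" for y
  proof -
    define A where "A = Lint (kR \<delta> y)"
    define \<beta> where "\<beta> = B \<delta> y / \<mu>_weight \<Omega> \<delta> y"
    have A: "0 \<le> A" "A \<le> \<alpha> / \<delta> ^ DIM('a) * M * m\<^sub>\<Omega>" using kernel_mass(2,3)[OF \<delta>, of R y] by (auto simp: A_def)
    have \<beta>: "0 \<le> \<beta>" "\<beta> \<le> b"
      unfolding \<beta>_def by (intro divide_nonneg_pos B_nonneg weight_pos \<delta>, rule b(2))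
    have "Lint (\<lambda>w. kR \<delta> y w * z w) \<le> Lint (\<lambda>w. s * kR \<delta> y w)"
    proof (rule integral_mono)
      show "integrable (lebesgue_on \<Omega>) (\<lambda>w. kR \<delta> y w * z w)" by (rule kernel_integrable(1)[OF \<delta> z]) simp
      show "integrable (lebesgue_on \<Omega>) (\<lambda>w. s * kR \<delta> y w)" using kernel_mass(1)[OF \<delta>, of R y] by simp
      fix w assume "w \<in> space (lebesgue_on \<Omega>)"
      then show "kR \<delta> y w * z w \<le> s * kR \<delta> y w"
        using zs[of w] kR_nonneg[OF \<delta>, of y w] by (simp add: mult.commute mult_right_mono)
    qed
    then have le: "Lint (\<lambda>w. kR \<delta> y w * z w) \<le> s * A" by (simp add: A_def)
    have t1: "1 / \<delta>\<^sup>2 * (z y * A - s * A) + 2 * \<beta> * z y \<le> - e"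
    proof -
      have "1 / \<delta>\<^sup>2 * (z y * A - s * A) \<le> 1 / \<delta>\<^sup>2 * (z y * A - Lint (\<lambda>w. kR \<delta> y w * z w))"
        using le by (intro mult_left_mono) auto
      then show ?thesis using L[OF y] unfolding Lop_alt[OF \<delta> z] A_def[symmetric] by (simp add: \<beta>_def mult_ac)
    qed
    have t2: "(s - z y) * (A / \<delta>\<^sup>2 + 2 * \<beta>) = - (1 / \<delta>\<^sup>2 * (z y * A - s * A) + 2 * \<beta> * z y) + 2 * \<beta> * s"
      by (simp add: algebra_simps diff_divide_distrib add_divide_distrib)
    have t3: "0 \<le> 2 * \<beta> * s" using \<beta> s0 by simp
    have "e \<le> (s - z y) * (A / \<delta>\<^sup>2 + 2 * \<beta>)" unfolding t2 using t1 t3 by linarith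
    also have "\<dots> \<le> (s - z y) * a"
    proof (rule mult_left_mono)
      have "A / \<delta>\<^sup>2 \<le> (\<alpha> / \<delta> ^ DIM('a) * M * m\<^sub>\<Omega>) / \<delta>\<^sup>2" using A by (intro divide_right_mono) auto
      then show "A / \<delta>\<^sup>2 + 2 * \<beta> \<le> a" using \<beta> unfolding a_def by linarith
    qed (use zs[OF y] in simp)
    finally have "e / a \<le> s - z y" using a0 by (simp add: divide_le_eq)
    then show ?thesis by linarith
  qed
  have "s \<le> s - e / a" unfolding s_def[of]
    by (rule cSUP_least) (use x step in \<open>auto simp: s_def\<close>)
  moreover have "0 < e / a" using e a0 by simp
  ultimately show False by linarith
qed

text \<open>Uniform up to the boundary by \<open>corkscrew\<close>; capping the radius at
  \<open>lam / 2\<close> covers large \<open>\<delta>\<close>.\<close>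

lemma kR_mass_lower:
  assumes \<delta>: "0 < \<delta>"
  shows "\<exists>c>0. \<forall>x\<in>\<Omega>. c \<le> Lint (kR \<delta> x)"
proof -
  define r where "r = min \<delta> (lam / 2)"
  have r: "0 < r" "2 * r \<le> lam" "r \<le> \<delta>" using \<delta> lam by (auto simp: r_def)
  define \<rho> where "\<rho> = r / (4 * (1 + \<Lambda>))"
  have \<rho>: "0 < \<rho>" using r \<Lambda>1 by (simp add: \<rho>_def)
  define c where "c = \<alpha> / \<delta> ^ DIM('a) * \<gamma>"
  have c0: "0 < c" using \<alpha> \<delta> \<gamma> by (simp add: c_def)
  have "measure lborel (ball (0::'a) \<rho>) * c \<le> Lint (kR \<delta> x)" if x: "x \<in> \<Omega>" for x
  proof -
    obtain z where z: "ball z \<rho> \<subseteq> \<Omega> \<inter> ball x r" using corkscrew[OF x r(1,2)] unfolding \<rho>_def by blast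
    have le: "indicator (ball z \<rho>) y * c \<le> indicator \<Omega> y * kR \<delta> x y" for y
    proof (cases "y \<in> ball z \<rho>")
      case True
      then have y: "y \<in> \<Omega>" "norm (x - y) < r" using z by (auto simp: dist_norm subset_iff)
      have "(norm (x - y))\<^sup>2 \<le> \<delta>\<^sup>2" using y(2) r by (intro power_mono) auto
      then have "(norm (x - y))\<^sup>2 / (4 * \<delta>\<^sup>2) \<le> 1/4" using \<delta> by (simp add: field_simps)
      then have "\<gamma> \<le> R ((norm (x - y))\<^sup>2 / (4 * \<delta>\<^sup>2))" by (intro R_\<gamma>) (auto intro: order_trans)
      then have "c \<le> kR \<delta> x y" unfolding c_def rescaled_kernel_def
        using factor_pos[OF \<delta>] by (intro mult_left_mono) auto
      then show ?thesis using True y by simp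
    next
      case False
      then show ?thesis using kR_nonneg[OF \<delta>] by simp
    qed
    have ib: "integrable lborel (indicator (ball z \<rho>) :: 'a \<Rightarrow> real)"
      using emeasure_bounded_finite[of "ball z \<rho>"] by (auto simp: integrable_indicator_iff)
    have ik: "integrable lborel (\<lambda>y. indicator \<Omega> y * kR \<delta> x y)"
      using \<Omega>_integrable(1)[OF \<delta>, of "\<lambda>_. 1" x 1 R] borel_indicator_\<Omega>[of "\<lambda>_. 1"] by simp
    have "measure lborel (ball (0::'a) \<rho>) * c = (\<integral>y. indicator (ball z \<rho>) y * c \<partial>lborel)"
      using \<rho> by (simp add: content_ball)
    also have "\<dots> \<le> (\<integral>y. indicator \<Omega> y * kR \<delta> x y \<partial>lborel)"
      by (rule integral_mono[OF _ ik le]) (use ib in auto)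
    also have "\<dots> = Lint (kR \<delta> x)"
      by (rule integral_lebesgue_on_\<Omega>[symmetric]) (rule borel_indicator_\<Omega>[OF kR_meas])
    finally show ?thesis .
  qed
  moreover have "0 < measure lborel (ball (0::'a) \<rho>) * c" using \<rho> c0 by (simp add: content_ball)
  ultimately show ?thesis by blast
qed

text \<open>The equation is solved for \<open>v x\<close>: its coefficient is bounded below by
  \<open>kR_mass_lower\<close>, and the integral of \<open>v\<close> against the kernel is bounded
  by the integral of \<open>\<bar>v\<bar>\<close>. So a solution known only to be square integrable
  is bounded at every point, as \<open>comparison\<close> requires.\<close>

lemma bounded_of_Lop:
  assumes \<delta>: "0 < \<delta>" and v: "integrable (lebesgue_on \<Omega>) v" and C: "\<And>x. x \<in> \<Omega> \<Longrightarrow> \<bar>Lop \<delta> v x\<bar> \<le> C"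
  shows "\<exists>Z. \<forall>x\<in>\<Omega>. \<bar>v x\<bar> \<le> Z"
proof -
  obtain c where c: "0 < c" "\<And>x. x \<in> \<Omega> \<Longrightarrow> c \<le> Lint (kR \<delta> x)" using kR_mass_lower[OF \<delta>] by blast
  define I where "I = \<alpha> / \<delta> ^ DIM('a) * M * Lint (\<lambda>y. \<bar>v y\<bar>)"
  have "\<bar>v x\<bar> \<le> (\<delta>\<^sup>2 * C + I) / c" if x: "x \<in> \<Omega>" for x
  proof -
    define A where "A = Lint (kR \<delta> x)"
    define \<beta> where "\<beta> = B \<delta> x / \<mu>_weight \<Omega> \<delta> x"
    have \<beta>: "0 \<le> \<beta>" unfolding \<beta>_def by (intro divide_nonneg_pos B_nonneg weight_pos \<delta>)
    have A: "c \<le> A" using c(2)[OF x] by (simp add: A_def)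
    define J where "J = Lint (\<lambda>y. kR \<delta> x y * v y)"
    have J: "\<bar>J\<bar> \<le> I" unfolding J_def I_def by (rule kernel_integrable(2)[OF \<delta> v]) simp
    have "v x * (A + 2 * \<delta>\<^sup>2 * \<beta>) = \<delta>\<^sup>2 * Lop \<delta> v x + J"
      unfolding Lop_alt[OF \<delta> v] A_def[symmetric] J_def[symmetric] using \<delta> by (simp add: \<beta>_def field_simps)
    then have "\<bar>v x\<bar> * \<bar>A + 2 * \<delta>\<^sup>2 * \<beta>\<bar> = \<bar>\<delta>\<^sup>2 * Lop \<delta> v x + J\<bar>" by (simp only: abs_mult[symmetric])
    also have "\<dots> \<le> \<delta>\<^sup>2 * \<bar>Lop \<delta> v x\<bar> + \<bar>J\<bar>" using abs_triangle_ineq[of "\<delta>\<^sup>2 * Lop \<delta> v x" J] by (simp add: abs_mult)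
    also have "\<dots> \<le> \<delta>\<^sup>2 * C + I" using C[OF x] J by (intro add_mono mult_left_mono) auto
    finally have 1: "\<bar>v x\<bar> * \<bar>A + 2 * \<delta>\<^sup>2 * \<beta>\<bar> \<le> \<delta>\<^sup>2 * C + I" .
    have "0 \<le> 2 * \<delta>\<^sup>2 * \<beta>" using \<beta> by simp
    then have "c \<le> \<bar>A + 2 * \<delta>\<^sup>2 * \<beta>\<bar>" using A c(1) by linarith
    then have "\<bar>v x\<bar> * c \<le> \<bar>v x\<bar> * \<bar>A + 2 * \<delta>\<^sup>2 * \<beta>\<bar>" by (rule mult_left_mono) simp
    then show ?thesis using 1 c(1) by (simp add: le_divide_eq)
  qed
  then show ?thesis by blast
qed

text \<open>\<open>comparison\<close> for \<open>v - w\<close> and for \<open>- v - w\<close>; the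
  slack \<open>e\<close> supplies its strict inequality.\<close>

lemma error_bound:
  assumes \<delta>: "0 < \<delta>" and v: "integrable (lebesgue_on \<Omega>) v" and C: "\<And>x. x \<in> \<Omega> \<Longrightarrow> \<bar>Lop \<delta> v x\<bar> \<le> C"
    and w: "integrable (lebesgue_on \<Omega>) w" and w0: "\<And>x. x \<in> \<Omega> \<Longrightarrow> 0 \<le> w x"
    and e: "0 < e" and L: "\<And>x. x \<in> \<Omega> \<Longrightarrow> \<bar>Lop \<delta> v x\<bar> + e \<le> Lop \<delta> w x" and x: "x \<in> \<Omega>"
  shows "\<bar>v x\<bar> \<le> w x"
proof -
  obtain Z where Z: "\<And>x. x \<in> \<Omega> \<Longrightarrow> \<bar>v x\<bar> \<le> Z" using bounded_of_Lop[OF \<delta> v C] by blast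
  have "v x - w x \<le> 0"
  proof (rule comparison[OF \<delta> _ _ e _ x])
    show "integrable (lebesgue_on \<Omega>) (\<lambda>x. v x - w x)" using v w by simp
    show "v y - w y \<le> Z" if "y \<in> \<Omega>" for y using Z[OF that] w0[OF that] by linarith
    show "Lop \<delta> (\<lambda>x. v x - w x) y \<le> - e" if "y \<in> \<Omega>" for y
      unfolding Lop_diff[OF \<delta> v w] using L[OF that] by linarith
  qed
  moreover have "(-1) * v x - w x \<le> 0"
  proof (rule comparison[OF \<delta> _ _ e _ x])
    have v': "integrable (lebesgue_on \<Omega>) (\<lambda>x. (-1) * v x)" using v by simp
    show "integrable (lebesgue_on \<Omega>) (\<lambda>x. (-1) * v x - w x)" using v' w by (rule Bochner_Integration.integrable_diff)
    show "(-1) * v y - w y \<le> Z" if "y \<in> \<Omega>" for y using Z[OF that] w0[OF that] by linarith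
    show "Lop \<delta> (\<lambda>x. (-1) * v x - w x) y \<le> - e" if "y \<in> \<Omega>" for y
      unfolding Lop_diff[OF \<delta> v' w] Lop_cmult using L[OF that] by linarith
  qed
  ultimately show ?thesis by linarith
qed

end

section \<open>Error equation, and the estimate for small \<delta>\<close>

context poisson_setting
begin

lemma u_le: "y \<in> \<Omega> \<Longrightarrow> \<bar>u y\<bar> \<le> Mu" using T.bound[of "[]" y] by simp

lemma u_frontier_le: "y \<in> frontier \<Omega> \<Longrightarrow> \<bar>u y\<bar> \<le> Mu"
  using continuous_on_closure_norm_le[OF T.cu, of Mu y] u_le by (simp add: frontier_def)

lemma laplacian_le: "y \<in> \<Omega> \<Longrightarrow> \<bar>laplacian u y\<bar> \<le> T.n * Mu"
proof -
  assume y: "y \<in> \<Omega>"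
  have "\<bar>laplacian u y\<bar> \<le> (\<Sum>b\<in>(Basis::'a set). Mu)"
    unfolding laplacian_def by (intro order_trans[OF sum_abs sum_mono] T.bound y) auto
  then show ?thesis by (simp add: T.n_def)
qed

lemma continuous_lebesgue_on: "continuous_on \<Omega> f \<Longrightarrow> (f :: 'a \<Rightarrow> real) \<in> borel_measurable (lebesgue_on \<Omega>)"
  using openO by (intro continuous_imp_measurable_on_sets_lebesgue) auto

lemma integrable_continuous_bounded:
  fixes f :: "'a \<Rightarrow> real"
  assumes "continuous_on \<Omega> f" "\<And>y. y \<in> \<Omega> \<Longrightarrow> \<bar>f y\<bar> \<le> c"
  shows "integrable (lebesgue_on \<Omega>) f"
proof (rule finite_measure.integrable_const_bound[OF finite_lebesgue_on_\<Omega>])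
  show "AE y in lebesgue_on \<Omega>. norm (f y) \<le> c" by (rule AE_I2) (use assms(2) in simp)
qed (rule continuous_lebesgue_on[OF assms(1)])

lemma u_integrable: "integrable (lebesgue_on \<Omega>) u"
  by (rule integrable_continuous_bounded[OF u_continuous u_le])

lemma laplacian_integrable: "integrable (lebesgue_on \<Omega>) (laplacian u)"
  by (rule integrable_continuous_bounded[OF laplacian_continuous laplacian_le])

text \<open>Only boundedness of \<open>u\<close>, its Laplacian and the kernels enters, without
  cancellation. The kernel factor is kept apart because for large \<open>\<delta>\<close> the
  supersolution gains the same factor.\<close>

lemma resid_crude:
  assumes \<delta>: "0 < \<delta>" and x: "x \<in> \<Omega>"
  shows "\<bar>resid u \<delta> x\<bar> \<le> (M * m\<^sub>\<Omega> * (2 * Mu / \<delta>\<^sup>2 + T.n * Mu)) * (\<alpha> / \<delta> ^ DIM('a))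
     + 4 * Mu * (B \<delta> x / \<mu>_weight \<Omega> \<delta> x)"
proof -
  define \<kappa> where "\<kappa> = \<alpha> / \<delta> ^ DIM('a)"
  have \<kappa>0: "0 < \<kappa>" unfolding \<kappa>_def by (rule factor_pos[OF \<delta>])
  have \<mu>0: "0 < \<mu>_weight \<Omega> \<delta> x" by (rule weight_pos[OF \<delta>])
  have const: "Lint (\<lambda>y. \<bar>f y\<bar>) \<le> c * m\<^sub>\<Omega>" if "integrable (lebesgue_on \<Omega>) f" "\<And>y. y \<in> \<Omega> \<Longrightarrow> \<bar>f y\<bar> \<le> c" for f :: "'a \<Rightarrow> real" and c
  proof -
    have "Lint (\<lambda>y. \<bar>f y\<bar>) \<le> Lint (\<lambda>y. c)"
      by (rule integral_mono[OF integrable_abs[OF that(1)] integrable_const_\<Omega>]) (use that(2) in simp)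
    then show ?thesis by (simp add: m\<^sub>\<Omega>_def mult.commute)
  qed
  have di: "integrable (lebesgue_on \<Omega>) (\<lambda>y. u x - u y)" using u_integrable integrable_const_\<Omega>[of "u x"] by simp
  have "\<bar>Lint (\<lambda>y. kR \<delta> x y * (u x - u y))\<bar> \<le> \<kappa> * M * Lint (\<lambda>y. \<bar>u x - u y\<bar>)"
    unfolding \<kappa>_def by (rule kernel_integrable(2)[OF \<delta> di]) simp
  also have "\<dots> \<le> \<kappa> * M * ((2 * Mu) * m\<^sub>\<Omega>)"
  proof (intro mult_left_mono const di)
    show "\<bar>u x - u y\<bar> \<le> 2 * Mu" if "y \<in> \<Omega>" for y using u_le[OF x] u_le[OF that] by linarith
  qed (use \<kappa>0 M0 in simp)
  finally have 1: "\<bar>1 / \<delta>\<^sup>2 * Lint (\<lambda>y. kR \<delta> x y * (u x - u y))\<bar> \<le> 1 / \<delta>\<^sup>2 * (\<kappa> * M * ((2 * Mu) * m\<^sub>\<Omega>))"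
    unfolding abs_mult by (intro mult_mono) auto
  have "\<bar>Lint (\<lambda>y. kB \<delta> x y * laplacian u y)\<bar> \<le> \<kappa> * M * Lint (\<lambda>y. \<bar>laplacian u y\<bar>)"
    unfolding \<kappa>_def by (rule kernel_integrable(2)[OF \<delta> laplacian_integrable]) simp
  also have "\<dots> \<le> \<kappa> * M * ((T.n * Mu) * m\<^sub>\<Omega>)"
    by (rule mult_left_mono[OF const[OF laplacian_integrable laplacian_le]]) (use \<kappa>0 M0 in auto)
  finally have 2: "\<bar>Lint (\<lambda>y. kB \<delta> x y * laplacian u y)\<bar> \<le> \<kappa> * M * ((T.n * Mu) * m\<^sub>\<Omega>)" .
  have "\<bar>\<integral>y. kB \<delta> x y * (u x - u y) \<partial>\<sigma>\<bar> \<le> (2 * Mu) * B \<delta> x"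
  proof (rule \<sigma>_integrable(2)[OF \<delta>])
    show "(\<lambda>y. u x - u y) \<in> borel_measurable \<sigma>" by (intro borel_measurable_diff u_meas_\<sigma>) simp
    show "\<bar>u x - u y\<bar> \<le> 2 * Mu" if "y \<in> frontier \<Omega>" for y
      using u_le[OF x] u_frontier_le[OF that] by linarith
  qed (use T.M in simp)
  then have 3: "\<bar>2 / \<mu>_weight \<Omega> \<delta> x * (\<integral>y. kB \<delta> x y * (u x - u y) \<partial>\<sigma>)\<bar> \<le> 2 / \<mu>_weight \<Omega> \<delta> x * ((2 * Mu) * B \<delta> x)"
    unfolding abs_mult using \<mu>0 by (intro mult_mono) auto
  have "\<bar>resid u \<delta> x\<bar> \<le> 1 / \<delta>\<^sup>2 * (\<kappa> * M * ((2 * Mu) * m\<^sub>\<Omega>)) + 2 / \<mu>_weight \<Omega> \<delta> x * ((2 * Mu) * B \<delta> x) + \<kappa> * M * ((T.n * Mu) * m\<^sub>\<Omega>)"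
    unfolding resid_def using 1 2 3 by linarith
  also have "\<dots> = (M * m\<^sub>\<Omega> * (2 * Mu / \<delta>\<^sup>2 + T.n * Mu)) * \<kappa> + 4 * Mu * (B \<delta> x / \<mu>_weight \<Omega> \<delta> x)"
    using \<delta> \<mu>0 by (simp add: field_simps)
  finally show ?thesis unfolding \<kappa>_def .
qed

text \<open>On the bounded set \<open>\<Omega>\<close> square integrability gives integrability, so
  \<open>Lop\<close> may be split. The data drop out, being minus the Laplacian of \<open>u\<close>
  inside and \<open>u\<close> on the frontier.\<close>

lemma error_equation:
  assumes \<delta>: "0 < \<delta>" and P: "solves_poisson \<Omega> f g u" and v: "solves_nonlocal \<Omega> \<sigma> R \<alpha> f g \<delta> v"
  shows "integrable (lebesgue_on \<Omega>) (\<lambda>y. u y - v y)"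
    and "x \<in> \<Omega> \<Longrightarrow> Lop \<delta> (\<lambda>y. u y - v y) x = resid u \<delta> x"
proof -
  have v2: "v \<in> borel_measurable (lebesgue_on \<Omega>)" "integrable (lebesgue_on \<Omega>) (\<lambda>x. (v x)\<^sup>2)"
    using v unfolding solves_nonlocal_def L2_on_def by auto
  have vi: "integrable (lebesgue_on \<Omega>) v"
  proof (rule Bochner_Integration.integrable_bound[where f="\<lambda>x. 1 + (v x)\<^sup>2"])
    show "integrable (lebesgue_on \<Omega>) (\<lambda>x. 1 + (v x)\<^sup>2)" using v2(2) integrable_const_\<Omega>[of 1] by simp
    have "\<bar>t\<bar> \<le> 1 + t\<^sup>2" for t :: real
    proof -
      have "0 \<le> (\<bar>t\<bar> - 1)\<^sup>2" by simp
      then have "2 * \<bar>t\<bar> \<le> 1 + t\<^sup>2" by (simp add: power2_diff)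
      then show ?thesis by linarith
    qed
    then show "AE x in lebesgue_on \<Omega>. norm (v x) \<le> norm (1 + (v x)\<^sup>2)"
      by (intro AE_I2) (simp add: add_nonneg_nonneg)
  qed (rule v2(1))
  show "integrable (lebesgue_on \<Omega>) (\<lambda>y. u y - v y)" using u_integrable vi by simp
  assume x: "x \<in> \<Omega>"
  have eq: "1 / \<delta>\<^sup>2 * Lint (\<lambda>y. kR \<delta> x y * (v x - v y)) + 2 / \<mu>_weight \<Omega> \<delta> x * (\<integral>y. kB \<delta> x y * (v x - g y) \<partial>\<sigma>)
     = Lint (\<lambda>y. kB \<delta> x y * f y)"
    using v x unfolding solves_nonlocal_def by blast
  have f: "Lint (\<lambda>y. kB \<delta> x y * f y) = - Lint (\<lambda>y. kB \<delta> x y * laplacian u y)"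
  proof -
    have "Lint (\<lambda>y. kB \<delta> x y * f y) = Lint (\<lambda>y. - (kB \<delta> x y * laplacian u y))"
    proof (rule Bochner_Integration.integral_cong[OF refl])
      fix y assume "y \<in> space (lebesgue_on \<Omega>)"
      then have "f y = - laplacian u y" using P by (simp add: solves_poisson_def)
      then show "kB \<delta> x y * f y = - (kB \<delta> x y * laplacian u y)" by simp
    qed
    then show ?thesis by simp
  qed
  define G where "G = (\<integral>y. kB \<delta> x y * u y \<partial>\<sigma>)"
  have iu: "integrable \<sigma> (\<lambda>y. kB \<delta> x y * u y)"
    by (rule \<sigma>_integrable(1)[OF \<delta> u_meas_\<sigma> u_frontier_le T.M])
  have i1: "integrable \<sigma> (\<lambda>y. kB \<delta> x y)"
    using \<sigma>_integrable(1)[OF \<delta>, of "\<lambda>_. 1" x 1] by simp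
  have bd: "(\<integral>y. kB \<delta> x y * (c - u y) \<partial>\<sigma>) = c * B \<delta> x - G" for c
  proof -
    have "(\<integral>y. kB \<delta> x y * (c - u y) \<partial>\<sigma>) = (\<integral>y. c * kB \<delta> x y - kB \<delta> x y * u y \<partial>\<sigma>)"
      by (intro Bochner_Integration.integral_cong refl) (simp add: algebra_simps)
    also have "\<dots> = c * B \<delta> x - G" unfolding B_def G_def using iu i1 by simp
    finally show ?thesis .
  qed
  have bg: "(\<integral>y. kB \<delta> x y * (v x - g y) \<partial>\<sigma>) = (\<integral>y. kB \<delta> x y * (v x - u y) \<partial>\<sigma>)"
    using P by (intro Bochner_Integration.integral_cong refl) (simp add: solves_poisson_def space_\<sigma>)
  have "Lop \<delta> (\<lambda>y. u y - v y) x = Lop \<delta> u x - Lop \<delta> v x" by (rule Lop_diff[OF \<delta> u_integrable vi])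
  also have "\<dots> = resid u \<delta> x"
    using eq unfolding Lop_def resid_def f bg bd by (simp add: algebra_simps)
  finally show "Lop \<delta> (\<lambda>y. u y - v y) x = resid u \<delta> x" .
qed

lemma resid_bounded:
  assumes \<delta>: "0 < \<delta>"
  shows "\<exists>C. \<forall>x\<in>\<Omega>. \<bar>resid u \<delta> x\<bar> \<le> C"
proof -
  obtain b where b: "\<And>x. B \<delta> x / \<mu>_weight \<Omega> \<delta> x \<le> b" using B_over_weight_bounded[OF \<delta>] by blast
  have "\<bar>resid u \<delta> x\<bar> \<le> (M * m\<^sub>\<Omega> * (2 * Mu / \<delta>\<^sup>2 + T.n * Mu)) * (\<alpha> / \<delta> ^ DIM('a)) + 4 * Mu * b" if "x \<in> \<Omega>" for x
    using resid_crude[OF \<delta> that] mult_left_mono[OF b[of x], of "4 * Mu"] T.M by linarith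
  then show ?thesis by blast
qed

lemma error_le:
  assumes \<delta>: "0 < \<delta>" and P: "solves_poisson \<Omega> f g u" and v: "solves_nonlocal \<Omega> \<sigma> R \<alpha> f g \<delta> v"
    and w: "integrable (lebesgue_on \<Omega>) w" and w0: "\<And>x. x \<in> \<Omega> \<Longrightarrow> 0 \<le> w x"
    and e: "0 < e" and L: "\<And>x. x \<in> \<Omega> \<Longrightarrow> \<bar>resid u \<delta> x\<bar> + e \<le> Lop \<delta> w x" and x: "x \<in> \<Omega>"
  shows "\<bar>u x - v x\<bar> \<le> w x"
proof -
  obtain C where C: "\<And>x. x \<in> \<Omega> \<Longrightarrow> \<bar>resid u \<delta> x\<bar> \<le> C" using resid_bounded[OF \<delta>] by blast
  show ?thesis
  proof (rule error_bound[where v="\<lambda>y. u y - v y", OF \<delta> error_equation(1)[OF \<delta> P v] _ w w0 e _ x])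
    show "\<bar>Lop \<delta> (\<lambda>y. u y - v y) y\<bar> \<le> C" if "y \<in> \<Omega>" for y
      unfolding error_equation(2)[OF \<delta> P v that] by (rule C[OF that])
    show "\<bar>Lop \<delta> (\<lambda>y. u y - v y) y\<bar> + e \<le> Lop \<delta> w y" if "y \<in> \<Omega>" for y
      unfolding error_equation(2)[OF \<delta> P v that] by (rule L[OF that])
  qed
qed

text \<open>\<open>lam / 8\<close> yields \<open>7 * \<delta> < lam\<close> for the charts,
  \<open>1 / (10 * \<Lambda>)\<close> the hypothesis of \<open>signed_distance\<close>, and the last
  entry puts \<open>2 * \<delta>\<close> below the Taylor radius of \<open>remainder4\<close>, with
  4 in place of 2 for strictness.\<close>

definition \<delta>\<^sub>0 :: real where
  "\<delta>\<^sub>0 = min (min 1 (lam / 8)) (min (1 / (10 * \<Lambda>)) (lam / (4 + \<Lambda>) / (3 + \<Lambda>) / (3 + \<Lambda>) / (3 + \<Lambda>) / 4))"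

lemma \<delta>0_pos: "0 < \<delta>\<^sub>0" using lam \<Lambda>1 by (simp add: \<delta>\<^sub>0_def)

lemma small_\<delta>:
  assumes "0 < \<delta>" "\<delta> \<le> \<delta>\<^sub>0"
  shows "\<delta> \<le> 1" "7 * \<delta> < lam" "2 * \<delta> \<le> lam" "10 * \<Lambda> * \<delta> \<le> 1"
    "2 * \<delta> < lam / (4 + \<Lambda>) / (3 + \<Lambda>) / (3 + \<Lambda>) / (3 + \<Lambda>)"
proof -
  have "(\<delta> \<le> 1 \<and> \<delta> \<le> lam / 8) \<and> \<delta> \<le> 1 / (10 * \<Lambda>) \<and> \<delta> \<le> lam / (4 + \<Lambda>) / (3 + \<Lambda>) / (3 + \<Lambda>) / (3 + \<Lambda>) / 4"
    using assms(2) unfolding \<delta>\<^sub>0_def min.bounded_iff .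
  then have d: "\<delta> \<le> 1" "\<delta> \<le> lam / 8" "\<delta> \<le> 1 / (10 * \<Lambda>)" "\<delta> \<le> lam / (4 + \<Lambda>) / (3 + \<Lambda>) / (3 + \<Lambda>) / (3 + \<Lambda>) / 4"
    by blast+
  show "\<delta> \<le> 1" by (rule d(1))
  show "7 * \<delta> < lam" "2 * \<delta> \<le> lam" using d(2) lam by linarith+
  show "10 * \<Lambda> * \<delta> \<le> 1" using d(3) \<Lambda>1 by (simp add: le_divide_eq mult_ac)
  have "0 < lam / (4 + \<Lambda>) / (3 + \<Lambda>) / (3 + \<Lambda>) / (3 + \<Lambda>)" using lam \<Lambda>1 by simp
  moreover have "2 * \<delta> < X" if "0 < X" "\<delta> \<le> X / 4" for X using that by simp
  ultimately show "2 * \<delta> < lam / (4 + \<Lambda>) / (3 + \<Lambda>) / (3 + \<Lambda>) / (3 + \<Lambda>)" using d(4) by blast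
qed

text \<open>The constant \<open>Cc\<close>, restated outside the locale of a fixed \<open>x\<close>
  and \<open>\<delta>\<close>, which exhibits its independence of both.\<close>

definition C\<^sub>1 :: real where
  "C\<^sub>1 = 2 * T.n * Mu * (140 * \<Lambda> + 1) + 8 * T.n^2 * Mu + 6 * T.n^3 * Mu + 8 * T.K2 + 16 * T.K4 * A\<^sub>0 + 4 * T.n * T.K2 * A\<^sub>0"

lemma small_\<delta>_estimates:
  assumes \<delta>: "0 < \<delta>" "\<delta> \<le> \<delta>\<^sub>0" and x: "x \<in> \<Omega>"
  shows "\<bar>resid u \<delta> x\<bar> \<le> C\<^sub>1 * \<delta>\<^sup>2 * (1 + B \<delta> x / \<mu>_weight \<Omega> \<delta> x)"
    and "real DIM('a) * (\<alpha> * \<gamma> / 4 * (unit_ball_vol (real DIM('a)) / (4 * (1 + \<Lambda>)) ^ DIM('a)))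
       + (B \<delta> x / \<mu>_weight \<Omega> \<delta> x) * (2 * K - (norm x)\<^sup>2 - 4 * norm x - 4 * real DIM('a))
      \<le> Lop \<delta> (\<lambda>y. K - (norm y)\<^sup>2 / 2) x"
proof -
  note s = small_\<delta>[OF \<delta>]
  obtain N N\<^sub>0 where bn: "boundary_normal x \<delta> N N\<^sub>0" using boundary_normal_exists[OF x \<delta>(1) s(2,4)] by blast
  interpret I: truncation_point \<Omega> \<sigma> lam \<Lambda> R M \<gamma> \<alpha> x \<delta> N N\<^sub>0 Mu u
    by unfold_locales (use x \<delta> bn s in auto)
  show "\<bar>resid u \<delta> x\<bar> \<le> C\<^sub>1 * \<delta>\<^sup>2 * (1 + B \<delta> x / \<mu>_weight \<Omega> \<delta> x)"
    using I.consistency unfolding I.Cc_def C\<^sub>1_def .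
  have "(\<lambda>y. kR \<delta> x y * ((K - (norm x)\<^sup>2 / 2) - (K - (norm y)\<^sup>2 / 2))) \<in> borel_measurable borel"
    by (intro borel_measurable_times kR_meas borel_measurable_continuous_onI continuous_intros) auto
  then have V: "I.V (\<lambda>y. (K - (norm x)\<^sup>2 / 2) - (K - (norm y)\<^sup>2 / 2)) = Lint (\<lambda>y. kR \<delta> x y * ((K - (norm x)\<^sup>2 / 2) - (K - (norm y)\<^sup>2 / 2)))"
    unfolding I.V_def by (intro integral_lebesgue_on_\<Omega>[symmetric] borel_indicator_\<Omega>)
  have "real DIM('a) * (\<alpha> * \<gamma> / 4 * (unit_ball_vol (real DIM('a)) / (4 * (1 + \<Lambda>)) ^ DIM('a))) \<le> real DIM('a) * I.VB (\<lambda>y. 1)"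
    by (intro mult_left_mono I.VB_lower[OF s(3)]) simp
  then show "real DIM('a) * (\<alpha> * \<gamma> / 4 * (unit_ball_vol (real DIM('a)) / (4 * (1 + \<Lambda>)) ^ DIM('a)))
       + (B \<delta> x / \<mu>_weight \<Omega> \<delta> x) * (2 * K - (norm x)\<^sup>2 - 4 * norm x - 4 * real DIM('a))
      \<le> Lop \<delta> (\<lambda>y. K - (norm y)\<^sup>2 / 2) x"
    using I.quadratic_supersolution[OF s(1,3), of K] unfolding Lop_def V by linarith
qed

lemma small_\<delta>_bound:
  assumes P: "solves_poisson \<Omega> f g u"
  shows "\<exists>C. \<forall>\<delta>>0. \<delta> \<le> \<delta>\<^sub>0 \<longrightarrow> (\<forall>v. solves_nonlocal \<Omega> \<sigma> R \<alpha> f g \<delta> v \<longrightarrow> (\<forall>x\<in>\<Omega>. \<bar>u x - v x\<bar> \<le> C * \<delta>\<^sup>2))"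
proof -
  obtain r where r: "\<And>x. x \<in> \<Omega> \<Longrightarrow> norm x \<le> r" using bdd unfolding bounded_iff by blast
  define c0 where "c0 = real DIM('a) * (\<alpha> * \<gamma> / 4 * (unit_ball_vol (real DIM('a)) / (4 * (1 + \<Lambda>)) ^ DIM('a)))"
  have c0: "0 < c0" using \<alpha> \<gamma> \<Lambda>1 by (simp add: c0_def)
  define r' where "r' = max r 0"
  have r': "norm x \<le> r'" "(norm x)\<^sup>2 \<le> r'\<^sup>2" if "x \<in> \<Omega>" for x
    using r[OF that] by (auto simp: r'_def intro!: power_mono)
  \<comment> \<open>Makes the coefficient of \<open>B / \<mu>\<close> in
    \<open>quadratic_supersolution\<close> at least 1 and keeps
    \<open>K - (norm y)\<^sup>2 / 2\<close> nonnegative on \<open>\<Omega>\<close>.\<close>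
  define K where "K = r'\<^sup>2 + 4 * r' + 4 * real DIM('a) + 1"
  define c where "c = min c0 1"
  \<comment> \<open>The operator applied to the quadratic is at least
    \<open>c * (1 + B / \<mu>)\<close>. After scaling by \<open>t * \<delta>\<^sup>2\<close> the
    summand \<open>\<bar>C\<^sub>1\<bar>\<close> absorbs the truncation error and the 1 pays for the
    slack \<open>\<delta>\<^sup>2\<close> in \<open>error_le\<close>.\<close>
  define t where "t = (\<bar>C\<^sub>1\<bar> + 1) / c"
  have c: "0 < c" "c \<le> c0" "c \<le> 1" using c0 by (auto simp: c_def)
  have t0: "0 < t" using c by (simp add: t_def add_nonneg_pos)
  have r0: "0 \<le> r'" by (simp add: r'_def)
  show ?thesis
  proof (intro exI[of _ "t * K"] allI impI ballI)
    fix \<delta> v x assume \<delta>: "0 < \<delta>" "\<delta> \<le> \<delta>\<^sub>0" and v: "solves_nonlocal \<Omega> \<sigma> R \<alpha> f g \<delta> v" and x: "x \<in> \<Omega>"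
    define w where "w = (\<lambda>y::'a. K - (norm y)\<^sup>2 / 2)"
    have w: "0 \<le> w y" "w y \<le> K" "1 \<le> 2 * K - (norm y)\<^sup>2 - 4 * norm y - 4 * real DIM('a)" if "y \<in> \<Omega>" for y
    proof -
      have "(norm y)\<^sup>2 / 2 \<le> r'\<^sup>2" using r'(2)[OF that] zero_le_power2[of "norm y"] by linarith
      then show "0 \<le> w y" unfolding w_def K_def using r0 by simp
      show "w y \<le> K" by (simp add: w_def)
      have arith: "1 \<le> 2 * (a + 4 * q + 4 * k + 1) - s - 4 * m - 4 * k"
        if "0 \<le> a" "0 \<le> k" "m \<le> q" "s \<le> a" "0 \<le> q" for a k m s q :: real
        using that by (simp add: algebra_simps)
      show "1 \<le> 2 * K - (norm y)\<^sup>2 - 4 * norm y - 4 * real DIM('a)"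
        unfolding K_def by (rule arith[OF _ _ r'[OF that] r0]) simp_all
    qed
    have "\<bar>u x - v x\<bar> \<le> (t * \<delta>\<^sup>2) * w x"
    proof (rule error_le[OF \<delta>(1) P v _ _ _ _ x, where e="\<delta>\<^sup>2"])
      have "integrable (lebesgue_on \<Omega>) w"
      proof (rule integrable_continuous_bounded)
        show "continuous_on \<Omega> w" unfolding w_def by (intro continuous_intros) auto
        show "\<bar>w y\<bar> \<le> K" if "y \<in> \<Omega>" for y using w(1,2)[OF that] by simp
      qed
      then show "integrable (lebesgue_on \<Omega>) (\<lambda>x. (t * \<delta>\<^sup>2) * w x)" by simp
      show "0 \<le> (t * \<delta>\<^sup>2) * w y" if "y \<in> \<Omega>" for y using w(1)[OF that] t0 by simp
      show "0 < \<delta>\<^sup>2" using \<delta> by simp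
      fix y assume y: "y \<in> \<Omega>"
      define \<beta> where "\<beta> = B \<delta> y / \<mu>_weight \<Omega> \<delta> y"
      have \<beta>: "0 \<le> \<beta>" unfolding \<beta>_def by (intro divide_nonneg_pos B_nonneg weight_pos \<delta>)
      have "c * (1 + \<beta>) \<le> c0 + \<beta> * (2 * K - (norm y)\<^sup>2 - 4 * norm y - 4 * real DIM('a))"
      proof -
        have "\<beta> * 1 \<le> \<beta> * (2 * K - (norm y)\<^sup>2 - 4 * norm y - 4 * real DIM('a))" using w(3)[OF y] \<beta> by (rule mult_left_mono)
        moreover have "c * \<beta> \<le> 1 * \<beta>" using c \<beta> by (intro mult_right_mono) auto
        ultimately show ?thesis using c by (simp add: distrib_left)
      qed
      also have "\<dots> \<le> Lop \<delta> w y"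
        using small_\<delta>_estimates(2)[OF \<delta> y, of K] unfolding c0_def \<beta>_def w_def .
      finally have "(t * \<delta>\<^sup>2) * (c * (1 + \<beta>)) \<le> (t * \<delta>\<^sup>2) * Lop \<delta> w y" using t0 by (intro mult_left_mono) auto
      moreover have "(t * \<delta>\<^sup>2) * (c * (1 + \<beta>)) = (\<bar>C\<^sub>1\<bar> + 1) * (\<delta>\<^sup>2 * (1 + \<beta>))" using c by (simp add: t_def)
      moreover have "\<bar>resid u \<delta> y\<bar> \<le> \<bar>C\<^sub>1\<bar> * (\<delta>\<^sup>2 * (1 + \<beta>))"
      proof -
        have "\<bar>resid u \<delta> y\<bar> \<le> C\<^sub>1 * (\<delta>\<^sup>2 * (1 + \<beta>))" using small_\<delta>_estimates(1)[OF \<delta> y] by (simp add: \<beta>_def mult.assoc)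
        also have "\<dots> \<le> \<bar>C\<^sub>1\<bar> * (\<delta>\<^sup>2 * (1 + \<beta>))" using \<beta> by (intro mult_right_mono) auto
        finally show ?thesis .
      qed
      moreover have "\<delta>\<^sup>2 \<le> \<delta>\<^sup>2 * (1 + \<beta>)" using \<beta> by (simp add: distrib_left)
      ultimately show "\<bar>resid u \<delta> y\<bar> + \<delta>\<^sup>2 \<le> Lop \<delta> (\<lambda>x. (t * \<delta>\<^sup>2) * w x) y"
        unfolding Lop_cmult by (simp add: distrib_right)
    qed
    also have "\<dots> \<le> (t * \<delta>\<^sup>2) * K" using w(2)[OF x] t0 by (intro mult_left_mono) auto
    finally show "\<bar>u x - v x\<bar> \<le> t * K * \<delta>\<^sup>2" by (simp add: mult_ac)
  qed
qed

end

section \<open>The estimate for \<delta> bounded below\<close>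

context poisson_setting
begin

text \<open>The values of the exponential at other points enter with a plus sign. They are kept only
  on a ball shifted from \<open>x\<close> by \<open>\<delta> / 4\<close> along \<open>b\<close>,
  where the kernel is at least \<open>\<kappa> * \<gamma>\<close> and the exponential has grown by a
  factor \<open>exp (l * \<delta> / 8)\<close>. The loss is the value at \<open>x\<close> times the
  total kernel mass, at most \<open>\<kappa> * M * m\<^sub>\<Omega>\<close>.\<close>

lemma exponential_mass_lower:
  fixes b :: 'a
  assumes \<delta>: "0 < \<delta>" and b: "norm b = 1" and l: "0 \<le> l" and x: "x \<in> \<Omega>" and sub: "ball x (\<delta> / 2) \<subseteq> \<Omega>"
    and ex: "integrable (lebesgue_on \<Omega>) (\<lambda>y. exp (l * (b \<bullet> y)))"
  defines "\<kappa> \<equiv> \<alpha> / \<delta> ^ DIM('a)"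
  shows "\<kappa> * exp (l * (b \<bullet> x)) * (\<gamma> * (exp (l * \<delta> / 8) - 1) * measure lborel (ball (0::'a) (\<delta> / 8)) - M * m\<^sub>\<Omega>)
      \<le> - Lint (\<lambda>y. kR \<delta> x y * (exp (l * (b \<bullet> x)) - exp (l * (b \<bullet> y))))"
proof -
  define E where "E = (\<lambda>y::'a. exp (l * (b \<bullet> y)))"
  define U where "U = ball (x + (\<delta> / 4) *\<^sub>R b) (\<delta> / 8)"
  define c where "c = \<kappa> * \<gamma> * (exp (l * \<delta> / 8) - 1) * E x"
  have \<kappa>0: "0 < \<kappa>" unfolding \<kappa>_def by (rule factor_pos[OF \<delta>])
  have ex1: "0 \<le> exp (l * \<delta> / 8) - 1" using l \<delta> by simp
  have UO: "y \<in> \<Omega>" "norm (x - y) < \<delta> / 2" "b \<bullet> x + \<delta> / 8 \<le> b \<bullet> y" if y: "y \<in> U" for y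
  proof -
    define r where "r = y - (x + (\<delta> / 4) *\<^sub>R b)"
    have r: "norm r < \<delta> / 8" using y by (simp add: U_def r_def dist_norm norm_minus_commute)
    have yx: "y = x + (\<delta> / 4) *\<^sub>R b + r" by (simp add: r_def)
    have "norm (y - x) \<le> \<delta> / 4 + norm r"
      unfolding yx using norm_triangle_ineq[of "(\<delta> / 4) *\<^sub>R b" r] b \<delta> by (simp add: add.assoc)
    then show n: "norm (x - y) < \<delta> / 2" using r \<delta> by (simp add: norm_minus_commute)
    then show "y \<in> \<Omega>" using sub by (auto simp: subset_iff dist_norm)
    have "\<bar>b \<bullet> r\<bar> < \<delta> / 8" using Cauchy_Schwarz_ineq2[of b r] b r by simp
    moreover have "b \<bullet> y = b \<bullet> x + \<delta> / 4 + b \<bullet> r" unfolding yx using b by (simp add: inner_add_right dot_square_norm)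
    ultimately show "b \<bullet> x + \<delta> / 8 \<le> b \<bullet> y" by linarith
  qed
  have pt: "indicator U y * c - E x * kR \<delta> x y \<le> - (kR \<delta> x y * (E x - E y))" for y
  proof (cases "y \<in> U")
    case True
    have "(norm (x - y))\<^sup>2 / (4 * \<delta>\<^sup>2) \<le> (\<delta> / 2)\<^sup>2 / (4 * \<delta>\<^sup>2)"
      using UO(2)[OF True] by (intro divide_right_mono power_mono) auto
    also have "\<dots> = 1/16" using \<delta> by (simp add: power_divide)
    finally have "(norm (x - y))\<^sup>2 / (4 * \<delta>\<^sup>2) \<le> 1/2" by simp
    then have "\<gamma> \<le> R ((norm (x - y))\<^sup>2 / (4 * \<delta>\<^sup>2))" by (intro R_\<gamma>) auto
    then have k: "\<kappa> * \<gamma> \<le> kR \<delta> x y" unfolding \<kappa>_def rescaled_kernel_def using factor_pos[OF \<delta>] by (intro mult_left_mono) auto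
    have "exp (l * \<delta> / 8) * E x = exp (l * (b \<bullet> x + \<delta> / 8))" unfolding E_def by (simp add: exp_add[symmetric] algebra_simps)
    also have "\<dots> \<le> E y" unfolding E_def using UO(3)[OF True] l by (simp add: mult_left_mono)
    finally have Ey: "(exp (l * \<delta> / 8) - 1) * E x \<le> E y - E x" by (simp add: algebra_simps)
    have "c = (\<kappa> * \<gamma>) * ((exp (l * \<delta> / 8) - 1) * E x)" by (simp add: c_def)
    also have "\<dots> \<le> kR \<delta> x y * (E y - E x)"
      using k Ey ex1 kR_nonneg[OF \<delta>] by (intro mult_mono) (auto simp: E_def)
    finally have "c \<le> kR \<delta> x y * (E y - E x)" .
    moreover have "0 \<le> E x * kR \<delta> x y" using kR_nonneg[OF \<delta>] by (simp add: E_def)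
    ultimately show ?thesis using True by (simp add: algebra_simps)
  next
    case False
    have "0 \<le> kR \<delta> x y * E y" using kR_nonneg[OF \<delta>] by (simp add: E_def)
    then show ?thesis using False by (simp add: algebra_simps)
  qed
  have UO': "U \<subseteq> \<Omega>" using UO(1) by blast
  have Um: "U \<in> sets borel" by (simp add: U_def)
  have iU: "integrable (lebesgue_on \<Omega>) (\<lambda>y. indicator U y * c)"
  proof (intro integrable_mult_left Bochner_Integration.integrable_bound[OF integrable_const_\<Omega>[of 1]])
    show "(indicator U :: 'a \<Rightarrow> real) \<in> borel_measurable (lebesgue_on \<Omega>)"
      by (rule borel_lebesgue_on) (use Um in simp)
    show "AE y in lebesgue_on \<Omega>. norm (indicator U y :: real) \<le> norm (1 :: real)"
      by (rule AE_I2) (simp add: indicator_def)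
  qed
  have LU: "Lint (\<lambda>y. indicator U y * c) = measure lborel (ball (0::'a) (\<delta> / 8)) * c"
  proof -
    have "(\<lambda>y. indicator \<Omega> y * (indicator U y * c)) = (\<lambda>y. indicator U y * c)"
      using UO' by (intro ext) (auto simp: indicator_def)
    then have "Lint (\<lambda>y. indicator U y * c) = (\<integral>y. indicator U y * c \<partial>lborel)"
      using Um by (subst integral_lebesgue_on_\<Omega>) auto
    also have "\<dots> = measure lborel U * c" by simp
    also have "measure lborel U = measure lborel (ball (0::'a) (\<delta> / 8))"
      using \<delta> by (simp add: U_def content_ball)
    finally show ?thesis .
  qed
  have "\<kappa> * E x * (\<gamma> * (exp (l * \<delta> / 8) - 1) * measure lborel (ball (0::'a) (\<delta> / 8)) - M * m\<^sub>\<Omega>)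
     = measure lborel (ball (0::'a) (\<delta> / 8)) * c - E x * (\<kappa> * M * m\<^sub>\<Omega>)"
    by (simp add: c_def algebra_simps)
  also have "\<dots> \<le> Lint (\<lambda>y. indicator U y * c) - E x * Lint (kR \<delta> x)"
  proof -
    have "E x * Lint (kR \<delta> x) \<le> E x * (\<kappa> * M * m\<^sub>\<Omega>)"
      unfolding \<kappa>_def by (rule mult_left_mono[OF kernel_mass(3)[OF \<delta>]]) (simp_all add: E_def)
    then show ?thesis unfolding LU by linarith
  qed
  also have "\<dots> = Lint (\<lambda>y. indicator U y * c - E x * kR \<delta> x y)"
    using iU kernel_mass(1)[OF \<delta>, of R x] by simp
  also have "\<dots> \<le> Lint (\<lambda>y. - (kR \<delta> x y * (E x - E y)))"
  proof (rule integral_mono[OF _ _ pt])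
    show "integrable (lebesgue_on \<Omega>) (\<lambda>y. indicator U y * c - E x * kR \<delta> x y)"
      using iU kernel_mass(1)[OF \<delta>, of R x] by simp
    show "integrable (lebesgue_on \<Omega>) (\<lambda>y. - (kR \<delta> x y * (E x - E y)))"
      using Lint_difference(2)[OF \<delta> ex, of x "E x"] by (simp add: E_def)
  qed
  finally show ?thesis by (simp add: E_def)
qed

text \<open>The ball of radius \<open>e\<close> around the nearest boundary point lies within
  \<open>\<delta>\<close> of \<open>x\<close>, where the profile argument is at most 1/4 and
  \<open>RR_lower\<close> applies.\<close>

lemma boundary_mass_lower:
  assumes \<delta>: "0 < \<delta>" and x: "x \<in> \<Omega>" and near: "infdist x (frontier \<Omega>) \<le> \<delta> / 2"
    and c: "\<And>p. p \<in> frontier \<Omega> \<Longrightarrow> c \<le> measure \<sigma> (frontier \<Omega> \<inter> ball p e)" and e: "e \<le> \<delta> / 2"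
  shows "\<alpha> / \<delta> ^ DIM('a) * (\<gamma> / 4) * c \<le> B \<delta> x"
proof -
  interpret finite_measure \<sigma> by (rule finite_\<sigma>)
  obtain p where p: "p \<in> frontier \<Omega>" "infdist x (frontier \<Omega>) = dist x p"
    using infdist_attains_inf[OF frontier_closed frontier_nonempty[OF x]] by metis
  define U where "U = frontier \<Omega> \<inter> ball p e"
  have Um: "U \<in> sets \<sigma>" unfolding U_def using borel_in_\<sigma>[of "ball p e"] by (simp add: Int_commute)
  define k where "k = \<alpha> / \<delta> ^ DIM('a) * (\<gamma> / 4)"
  have k0: "0 < k" unfolding k_def by (intro mult_pos_pos factor_pos \<delta>) (use \<gamma> in simp)
  have le: "indicator U y * k \<le> kB \<delta> x y" for y
  proof (cases "y \<in> U")
    case True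
    then have "dist x y \<le> \<delta>" using near p(2) e dist_triangle[of x y p] by (simp add: U_def)
    then have "(norm (x - y))\<^sup>2 \<le> \<delta>\<^sup>2" by (intro power_mono) (auto simp: dist_norm)
    then have "(norm (x - y))\<^sup>2 / (4 * \<delta>\<^sup>2) \<le> 1/4" using \<delta> by (simp add: field_simps)
    then have "\<gamma> / 4 \<le> RR ((norm (x - y))\<^sup>2 / (4 * \<delta>\<^sup>2))" by (intro RR_lower) auto
    then have "k \<le> kB \<delta> x y" unfolding k_def rescaled_kernel_def
      using factor_pos[OF \<delta>] by (intro mult_left_mono) auto
    then show ?thesis using True by simp
  next
    case False then show ?thesis using kB_nonneg[OF \<delta>] by simp
  qed
  have iU: "integrable \<sigma> (\<lambda>y. indicator U y * k)" using Um by (auto simp: integrable_indicator_iff less_top[symmetric])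
  have ik: "integrable \<sigma> (\<lambda>y. kB \<delta> x y)" using \<sigma>_integrable(1)[OF \<delta>, of "\<lambda>_. 1" x 1] by simp
  have "k * c \<le> k * measure \<sigma> U" using c[OF p(1)] k0 unfolding U_def by (intro mult_left_mono) auto
  also have "\<dots> = (\<integral>y. indicator U y * k \<partial>\<sigma>)" using Um by (simp add: sets.sets_into_space Int_absorb2)
  also have "\<dots> \<le> B \<delta> x" unfolding B_def by (rule integral_mono[OF iU ik le])
  finally show ?thesis by (simp add: k_def)
qed

text \<open>The truncation error has a part proportional to the kernel factor
  \<open>\<kappa>\<close> and one proportional to \<open>B / \<mu>\<close>. Within
  \<open>\<delta> / 2\<close> of the frontier \<open>B\<close> is itself at least a multiple of
  \<open>\<kappa>\<close>, and the constant in the supersolution dominates; farther inside, the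
  exponential gains a multiple of \<open>\<kappa>\<close>. The constants are fixed before
  \<open>\<delta>\<close>.\<close>

lemma large_\<delta>_bound:
  assumes P: "solves_poisson \<Omega> f g u"
  shows "\<exists>C. \<forall>\<delta>\<ge>\<delta>\<^sub>0. \<forall>v. solves_nonlocal \<Omega> \<sigma> R \<alpha> f g \<delta> v \<longrightarrow> (\<forall>x\<in>\<Omega>. \<bar>u x - v x\<bar> \<le> C * \<delta>\<^sup>2)"
proof -
  obtain b :: 'a where "b \<in> Basis" using nonempty_Basis by blast
  then have b: "norm b = 1" by simp
  obtain r where r: "\<And>x. x \<in> \<Omega> \<Longrightarrow> norm x \<le> r" using bdd unfolding bounded_iff by blast
  obtain c\<sigma> where c\<sigma>: "0 < c\<sigma>" "\<And>p. p \<in> frontier \<Omega> \<Longrightarrow> c\<sigma> \<le> measure \<sigma> (frontier \<Omega> \<inter> ball p (\<delta>\<^sub>0 / 2))"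
    using \<sigma>_ball_lower[of "\<delta>\<^sub>0 / 2"] \<delta>0_pos by auto
  define v0 where "v0 = measure lborel (ball (0::'a) (\<delta>\<^sub>0 / 8))"
  have v0: "0 < v0" using \<delta>0_pos by (simp add: v0_def content_ball)
  \<comment> \<open>Chosen so that \<open>\<gamma> * X * v0 = M * m\<^sub>\<Omega> + 1\<close>; the
    rate \<open>l\<close> then gives \<open>X \<le> exp (l * \<delta> / 8) - 1\<close> for every
    \<open>\<delta> \<ge> \<delta>\<^sub>0\<close>.\<close>
  define X where "X = (M * m\<^sub>\<Omega> + 1) / (\<gamma> * v0)"
  have X0: "0 < X" using M0 m_nonneg \<gamma> v0 by (simp add: X_def add_nonneg_pos)
  define l where "l = 8 * X / \<delta>\<^sub>0"
  have l0: "0 < l" using X0 \<delta>0_pos by (simp add: l_def)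
  define E where "E = (\<lambda>y::'a. exp (l * (b \<bullet> y)))"
  have Eb: "exp (- (l * r)) \<le> E y" "E y \<le> exp (l * r)" if "y \<in> \<Omega>" for y
  proof -
    have "\<bar>b \<bullet> y\<bar> \<le> r" using Cauchy_Schwarz_ineq2[of b y] b r[OF that] by simp
    then have "b \<bullet> y \<le> r" "- r \<le> b \<bullet> y" by linarith+
    then have "l * (b \<bullet> y) \<le> l * r" and "l * - r \<le> l * (b \<bullet> y)" by (simp_all only: mult_left_mono less_imp_le[OF l0])
    then show "exp (- (l * r)) \<le> E y" "E y \<le> exp (l * r)" by (simp_all add: E_def)
  qed
  have Ei: "integrable (lebesgue_on \<Omega>) E"
    by (rule integrable_continuous_bounded[where c="exp (l * r)"])
      (use Eb in \<open>auto simp: E_def intro!: continuous_intros\<close>)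
  define c1 where "c1 = M * m\<^sub>\<Omega> * (2 * Mu / \<delta>\<^sub>0\<^sup>2 + T.n * Mu)"
  define c2 where "c2 = 4 * Mu"
  have c10: "0 \<le> c1" unfolding c1_def using M0 m_nonneg T.M T.n0 by simp
  have c20: "0 \<le> c2" using T.M by (simp add: c2_def)
  \<comment> \<open>Then \<open>t * exp (- (l * r)) = c1 + 1\<close>: away from the frontier the
    exponential pays for the error \<open>c1 * \<kappa>\<close> and for the slack
    \<open>\<kappa>\<close>.\<close>
  define t where "t = (c1 + 1) / exp (- (l * r))"
  have t0: "0 < t" using c10 by (simp add: t_def add_nonneg_pos)
  \<comment> \<open>The most that the exponential can lose near the frontier, in units of
    \<open>\<kappa>\<close>.\<close>
  define c3 where "c3 = t * (M * m\<^sub>\<Omega> * exp (l * r))"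
  have c30: "0 \<le> c3" unfolding c3_def using t0 M0 m_nonneg by simp
  \<comment> \<open>The first summand covers the part \<open>c2 * B / \<mu>\<close> of the error.
    The second covers \<open>c1 + c3 + 1\<close> near the frontier, where
    \<open>\<delta>\<^sup>2 * B / \<mu>\<close> is at least
    \<open>\<delta>\<^sub>0 * \<gamma> * c\<sigma> / 8\<close> times
    \<open>\<kappa>\<close>.\<close>
  define K' where "K' = c2 / \<delta>\<^sub>0\<^sup>2 + (c1 + c3 + 1) / (\<delta>\<^sub>0 * \<gamma> * c\<sigma> / 8)"
  have d0: "0 < \<delta>\<^sub>0 * \<gamma> * c\<sigma> / 8" using \<delta>0_pos \<gamma> c\<sigma> by simp
  have K'0: "0 \<le> K'" unfolding K'_def using c20 c10 c30 d0 by (intro add_nonneg_nonneg divide_nonneg_pos) auto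
  have K'1: "c2 \<le> \<delta>\<^sub>0\<^sup>2 * K'"
  proof -
    have "c2 / \<delta>\<^sub>0\<^sup>2 \<le> K'" unfolding K'_def using c10 c30 d0 by simp
    then show ?thesis using \<delta>0_pos by (simp add: divide_le_eq mult.commute)
  qed
  have K'2: "c1 + c3 + 1 \<le> (\<delta>\<^sub>0 * \<gamma> * c\<sigma> / 8) * K'"
  proof -
    have "(c1 + c3 + 1) / (\<delta>\<^sub>0 * \<gamma> * c\<sigma> / 8) \<le> K'" unfolding K'_def using c20 by simp
    then show ?thesis using d0 by (simp only: pos_divide_le_eq mult.commute)
  qed
  \<comment> \<open>The added term bounds \<open>t * E y\<close> on \<open>\<Omega>\<close>, so that
    \<open>w\<close> stays above \<open>K'\<close> there.\<close>
  define K where "K = K' + t * exp (l * r)"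
  define w where "w = (\<lambda>y. K - t * E y)"
  have w: "K' \<le> w y" "w y \<le> K" if "y \<in> \<Omega>" for y
    using mult_left_mono[OF Eb(2)[OF that], of t] t0 by (auto simp: w_def K_def E_def)
  show ?thesis
  proof (intro exI[of _ K] allI impI ballI)
    fix \<delta> v x assume \<delta>\<delta>: "\<delta>\<^sub>0 \<le> \<delta>" and v: "solves_nonlocal \<Omega> \<sigma> R \<alpha> f g \<delta> v" and x: "x \<in> \<Omega>"
    have \<delta>: "0 < \<delta>" using \<delta>\<delta> \<delta>0_pos by linarith
    define \<kappa> where "\<kappa> = \<alpha> / \<delta> ^ DIM('a)"
    have \<kappa>0: "0 < \<kappa>" unfolding \<kappa>_def by (rule factor_pos[OF \<delta>])
    have wi: "integrable (lebesgue_on \<Omega>) w" unfolding w_def using Ei integrable_const_\<Omega>[of K] by simp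
    have "\<bar>u x - v x\<bar> \<le> \<delta>\<^sup>2 * w x"
    proof (rule error_le[OF \<delta> P v _ _ \<kappa>0 _ x])
      show "integrable (lebesgue_on \<Omega>) (\<lambda>x. \<delta>\<^sup>2 * w x)" using wi by simp
      show "0 \<le> \<delta>\<^sup>2 * w y" if "y \<in> \<Omega>" for y using w(1)[OF that] K'0 by simp
      fix y assume y: "y \<in> \<Omega>"
      define \<beta> where "\<beta> = B \<delta> y / \<mu>_weight \<Omega> \<delta> y"
      define I where "I = - Lint (\<lambda>z. kR \<delta> y z * (E y - E z))"
      have \<beta>: "0 \<le> \<beta>" unfolding \<beta>_def by (intro divide_nonneg_pos B_nonneg weight_pos \<delta>)
      have "Lint (\<lambda>z. kR \<delta> y z * (w y - w z)) = t * I"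
      proof -
        have "Lint (\<lambda>z. kR \<delta> y z * (w y - w z)) = Lint (\<lambda>z. (- t) * (kR \<delta> y z * (E y - E z)))"
          by (intro Bochner_Integration.integral_cong refl) (simp add: w_def algebra_simps)
        also have "\<dots> = (- t) * Lint (\<lambda>z. kR \<delta> y z * (E y - E z))" by (rule integral_mult_right_zero)
        finally show ?thesis by (simp add: I_def)
      qed
      then have "Lop \<delta> w y = 1 / \<delta>\<^sup>2 * (t * I) + 2 * \<beta> * w y" unfolding Lop_def by (simp add: \<beta>_def)
      then have Leq: "\<delta>\<^sup>2 * Lop \<delta> w y = t * I + 2 * \<delta>\<^sup>2 * \<beta> * w y" using \<delta> by (simp add: field_simps)
      have res: "\<bar>resid u \<delta> y\<bar> \<le> c1 * \<kappa> + c2 * \<beta>"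
      proof -
        have "2 * Mu / \<delta>\<^sup>2 \<le> 2 * Mu / \<delta>\<^sub>0\<^sup>2" using \<delta>\<delta> \<delta>0_pos T.M by (intro divide_left_mono power_mono) auto
        then have "(M * m\<^sub>\<Omega> * (2 * Mu / \<delta>\<^sup>2 + T.n * Mu)) * \<kappa> \<le> c1 * \<kappa>"
          unfolding c1_def using M0 m_nonneg \<kappa>0 by (intro mult_right_mono mult_left_mono) auto
        then show ?thesis using resid_crude[OF \<delta> y] unfolding \<kappa>_def \<beta>_def c2_def by linarith
      qed
      \<comment> \<open>The boundary term of \<open>Lop\<close> carries a factor 2: one half pays
        for \<open>c2 * \<beta>\<close>, the other half is left for the case distinction
        below.\<close>
      have part: "c2 * \<beta> \<le> \<delta>\<^sup>2 * \<beta> * w y"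
      proof -
        have "c2 \<le> \<delta>\<^sub>0\<^sup>2 * K'" by (rule K'1)
        also have "\<dots> \<le> \<delta>\<^sup>2 * w y" using \<delta>\<delta> \<delta>0_pos w(1)[OF y] K'0 by (intro mult_mono power_mono) auto
        finally have "c2 * \<beta> \<le> (\<delta>\<^sup>2 * w y) * \<beta>" using \<beta> by (rule mult_right_mono)
        then show ?thesis by (simp add: mult_ac)
      qed
      have "c1 * \<kappa> + \<kappa> \<le> t * I + \<delta>\<^sup>2 * \<beta> * w y"
      proof (cases "infdist y (frontier \<Omega>) \<le> \<delta> / 2")
        case True
        have B: "\<kappa> * (\<gamma> / 4) * c\<sigma> \<le> B \<delta> y"
          unfolding \<kappa>_def by (rule boundary_mass_lower[OF \<delta> y True c\<sigma>(2)]) (use \<delta>\<delta> in auto)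
        have "\<bar>Lint (\<lambda>z. kR \<delta> y z * (E y - E z))\<bar> \<le> \<kappa> * M * Lint (\<lambda>z. \<bar>E y - E z\<bar>)"
          unfolding \<kappa>_def using Ei integrable_const_\<Omega>[of "E y"] by (intro kernel_integrable(2)[OF \<delta>]) auto
        also have "\<dots> \<le> \<kappa> * M * Lint (\<lambda>z. exp (l * r))"
        proof (intro mult_left_mono integral_mono integrable_const_\<Omega>)
          show "integrable (lebesgue_on \<Omega>) (\<lambda>z. \<bar>E y - E z\<bar>)" using Ei integrable_const_\<Omega>[of "E y"] by simp
          fix z assume "z \<in> space (lebesgue_on \<Omega>)"
          then have "z \<in> \<Omega>" by simp
          moreover have "0 < E z" "0 < E y" by (simp_all add: E_def)
          ultimately show "\<bar>E y - E z\<bar> \<le> exp (l * r)" using Eb(2)[of z] Eb(2)[OF y] by linarith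
        qed (use \<kappa>0 M0 in auto)
        also have "\<dots> = \<kappa> * (M * m\<^sub>\<Omega> * exp (l * r))" by (simp add: m\<^sub>\<Omega>_def)
        finally have "- (\<kappa> * (M * m\<^sub>\<Omega> * exp (l * r))) \<le> I" unfolding I_def by linarith
        then have "t * - (\<kappa> * (M * m\<^sub>\<Omega> * exp (l * r))) \<le> t * I" using t0 by (intro mult_left_mono) auto
        then have tI: "- (\<kappa> * c3) \<le> t * I" by (simp add: c3_def mult_ac)
        have "\<kappa> * (c1 + c3 + 1) \<le> \<kappa> * ((\<delta>\<^sub>0 * \<gamma> * c\<sigma> / 8) * K')" using K'2 \<kappa>0 by (intro mult_left_mono) auto
        also have "\<dots> = (\<delta>\<^sub>0 / 2) * (\<kappa> * (\<gamma> / 4) * c\<sigma>) * K'" by simp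
        also have "\<dots> \<le> (\<delta> / 2) * B \<delta> y * w y"
          using \<delta>\<delta> \<delta>0_pos B \<kappa>0 \<gamma> c\<sigma>(1) K'0 w(1)[OF y] B_nonneg[OF \<delta>] by (intro mult_mono mult_nonneg_nonneg) auto
        also have "\<dots> \<le> (\<delta>\<^sup>2 * \<beta>) * w y"
        proof (rule mult_right_mono)
          have "B \<delta> y = \<mu>_weight \<Omega> \<delta> y * \<beta>" using weight_pos[OF \<delta>, of y] by (simp add: \<beta>_def)
          also have "\<dots> \<le> (2 * \<delta>) * \<beta>" using weight_le \<beta> by (rule mult_right_mono)
          finally have "(\<delta> / 2) * B \<delta> y \<le> (\<delta> / 2) * ((2 * \<delta>) * \<beta>)" using \<delta> by (intro mult_left_mono) auto
          then show "\<delta> / 2 * B \<delta> y \<le> \<delta>\<^sup>2 * \<beta>" by (simp add: power2_eq_square)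
        qed (use w(1)[OF y] K'0 in linarith)
        finally show ?thesis using tI by (simp add: algebra_simps)
      next
        case False
        have sub: "ball y (\<delta> / 2) \<subseteq> \<Omega>" using False \<delta> by (intro ball_infdist_subset[OF y]) auto
        have "X \<le> exp (l * \<delta> / 8) - 1"
        proof -
          have "X = l * \<delta>\<^sub>0 / 8" using \<delta>0_pos by (simp add: l_def)
          also have "\<dots> \<le> l * \<delta> / 8" using \<delta>\<delta> l0 by simp
          also have "\<dots> \<le> exp (l * \<delta> / 8) - 1" using exp_ge_add_one_self[of "l * \<delta> / 8"] by linarith
          finally show ?thesis .
        qed
        moreover have "v0 \<le> measure lborel (ball (0::'a) (\<delta> / 8))"
          unfolding v0_def using \<delta>\<delta> \<delta>0_pos \<delta> by (simp add: content_ball mult_left_mono power_mono divide_right_mono)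
        ultimately have "\<gamma> * X * v0 \<le> \<gamma> * (exp (l * \<delta> / 8) - 1) * measure lborel (ball (0::'a) (\<delta> / 8))"
          using \<gamma> X0 v0 l0 \<delta> by (intro mult_mono mult_left_mono) auto
        moreover have "\<gamma> * X * v0 = M * m\<^sub>\<Omega> + 1" using \<gamma> v0 by (simp add: X_def)
        ultimately have "1 \<le> \<gamma> * (exp (l * \<delta> / 8) - 1) * measure lborel (ball (0::'a) (\<delta> / 8)) - M * m\<^sub>\<Omega>" by linarith
        then have "\<kappa> * E y * 1 \<le> \<kappa> * E y * (\<gamma> * (exp (l * \<delta> / 8) - 1) * measure lborel (ball (0::'a) (\<delta> / 8)) - M * m\<^sub>\<Omega>)"
          using \<kappa>0 by (intro mult_left_mono) (auto simp: E_def)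
        also have "\<dots> \<le> I"
          unfolding \<kappa>_def E_def I_def
          by (rule exponential_mass_lower[OF \<delta> b _ y sub]) (use l0 Ei in \<open>auto simp: E_def\<close>)
        finally have "\<kappa> * E y \<le> I" by simp
        moreover have "\<kappa> * exp (- (l * r)) \<le> \<kappa> * E y" using Eb(1)[OF y] \<kappa>0 by (intro mult_left_mono) auto
        ultimately have "t * (\<kappa> * exp (- (l * r))) \<le> t * I" using t0 by (intro mult_left_mono) auto
        moreover have "t * (\<kappa> * exp (- (l * r))) = c1 * \<kappa> + \<kappa>" by (simp add: t_def field_simps)
        moreover have "0 \<le> \<delta>\<^sup>2 * \<beta> * w y" using \<beta> w(1)[OF y] K'0 by simp
        ultimately show ?thesis by linarith
      qed
      then show "\<bar>resid u \<delta> y\<bar> + \<kappa> \<le> Lop \<delta> (\<lambda>x. \<delta>\<^sup>2 * w x) y"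
        unfolding Lop_cmult Leq using res part by linarith
    qed
    also have "\<dots> \<le> \<delta>\<^sup>2 * K" using w(2)[OF x] by (intro mult_left_mono) auto
    finally show "\<bar>u x - v x\<bar> \<le> K * \<delta>\<^sup>2" by (simp add: mult.commute)
  qed
qed

lemma error_estimate:
  assumes P: "solves_poisson \<Omega> f g u"
  shows "\<exists>C>0. \<forall>\<delta>>0. \<forall>v. solves_nonlocal \<Omega> \<sigma> R \<alpha> f g \<delta> v \<longrightarrow> (\<forall>x\<in>\<Omega>. \<bar>u x - v x\<bar> \<le> C * \<delta>\<^sup>2)"
proof -
  obtain Ca where Ca: "\<And>\<delta> v x. 0 < \<delta> \<Longrightarrow> \<delta> \<le> \<delta>\<^sub>0 \<Longrightarrow> solves_nonlocal \<Omega> \<sigma> R \<alpha> f g \<delta> v \<Longrightarrow> x \<in> \<Omega> \<Longrightarrow> \<bar>u x - v x\<bar> \<le> Ca * \<delta>\<^sup>2"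
    using small_\<delta>_bound[OF P] by blast
  obtain Cb where Cb: "\<And>\<delta> v x. \<delta>\<^sub>0 \<le> \<delta> \<Longrightarrow> solves_nonlocal \<Omega> \<sigma> R \<alpha> f g \<delta> v \<Longrightarrow> x \<in> \<Omega> \<Longrightarrow> \<bar>u x - v x\<bar> \<le> Cb * \<delta>\<^sup>2"
    using large_\<delta>_bound[OF P] by blast
  show ?thesis
  proof (intro exI[of _ "\<bar>Ca\<bar> + \<bar>Cb\<bar> + 1"] conjI allI impI ballI)
    fix \<delta> :: real and v x assume "0 < \<delta>" "solves_nonlocal \<Omega> \<sigma> R \<alpha> f g \<delta> v" "x \<in> \<Omega>"
    then have "\<bar>u x - v x\<bar> \<le> Ca * \<delta>\<^sup>2 \<or> \<bar>u x - v x\<bar> \<le> Cb * \<delta>\<^sup>2" using Ca Cb by (meson linear)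
    moreover have "Ca * \<delta>\<^sup>2 \<le> (\<bar>Ca\<bar> + \<bar>Cb\<bar> + 1) * \<delta>\<^sup>2" "Cb * \<delta>\<^sup>2 \<le> (\<bar>Ca\<bar> + \<bar>Cb\<bar> + 1) * \<delta>\<^sup>2"
      by (intro mult_right_mono; simp)+
    ultimately show "\<bar>u x - v x\<bar> \<le> (\<bar>Ca\<bar> + \<bar>Cb\<bar> + 1) * \<delta>\<^sup>2" by linarith
  qed simp
qed

end

text \<open>The continuous extensions of the finitely many partial derivatives are bounded on the
  compact closure.\<close>

lemma Ck_on_closure_bounded:
  fixes u :: "'a::euclidean_space \<Rightarrow> real"
  assumes u: "Ck_on_closure k u \<Omega>" and bdd: "bounded \<Omega>"
  shows "\<exists>M\<ge>0. \<forall>bs x. set bs \<subseteq> Basis \<and> length bs \<le> k \<and> x \<in> \<Omega> \<longrightarrow> \<bar>iter_partial bs u x\<bar> \<le> M"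
proof -
  have cl: "compact (closure \<Omega>)" using bdd by simp
  have "\<exists>M\<ge>0. \<forall>bs\<in>{bs. set bs \<subseteq> (Basis::'a set) \<and> length bs \<le> k}. \<forall>x\<in>\<Omega>. \<bar>iter_partial bs u x\<bar> \<le> M"
  proof (rule finite_family_uniform_bound[OF finite_Basis_lists])
    fix bs :: "'a list" assume "bs \<in> {bs. set bs \<subseteq> Basis \<and> length bs \<le> k}"
    then obtain F where F: "continuous_on (closure \<Omega>) F" "\<forall>x\<in>\<Omega>. F x = iter_partial bs u x"
      using u unfolding Ck_on_closure_def by blast
    obtain M where "\<forall>x\<in>closure \<Omega>. \<bar>F x\<bar> \<le> M" using compact_continuous_bound[OF cl F(1)] by blast
    then show "\<exists>M. \<forall>x\<in>\<Omega>. \<bar>iter_partial bs u x\<bar> \<le> M" using F(2) closure_subset[of \<Omega>] by (metis subsetD)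
  qed
  then show ?thesis by blast
qed

theorem theorem2p5:
  fixes \<Omega> :: "'a::euclidean_space set"
    and \<sigma> :: "'a measure"
    and R :: "real \<Rightarrow> real"
    and \<alpha> :: real
    and u f g :: "'a \<Rightarrow> real"
  assumes "open \<Omega>" and "connected \<Omega>" and "bounded \<Omega>" and "smooth_boundary \<Omega>"
    and "is_surface_measure (frontier \<Omega>) \<sigma>"
    and R_C1: "\<exists>R'. continuous_on {0..1} R' \<and>
          (\<forall>r\<in>{0..1}. (R has_real_derivative R' r) (at r within {0..1}))"
    and R_nonneg: "\<forall>r\<ge>0. R r \<ge> 0"
    and R_support: "\<forall>r>1. R r = 0"
    and R_pos: "\<exists>\<gamma>\<^sub>0>0. \<forall>r. 0 \<le> r \<and> r \<le> 1/2 \<longrightarrow> R r \<ge> \<gamma>\<^sub>0"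
    and \<alpha>_pos: "\<alpha> > 0"
    and \<alpha>_normalised: "\<forall>\<delta>>0. \<forall>x::'a.
          (\<integral>y. rescaled_kernel \<alpha> (Rbar R) \<delta> x y \<partial>lborel) = 1"
    and "solves_poisson \<Omega> f g u"
    and "Ck_on_closure 4 u \<Omega>"
  shows "\<exists>C>0. \<forall>\<delta>>0. \<forall>u\<^sub>\<delta>. solves_nonlocal \<Omega> \<sigma> R \<alpha> f g \<delta> u\<^sub>\<delta> \<longrightarrow>
           (\<forall>x\<in>\<Omega>. \<bar>u x - u\<^sub>\<delta> x\<bar> \<le> C * \<delta>\<^sup>2)"
proof -
  (* R is unconstrained at negative arguments, which the kernels never use. *)
  define Q where "Q = (\<lambda>s. if 0 \<le> s \<and> s \<le> 1 then R s else 0)"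
  have QR: "Q s = R s" if "0 \<le> s" for s using that R_support by (auto simp: Q_def)
  have kernel_eq: "rescaled_kernel \<alpha> R = (rescaled_kernel \<alpha> Q :: real \<Rightarrow> 'a \<Rightarrow> 'a \<Rightarrow> real)"
    by (intro ext) (simp add: rescaled_kernel_def QR)
  have "Rbar Q s = Rbar R s" if "0 \<le> s" for s
    unfolding Rbar_def set_lebesgue_integral_def using that
    by (intro Bochner_Integration.integral_cong refl) (simp add: indicator_def QR)
  then have kernel_eq': "rescaled_kernel \<alpha> (Rbar R) = (rescaled_kernel \<alpha> (Rbar Q) :: real \<Rightarrow> 'a \<Rightarrow> 'a \<Rightarrow> real)"
    by (intro ext) (simp add: rescaled_kernel_def)
  have nl: "solves_nonlocal \<Omega> \<sigma> R \<alpha> f g = solves_nonlocal \<Omega> \<sigma> Q \<alpha> f g"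
    by (intro ext) (simp only: solves_nonlocal_def kernel_eq kernel_eq')
  have Rc: "continuous_on {0..1} R"
  proof -
    obtain R' where "\<forall>r\<in>{0..1}. (R has_real_derivative R' r) (at r within {0..1})" using R_C1 by blast
    then show ?thesis by (meson DERIV_continuous continuous_on_eq_continuous_within)
  qed
  obtain M where M: "\<forall>s\<in>{0..1}. \<bar>R s\<bar> \<le> M" using compact_continuous_bound[OF compact_Icc Rc] by blast
  obtain \<gamma> where \<gamma>: "0 < \<gamma>" "\<And>r. 0 \<le> r \<Longrightarrow> r \<le> 1/2 \<Longrightarrow> \<gamma> \<le> R r" using R_pos by blast
  have M0: "0 \<le> M" using bspec[OF M, of 0] by simp
  have prof: "profile Q M \<gamma>"
  proof
    show "Q s = 0" if "s < 0 \<or> 1 < s" for s using that by (auto simp: Q_def)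
    show "0 \<le> Q s" for s using R_nonneg by (simp add: Q_def)
    show "Q s \<le> M" for s using M M0 by (auto simp: Q_def abs_le_iff)
    show "continuous_on {0..1} Q" by (rule continuous_on_eq[OF Rc]) (simp add: QR)
    show "0 < \<gamma>" by (rule \<gamma>(1))
    show "\<gamma> \<le> Q s" if "0 \<le> s" "s \<le> 1/2" for s using \<gamma>(2)[OF that] QR[OF that(1)] by simp
  qed
  obtain lam \<Lambda> where ch: "0 < lam" "1 \<le> \<Lambda>" "\<And>p. p \<in> frontier \<Omega> \<Longrightarrow> \<exists>\<nu> h. boundary_chart \<Omega> p lam \<Lambda> \<nu> h"
    using uniform_charts[OF assms(1,3,4)] by blast
  have dom: "smooth_domain \<Omega> \<sigma> lam \<Lambda>"
    by (intro smooth_domain.intro surface_measure.intro smooth_domain_axioms.intro assms ch)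
  obtain Mu where Mu: "0 \<le> Mu" "\<And>bs x. set bs \<subseteq> Basis \<Longrightarrow> length bs \<le> 4 \<Longrightarrow> x \<in> \<Omega> \<Longrightarrow> \<bar>iter_partial bs u x\<bar> \<le> Mu"
    using Ck_on_closure_bounded[OF assms(13,3)] by blast
  have c4: "C4_data \<Omega> (3 + \<Lambda>) (lam / (4 + \<Lambda>)) Mu u"
  proof (rule C4_data.intro)
    show "quasiconvex \<Omega> (3 + \<Lambda>) (lam / (4 + \<Lambda>))" by (rule smooth_domain.quasiconvex[OF dom])
    show "Ck_on 4 u \<Omega>" "continuous_on (closure \<Omega>) u" using assms(13) by (simp_all add: Ck_on_closure_def)
  qed (use assms(1) ch Mu in auto)
  have "poisson_setting \<Omega> \<sigma> lam \<Lambda> Q M \<gamma> \<alpha> Mu u"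
    by (intro poisson_setting.intro nonlocal_setting.intro nonlocal_setting_axioms.intro dom prof c4 \<alpha>_pos)
  from poisson_setting.error_estimate[OF this assms(12)] show ?thesis unfolding nl .
qed

end
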